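(* Let $M$ be a compact irreducible real algebraic variety and let $A,B\subset M$ be disjoint open semialgebraic subsets. Assume that $M$ is non-singular and that $A$ and $B$ have (non-singular) walls at normal crossings. Then $A$ and $B$ are generically separable if and only if for every wall $W$ of $A$ and $B$ in $M$, either the shadows of $A$ and $B$ in $W$ are generically separable in $W$, or the counter-shadows of $A$ and $B$ in $W$ are generically separable in $W$.
   Context: For an irreducible real algebraic variety $M$ (real algebraic subset of some $\mathbb{R}^N$), $\mathfrak{R}(M)$ is its ring of regular functions (quotients $p/q$ of polynomial functions with $q$ nowhere zero on $M$). *Generic separability.* Semialgebraic subsets $S,T$ of an irreducible variety $V$ are generically separable in $V$ if there is a non-zero $f\in\mathfrak{R}(V)$ with $f\ge 0$ on $S$ and $f\le 0$ on $T$. (This is applied with $V=M$ and with $V=W$ a wall.) *Walls.* With $n=\dim M$ and $\partial S=\overline S\setminus\operatorname{Int}(S)$, the walls of $A$ and $B$ in $M$ are the irreducible components of dimension $n-1$ of the union of the Zariski closures of $\partial A$ and $\partial B$. *Normal crossings.* That the walls are at normal crossings means: $A$ and $B$ are described by (boolean combinations of sign conditions on) a family of polynomials $f_1,\dots,f_s$ which are all normal crossings, i.e. at each point $x\in M$ there is a regular system of parameters $x_1,\dots,x_n$ of the local ring $\mathfrak{R}(M)_x$ such that every $f_j=a_jx_1^{m_{j1}}\cdots x_n^{m_{jn}}$ with $a_j$ a unit of $\mathfrak{R}(M)_x$ and $m_{ji}\ge 0$ integers. *Shadows and counter-shadows.* The shadows of $A$ and $B$ in a wall $W$ are $A_W=\overline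 A\cap W$ and $B_W=\overline B\cap W$. Let $t$ be a uniformizer of the discrete valuation ring $\mathfrak{R}(M)_{\mathfrak{J}(W)}$ ($\mathfrak{J}(W)$ the ideal of $W$), and put $A^t=(A\cap\{t>0\})\cup(B\cap\{t<0\})$, $B^t=(A\cap\{t<0\})\cup(B\cap\{t>0\})$. The counter-shadows of $A$ and $B$ in $W$ are the shadows $\overline{A^t}\cap W$ and $\overline{B^t}\cap W$ (generically, and up to exchanging the two, they do not depend on $t$). *)

theory Defs
  imports "HOL-Analysis.Analysis" "HOL-Algebra.Ring_Divisibility"
begin

subsection \<open>Localisations and local rings\<close>

definition loc_rel :: "('a, 'r) ring_scheme \<Rightarrow> 'a set \<Rightarrow> (('a \<times> 'a) \<times> ('a \<times> 'a)) set" where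
  "loc_rel R P =
     {((a, s), (b, u)). a \<in> carrier R \<and> b \<in> carrier R \<and> s \<in> carrier R - P \<and> u \<in> carrier R - P \<and>
        (\<exists>v \<in> carrier R - P. v \<otimes>\<^bsub>R\<^esub> (a \<otimes>\<^bsub>R\<^esub> u) = v \<otimes>\<^bsub>R\<^esub> (b \<otimes>\<^bsub>R\<^esub> s))}"

definition loc_frac :: "('a, 'r) ring_scheme \<Rightarrow> 'a set \<Rightarrow> 'a \<Rightarrow> 'a \<Rightarrow> ('a \<times> 'a) set" where
  "loc_frac R P a s = loc_rel R P `` {(a, s)}"

text \<open>The localisation of a commutative ring \<open>R\<close> at a prime ideal \<open>P\<close>; an element is the
  set of all pairs (numerator, denominator) representing it.\<close>

definition localization :: "('a, 'r) ring_scheme \<Rightarrow> 'a set \<Rightarrow> ('a \<times> 'a) set ring" where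
  "localization R P =
     \<lparr> carrier = (carrier R \<times> (carrier R - P)) // loc_rel R P,
       mult = (\<lambda>X Y. \<Union>(a, s)\<in>X. \<Union>(b, u)\<in>Y. loc_frac R P (a \<otimes>\<^bsub>R\<^esub> b) (s \<otimes>\<^bsub>R\<^esub> u)),
       one = loc_frac R P \<one>\<^bsub>R\<^esub> \<one>\<^bsub>R\<^esub>,
       zero = loc_frac R P \<zero>\<^bsub>R\<^esub> \<one>\<^bsub>R\<^esub>,
       add = (\<lambda>X Y. \<Union>(a, s)\<in>X. \<Union>(b, u)\<in>Y.
                loc_frac R P (a \<otimes>\<^bsub>R\<^esub> u \<oplus>\<^bsub>R\<^esub> b \<otimes>\<^bsub>R\<^esub> s) (s \<otimes>\<^bsub>R\<^esub> u)) \<rparr>"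

definition loc_map :: "('a, 'r) ring_scheme \<Rightarrow> 'a set \<Rightarrow> 'a \<Rightarrow> ('a \<times> 'a) set" where
  "loc_map R P a = loc_frac R P a \<one>\<^bsub>R\<^esub>"

definition krull_dim :: "('a, 'r) ring_scheme \<Rightarrow> enat" where
  "krull_dim R = Sup {enat n | n. \<exists>P. (\<forall>i\<le>n. primeideal (P i) R) \<and> (\<forall>i<n. P i \<subset> P (Suc i))}"

definition local_ring :: "('a, 'r) ring_scheme \<Rightarrow> bool" where
  "local_ring R \<longleftrightarrow> cring R \<and> (\<exists>!m. maximalideal m R)"

text \<open>In the next two definitions \<open>R\<close> is meant to be a local ring, so that the only ideal that
  can satisfy \<^const>\<open>maximalideal\<close> is its unique maximal ideal.\<close>

definition regular_system_of_parameters :: "('a, 'r) ring_scheme \<Rightarrow> 'a list \<Rightarrow> bool" where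
  "regular_system_of_parameters R xs \<longleftrightarrow>
     set xs \<subseteq> carrier R \<and> enat (length xs) = krull_dim R \<and> maximalideal (Idl\<^bsub>R\<^esub> (set xs)) R"

definition uniformizer :: "('a, 'r) ring_scheme \<Rightarrow> 'a \<Rightarrow> bool" where
  "uniformizer R t \<longleftrightarrow> t \<in> carrier R \<and> maximalideal (PIdl\<^bsub>R\<^esub> t) R"

definition regular_local_ring :: "('a, 'r) ring_scheme \<Rightarrow> bool" where
  "regular_local_ring R \<longleftrightarrow>
     local_ring R \<and> noetherian_ring R \<and> (\<exists>xs. regular_system_of_parameters R xs)"

subsection \<open>Real algebraic sets and regular functions\<close>

definition algebraic_set :: "'a::euclidean_space set \<Rightarrow> bool" where
  "algebraic_set V \<longleftrightarrow>
     (\<exists>P. (\<forall>p\<in>P. real_polynomial_function p) \<and> V = {x. \<forall>p\<in>P. p x = 0})"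

definition irreducible_algebraic_set :: "'a::euclidean_space set \<Rightarrow> bool" where
  "irreducible_algebraic_set V \<longleftrightarrow> algebraic_set V \<and> V \<noteq> {} \<and>
     (\<forall>V1 V2. algebraic_set V1 \<and> algebraic_set V2 \<and> V = V1 \<union> V2 \<longrightarrow> V = V1 \<or> V = V2)"

definition zariski_closure :: "'a::euclidean_space set \<Rightarrow> 'a set" where
  "zariski_closure S = algebraic_set hull S"

definition irreducible_component :: "'a::euclidean_space set \<Rightarrow> 'a set \<Rightarrow> bool" where
  "irreducible_component V Z \<longleftrightarrow> irreducible_algebraic_set V \<and> V \<subseteq> Z \<and>
     (\<forall>V'. irreducible_algebraic_set V' \<and> V \<subseteq> V' \<and> V' \<subseteq> Z \<longrightarrow> V' = V)"

text \<open>Functions on \<open>V\<close> are represented as extensional functions (\<^const>\<open>undefined\<close> off \<open>V\<close>).\<close>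

definition regular_ring :: "'a::euclidean_space set \<Rightarrow> ('a \<Rightarrow> real) ring" where
  "regular_ring V =
     \<lparr> carrier = {\<lambda>x\<in>V. p x / q x | p q.
         real_polynomial_function p \<and> real_polynomial_function q \<and> (\<forall>x\<in>V. q x \<noteq> 0)},
       mult = (\<lambda>f g. \<lambda>x\<in>V. f x * g x),
       one = (\<lambda>x\<in>V. 1),
       zero = (\<lambda>x\<in>V. 0),
       add = (\<lambda>f g. \<lambda>x\<in>V. f x + g x) \<rparr>"

definition vanishing_ideal :: "'a::euclidean_space set \<Rightarrow> 'a set \<Rightarrow> ('a \<Rightarrow> real) set" where
  "vanishing_ideal V W = {f \<in> carrier (regular_ring V). \<forall>x\<in>W. f x = 0}"

text \<open>The localisation of the ring of regular functions on \<open>V\<close> at the ideal of a subvariety \<open>W\<close>;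
  the local ring of \<open>V\<close> at a point \<open>x\<close> is \<open>local_ring_at V {x}\<close>.\<close>

abbreviation local_ring_at :: "'a::euclidean_space set \<Rightarrow> 'a set \<Rightarrow> (('a \<Rightarrow> real) \<times> ('a \<Rightarrow> real)) set ring" where
  "local_ring_at V W \<equiv> localization (regular_ring V) (vanishing_ideal V W)"

definition alg_dim :: "'a::euclidean_space set \<Rightarrow> enat" where
  "alg_dim V = krull_dim (regular_ring V)"

definition nonsingular :: "'a::euclidean_space set \<Rightarrow> bool" where
  "nonsingular V \<longleftrightarrow>
     (\<forall>x\<in>V. regular_local_ring (local_ring_at V {x}) \<and> krull_dim (local_ring_at V {x}) = alg_dim V)"

subsection \<open>Semialgebraic sets\<close>

inductive sign_combination :: "('a \<Rightarrow> real) set \<Rightarrow> 'a set \<Rightarrow> bool" for F where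
  pos: "f \<in> F \<Longrightarrow> sign_combination F {x. f x > 0}"
| zero: "f \<in> F \<Longrightarrow> sign_combination F {x. f x = 0}"
| neg: "f \<in> F \<Longrightarrow> sign_combination F {x. f x < 0}"
| univ: "sign_combination F UNIV"
| compl: "sign_combination F S \<Longrightarrow> sign_combination F (- S)"
| inter: "sign_combination F S \<Longrightarrow> sign_combination F T \<Longrightarrow> sign_combination F (S \<inter> T)"
| union: "sign_combination F S \<Longrightarrow> sign_combination F T \<Longrightarrow> sign_combination F (S \<union> T)"

definition semialgebraic :: "'a::euclidean_space set \<Rightarrow> bool" where
  "semialgebraic S \<longleftrightarrow> sign_combination {p. real_polynomial_function p} S"

definition described_by :: "'a set \<Rightarrow> ('a \<Rightarrow> real) set \<Rightarrow> 'a set \<Rightarrow> bool" where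
  "described_by M F A \<longleftrightarrow> (\<exists>S. sign_combination F S \<and> A = M \<inter> S)"

definition generically_separable :: "'a::euclidean_space set \<Rightarrow> 'a set \<Rightarrow> 'a set \<Rightarrow> bool" where
  "generically_separable V S T \<longleftrightarrow>
     (\<exists>f \<in> carrier (regular_ring V). f \<noteq> \<zero>\<^bsub>regular_ring V\<^esub> \<and> (\<forall>x\<in>S. f x \<ge> 0) \<and> (\<forall>x\<in>T. f x \<le> 0))"

subsection \<open>Walls, shadows and counter-shadows\<close>

definition walls :: "'a::euclidean_space set \<Rightarrow> 'a set \<Rightarrow> 'a set \<Rightarrow> 'a set set" where
  "walls M A B =
     {W. irreducible_component W
           (zariski_closure (top_of_set M frontier_of A) \<union> zariski_closure (top_of_set M frontier_of B))
         \<and> alg_dim W + 1 = alg_dim M}"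

definition normal_crossings :: "'a::euclidean_space set \<Rightarrow> ('a \<Rightarrow> real) set \<Rightarrow> bool" where
  "normal_crossings M F \<longleftrightarrow>
     (\<forall>x\<in>M. let L = local_ring_at M {x} in
        \<exists>xs. regular_system_of_parameters L xs \<and>
          (\<forall>f\<in>F. \<exists>a \<in> Units L. \<exists>m :: nat \<Rightarrow> nat.
             loc_map (regular_ring M) (vanishing_ideal M {x}) (restrict f M) =
               a \<otimes>\<^bsub>L\<^esub> (\<Otimes>\<^bsub>L\<^esub>i\<in>{..<length xs}. (xs ! i) [^]\<^bsub>L\<^esub> m i)))"

definition walls_at_normal_crossings :: "'a::euclidean_space set \<Rightarrow> 'a set \<Rightarrow> 'a set \<Rightarrow> bool" where
  "walls_at_normal_crossings M A B \<longleftrightarrow>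
     (\<exists>F. finite F \<and> (\<forall>f\<in>F. real_polynomial_function f) \<and> normal_crossings M F \<and>
        described_by M F A \<and> described_by M F B)"

definition shadow :: "'a::euclidean_space set \<Rightarrow> 'a set \<Rightarrow> 'a set" where
  "shadow W A = closure A \<inter> W"

text \<open>The sets \<open>{t > 0}\<close> and \<open>{t < 0}\<close> for a fraction \<open>t\<close> of regular functions on \<open>M\<close>, that is, an
  element of a localisation: only the points at which some representation of \<open>t\<close> has a
  non-vanishing denominator are considered.\<close>

definition frac_pos :: "'a set \<Rightarrow> (('a \<Rightarrow> real) \<times> ('a \<Rightarrow> real)) set \<Rightarrow> 'a set" where
  "frac_pos M t = {x \<in> M. \<exists>(f, g) \<in> t. g x \<noteq> 0 \<and> f x / g x > 0}"

definition frac_neg :: "'a set \<Rightarrow> (('a \<Rightarrow> real) \<times> ('a \<Rightarrow> real)) set \<Rightarrow> 'a set" where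
  "frac_neg M t = {x \<in> M. \<exists>(f, g) \<in> t. g x \<noteq> 0 \<and> f x / g x < 0}"

text \<open>\<open>twist M t A B\<close> is $A^t$ and \<open>twist M t B A\<close> is $B^t$.\<close>

definition twist ::
  "'a set \<Rightarrow> (('a \<Rightarrow> real) \<times> ('a \<Rightarrow> real)) set \<Rightarrow> 'a set \<Rightarrow> 'a set \<Rightarrow> 'a set" where
  "twist M t A B = (A \<inter> frac_pos M t) \<union> (B \<inter> frac_neg M t)"

end

theory Submission
  imports Defs
begin

text \<open>Normal crossings provide, around each point of \<open>M\<close>, a chart in which the walls are coordinate
  hyperplanes and \<open>A\<close>, \<open>B\<close> are, off the walls, unions of orthants. If a function separates \<open>A\<close> and \<open>B\<close>
  generically, its leading coefficient along a wall separates the shadows or the counter-shadows, according as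
  its order there is even or odd.

  Conversely, expand the separating function of a wall along a flag of strata. The orders of vanishing met on
  the way depend only on the flag, and their parities tell the orthants in \<open>A\<close> from those in \<open>B\<close>:
  for \<open>z\<close> in \<open>A\<close> the product of the \<open>sgn (z $ b) ^ k b\<close> is a constant \<open>s\<close>, and it is \<open>- s\<close> for \<open>z\<close> in \<open>B\<close>.
  For every flag at each of finitely many chart centres, multiply the local equations of odd exponent by
  non-negative factors vanishing along the walls to high orders that increase along the flag. On each
  chart these functions are bounded by a multiple of the sum of the absolute values of those belonging to its own
  flags, so a combination with suitable continuous coefficients has the right sign off the walls. By the
  Stone-Weierstrass theorem the coefficients may be taken to be polynomials.\<close>

subsection \<open>Polynomial functions and their derivatives\<close>

text \<open>Regularity of a local ring is an algebraic statement, while signs live on Euclidean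
  germs. The bridge is that a polynomial seen in a chart behaves like an analytic function: if it
  vanishes to infinite order at the centre of a coordinate slice, it vanishes on the whole slice. No
  power series enter. Having one function more than the dimension of the slice gives an algebraic
  relation, and the relation forbids fast decay; Krull's intersection theorem then turns infinite
  order into divisibility by local equations, up to a denominator that is non-zero at the centre.
  The global obstacle is that walls may meet in several components. Orders along flags at two
  centres are comparable only as long as the strata, and not merely the walls, agree; where they
  separate, an additional factor has to damp the function. All estimates are relative to the sum of
  the absolute values of the glued functions. This sum may tend to zero at the walls, so an absolute
  margin could not survive an approximation of the coefficients, whereas a proportional one
  does.\<close>

abbreviation rpf :: "((real ^ 'n) => real) => bool" where
 "rpf \<equiv> real_polynomial_function"

definition pd :: "'n::finite => (real ^ 'n => real) => real ^ 'n => real" where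
 "pd i f x = frechet_derivative f (at x) (axis i 1)"

definition vf :: "('n::finite => real ^ 'n => real) => (real ^ 'n => real) => real ^ 'n => real" where
 "vf a f x = (\<Sum>i\<in>UNIV. a i x * pd i f x)"

lemma rpf_nth [intro, simp]: "rpf (%x. x $ i)"
 by (rule real_polynomial_function.intros(1)) (rule bounded_linear_vec_nth)

lemma rpf_const [intro, simp]: "rpf (%x. c)"
 by (rule real_polynomial_function.intros(2))

lemma rpf_cmult: "rpf f ==> rpf (%x. c * f x)"
 by (rule real_polynomial_function.intros(4)) auto

lemmas rpf_intros = rpf_const rpf_nth real_polynomial_function.intros(3,4)
 real_polynomial_function_diff real_polynomial_function_minus real_polynomial_function_sum
 real_polynomial_function_prod real_polynomial_function_power

lemma linear_vec_expand:
 fixes f :: "real ^ 'n => real"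
 assumes "linear f"
 shows "f h = (\<Sum>i\<in>UNIV. f (axis i 1) * h $ i)"
proof -
 have "f h = f (\<Sum>i\<in>UNIV. h $ i *\<^sub>R axis i 1)"
  by (simp add: basis_expansion flip: scalar_mult_eq_scaleR)
 also have "... = (\<Sum>i\<in>UNIV. f (axis i 1) * h $ i)"
  by (simp add: linear_sum[OF assms] linear_cmul[OF assms] mult.commute)
 finally show ?thesis .
qed

lemma has_derivative_pd:
 fixes f :: "real ^ 'n => real"
 assumes "f differentiable at x"
 shows "(f has_derivative (%h. \<Sum>i\<in>UNIV. pd i f x * h $ i)) (at x)"
proof -
 have d: "(f has_derivative frechet_derivative f (at x)) (at x)"
  using assms frechet_derivative_works by blast
 have "frechet_derivative f (at x) = (%h. \<Sum>i\<in>UNIV. pd i f x * h $ i)"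
  unfolding pd_def using linear_vec_expand[OF has_derivative_linear[OF d]] by blast
 with d show ?thesis by simp
qed

lemma pd_unique:
 fixes f :: "real ^ 'n => real"
 assumes "(f has_derivative (%h. \<Sum>i\<in>UNIV. g i * h $ i)) (at x)"
 shows "pd i f x = g i"
 by (simp add: pd_def frechet_derivative_at[OF assms, symmetric] axis_def if_distrib cong: if_cong)

lemma pd_unique':
 fixes f :: "real ^ 'n => real"
 assumes "(f has_derivative f') (at x)"
 shows "pd i f x = f' (axis i 1)"
 by (simp add: pd_def frechet_derivative_at[OF assms, symmetric])

lemma pd_add:
 assumes "f differentiable at x" "g differentiable at x"
 shows "pd i (%x. f x + g x) x = pd i f x + pd i g x"
 using pd_unique'[OF has_derivative_add[OF assms[THEN has_derivative_pd]]]
 by (simp add: axis_def if_distrib cong: if_cong)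

lemma pd_mult:
 assumes "f differentiable at x" "g differentiable at x"
 shows "pd i (%x. f x * g x) x = f x * pd i g x + g x * pd i f x"
 using pd_unique'[OF has_derivative_mult[OF assms[THEN has_derivative_pd]]]
 by (simp add: axis_def if_distrib cong: if_cong)

lemma pd_const [simp]: "pd i (%x. c) x = 0"
 by (simp add: pd_def)

lemma pd_nth: "pd i (%x. x $ j) x = (if i = j then 1 else 0)"
 by (subst pd_unique'[OF bounded_linear_imp_has_derivative[OF bounded_linear_vec_nth]])
   (simp add: axis_def)

text \<open>Differentiability and polynomiality of the partial derivatives are proved together, so
  that one induction over the generation of polynomial functions gives both.\<close>

lemma rpf_gradient:
 fixes f :: "real ^ 'n => real"
 assumes "rpf f"
 shows "EX g. (ALL i. rpf (g i)) & (ALL x. (f has_derivative (%h. \<Sum>i\<in>UNIV. g i x * h $ i)) (at x))"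
 using assms
proof induction
 case (linear f)
 have "f = (%h. \<Sum>i\<in>UNIV. f (axis i 1) * h $ i)"
  using linear_vec_expand bounded_linear.linear[OF linear] by blast
 moreover have "(f has_derivative f) (at x)" for x
  by (rule bounded_linear_imp_has_derivative[OF linear])
 ultimately have "(f has_derivative (%h. \<Sum>i\<in>UNIV. f (axis i 1) * h $ i)) (at x)" for x
  by metis
 then show ?case
  by (intro exI[of _ "%i x. f (axis i 1)"]) auto
next
 case (const c)
 show ?case by (intro exI[of _ "%i x. 0"]) auto
next
 case (add f g)
 obtain f' where f': "ALL i. rpf (f' i)" "ALL x. (f has_derivative (%h. \<Sum>i\<in>UNIV. f' i x * h $ i)) (at x)"
  using add.IH(1) by blast
 obtain g' where g': "ALL i. rpf (g' i)" "ALL x. (g has_derivative (%h. \<Sum>i\<in>UNIV. g' i x * h $ i)) (at x)"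
  using add.IH(2) by blast
 have "((%x. f x + g x) has_derivative (%h. \<Sum>i\<in>UNIV. (f' i x + g' i x) * h $ i)) (at x)" for x
  using has_derivative_add[OF f'(2)[rule_format] g'(2)[rule_format], of x]
  by (simp add: sum.distrib algebra_simps)
 then show ?case
  using f'(1) g'(1) by (intro exI[of _ "%i x. f' i x + g' i x"]) auto
next
 case (mult f g)
 obtain f' where f': "ALL i. rpf (f' i)" "ALL x. (f has_derivative (%h. \<Sum>i\<in>UNIV. f' i x * h $ i)) (at x)"
  using mult.IH(1) by blast
 obtain g' where g': "ALL i. rpf (g' i)" "ALL x. (g has_derivative (%h. \<Sum>i\<in>UNIV. g' i x * h $ i)) (at x)"
  using mult.IH(2) by blast
 have "((%x. f x * g x) has_derivative (%h. \<Sum>i\<in>UNIV. (f x * g' i x + f' i x * g x) * h $ i)) (at x)" for x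
  using has_derivative_mult[OF f'(2)[rule_format] g'(2)[rule_format], of x]
  by (simp add: sum_distrib_left sum_distrib_right sum.distrib algebra_simps)
 then show ?case
  using f'(1) g'(1) mult.hyps by (intro exI[of _ "%i x. f x * g' i x + f' i x * g x"])
   (auto intro!: rpf_intros)
qed

lemma rpf_differentiable [intro, simp]: "rpf f ==> f differentiable at x"
 using rpf_gradient differentiable_def by blast

lemma rpf_pd [intro, simp]: "rpf f ==> rpf (pd i f)"
proof -
 assume "rpf f"
 then obtain g where g: "ALL i. rpf (g i)"
  "ALL x. (f has_derivative (%h. \<Sum>i\<in>UNIV. g i x * h $ i)) (at x)"
  using rpf_gradient by metis
 then have "pd i f = g i" by (intro ext pd_unique) blast
 with g show ?thesis by simp
qed

lemma rpf_continuous [intro, simp]: "rpf f ==> continuous_on S f"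
 by (simp add: continuous_on_polymonial_function real_polynomial_function_eq)

lemma rpf_isCont [intro, simp]: "rpf f ==> isCont f x"
 using rpf_continuous[of f UNIV] continuous_on_eq_continuous_at[OF open_UNIV] by blast

lemma rpf_vf [intro]: "(!!i. rpf (a i)) ==> rpf f ==> rpf (vf a f)"
 unfolding vf_def by (intro real_polynomial_function_sum real_polynomial_function.intros(4)) auto

subsection \<open>Algebraic dependence\<close>

text \<open>Gaussian elimination: an unknown \<open>d\<close> with non-zero coefficient in one
  equation is removed from the other equations, and the induction hypothesis solves these in the
  remaining unknowns.\<close>

lemma homogeneous_system_nontrivial:
 fixes a :: "'b => 'c => real"
 assumes "finite B" "finite C" "card B < card C"
 shows "EX x. (EX c:C. x c ~= 0) & (ALL b:B. (\<Sum>c\<in>C. a b c * x c) = 0)"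
 using assms
proof (induction B arbitrary: C a rule: finite_induct)
 case empty
 then obtain c where "c : C" by fastforce
 then show ?case by (intro exI[of _ "%_. 1"]) auto
next
 case (insert b B)
 show ?case
 proof (cases "ALL c:C. a b c = 0")
  case True
  have "card B < card C" using insert by simp
  from insert.IH[OF insert.prems(1) this, of a] obtain x
   where "EX c:C. x c ~= 0" "ALL b:B. (\<Sum>c\<in>C. a b c * x c) = 0" by auto
  with True show ?thesis by (intro exI[of _ x]) auto
 next
  case False
  then obtain d where d: "d : C" "a b d ~= 0" by auto
  have "card B < card (C - {d})" using insert d by (simp add: card_Diff_singleton)
  from insert.IH[OF _ this, of "%b' c. a b' c - a b' d * a b c / a b d"] insert.prems(1)
  obtain x where x: "EX c:C - {d}. x c ~= 0"
   "ALL b':B. (\<Sum>c\<in>C - {d}. (a b' c - a b' d * a b c / a b d) * x c) = 0" by auto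
  \<comment> \<open>The value at \<open>d\<close> is the one that the eliminated equation
    forces.\<close>
  define y where "y = x(d := - (\<Sum>c\<in>C - {d}. a b c * x c) / a b d)"
  have y: "(\<Sum>c\<in>C. a b' c * y c) = a b' d * y d + (\<Sum>c\<in>C - {d}. a b' c * x c)" for b'
   using sum.remove[OF insert.prems(1) d(1), of "%c. a b' c * y c"] by (simp add: y_def)
  have "(\<Sum>c\<in>C. a b c * y c) = 0" using d(2) unfolding y by (simp add: y_def)
  moreover have "(\<Sum>c\<in>C. a b' c * y c) = 0" if "b' : B" for b'
  proof -
   have "0 = (\<Sum>c\<in>C - {d}. a b' c * x c) - a b' d / a b d * (\<Sum>c\<in>C - {d}. a b c * x c)"
    using x(2) that by (simp add: sum_subtractf algebra_simps sum_distrib_left)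
   then show ?thesis unfolding y by (simp add: y_def algebra_simps)
  qed
  moreover have "EX c:C. y c ~= 0" using x(1) by (auto simp: y_def)
  ultimately show ?thesis by blast
 qed
qed

text \<open>Polynomials in variables of an arbitrary index type, as functions of the assignment. The
  parameter bounds the variables that occur, so that a coefficient free of a given variable can be
  expressed. Sums, options and natural numbers serve as index types later.\<close>

inductive pfun :: "'i set => (('i => real) => real) => bool" for I where
 const: "pfun I (%v. c)"
| var: "i : I ==> pfun I (%v. v i)"
| add: "pfun I f ==> pfun I g ==> pfun I (%v. f v + g v)"
| mult: "pfun I f ==> pfun I g ==> pfun I (%v. f v * g v)"

lemma pfun_mono: "pfun I f ==> I \<subseteq> J ==> pfun J f"
 by (induction rule: pfun.induct) (auto intro: pfun.intros)

lemma pfun_cong: "pfun I f ==> (!!i. i : I ==> v i = w i) ==> f v = f w"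
 by (induction rule: pfun.induct) auto

lemma pfun_power: "pfun I f ==> pfun I (%v. f v ^ k)"
 by (induction k) (auto intro: pfun.intros)

lemma pfun_sum: "(!!k. k : K ==> pfun I (f k)) ==> pfun I (%v. \<Sum>k\<in>K. f k v)"
 by (induction K rule: infinite_finite_induct) (auto intro: pfun.intros)

lemma pfun_prod: "(!!k. k : K ==> pfun I (f k)) ==> pfun I (%v. \<Prod>k\<in>K. f k v)"
 by (induction K rule: infinite_finite_induct) (auto intro: pfun.intros)

lemma pfun_rpf:
 "pfun I f ==> (!!i. i : I ==> real_polynomial_function (y i)) ==> real_polynomial_function (%x. f (%i. y i x))"
 by (induction rule: pfun.induct) (auto intro: real_polynomial_function.intros)

lemma pfun_expand:
 assumes "pfun I f"
 shows "EX n c. (ALL k. pfun (I - {i}) (c k)) & f = (%v. \<Sum>k\<le>n. c k v * v i ^ k)"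
 using assms
proof induction
 case (const c)
 show ?case by (intro exI[of _ 0] exI[of _ "%k v. c"]) (auto intro: pfun.intros)
next
 case (var j)
 show ?case
 proof (cases "j = i")
  case True
  then show ?thesis
   by (intro exI[of _ 1] exI[of _ "%k v. real k"]) (auto intro: pfun.intros)
 next
  case False
  with var show ?thesis
   by (intro exI[of _ 0] exI[of _ "%k v. v j"]) (auto intro: pfun.intros)
 qed
next
 case (add f g)
 then obtain n c m d where
  c: "!!k. pfun (I - {i}) (c k)" "f = (%v. \<Sum>k\<le>n::nat. c k v * v i ^ k)" and
  d: "!!k. pfun (I - {i}) (d k)" "g = (%v. \<Sum>k\<le>m::nat. d k v * v i ^ k)" by blast
 have 1: "f v = (\<Sum>k\<le>max n m. (if k <= n then c k v else 0) * v i ^ k)" for v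
  unfolding c(2) by (rule sum.mono_neutral_cong_left) auto
 have 2: "g v = (\<Sum>k\<le>max n m. (if k <= m then d k v else 0) * v i ^ k)" for v
  unfolding d(2) by (rule sum.mono_neutral_cong_left) auto
 have "pfun (I - {i}) (%v. (if k <= n then c k v else 0) + (if k <= m then d k v else 0))" for k
  using c(1)[of k] d(1)[of k] by (cases "k <= n"; cases "k <= m") (auto intro: pfun.intros)
 then show ?case
  by (intro exI[of _ "max n m"] exI[of _ "%k v. (if k <= n then c k v else 0) + (if k <= m then d k v else 0)"])
    (simp add: 1 2 ring_distribs sum.distrib)
next
 case (mult f g)
 then obtain n c m d where
  c: "!!k. pfun (I - {i}) (c k)" "f = (%v. \<Sum>k\<le>n::nat. c k v * v i ^ k)" and
  d: "!!k. pfun (I - {i}) (d k)" "g = (%v. \<Sum>k\<le>m::nat. d k v * v i ^ k)" by blast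
 define c' where "c' k v = (if k <= n then c k v else 0)" for k v
 define d' where "d' k v = (if k <= m then d k v else 0)" for k v
 have c': "pfun (I - {i}) (c' k)" for k
  using c(1)[of k] by (cases "k <= n") (auto simp: c'_def[abs_def] intro: pfun.intros)
 have d': "pfun (I - {i}) (d' k)" for k
  using d(1)[of k] by (cases "k <= m") (auto simp: d'_def[abs_def] intro: pfun.intros)
 have 1: "f v = (\<Sum>k\<le>n. c' k v * v i ^ k)" for v
  unfolding c(2) by (rule sum.cong) (auto simp: c'_def)
 have 2: "g v = (\<Sum>k\<le>m. d' k v * v i ^ k)" for v
  unfolding d(2) by (rule sum.cong) (auto simp: d'_def)
 have "f v * g v = (\<Sum>r\<le>n + m. (\<Sum>k\<le>r. c' k v * d' (r - k) v) * v i ^ r)" for v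
  unfolding 1 2 by (rule polynomial_product) (auto simp: c'_def d'_def)
 moreover have "pfun (I - {i}) (%v. \<Sum>k\<le>r. c' k v * d' (r - k) v)" for r
  by (intro pfun_sum pfun.mult c' d')
 ultimately show ?case
  by (intro exI[of _ "n + m"] exI[of _ "%r v. \<Sum>k\<le>r. c' k v * d' (r - k) v"]) auto
qed

text \<open>\<open>e\<close> is the least exponent of \<open>v i\<close> with a non-zero
  coefficient, so the part \<open>g0\<close> free of \<open>v i\<close> is non-zero. A relation can
  then be restricted to \<open>v i = 0\<close> without becoming trivial; this is how relations are
  carried to smaller strata.\<close>

lemma pfun_factor:
 assumes f: "pfun I f" and nz: "f ~= (%v. 0)" and i: "i : I"
 obtains e g g0 g1 where "f = (%v. v i ^ e * g v)" "pfun I g" "pfun (I - {i}) g0" "pfun I g1"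
  "g0 ~= (%v. 0)" "g = (%v. g0 v + v i * g1 v)"
proof -
 obtain n c where c: "!!k. pfun (I - {i}) (c k)" "f = (%v. \<Sum>k\<le>n::nat. c k v * v i ^ k)"
  using pfun_expand[OF f] by blast
 have ex: "EX k<=n. c k ~= (%v. 0)"
 proof (rule ccontr)
  assume "\<not> ?thesis"
  then have "c k v = 0" if "k <= n" for k v using that by (metis)
  then have "f = (%v. 0)" unfolding c(2) by (intro ext sum.neutral) auto
  with nz show False by contradiction
 qed
 define e where "e = (LEAST k. k <= n & c k ~= (%v. 0))"
 have e: "e <= n" "c e ~= (%v. 0)"
  using LeastI_ex[OF ex[unfolded]] unfolding e_def by blast+
 have less: "c k = (%v. 0)" if "k < e" for k
  using not_less_Least[of k "%k. k <= n & c k ~= (%v. 0)"] that e(1) unfolding e_def[symmetric] by auto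
 define g1 where "g1 v = (\<Sum>k\<in>{e<..n}. c k v * v i ^ (k - Suc e))" for v
 have "f v = v i ^ e * (c e v + v i * g1 v)" for v
 proof -
  have "f v = (\<Sum>k\<in>{e..n}. c k v * v i ^ k)"
   unfolding c(2) by (rule sum.mono_neutral_right) (use less in "auto simp: not_le")
  also have "... = c e v * v i ^ e + (\<Sum>k\<in>{e<..n}. c k v * v i ^ k)"
  proof -
   have "{e..n} = insert e {e<..n}" using e(1) by auto
   then show ?thesis by simp
  qed
  also have "(\<Sum>k\<in>{e<..n}. c k v * v i ^ k) = v i ^ Suc e * g1 v"
   unfolding g1_def sum_distrib_left
  proof (rule sum.cong[OF refl])
   fix k assume "k : {e<..n}"
   then have "v i ^ k = v i ^ Suc e * v i ^ (k - Suc e)"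
    by (metis Suc_leI greaterThanAtMost_iff le_add_diff_inverse power_add)
   then show "c k v * v i ^ k = v i ^ Suc e * (c k v * v i ^ (k - Suc e))" by simp
  qed
  finally show ?thesis by (simp add: algebra_simps)
 qed
 moreover have g1: "pfun I g1"
  unfolding g1_def by (intro pfun_sum pfun.mult pfun_power pfun.var i pfun_mono[OF c(1)]) auto
 moreover have "pfun I (%v. c e v + v i * g1 v)"
  by (intro pfun.add pfun.mult pfun.var g1 i pfun_mono[OF c(1)]) auto
 ultimately show ?thesis using c(1) e(2) that[of e "%v. c e v + v i * g1 v" "c e" g1] by auto
qed

text \<open>Grouping by the exponent of one variable gives a polynomial in that variable that
  vanishes identically, so each of its coefficients, a polynomial in the other variables, is
  zero.\<close>

lemma pfun_monomials_independent:
 assumes "finite I" "!!v. (\<Sum>al\<in>Pi\<^sub>E I (%_. {..K::nat}). c al * (\<Prod>i\<in>I. v i ^ al i)) = (0::real)"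
  "al : Pi\<^sub>E I (%_. {..K})"
 shows "c al = 0"
 using assms
proof (induction I arbitrary: c al rule: finite_induct)
 case empty
 then show ?case by simp
next
 case (insert i I)
 let ?E = "Pi\<^sub>E I (%_. {..K})"
 have inj: "inj_on (%(y, g). g(i := y)) ({..K} \<times> ?E)"
  using inj_combinator[OF insert.hyps(2), of "%_. {..K}"] by simp
 have fin: "finite ?E" using insert.hyps by (intro finite_PiE) auto
 have split: "(\<Sum>al\<in>Pi\<^sub>E (insert i I) (%_. {..K}). c al * (\<Prod>j\<in>insert i I. v j ^ al j))
   = (\<Sum>k\<le>K. (\<Sum>beta\<in>?E. c (beta(i := k)) * (\<Prod>j\<in>I. v j ^ beta j)) * v i ^ k)" for v :: "'a => real"
 proof -
  have p: "(\<Prod>j\<in>I. v j ^ (beta(i := k)) j) = (\<Prod>j\<in>I. v j ^ beta j)" for beta and k :: nat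
   using insert.hyps(2) by (intro prod.cong) auto
  have "(\<Sum>al\<in>Pi\<^sub>E (insert i I) (%_. {..K}). c al * (\<Prod>j\<in>insert i I. v j ^ al j))
    = (\<Sum>(k, beta)\<in>{..K} \<times> ?E. c (beta(i := k)) * (v i ^ k * (\<Prod>j\<in>I. v j ^ beta j)))"
   unfolding PiE_insert_eq sum.reindex[OF inj]
  proof (intro sum.cong refl, clarify)
   fix k and beta :: "'a => nat"
   show "((%al. c al * (\<Prod>j\<in>insert i I. v j ^ al j)) \<circ> (%(y, g). g(i := y))) (k, beta)
     = c (beta(i := k)) * (v i ^ k * (\<Prod>j\<in>I. v j ^ beta j))"
    using p[of beta k] by (simp only: comp_def case_prod_conv prod.insert[OF insert.hyps] fun_upd_same)
  qed
  also have "... = (\<Sum>k\<le>K. \<Sum>beta\<in>?E. c (beta(i := k)) * (v i ^ k * (\<Prod>j\<in>I. v j ^ beta j)))"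
   by (simp only: sum.cartesian_product)
  finally show ?thesis by (simp add: sum_distrib_left sum_distrib_right mult_ac)
 qed
 have "(\<Sum>beta\<in>?E. c (beta(i := k)) * (\<Prod>j\<in>I. v j ^ beta j)) = 0" if "k <= K" for k v
 proof -
  have "(\<Sum>k\<le>K. (\<Sum>beta\<in>?E. c (beta(i := k)) * (\<Prod>j\<in>I. v j ^ beta j)) * t ^ k) = 0" for t
  proof -
   have "(\<Prod>j\<in>I. (v(i := t)) j ^ beta j) = (\<Prod>j\<in>I. v j ^ beta j)" for beta :: "'a => nat"
    using insert.hyps(2) by (intro prod.cong) auto
   with insert.prems(1)[of "v(i := t)"] show ?thesis unfolding split by simp
  qed
  with that show ?thesis
   using polyfun_eq_0[of "%k. \<Sum>beta\<in>?E. c (beta(i := k)) * (\<Prod>j\<in>I. v j ^ beta j)" K] by simp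
 qed
 moreover obtain beta k where "al = beta(i := k)" "beta : ?E" "k <= K"
  using insert.prems(2) unfolding PiE_insert_eq by auto
 ultimately show ?case using insert.IH[of "%beta. c (beta(i := k))"] by blast
qed

text \<open>The bound concerns the exponent of every single coordinate and not the total degree; the
  exponents then fill a box, which is easy to count.\<close>

definition bdeg :: "nat => (real ^ 'n => real) => bool" where
 "bdeg D f \<longleftrightarrow> (EX c. f = (%x. \<Sum>beta\<in>UNIV \<rightarrow>\<^sub>E {..D}. c beta * (\<Prod>i\<in>UNIV. x $ i ^ beta i)))"

lemma finite_exps [simp]: "finite (UNIV \<rightarrow>\<^sub>E {..D::nat} :: ('n::finite => nat) set)"
 by (intro finite_PiE) auto

lemma bdeg_monomial:
 assumes "!!i. beta i <= D"
 shows "bdeg D (%x :: real ^ 'n. c * (\<Prod>i\<in>UNIV. x $ i ^ beta i))"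
proof -
 have b: "beta : UNIV \<rightarrow>\<^sub>E {..D}" using assms by (auto simp: PiE_def)
 have "(%x :: real ^ 'n. c * (\<Prod>i\<in>UNIV. x $ i ^ beta i)) =
   (%x. \<Sum>\<gamma>\<in>UNIV \<rightarrow>\<^sub>E {..D}. (if \<gamma> = beta then c else 0) * (\<Prod>i\<in>UNIV. x $ i ^ \<gamma> i))"
  using b by (simp add: if_distrib[of "%z. z * _"] sum.delta cong: if_cong)
 then show ?thesis unfolding bdeg_def by (rule exI[of _ "%\<gamma>. if \<gamma> = beta then c else 0"])
qed

lemma bdeg_add: "bdeg D f ==> bdeg D g ==> bdeg D (%x. f x + g x)"
 unfolding bdeg_def
proof safe
 fix c d :: "('a => nat) => real"
 show "EX e. (%x. (\<Sum>beta\<in>UNIV \<rightarrow>\<^sub>E {..D}. c beta * (\<Prod>i\<in>UNIV. x $ i ^ beta i)) + (\<Sum>beta\<in>UNIV \<rightarrow>\<^sub>E {..D}. d beta * (\<Prod>i\<in>UNIV. x $ i ^ beta i)))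
   = (%x. \<Sum>beta\<in>UNIV \<rightarrow>\<^sub>E {..D}. e beta * (\<Prod>i\<in>UNIV. x $ i ^ beta i))"
  by (intro exI[of _ "%beta. c beta + d beta"]) (simp add: ring_distribs sum.distrib)
qed

lemma bdeg_sum: "finite K ==> (!!k. k : K ==> bdeg D (f k)) ==> bdeg D (%x. \<Sum>k\<in>K. f k x)"
proof (induction K rule: finite_induct)
 case empty
 show ?case using bdeg_monomial[of "%_. 0" D 0] by simp
qed (simp add: bdeg_add)

lemma bdeg_mono:
 assumes "bdeg D f" "D <= E"
 shows "bdeg E f"
proof -
 obtain c where c: "f = (%x. \<Sum>beta\<in>UNIV \<rightarrow>\<^sub>E {..D}. c beta * (\<Prod>i\<in>UNIV. x $ i ^ beta i))"
  using assms unfolding bdeg_def by blast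
 show ?thesis unfolding c
 proof (intro bdeg_sum bdeg_monomial)
  fix beta :: "'a => nat" and i assume "beta : UNIV \<rightarrow>\<^sub>E {..D}"
  then show "beta i <= E" using assms(2) by (meson PiE_mem UNIV_I atMost_iff order_trans)
 qed simp
qed

lemma bdeg_mult:
 assumes "bdeg D f" "bdeg E g"
 shows "bdeg (D + E) (%x. f x * g x)"
proof -
 obtain c d where c: "f = (%x. \<Sum>beta\<in>UNIV \<rightarrow>\<^sub>E {..D}. c beta * (\<Prod>i\<in>UNIV. x $ i ^ beta i))"
  and d: "g = (%x. \<Sum>beta\<in>UNIV \<rightarrow>\<^sub>E {..E}. d beta * (\<Prod>i\<in>UNIV. x $ i ^ beta i))"
  using assms unfolding bdeg_def by blast
 have "(%x. f x * g x) = (%x. \<Sum>beta\<in>UNIV \<rightarrow>\<^sub>E {..D}. \<Sum>\<gamma>\<in>UNIV \<rightarrow>\<^sub>E {..E}.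
   (c beta * d \<gamma>) * (\<Prod>i\<in>UNIV. x $ i ^ (beta i + \<gamma> i)))"
  unfolding c d sum_product by (simp add: power_add prod.distrib mult_ac)
 moreover have "bdeg (D + E) ..."
 proof (intro bdeg_sum bdeg_monomial finite_exps)
  fix beta \<gamma> :: "'a => nat" and i
  assume "beta : UNIV \<rightarrow>\<^sub>E {..D}" "\<gamma> : UNIV \<rightarrow>\<^sub>E {..E}"
  then have "beta i <= D" "\<gamma> i <= E" by (meson PiE_mem UNIV_I atMost_iff)+
  then show "beta i + \<gamma> i <= D + E" by simp
 qed
 ultimately show ?thesis by simp
qed

lemma rpf_bdeg:
 fixes f :: "real ^ 'n => real"
 assumes "rpf f"
 shows "EX D. bdeg D f"
 using assms
proof induction
 case (linear f)
 have *: "bdeg 1 (%x. f (axis i 1) * x $ i)" for i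
 proof -
  have "(\<Prod>j\<in>UNIV. (x :: real ^ 'n) $ j ^ (if j = i then 1 else 0)) = x $ i" for x
   by (subst prod.remove[of _ i]) (auto intro!: prod.neutral)
  with bdeg_monomial[of "%j. if j = i then 1 else 0" 1 "f (axis i 1)"] show ?thesis by simp
 qed
 have "f = (%x. \<Sum>i\<in>UNIV. f (axis i 1) * x $ i)"
  using linear_vec_expand bounded_linear.linear[OF linear] by blast
 moreover have "bdeg 1 (%x. \<Sum>i\<in>UNIV. f (axis i 1) * x $ i)" by (intro bdeg_sum *) simp
 ultimately have "bdeg 1 f" by (rule arg_cong[where f = "bdeg 1", THEN iffD2])
 then show ?case by blast
next
 case (const c)
 show ?case using bdeg_monomial[of "%_. 0" 0 c] by auto
next
 case (add f g)
 then obtain D E where "bdeg D f" "bdeg E g" by blast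
 from bdeg_add[OF bdeg_mono[OF this(1), of "max D E"] bdeg_mono[OF this(2), of "max D E"]]
 show ?case by auto
next
 case (mult f g)
 then show ?case using bdeg_mult by blast
qed

text \<open>The monomials in the \<open>y i\<close> of bounded degree outnumber those in the coordinates.\<close>

lemma algebraically_dependent:
 fixes y :: "'i => real ^ 'n => real"
 assumes I: "finite I" "CARD('n) < card I" and y: "!!i. i : I ==> rpf (y i)"
 obtains f where "pfun I f" "f ~= (%v. 0)" "!!x. f (%i. y i x) = 0"
proof -
 have "EX D. ALL i:I. bdeg D (y i)"
 proof -
  have "ALL i:I. EX D. bdeg D (y i)" using y rpf_bdeg by blast
  then obtain D where D: "!!i. i : I ==> bdeg (D i) (y i)" by metis
  have "bdeg (Max (D ` I)) (y i)" if "i : I" for i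
   using bdeg_mono[OF D[OF that]] I(1) that by simp
  then show ?thesis by blast
 qed
 then obtain D where D: "!!i. i : I ==> bdeg D (y i)" by blast
 define m where "m = card I"
 \<comment> \<open>Products of the \<open>y i\<close> with exponents up to \<open>K\<close> have
   exponents at most \<open>m * (K * D)\<close> in each coordinate. With this \<open>K\<close> the
   number of coordinate monomials is at most \<open>((m * D + 1) * (K + 1)) ^ CARD('n)\<close>,
   which equals \<open>K * (K + 1) ^ CARD('n)\<close> and is less than
   \<open>(K + 1) ^ m\<close>.\<close>
 define K where "K = (m * D + 1) ^ CARD('n)"
 let ?E = "Pi\<^sub>E I (%_. {..K})" and ?B = "UNIV \<rightarrow>\<^sub>E {..m * (K * D)} :: ('n => nat) set"
 have pw: "bdeg (k * D) (%x. y i x ^ k)" if "i : I" for i k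
 proof (induction k)
  case 0 show ?case using bdeg_monomial[of "%_. 0" 0 1] by simp
 next
  case (Suc k) show ?case using bdeg_mult[OF D[OF that] Suc] by simp
 qed
 have mon: "bdeg (m * (K * D)) (%x. \<Prod>i\<in>I. y i x ^ al i)" if "al : ?E" for al
 proof -
  have "bdeg (card J * (K * D)) (%x. \<Prod>i\<in>J. y i x ^ al i)" if "finite J" "J \<subseteq> I" for J
   using that
  proof (induction J rule: finite_induct)
   case empty show ?case using bdeg_monomial[of "%_. 0" 0 1] by simp
  next
   case (insert i J)
   have "al i <= K" using insert.prems \<open>al : ?E\<close> by (meson PiE_mem atMost_iff insert_subset)
   then have "bdeg (K * D) (%x. y i x ^ al i)"
    using pw[of i "al i"] insert.prems bdeg_mono mult_le_mono1 by (metis insert_subset)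
   from bdeg_mult[OF this insert.IH] insert.prems
   have "bdeg (K * D + card J * (K * D)) (%x. y i x ^ al i * (\<Prod>i\<in>J. y i x ^ al i))" by simp
   then show ?case using insert.hyps by simp
  qed
  from this[OF I(1)] show ?thesis by (simp add: m_def)
 qed
 then have "ALL al:?E. EX c. (%x. \<Prod>i\<in>I. y i x ^ al i) = (%x. \<Sum>beta\<in>?B. c beta * (\<Prod>j\<in>UNIV. x $ j ^ beta j))"
  unfolding bdeg_def by blast
 from bchoice[OF this] obtain c where
  "ALL al:?E. (%x. \<Prod>i\<in>I. y i x ^ al i) = (%x. \<Sum>beta\<in>?B. c al beta * (\<Prod>j\<in>UNIV. x $ j ^ beta j))"
  by blast
 then have c: "(\<Prod>i\<in>I. y i x ^ al i) = (\<Sum>beta\<in>?B. c al beta * (\<Prod>j\<in>UNIV. x $ j ^ beta j))"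
  if "al : ?E" for al x
  using that by (blast dest: fun_cong)
 have "card ?B = (m * (K * D) + 1) ^ CARD('n)" by (simp add: card_PiE)
 also have "... <= ((m * D + 1) * (K + 1)) ^ CARD('n)"
  by (intro power_mono) (auto simp: algebra_simps)
 also have "... = K * (K + 1) ^ CARD('n)" by (simp only: power_mult_distrib K_def)
 also have "... < (K + 1) * (K + 1) ^ CARD('n)" by simp
 also have "... = (K + 1) ^ Suc (CARD('n))" by simp
 also have "... <= (K + 1) ^ m" using I(2) by (intro power_increasing) (auto simp: m_def)
 also have "... = card ?E" using I(1) by (simp add: card_PiE m_def)
 finally have "card ?B < card ?E" .
 moreover have "finite ?E" using I by (intro finite_PiE) auto
 \<comment> \<open>A non-trivial combination of the products of the \<open>y i\<close> in which
   every monomial in the coordinates cancels.\<close>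
 ultimately obtain s where s: "EX al:?E. s al ~= 0" "ALL beta:?B. (\<Sum>al\<in>?E. c al beta * s al) = 0"
  using homogeneous_system_nontrivial[of ?B ?E "%beta al. c al beta"] by auto
 define f where "f v = (\<Sum>al\<in>?E. s al * (\<Prod>i\<in>I. v i ^ al i))" for v
 have "pfun I f" unfolding f_def
  by (intro pfun_sum pfun.mult pfun_prod pfun_power pfun.var pfun.const)
 moreover have "f ~= (%v. 0)"
 proof
  assume "f = (%v. 0)"
  then have "f v = 0" for v by simp
  then show False using s(1) pfun_monomials_independent[OF I(1), of s K] unfolding f_def by blast
 qed
 moreover have "f (%i. y i x) = 0" for x
 proof -
  have "f (%i. y i x) = (\<Sum>al\<in>?E. \<Sum>beta\<in>?B. s al * (c al beta * (\<Prod>j\<in>UNIV. x $ j ^ beta j)))"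
   unfolding f_def by (intro sum.cong refl) (simp add: c sum_distrib_left)
  also have "... = (\<Sum>beta\<in>?B. (\<Sum>al\<in>?E. c al beta * s al) * (\<Prod>j\<in>UNIV. x $ j ^ beta j))"
   by (subst sum.swap) (simp add: sum_distrib_left sum_distrib_right mult_ac)
  also have "... = 0" using s(2) by (intro sum.neutral) auto
  finally show ?thesis .
 qed
 ultimately show ?thesis using that by blast
qed

subsection \<open>Localisations of rings of regular functions\<close>

text \<open>The numerators of a prime ideal of the ring of regular functions on \<open>V\<close>.
  The last clause says that the ideal is proper: a polynomial without zeros on \<open>V\<close> is
  invertible there.\<close>

definition polyprime :: "(real ^ 'n) set => (real ^ 'n => real) set => bool" where
 "polyprime V P \<longleftrightarrow> P \<subseteq> Collect rpf & (ALL f. rpf f & (ALL x:V. f x = 0) --> f : P)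
   & (ALL f:P. ALL g:P. (%x. f x + g x) : P) & (ALL f:P. ALL g. rpf g --> (%x. f x * g x) : P)
   & (ALL f g. rpf f & rpf g & (%x. f x * g x) : P --> f : P | g : P) & (ALL f:P. EX x:V. f x = 0)"

lemma polyprime_add: "polyprime V P ==> f : P ==> g : P ==> (%x. f x + g x) : P"
 by (auto simp: polyprime_def)

lemma polyprime_mult: "polyprime V P ==> f : P ==> rpf g ==> (%x. f x * g x) : P"
 by (auto simp: polyprime_def)

lemma polyprime_prime: "polyprime V P ==> rpf f ==> rpf g ==> (%x. f x * g x) : P ==> f : P | g : P"
 by (auto simp: polyprime_def)

lemma polyprime_rpf: "polyprime V P ==> f : P ==> rpf f"
 by (auto simp: polyprime_def)

lemma polyprime_vanish: "polyprime V P ==> rpf f ==> (!!x. x : V ==> f x = 0) ==> f : P"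
 by (auto simp: polyprime_def)

lemma polyprime_zero: "polyprime V P ==> f : P ==> EX x:V. f x = 0"
 by (auto simp: polyprime_def)

lemma polyprime_cong:
 assumes "polyprime V P" "f : P" "rpf g" "!!x. x : V ==> f x = g x"
 shows "g : P"
proof -
 have "(%x. g x - f x) : P"
 proof (rule polyprime_vanish[OF assms(1)])
  show "rpf (%x. g x - f x)"
   by (rule real_polynomial_function_diff[OF assms(3) polyprime_rpf[OF assms(1,2)]])
 qed (simp add: assms(4))
 from polyprime_add[OF assms(1) assms(2) this] show ?thesis by simp
qed

lemma polyprime_power:
 assumes P: "polyprime V P" and f: "rpf f" and "(%x. f x ^ k) : P"
 shows "f : P"
 using assms(3)
proof (induction k)
 case 0
 then show ?case using polyprime_zero[OF P] by fastforce
next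
 case (Suc k)
 have "(%x. f x * f x ^ k) : P" using Suc.prems by simp
 from polyprime_prime[OF P f _ this] Suc.IH f show ?case by (auto intro: rpf_intros)
qed

text \<open>Zariski irreducibility through products: the polynomials vanishing on the set form a
  prime ideal. In this form it makes sense for sets that are not closed.\<close>

definition primeset :: "(real ^ 'n) set => bool" where
 "primeset W \<longleftrightarrow> W ~= {} & (ALL f g. rpf f & rpf g & (ALL x:W. f x * g x = 0)
   --> (ALL x:W. f x = 0) | (ALL x:W. g x = 0))"

lemma primesetD:
 "primeset W ==> rpf f ==> rpf g ==> (!!x. x : W ==> f x * g x = 0) ==>
  (ALL x:W. f x = 0) | (ALL x:W. g x = 0)"
 by (auto simp: primeset_def)

lemma primeset_singleton: "primeset {p}"
 by (auto simp: primeset_def)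

lemma algebraic_set_zeros:
 assumes "algebraic_set V" "rpf f"
 shows "algebraic_set {x : V. f x = 0}"
proof -
 obtain P where "ALL p:P. rpf p" "V = {x. ALL p:P. p x = 0}"
  using assms unfolding algebraic_set_def by blast
 then show ?thesis using assms(2) unfolding algebraic_set_def
  by (intro exI[of _ "insert f P"]) auto
qed

lemma irreducible_primeset:
 assumes "irreducible_algebraic_set V"
 shows "primeset V"
proof -
 have "(ALL x:V. f x = 0) | (ALL x:V. g x = 0)"
  if "rpf f" "rpf g" "ALL x:V. f x * g x = 0" for f g
 proof -
  have "V = {x : V. f x = 0} \<union> {x : V. g x = 0}" using that(3) by auto
  with assms that algebraic_set_zeros[of V] show ?thesis
   unfolding irreducible_algebraic_set_def by blast
 qed
 with assms show ?thesis by (auto simp: primeset_def irreducible_algebraic_set_def)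
qed

lemma rr_simps:
 "carrier (regular_ring V) = {\<lambda>x\<in>V. p x / q x | p q. rpf p & rpf q & (ALL x:V. q x ~= 0)}"
 "mult (regular_ring V) f g = (\<lambda>x\<in>V. f x * g x)"
 "one (regular_ring V) = (\<lambda>x\<in>V. 1)"
 "zero (regular_ring V) = (\<lambda>x\<in>V. 0)"
 "add (regular_ring V) f g = (\<lambda>x\<in>V. f x + g x)"
 by (simp_all add: regular_ring_def)

lemma regular_carrierI:
 "rpf p ==> rpf q ==> (!!x. x : V ==> q x ~= 0) ==> (!!x. x : V ==> f x = p x / q x) ==>
  f : extensional V ==> f : carrier (regular_ring V)"
 unfolding rr_simps
 by (intro CollectI exI[of _ p] exI[of _ q] conjI ballI extensionalityI[of f V]) auto

lemma regular_carrierE: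
 assumes "f : carrier (regular_ring V)"
 obtains p q where "rpf p" "rpf q" "!!x. x : V ==> q x ~= 0" "!!x. x : V ==> f x = p x / q x"
  "f : extensional V"
 using assms unfolding rr_simps by auto

lemma restrict_regular: "rpf f ==> restrict f V : carrier (regular_ring V)"
 by (rule regular_carrierI[of f "%_. 1"]) auto

lemma regular_eqI:
 fixes V :: "(real ^ 'n) set"
 shows "f : carrier (regular_ring V) ==> g : carrier (regular_ring V) ==> (!!x. x : V ==> f x = g x) ==> f = g"
 by (rule extensionalityI[of _ V]) (auto simp: rr_simps)

lemma regular_mult_closed:
 fixes V :: "(real ^ 'n) set"
 assumes "f : carrier (regular_ring V)" "g : carrier (regular_ring V)"
 shows "(\<lambda>x\<in>V. f x * g x) : carrier (regular_ring V)"
proof -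
 obtain p q where "rpf p" "rpf q" "!!x. x : V ==> q x ~= 0" "!!x. x : V ==> f x = p x / q x"
  using assms(1) by (rule regular_carrierE) blast
 moreover obtain r s where "rpf r" "rpf s" "!!x. x : V ==> s x ~= 0" "!!x. x : V ==> g x = r x / s x"
  using assms(2) by (rule regular_carrierE) blast
 ultimately show ?thesis
  by (intro regular_carrierI[of "%x. p x * r x" "%x. q x * s x"]) (auto intro: rpf_intros)
qed

lemma regular_add_closed:
 fixes V :: "(real ^ 'n) set"
 assumes "f : carrier (regular_ring V)" "g : carrier (regular_ring V)"
 shows "(\<lambda>x\<in>V. f x + g x) : carrier (regular_ring V)"
proof -
 obtain p q where "rpf p" "rpf q" "!!x. x : V ==> q x ~= 0" "!!x. x : V ==> f x = p x / q x"
  using assms(1) by (rule regular_carrierE) blast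
 moreover obtain r s where "rpf r" "rpf s" "!!x. x : V ==> s x ~= 0" "!!x. x : V ==> g x = r x / s x"
  using assms(2) by (rule regular_carrierE) blast
 ultimately show ?thesis
  by (intro regular_carrierI[of "%x. p x * s x + r x * q x" "%x. q x * s x"])
    (auto intro: rpf_intros simp: add_frac_eq)
qed

lemma cring_regular_ring: "cring (regular_ring (V :: (real ^ 'n) set))"
proof (rule cringI)
 show "abelian_group (regular_ring V)"
 proof (rule abelian_groupI)
  fix f assume f: "f : carrier (regular_ring V)"
  then obtain p q where pq: "rpf p" "rpf q" "!!x. x : V ==> q x ~= 0" "!!x. x : V ==> f x = p x / q x"
   by (rule regular_carrierE) blast
  have "(\<lambda>x\<in>V. - f x) : carrier (regular_ring V)"
   by (rule regular_carrierI[of "%x. - p x" q]) (use pq in "auto intro: rpf_intros")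
  then show "EX y:carrier (regular_ring V). y \<oplus>\<^bsub>regular_ring V\<^esub> f = \<zero>\<^bsub>regular_ring V\<^esub>"
   by (rule bexI[rotated]) (auto simp: rr_simps(2-) intro!: ext)
  show "\<zero>\<^bsub>regular_ring V\<^esub> \<oplus>\<^bsub>regular_ring V\<^esub> f = f"
   using regular_add_closed[OF restrict_regular[of "%_. 0" V] f]
   unfolding rr_simps(2-) by (intro regular_eqI[OF _ f]) auto
 qed (auto simp: rr_simps(2-) algebra_simps intro!: regular_add_closed
     restrict_regular[of "%_. 0"])
 show "comm_monoid (regular_ring V)"
 proof (rule comm_monoidI)
  fix f assume f: "f : carrier (regular_ring V)"
  then show "\<one>\<^bsub>regular_ring V\<^esub> \<otimes>\<^bsub>regular_ring V\<^esub> f = f"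
   using regular_mult_closed[OF restrict_regular[of "%_. 1" V] f]
   unfolding rr_simps(2-) by (intro regular_eqI[OF _ f]) auto
 qed (auto simp: rr_simps(2-) algebra_simps intro!: regular_mult_closed
     restrict_regular[of "%_. 1"])
qed (auto simp: rr_simps(2-) algebra_simps)

locale localized =
 fixes M W :: "(real ^ 'n) set"
 assumes M: "primeset M" and W: "primeset W" and WM: "W \<subseteq> M"
begin

abbreviation "R \<equiv> regular_ring M"

abbreviation "J \<equiv> vanishing_ideal M W"

abbreviation "L \<equiv> local_ring_at M W"

definition den :: "(real ^ 'n => real) => bool" where
 "den g \<longleftrightarrow> rpf g & (EX x:W. g x ~= 0)"

text \<open>Fractions of polynomials instead of regular functions. Every element of the localisation
  is of this form (\<open>carrier_frE\<close>), because the denominators of regular functions can be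
  cleared.\<close>

definition fr :: "(real ^ 'n => real) => (real ^ 'n => real) => ((real ^ 'n => real) \<times> (real ^ 'n => real)) set" where
 "fr f g = loc_frac R J (restrict f M) (restrict g M)"

lemma den_rpf: "den g ==> rpf g" by (simp add: den_def)

lemma den_one [simp]: "den (%x. 1)"
 using W by (auto simp: den_def primeset_def)

lemma den_mult: "den f ==> den g ==> den (%x. f x * g x)"
 using primesetD[OF W, of f g] by (auto simp: den_def intro: rpf_intros)

lemma den_prod: "finite K ==> (!!k. k : K ==> den (f k)) ==> den (%x. \<Prod>k\<in>K. f k x)"
 by (induction K rule: finite_induct) (auto intro: den_mult)

lemma den_power: "den f ==> den (%x. f x ^ k)"
 by (induction k) (auto intro: den_mult)

lemma cancel_den:
 assumes "den h" "rpf f" "rpf g" "!!x. x : M ==> h x * f x = h x * g x" "x : M"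
 shows "f x = g x"
 using primesetD[OF M, of h "%x. f x - g x"] assms WM
 by (auto simp: den_def algebra_simps intro: rpf_intros)

lemma nonzero_regular:
 assumes "s : carrier R - J"
 obtains p q where "den p" "rpf q" "!!x. x : M ==> q x ~= 0" "!!x. x : M ==> s x = p x / q x"
proof -
 obtain p q where pq: "rpf p" "rpf q" "!!x. x : M ==> q x ~= 0" "!!x. x : M ==> s x = p x / q x"
  using assms by (auto elim: regular_carrierE)
 obtain x where x: "x : W" "s x ~= 0" using assms by (auto simp: vanishing_ideal_def)
 then have "p x ~= 0" using pq(4)[of x] WM by auto
 then have "den p" using pq(1) x(1) by (auto simp: den_def)
 then show ?thesis using pq that by blast
qed

lemma den_nonzero: "den g ==> restrict g M : carrier R - J"
 using WM by (auto simp: den_def vanishing_ideal_def restrict_regular)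

text \<open>The multiplier \<open>v\<close> allowed by the definition can be cancelled: it is not
  identically zero on \<open>W\<close>, hence not on \<open>M\<close>, and \<open>M\<close> is
  irreducible.\<close>

lemma loc_rel_iff:
 "((a, s), (b, u)) : loc_rel R J \<longleftrightarrow>
   a : carrier R & b : carrier R & s : carrier R - J & u : carrier R - J & (ALL x:M. a x * u x = b x * s x)"
proof -
 have "(EX v:carrier R - J. v \<otimes>\<^bsub>R\<^esub> (a \<otimes>\<^bsub>R\<^esub> u) = v \<otimes>\<^bsub>R\<^esub> (b \<otimes>\<^bsub>R\<^esub> s)) \<longleftrightarrow> (ALL x:M. a x * u x = b x * s x)"
  if ab: "a : carrier R" "b : carrier R" "s : carrier R - J" "u : carrier R - J"
 proof
  assume "EX v:carrier R - J. v \<otimes>\<^bsub>R\<^esub> (a \<otimes>\<^bsub>R\<^esub> u) = v \<otimes>\<^bsub>R\<^esub> (b \<otimes>\<^bsub>R\<^esub> s)"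
  then obtain v where v: "v : carrier R - J" "!!x. x : M ==> v x * (a x * u x) = v x * (b x * s x)"
   by (auto simp: rr_simps(2-) fun_eq_iff restrict_def split: if_splits)
  obtain p q where pq: "den p" "rpf q" "!!x. x : M ==> q x ~= 0" "!!x. x : M ==> v x = p x / q x"
   using v(1) by (rule nonzero_regular) blast
  obtain a1 a2 where a: "rpf a1" "rpf a2" "!!x. x : M ==> a2 x ~= 0" "!!x. x : M ==> a x = a1 x / a2 x"
   using ab(1) by (rule regular_carrierE) blast
  obtain b1 b2 where b: "rpf b1" "rpf b2" "!!x. x : M ==> b2 x ~= 0" "!!x. x : M ==> b x = b1 x / b2 x"
   using ab(2) by (rule regular_carrierE) blast
  obtain s1 s2 where s: "den s1" "rpf s2" "!!x. x : M ==> s2 x ~= 0" "!!x. x : M ==> s x = s1 x / s2 x"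
   using ab(3) by (rule nonzero_regular) blast
  obtain u1 u2 where u: "den u1" "rpf u2" "!!x. x : M ==> u2 x ~= 0" "!!x. x : M ==> u x = u1 x / u2 x"
   using ab(4) by (rule nonzero_regular) blast
  have *: "(a1 x * u1 x) * (b2 x * s2 x) = (b1 x * s1 x) * (a2 x * u2 x)" if "x : M" for x
  proof (rule cancel_den[OF pq(1) _ _ _ that])
   fix x assume x: "x : M"
   note nz = pq(3)[OF x] a(3)[OF x] b(3)[OF x] s(3)[OF x] u(3)[OF x]
   from v(2)[OF x] have "p x * (a1 x * u1 x) / (q x * a2 x * u2 x) = p x * (b1 x * s1 x) / (q x * b2 x * s2 x)"
    by (simp add: pq(4)[OF x] a(4)[OF x] b(4)[OF x] s(4)[OF x] u(4)[OF x])
   then show "p x * (a1 x * u1 x * (b2 x * s2 x)) = p x * (b1 x * s1 x * (a2 x * u2 x))"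
    using nz by (simp add: frac_eq_eq) (simp add: mult_ac)
  qed (use a b s u den_rpf in "auto intro!: rpf_intros")
  show "ALL x:M. a x * u x = b x * s x"
  proof
   fix x assume x: "x : M"
   note nz = pq(3)[OF x] a(3)[OF x] b(3)[OF x] s(3)[OF x] u(3)[OF x]
   show "a x * u x = b x * s x" using *[OF x] nz
    by (simp add: a(4)[OF x] b(4)[OF x] s(4)[OF x] u(4)[OF x] frac_eq_eq)
  qed
 next
  assume "ALL x:M. a x * u x = b x * s x"
  then have "a \<otimes>\<^bsub>R\<^esub> u = b \<otimes>\<^bsub>R\<^esub> s"
   unfolding rr_simps(2) by (intro restrict_ext) blast
  then show "EX v:carrier R - J. v \<otimes>\<^bsub>R\<^esub> (a \<otimes>\<^bsub>R\<^esub> u) = v \<otimes>\<^bsub>R\<^esub> (b \<otimes>\<^bsub>R\<^esub> s)"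
   using den_nonzero[OF den_one] by metis
 qed
 then show ?thesis unfolding loc_rel_def mem_Collect_eq case_prod_conv by blast
qed

text \<open>The middle denominator serves as the multiplier that \<open>loc_rel\<close>
  allows.\<close>

lemma loc_rel_trans:
 assumes "((a, s), (b, u)) : loc_rel R J" "((b, u), (c, w)) : loc_rel R J"
 shows "((a, s), (c, w)) : loc_rel R J"
proof -
 have 1: "ALL x:M. a x * u x = b x * s x" "ALL x:M. b x * w x = c x * u x"
  using assms unfolding loc_rel_iff by blast+
 have "(u \<otimes>\<^bsub>R\<^esub> (a \<otimes>\<^bsub>R\<^esub> w)) = (u \<otimes>\<^bsub>R\<^esub> (c \<otimes>\<^bsub>R\<^esub> s))"
 proof -
  have "u x * (a x * w x) = u x * (c x * s x)" if "x : M" for x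
  proof -
   have "u x * (a x * w x) = (a x * u x) * w x" by simp
   also have "... = s x * (b x * w x)" using 1(1) that by simp
   also have "... = u x * (c x * s x)" using 1(2) that by simp
   finally show ?thesis .
  qed
  then show ?thesis by (auto simp: rr_simps(2-) fun_eq_iff restrict_def)
 qed
 moreover have "u : carrier R - J" "a : carrier R" "s : carrier R - J" "c : carrier R" "w : carrier R - J"
  using assms unfolding loc_rel_iff by blast+
 ultimately show ?thesis
  unfolding loc_rel_def mem_Collect_eq case_prod_conv by blast
qed

lemma loc_frac_eq_iff:
 assumes "a : carrier R" "s : carrier R - J" "b : carrier R" "u : carrier R - J"
 shows "loc_frac R J a s = loc_frac R J b u \<longleftrightarrow> (ALL x:M. a x * u x = b x * s x)"
proof -
 have refl: "((b, u), (b, u)) : loc_rel R J" using assms unfolding loc_rel_iff by blast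
 have sym: "((c, w), (d, z)) : loc_rel R J ==> ((d, z), (c, w)) : loc_rel R J" for c w d z
  unfolding loc_rel_iff by (blast intro: HOL.sym)
 have "loc_frac R J a s = loc_frac R J b u \<longleftrightarrow> ((a, s), (b, u)) : loc_rel R J"
 proof
  assume "loc_frac R J a s = loc_frac R J b u"
  with refl show "((a, s), (b, u)) : loc_rel R J"
   by (simp only: loc_frac_def Image_singleton_iff set_eq_iff)
 next
  assume r: "((a, s), (b, u)) : loc_rel R J"
  show "loc_frac R J a s = loc_frac R J b u"
  proof (rule Set.set_eqI)
   fix z :: "(real ^ 'n => real) \<times> (real ^ 'n => real)"
   obtain c w where z: "z = (c, w)" by (cases z)
   show "z : loc_frac R J a s \<longleftrightarrow> z : loc_frac R J b u"
    unfolding z loc_frac_def Image_singleton_iff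
    using loc_rel_trans[OF r, of c w] loc_rel_trans[OF sym[OF r], of c w] by argo
  qed
 qed
 also have "... \<longleftrightarrow> (ALL x:M. a x * u x = b x * s x)"
  unfolding loc_rel_iff using assms by (simp only: simp_thms)
 finally show ?thesis .
qed

lemma fr_eq_iff:
 assumes "rpf f" "den g" "rpf f'" "den g'"
 shows "fr f g = fr f' g' \<longleftrightarrow> (ALL x:M. f x * g' x = f' x * g x)"
 unfolding fr_def
 using assms loc_frac_eq_iff[OF restrict_regular[OF assms(1)] den_nonzero[OF assms(2)]
   restrict_regular[OF assms(3)] den_nonzero[OF assms(4)]] by simp

lemma loc_frac_eq_fr:
 assumes "a : carrier R" "s : carrier R - J" "rpf f" "den g" "!!x. x : M ==> a x * g x = f x * s x"
 shows "loc_frac R J a s = fr f g"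
 unfolding fr_def
 using assms loc_frac_eq_iff[OF assms(1,2) restrict_regular[OF assms(3)] den_nonzero[OF assms(4)]] by simp

lemma fr_mem:
 assumes "rpf f" "den g"
 shows "(a, s) : fr f g \<longleftrightarrow> a : carrier R & s : carrier R - J & (ALL x:M. f x * s x = a x * g x)"
proof -
 have "(ALL x:M. restrict f M x * s x = a x * restrict g M x) \<longleftrightarrow> (ALL x:M. f x * s x = a x * g x)"
  by (intro ball_cong refl) simp
 then show ?thesis
  unfolding fr_def loc_frac_def Image_singleton_iff loc_rel_iff
  using den_nonzero[OF assms(2)] restrict_regular[OF assms(1), of M] by argo
qed

lemma carrier_fr: "rpf f ==> den g ==> fr f g : carrier L"
proof -
 assume "rpf f" "den g"
 then have "(restrict f M, restrict g M) : carrier R \<times> (carrier R - J)"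
  using restrict_regular den_nonzero by blast
 from quotientI[OF this, of "loc_rel R J"] show ?thesis
  by (simp add: localization_def fr_def loc_frac_def)
qed

lemma carrier_frE:
 assumes "X : carrier L"
 obtains f g where "rpf f" "den g" "X = fr f g"
proof -
 have "X : (carrier R \<times> (carrier R - J)) // loc_rel R J"
  using assms by (simp only: localization_def partial_object.simps)
 then obtain z where z: "z : carrier R \<times> (carrier R - J)" "X = loc_rel R J `` {z}"
  by (rule quotientE)
 obtain a s where "z = (a, s)" by (cases z)
 with z have as: "a : carrier R" "s : carrier R - J" "X = loc_frac R J a s"
  by (simp_all only: mem_Sigma_iff loc_frac_def)
 obtain a1 a2 where a: "rpf a1" "rpf a2" "!!x. x : M ==> a2 x ~= 0" "!!x. x : M ==> a x = a1 x / a2 x"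
  using as(1) by (rule regular_carrierE) blast
 obtain s1 s2 where s: "den s1" "rpf s2" "!!x. x : M ==> s2 x ~= 0" "!!x. x : M ==> s x = s1 x / s2 x"
  using as(2) by (rule nonzero_regular) blast
 obtain y where y: "y : W" using W by (auto simp: primeset_def)
 then have "a2 y ~= 0" using a(3) WM by auto
 with a(2) y have "den a2" by (auto simp: den_def)
 then have d: "den (%x. a2 x * s1 x)" using s(1) by (rule den_mult)
 have r: "rpf (%x. a1 x * s2 x)" using a s by (auto intro: rpf_intros)
 have "X = fr (%x. a1 x * s2 x) (%x. a2 x * s1 x)"
  unfolding as(3)
  by (rule loc_frac_eq_fr[OF as(1,2) r d]) (use a s in "auto simp: field_simps")
 then show ?thesis using that d r by blast
qed

lemma one_fr: "\<one>\<^bsub>L\<^esub> = fr (%x. 1) (%x. 1)"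
 by (simp add: localization_def fr_def rr_simps)

lemma zero_fr: "\<zero>\<^bsub>L\<^esub> = fr (%x. 0) (%x. 1)"
 by (simp add: localization_def fr_def rr_simps)

lemma loc_map_fr: "loc_map R J (restrict f M) = fr f (%x. 1)"
 by (simp add: loc_map_def fr_def rr_simps)

lemma fr_self: "rpf f ==> den g ==> (restrict f M, restrict g M) : fr f g"
 using fr_mem[of f g "restrict f M" "restrict g M"] restrict_regular[of f M] den_nonzero[of g] by simp

lemma nonzero_mult:
 assumes "s : carrier R - J" "u : carrier R - J"
 shows "(\<lambda>x\<in>M. s x * u x) : carrier R - J"
proof -
 obtain s1 s2 where s: "den s1" "rpf s2" "!!x. x : M ==> s2 x ~= 0" "!!x. x : M ==> s x = s1 x / s2 x"
  using assms(1) by (rule nonzero_regular) blast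
 obtain u1 u2 where u: "den u1" "rpf u2" "!!x. x : M ==> u2 x ~= 0" "!!x. x : M ==> u x = u1 x / u2 x"
  using assms(2) by (rule nonzero_regular) blast
 obtain x where "x : W" "s1 x * u1 x ~= 0" using den_mult[OF s(1) u(1)] by (auto simp: den_def)
 then have "x : W" "s x * u x ~= 0" using s u WM by auto
 then show ?thesis using regular_mult_closed assms WM by (auto simp: vanishing_ideal_def)
qed

lemma mult_fr:
 assumes "rpf f" "den g" "rpf f'" "den g'"
 shows "fr f g \<otimes>\<^bsub>L\<^esub> fr f' g' = fr (%x. f x * f' x) (%x. g x * g' x)"
proof -
 let ?T = "fr (%x. f x * f' x) (%x. g x * g' x)"
 have *: "loc_frac R J (a \<otimes>\<^bsub>R\<^esub> b) (s \<otimes>\<^bsub>R\<^esub> u) = ?T" if "(a, s) : fr f g" "(b, u) : fr f' g'" for a b s u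
 proof -
  have 1: "a : carrier R" "s : carrier R - J" "!!x. x : M ==> f x * s x = a x * g x"
   "b : carrier R" "u : carrier R - J" "!!x. x : M ==> f' x * u x = b x * g' x"
   using that unfolding fr_mem[OF assms(1,2)] fr_mem[OF assms(3,4)] by blast+
  have "a x * b x * (g x * g' x) = f x * f' x * (s x * u x)" if "x : M" for x
  proof -
   have "a x * b x * (g x * g' x) = (a x * g x) * (b x * g' x)" by simp
   also have "... = (f x * s x) * (f' x * u x)" using 1(3,6)[OF that] by simp
   finally show ?thesis by simp
  qed
  then have "loc_frac R J (\<lambda>x\<in>M. a x * b x) (\<lambda>x\<in>M. s x * u x) = ?T"
   by (intro loc_frac_eq_fr regular_mult_closed nonzero_mult 1 rpf_intros den_mult assms) simp
  then show ?thesis by (simp add: rr_simps(2-))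
 qed
 have "fr f g \<otimes>\<^bsub>L\<^esub> fr f' g' = (\<Union>(a, s)\<in>fr f g. \<Union>(b, u)\<in>fr f' g'. loc_frac R J (a \<otimes>\<^bsub>R\<^esub> b) (s \<otimes>\<^bsub>R\<^esub> u))"
  by (simp add: localization_def)
 also have "... = (\<Union>(a, s)\<in>fr f g. \<Union>(b, u)\<in>fr f' g'. ?T)"
  using * by (intro SUP_cong refl) auto
 also have "... = ?T" using fr_self[OF assms(1,2)] fr_self[OF assms(3,4)] by blast
 finally show ?thesis .
qed

lemma add_fr:
 assumes "rpf f" "den g" "rpf f'" "den g'"
 shows "fr f g \<oplus>\<^bsub>L\<^esub> fr f' g' = fr (%x. f x * g' x + f' x * g x) (%x. g x * g' x)"
proof -
 let ?T = "fr (%x. f x * g' x + f' x * g x) (%x. g x * g' x)"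
 have *: "loc_frac R J (a \<otimes>\<^bsub>R\<^esub> u \<oplus>\<^bsub>R\<^esub> b \<otimes>\<^bsub>R\<^esub> s) (s \<otimes>\<^bsub>R\<^esub> u) = ?T"
  if "(a, s) : fr f g" "(b, u) : fr f' g'" for a b s u
 proof -
  have 1: "a : carrier R" "s : carrier R - J" "!!x. x : M ==> f x * s x = a x * g x"
   "b : carrier R" "u : carrier R - J" "!!x. x : M ==> f' x * u x = b x * g' x"
   using that unfolding fr_mem[OF assms(1,2)] fr_mem[OF assms(3,4)] by blast+
  have e: "(a x * u x + b x * s x) * (g x * g' x) = (f x * g' x + f' x * g x) * (s x * u x)" if "x : M" for x
  proof -
   have "(a x * u x + b x * s x) * (g x * g' x) = (a x * g x) * u x * g' x + (b x * g' x) * s x * g x"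
    by (simp add: algebra_simps)
   also have "... = (f x * s x) * u x * g' x + (f' x * u x) * s x * g x" using 1(3,6)[OF that] by simp
   finally show ?thesis by (simp add: algebra_simps)
  qed
  have c: "(\<lambda>x\<in>M. a x * u x + b x * s x) : carrier R"
  proof -
   have "(\<lambda>x\<in>M. (\<lambda>x\<in>M. a x * u x) x + (\<lambda>x\<in>M. b x * s x) x) : carrier R"
    using 1 by (intro regular_add_closed regular_mult_closed) auto
   then show ?thesis by (simp cong: restrict_cong)
  qed
  have "loc_frac R J (\<lambda>x\<in>M. a x * u x + b x * s x) (\<lambda>x\<in>M. s x * u x) = ?T"
   by (intro loc_frac_eq_fr c nonzero_mult 1 rpf_intros den_mult assms den_rpf) (simp add: e)
  moreover have "a \<otimes>\<^bsub>R\<^esub> u \<oplus>\<^bsub>R\<^esub> b \<otimes>\<^bsub>R\<^esub> s = (\<lambda>x\<in>M. a x * u x + b x * s x)" "s \<otimes>\<^bsub>R\<^esub> u = (\<lambda>x\<in>M. s x * u x)"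
   by (auto simp: rr_simps(2-) cong: restrict_cong)
  ultimately show ?thesis by simp
 qed
 have "fr f g \<oplus>\<^bsub>L\<^esub> fr f' g' = (\<Union>(a, s)\<in>fr f g. \<Union>(b, u)\<in>fr f' g'.
   loc_frac R J (a \<otimes>\<^bsub>R\<^esub> u \<oplus>\<^bsub>R\<^esub> b \<otimes>\<^bsub>R\<^esub> s) (s \<otimes>\<^bsub>R\<^esub> u))"
  by (simp add: localization_def)
 also have "... = (\<Union>(a, s)\<in>fr f g. \<Union>(b, u)\<in>fr f' g'. ?T)"
  using * by (intro SUP_cong refl) auto
 also have "... = ?T" using fr_self[OF assms(1,2)] fr_self[OF assms(3,4)] by blast
 finally show ?thesis .
qed

end

subsection \<open>Prime ideals and Krull dimension\<close>

lemma (in cring) ideal_from_closed: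
 assumes "I \<subseteq> carrier R" "\<zero> : I" "!!a b. a : I ==> b : I ==> a \<oplus> b : I"
  "!!a x. a : I ==> x : carrier R ==> x \<otimes> a : I"
 shows "ideal I R"
proof (rule idealI)
 show "subgroup I (add_monoid R)"
 proof (rule add.subgroupI)
  fix a assume a: "a : I"
  then have "(\<ominus> \<one>) \<otimes> a = \<ominus> a" using assms(1) by (simp add: l_minus subset_iff)
  with assms(4)[OF a, of "\<ominus> \<one>"] show "\<ominus> a : I" by simp
 qed (use assms in auto)
 show "a \<otimes> x : I" if "a : I" "x : carrier R" for a x
  using assms(1) assms(4)[OF that] m_comm[of a x] that by auto
qed (use assms(4) ring_axioms in auto)

lemma krull_dim_ge:
 assumes "!!i. i <= k ==> primeideal (P i) R" "!!i. i < k ==> P i \<subset> P (Suc i)"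
 shows "enat k <= krull_dim R"
 unfolding krull_dim_def using assms by (intro Sup_upper) blast

text \<open>A longer chain can be truncated, so without a chain of length \<open>k\<close> all
  chains are shorter. Length \<open>0\<close> is excluded because the supremum over no chains at all
  is also \<open>0\<close>.\<close>

lemma krull_dim_chain:
 assumes "enat k <= krull_dim R" "k > 0"
 shows "EX P. (ALL i<=k. primeideal (P i) R) & (ALL i<k. P i \<subset> P (Suc i))"
proof (rule ccontr)
 assume no: "\<not> ?thesis"
 have "e <= enat (k - 1)"
  if "e : {enat n | n. EX P. (ALL i<=n. primeideal (P i) R) & (ALL i<n. P i \<subset> P (Suc i))}" for e
 proof -
  from that obtain n where n: "e = enat n"
   "EX P. (ALL i<=n. primeideal (P i) R) & (ALL i<n. P i \<subset> P (Suc i))" by auto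
  have "n < k"
  proof (rule ccontr)
   assume "\<not> n < k"
   then have "k <= n" by simp
   with n(2) have "EX P. (ALL i<=k. primeideal (P i) R) & (ALL i<k. P i \<subset> P (Suc i))"
    by (meson le_trans less_le_trans)
   with no show False by contradiction
  qed
  then show ?thesis using n(1) by simp
 qed
 then have "krull_dim R <= enat (k - 1)" unfolding krull_dim_def by (rule Sup_least)
 with assms(1) have "enat k <= enat (k - 1)" by (rule order_trans)
 with assms(2) show False by simp
qed

text \<open>The polynomials in the inverse image of an ideal of the local ring of \<open>M\<close>
  at \<open>p\<close>: the last clause is saturation with respect to polynomials non-zero at
  \<open>p\<close>. Working with such sets keeps fractions out of the later arguments.\<close>

definition pideal :: "(real ^ 'n) set => real ^ 'n => (real ^ 'n => real) set => bool" where
 "pideal M p I \<longleftrightarrow> I \<subseteq> Collect rpf & (ALL f. rpf f & (ALL x:M. f x = 0) --> f : I)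
   & (ALL f:I. ALL g:I. (%x. f x + g x) : I) & (ALL f:I. ALL g. rpf g --> (%x. f x * g x) : I)
   & (ALL f h. rpf f & rpf h & h p ~= 0 & (%x. h x * f x) : I --> f : I)"

lemma pidealD:
 assumes "pideal M p I"
 shows "I \<subseteq> Collect rpf" "ALL f. rpf f & (ALL x:M. f x = 0) --> f : I"
  "ALL f:I. ALL g:I. (%x. f x + g x) : I" "ALL f:I. ALL g. rpf g --> (%x. f x * g x) : I"
  "ALL f h. rpf f & rpf h & h p ~= 0 & (%x. h x * f x) : I --> f : I"
 using assms unfolding pideal_def by - (elim conjE, assumption)+

lemma pideal_rpf: "pideal M p I ==> f : I ==> rpf f"
 using pidealD(1) by blast

lemma pideal_vanish: "pideal M p I ==> rpf f ==> (!!x. x : M ==> f x = 0) ==> f : I"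
 by (rule pidealD(2)[rule_format]) auto

lemma pideal_add: "pideal M p I ==> f : I ==> g : I ==> (%x. f x + g x) : I"
 by (rule pidealD(3)[rule_format])

lemma pideal_mult: "pideal M p I ==> f : I ==> rpf g ==> (%x. g x * f x) : I"
 using pidealD(4)[rule_format, of M p I f g] by (simp only: mult.commute)

lemma pideal_cancel: "pideal M p I ==> rpf f ==> rpf h ==> h p ~= 0 ==> (%x. h x * f x) : I ==> f : I"
 by (rule pidealD(5)[rule_format, of M p I f h]) simp_all

lemma pideal_cong:
 assumes "pideal M p I" "f : I" "rpf g" "!!x. x : M ==> f x = g x"
 shows "g : I"
proof -
 have "(%x. g x - f x) : I"
 proof (rule pideal_vanish[OF assms(1)])
  show "rpf (%x. g x - f x)"
   by (rule real_polynomial_function_diff[OF assms(3) pideal_rpf[OF assms(1,2)]])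
 qed (simp add: assms(4))
 from pideal_add[OF assms(1) assms(2) this] show ?thesis by simp
qed

lemma pideal_sum:
 assumes I: "pideal M p I" and "finite K" "!!k. k : K ==> f k : I"
 shows "(%x. \<Sum>k\<in>K. f k x) : I"
 using assms(2,3)
proof (induction K rule: finite_induct)
 case empty
 then show ?case using pideal_vanish[OF I, of "%_. 0"] by simp
next
 case (insert k K)
 then show ?case using pideal_add[OF I, of "f k" "%x. \<Sum>k\<in>K. f k x"] by simp
qed

definition acc_at :: "(real ^ 'n) set => real ^ 'n => bool" where
 "acc_at M p \<longleftrightarrow> (ALL I :: nat => _. (ALL i. pideal M p (I i)) & (ALL i. I i \<subseteq> I (Suc i)) --> (EX k. I (Suc k) = I k))"

locale local_point = localized M "{p}" for M :: "(real ^ 'n) set" and p +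
 assumes ring: "cring L" and unique_max: "EX! m. maximalideal m L"
begin

lemma den_iff: "den g \<longleftrightarrow> rpf g & g p ~= 0"
 by (simp add: den_def)

definition ext :: "(real ^ 'n => real) set => ((real ^ 'n => real) \<times> (real ^ 'n => real)) set set" where
 "ext I = {fr f g | f g. f : I & den g}"

lemma ext_iff:
 assumes I: "pideal M p I" and f: "rpf f" "den g"
 shows "fr f g : ext I \<longleftrightarrow> f : I"
proof
 assume "fr f g : ext I"
 then obtain f' g' where *: "f' : I" "den g'" "fr f g = fr f' g'" by (auto simp: ext_def)
 then have e: "!!x. x : M ==> f x * g' x = f' x * g x"
  using fr_eq_iff[OF f, of f' g'] pideal_rpf[OF I] by simp
 have r: "rpf g" "rpf g'" "g' p ~= 0" using f * by (auto simp: den_iff)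
 have "(%x. g x * f' x) : I" by (rule pideal_mult[OF I *(1) r(1)])
 then have "(%x. g' x * f x) : I"
  by (rule pideal_cong[OF I]) (use e r f in "auto simp: mult.commute intro!: rpf_intros")
 then show "f : I" by (rule pideal_cancel[OF I f(1) r(2,3)])
qed (use f in "auto simp: ext_def")

lemma ideal_ext:
 assumes I: "pideal M p I"
 shows "ideal (ext I) L"
proof -
 interpret cring L by (rule ring)
 show ?thesis
 proof (rule ideal_from_closed)
  show "ext I \<subseteq> carrier L" using pideal_rpf[OF I] by (auto simp: ext_def intro: carrier_fr)
  show "\<zero>\<^bsub>L\<^esub> : ext I"
   using pideal_vanish[OF I, of "%_. 0"] unfolding zero_fr by (subst ext_iff[OF I]) auto
 next
  fix a b assume "a : ext I" "b : ext I"
  then obtain f g f' g' where *: "f : I" "den g" "a = fr f g" "f' : I" "den g'" "b = fr f' g'"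
   by (auto simp: ext_def)
  note r = pideal_rpf[OF I *(1)] pideal_rpf[OF I *(4)] den_rpf[OF *(2)] den_rpf[OF *(5)]
  have "(%x. g' x * f x + g x * f' x) : I" by (intro pideal_add[OF I] pideal_mult[OF I] * r)
  then show "a \<oplus>\<^bsub>L\<^esub> b : ext I"
   unfolding *(3,6) add_fr[OF r(1) *(2) r(2) *(5)]
   by (subst ext_iff[OF I]) (use r * in "auto simp: mult.commute intro!: rpf_intros den_mult")
 next
  fix a x assume "a : ext I" "x : carrier L"
  then obtain f g f' g' where *: "f : I" "den g" "a = fr f g" "rpf f'" "den g'" "x = fr f' g'"
   by (auto simp: ext_def elim!: carrier_frE)
  note r = pideal_rpf[OF I *(1)]
  have "(%x. f' x * f x) : I" by (intro pideal_mult[OF I] * r)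
  then show "x \<otimes>\<^bsub>L\<^esub> a : ext I"
   unfolding *(3,6) mult_fr[OF *(4,5) r *(2)]
   by (subst ext_iff[OF I]) (use r * in "auto intro!: rpf_intros den_mult")
 qed
qed

definition mpoly :: "(real ^ 'n => real) set" where
 "mpoly = {f. rpf f & f p = 0}"

lemma p_in: "p : M" using WM by simp

lemma pideal_mpoly: "pideal M p mpoly"
 unfolding pideal_def mpoly_def using p_in
 by (intro conjI allI ballI impI) (auto intro: rpf_intros)

lemma not_vanishing_carrier:
 assumes "ideal I L" "fr f g : I" "rpf f" "den g" "f p ~= 0"
 shows "I = carrier L"
proof -
 interpret I: ideal I L by fact
 have d: "den f" using assms by (simp add: den_iff)
 have "fr f g \<otimes>\<^bsub>L\<^esub> fr g f : I"
  using assms d by (intro I.I_r_closed carrier_fr den_rpf)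
 also have "fr f g \<otimes>\<^bsub>L\<^esub> fr g f = \<one>\<^bsub>L\<^esub>"
  unfolding one_fr using assms d by (simp add: mult_fr fr_eq_iff den_mult den_rpf rpf_intros mult.commute)
 finally show ?thesis by (rule I.one_imp_carrier)
qed

lemma maximal_ext_mpoly: "maximalideal (ext mpoly) L"
proof (rule maximalidealI[OF ideal_ext[OF pideal_mpoly]])
 have "fr (%_. 1) (%_. 1) : carrier L" "fr (%_. 1) (%_. 1) ~: ext mpoly"
  by (auto intro!: carrier_fr simp: ext_iff[OF pideal_mpoly]) (simp add: mpoly_def)
 then show "carrier L ~= ext mpoly" by blast
next
 fix K assume K: "ideal K L" "ext mpoly \<subseteq> K" "K \<subseteq> carrier L"
 show "K = ext mpoly | K = carrier L"
 proof (cases "K \<subseteq> ext mpoly")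
  case False
  then obtain a where a: "a : K" "a ~: ext mpoly" by blast
  then obtain f g where f: "rpf f" "den g" "a = fr f g" using K(3) carrier_frE by blast
  then have "f p ~= 0" using a by (simp add: ext_iff[OF pideal_mpoly]) (simp add: mpoly_def)
  then show ?thesis using not_vanishing_carrier K(1) a f by blast
 qed (use K in auto)
qed

lemma max_unique: "maximalideal m L ==> m = ext mpoly"
 using unique_max maximal_ext_mpoly by blast

lemma unit_nonzero:
 assumes "fr f g : Units L" "rpf f" "den g"
 shows "f p ~= 0"
proof -
 obtain b where b: "b : carrier L" "fr f g \<otimes>\<^bsub>L\<^esub> b = \<one>\<^bsub>L\<^esub>"
  using assms(1) by (auto simp: Units_def)
 obtain f' g' where f': "rpf f'" "den g'" "b = fr f' g'" using b(1) by (rule carrier_frE)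
 have "ALL x:M. f x * f' x * 1 = 1 * (g x * g' x)"
  using b(2) assms(2,3) f' unfolding one_fr f'(3) mult_fr[OF assms(2,3) f'(1,2)]
  by (subst (asm) fr_eq_iff) (auto intro!: rpf_intros den_mult)
 then have "f p * f' p = g p * g' p" using p_in by simp
 then show ?thesis using assms(3) f'(2) by (auto simp: den_iff)
qed

text \<open>The polynomials that become combinations of the \<open>X j\<close> after multiplication
  by a denominator form a \<open>pideal\<close>. Its extension to the local ring contains the
  generators, hence the maximal ideal that they generate.\<close>

lemma maximal_generators:
 assumes xs: "maximalideal (Idl\<^bsub>L\<^esub> (set xs)) L" "set xs \<subseteq> carrier L"
  and X: "!!j. j < length xs ==> rpf (X j) & den (Y j) & xs ! j = fr (X j) (Y j)"
 shows "!!j. j < length xs ==> X j p = 0"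
  and "!!f. rpf f ==> f p = 0 ==> EX h c. rpf h & h p ~= 0 & (ALL j<length xs. rpf (c j)) &
    (ALL x:M. h x * f x = (\<Sum>j<length xs. c j x * X j x))"
proof -
 interpret cring L by (rule ring)
 have eq: "Idl\<^bsub>L\<^esub> (set xs) = ext mpoly" by (rule max_unique[OF xs(1)])
 show "X j p = 0" if "j < length xs" for j
 proof -
  have "fr (X j) (Y j) : ext mpoly"
   using genideal_self[OF xs(2)] that X[OF that] unfolding eq by (metis nth_mem subsetD)
  then show ?thesis using X[OF that] by (simp add: ext_iff[OF pideal_mpoly]) (simp add: mpoly_def)
 qed
 define I where "I = {f. rpf f & (EX h c. rpf h & h p ~= 0 & (ALL j<length xs. rpf (c j)) &
    (ALL x:M. h x * f x = (\<Sum>j<length xs. c j x * X j x)))}"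
 have I_I: "f : I" if "rpf f" "rpf h" "h p ~= 0" "!!j. j < length xs ==> rpf (c j)"
   "!!x. x : M ==> h x * f x = (\<Sum>j<length xs. c j x * X j x)" for f h c
  using that unfolding I_def by blast
 have pI: "pideal M p I"
  unfolding pideal_def
 proof (intro conjI allI ballI impI)
  show "I \<subseteq> Collect rpf" by (auto simp: I_def)
 next
  fix f assume "rpf f & (ALL x:M. f x = 0)"
  then show "f : I" by (intro I_I[of f "%_. 1" "%_ _. 0"]) auto
 next
  fix f g :: "real ^ 'n => real" assume "f : I" "g : I"
  then obtain h c h' c' where *: "rpf f" "rpf h" "h p ~= 0" "ALL j<length xs. rpf (c j)"
    "ALL x:M. h x * f x = (\<Sum>j<length xs. c j x * X j x)" and
    **: "rpf g" "rpf h'" "h' p ~= 0" "ALL j<length xs. rpf (c' j)"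
    "ALL x:M. h' x * g x = (\<Sum>j<length xs. c' j x * X j x)"
   unfolding I_def by blast
  have "h x * h' x * (f x + g x) = (\<Sum>j<length xs. (h' x * c j x + h x * c' j x) * X j x)" if "x : M" for x
  proof -
   have "h x * h' x * (f x + g x) = h' x * (h x * f x) + h x * (h' x * g x)"
    by (simp add: algebra_simps)
   also have "... = h' x * (\<Sum>j<length xs. c j x * X j x) + h x * (\<Sum>j<length xs. c' j x * X j x)"
    using *(5) **(5) that by simp
   finally show ?thesis by (simp add: sum_distrib_left sum.distrib ring_distribs mult_ac)
  qed
  with * ** show "(%x. f x + g x) : I"
   by (intro I_I[of _ "%x. h x * h' x" "%j x. h' x * c j x + h x * c' j x"] rpf_intros) auto
 next
  fix f g :: "real ^ 'n => real" assume "f : I" and g: "rpf g"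
  then obtain h c where *: "rpf f" "rpf h" "h p ~= 0" "ALL j<length xs. rpf (c j)"
    "ALL x:M. h x * f x = (\<Sum>j<length xs. c j x * X j x)" unfolding I_def by blast
  have "h x * (f x * g x) = (\<Sum>j<length xs. (g x * c j x) * X j x)" if "x : M" for x
  proof -
   have "h x * (f x * g x) = g x * (h x * f x)" by simp
   also have "... = g x * (\<Sum>j<length xs. c j x * X j x)" using *(5) that by simp
   finally show ?thesis by (simp add: sum_distrib_left mult_ac)
  qed
  with * g show "(%x. f x * g x) : I"
   by (intro I_I[of _ h "%j x. g x * c j x"] rpf_intros) auto
 next
  fix f k :: "real ^ 'n => real" assume k: "rpf f & rpf k & k p ~= 0 & (%x. k x * f x) : I"
  then obtain h c where *: "rpf h" "h p ~= 0" "ALL j<length xs. rpf (c j)"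
    "ALL x:M. h x * (k x * f x) = (\<Sum>j<length xs. c j x * X j x)" unfolding I_def by blast
  with k show "f : I"
   by (intro I_I[of f "%x. h x * k x" c] rpf_intros) (auto simp: mult.assoc)
 qed
 have "set xs \<subseteq> ext I"
 proof
  fix y assume "y : set xs"
  then obtain j where j: "j < length xs" "y = xs ! j" by (auto simp: in_set_conv_nth)
  have "X j : I"
  proof (rule I_I[of _ "%_. 1" "%i _. if i = j then 1 else 0"])
   fix x show "1 * X j x = (\<Sum>i<length xs. (if i = j then 1 else 0) * X i x)"
    using j(1) by (simp add: if_distrib[of "%z. z * _"] cong: if_cong)
  qed (use X[OF j(1)] in auto)
  then show "y : ext I" using X[OF j(1)] j(2) ext_iff[OF pI] by auto
 qed
 then have "ext mpoly \<subseteq> ext I"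
  unfolding eq[symmetric] by (rule genideal_minimal[OF ideal_ext[OF pI]])
 moreover fix f assume f: "rpf f" "f p = 0"
 then have "fr f (%_. 1) : ext mpoly" unfolding ext_iff[OF pideal_mpoly f(1) den_one] by (simp add: mpoly_def)
 ultimately have "f : I" using ext_iff[OF pI f(1) den_one] by blast
 then show "EX h c. rpf h & h p ~= 0 & (ALL j<length xs. rpf (c j)) &
    (ALL x:M. h x * f x = (\<Sum>j<length xs. c j x * X j x))" by (auto simp: I_def)
qed

lemma noetherian_acc:
 assumes "noetherian_ring L"
 shows "acc_at M p"
 unfolding acc_at_def
proof (intro allI impI, elim conjE)
 fix I :: "nat => _"
 assume I: "ALL i. pideal M p (I i)" and mono: "ALL i. I i \<subseteq> I (Suc i)"
 interpret noetherian_ring L by fact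
 have le: "I i \<subseteq> I j" if "i <= j" for i j using lift_Suc_mono_le[of I i j] mono that by blast
 define C where "C = range (%i. ext (I i))"
 have "subset.chain {J. ideal J L} C"
  unfolding subset_chain_def
 proof (intro conjI ballI)
  show "C \<subseteq> {J. ideal J L}" using I ideal_ext by (auto simp: C_def)
  fix a b assume "a : C" "b : C"
  then obtain i j where "a = ext (I i)" "b = ext (I j)" by (auto simp: C_def)
  moreover have "ext (I i) \<subseteq> ext (I j) | ext (I j) \<subseteq> ext (I i)"
   using le[of i j] le[of j i] linear[of i j] by (auto simp: ext_def)
  ultimately show "a \<subseteq> b | b \<subseteq> a" by blast
 qed
 from ideal_chain_is_trivial[OF _ this] have "\<Union>C \<in> C" by (auto simp: C_def)
 then obtain k where k: "\<Union>C = ext (I k)" by (auto simp: C_def)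
 have "I (Suc k) \<subseteq> I k"
 proof
  fix f assume f: "f : I (Suc k)"
  then have r: "rpf f" using I pideal_rpf by blast
  have "fr f (%_. 1) : ext (I (Suc k))" using f r I by (simp add: ext_iff)
  then have "fr f (%_. 1) : ext (I k)" unfolding k[symmetric] by (auto simp: C_def)
  then show "f : I k" using r I by (simp add: ext_iff)
 qed
 with mono show "EX k. I (Suc k) = I k" by blast
qed

lemma prime_polyprime:
 assumes "primeideal P L"
 shows "polyprime M {f. rpf f & fr f (%_. 1) : P}" "ALL f:{f. rpf f & fr f (%_. 1) : P}. f p = 0"
proof -
 interpret P: primeideal P L by fact
 show v: "ALL f:{f. rpf f & fr f (%_. 1) : P}. f p = 0"
  using not_vanishing_carrier[OF P.is_ideal, of _ "%_. 1"] P.I_notcarr den_one by blast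
 show "polyprime M {f. rpf f & fr f (%_. 1) : P}"
  unfolding polyprime_def
 proof (intro conjI allI ballI impI)
  fix f assume "rpf f & (ALL x:M. f x = 0)"
  then have "rpf f" "fr f (%_. 1) = \<zero>\<^bsub>L\<^esub>" by (auto simp: zero_fr fr_eq_iff)
  then show "f : {f. rpf f & fr f (%_. 1) : P}" using P.zero_closed by simp
 next
  fix f g :: "real ^ 'n => real" assume *: "f : {f. rpf f & fr f (%_. 1) : P}" "g : {f. rpf f & fr f (%_. 1) : P}"
  then have "fr f (%_. 1) \<oplus>\<^bsub>L\<^esub> fr g (%_. 1) : P" by (auto intro: P.a_closed)
  with * show "(%x. f x + g x) : {f. rpf f & fr f (%_. 1) : P}"
   by (simp add: add_fr rpf_intros)
 next
  fix f g :: "real ^ 'n => real" assume *: "f : {f. rpf f & fr f (%_. 1) : P}" "rpf g"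
  then have "fr f (%_. 1) \<otimes>\<^bsub>L\<^esub> fr g (%_. 1) : P"
   using P.I_r_closed[of "fr f (%_. 1)" "fr g (%_. 1)"] carrier_fr[of g "%_. 1"] by simp
  with * show "(%x. f x * g x) : {f. rpf f & fr f (%_. 1) : P}"
   by (simp add: mult_fr rpf_intros)
 next
  fix f g :: "real ^ 'n => real" assume *: "rpf f & rpf g & (%x. f x * g x) : {f. rpf f & fr f (%_. 1) : P}"
  then have "fr f (%_. 1) \<otimes>\<^bsub>L\<^esub> fr g (%_. 1) : P" by (simp add: mult_fr)
  from P.I_prime[OF _ _ this] *
  show "f : {f. rpf f & fr f (%_. 1) : P} | g : {f. rpf f & fr f (%_. 1) : P}"
   by (simp add: carrier_fr)
 next
  fix f assume "f : {f. rpf f & fr f (%_. 1) : P}"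
  with v p_in show "EX x:M. f x = 0" by blast
 qed auto
qed

lemma prime_polyprime_strict:
 assumes "primeideal P L" "primeideal Q L" "P \<subset> Q"
 shows "{f. rpf f & fr f (%_. 1) : P} \<subset> {f. rpf f & fr f (%_. 1) : Q}"
proof -
 interpret P: primeideal P L by fact
 interpret Q: primeideal Q L by fact
 obtain a where a: "a : Q" "a ~: P" using assms(3) by blast
 then obtain f g where f: "rpf f" "den g" "a = fr f g" using Q.Icarr carrier_frE by blast
 note r = f(1,2) den_rpf[OF f(2)]
 have "fr f (%_. 1) = a \<otimes>\<^bsub>L\<^esub> fr g (%_. 1)" "a = fr f (%_. 1) \<otimes>\<^bsub>L\<^esub> fr (%_. 1) g"
  unfolding f(3) using r by (simp_all add: mult_fr fr_eq_iff rpf_intros)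
 then have "fr f (%_. 1) : Q" "fr f (%_. 1) ~: P"
  using a Q.I_r_closed[OF a(1) carrier_fr[OF r(3) den_one]] P.I_r_closed[OF _ carrier_fr[OF _ r(2)], of _ "%_. 1"]
  by auto
 then show ?thesis using assms(3) f(1) by blast
qed

lemma poly_chain:
 assumes "krull_dim L = enat n"
 shows "EX P. (ALL i<=n. polyprime M (P i) & (ALL f:P i. f p = 0)) & (ALL i<n. P i \<subset> P (Suc i))"
proof (cases "n = 0")
 case True
 \<comment> \<open>\<open>krull_dim_chain\<close> excludes length \<open>0\<close>; here the maximal
   ideal is the only member of the chain.\<close>
 have "primeideal (ext mpoly) L" using cring.maximalideal_prime[OF ring maximal_ext_mpoly] .
 from prime_polyprime[OF this] show ?thesis using True
  by (intro exI[of _ "%_. {f. rpf f & fr f (%_. 1) : ext mpoly}"]) simp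
next
 case False
 obtain P where P: "ALL i<=n. primeideal (P i) L" "ALL i<n. P i \<subset> P (Suc i)"
  using krull_dim_chain[of n L] assms False by auto
 show ?thesis
  by (intro exI[of _ "%i. {f. rpf f & fr f (%_. 1) : P i}"] conjI allI impI
     prime_polyprime prime_polyprime_strict) (use P in auto)
qed

end

text \<open>Allowing denominators without zeros on \<open>V\<close> turns numerators of primes into
  primes of the ring of regular functions and keeps inclusions strict, so chains may be given by
  polynomials.\<close>

lemma alg_dim_ge:
 fixes V :: "(real ^ 'n) set"
 assumes P: "!!i. i <= k ==> polyprime V (P i)" and strict: "!!i. i < k ==> P i \<subset> P (Suc i)"
 shows "enat k <= alg_dim V"
proof -
 interpret cring "regular_ring V" by (rule cring_regular_ring)
 define Q where "Q i = {f : carrier (regular_ring V). EX p q. p : P i & rpf q & (ALL x:V. q x ~= 0) &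
   (ALL x:V. f x * q x = p x)}" for i
 have QD: "p : P i" if "i <= k" "f : Q i" "rpf p" "rpf q" "!!x. x : V ==> q x ~= 0" "!!x. x : V ==> f x * q x = p x"
  for i f p q
 proof -
  obtain p' q' where *: "p' : P i" "rpf q'" "ALL x:V. q' x ~= 0" "ALL x:V. f x * q' x = p' x"
   using \<open>f : Q i\<close> by (auto simp: Q_def)
  have "(%x. p' x * q x) : P i" by (rule polyprime_mult[OF P *(1)]) fact+
  then have "(%x. p x * q' x) : P i"
  proof (rule polyprime_cong[OF P[OF that(1)]])
   fix x assume x: "x : V"
   have "p' x * q x = f x * q' x * q x" using * x by simp
   also have "... = p x * q' x" using that(6)[OF x] by (simp add: mult_ac)
   finally show "p' x * q x = p x * q' x" .
  qed (use that * in "auto intro: rpf_intros")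
  then show ?thesis using polyprime_prime[OF P[OF that(1)] \<open>rpf p\<close> *(2)] polyprime_zero[OF P[OF that(1)]] *(3) by blast
 qed
 have QI: "f : Q i" if "f : carrier (regular_ring V)" "p : P i" "rpf q" "!!x. x : V ==> q x ~= 0"
   "!!x. x : V ==> f x * q x = p x" for i f p q
  using that unfolding Q_def by blast
 have "primeideal (Q i) (regular_ring V)" if i: "i <= k" for i
 proof (rule primeidealI[OF ideal_from_closed])
  show "cring (regular_ring V)" by (rule cring_regular_ring)
  show "Q i \<subseteq> carrier (regular_ring V)" by (auto simp: Q_def)
  show "\<zero>\<^bsub>regular_ring V\<^esub> : Q i"
  proof (rule QI[OF zero_closed, of "%_. 0" i "%_. 1"])
   show "(%_. 0) : P i" by (rule polyprime_vanish[OF P[OF i]]) auto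
  qed (auto simp: rr_simps(4))
 next
  fix a b assume ab: "a : Q i" "b : Q i"
  then obtain p q p' q' where *: "p : P i" "rpf q" "ALL x:V. q x ~= 0" "ALL x:V. a x * q x = p x"
   "p' : P i" "rpf q'" "ALL x:V. q' x ~= 0" "ALL x:V. b x * q' x = p' x" by (auto simp: Q_def)
  have "a \<oplus>\<^bsub>regular_ring V\<^esub> b : carrier (regular_ring V)" using ab by (auto simp: Q_def)
  then show "a \<oplus>\<^bsub>regular_ring V\<^esub> b : Q i"
  proof (rule QI)
   show "(%x. p x * q' x + p' x * q x) : P i"
    by (intro polyprime_add[OF P[OF i]] polyprime_mult[OF P[OF i]] *)
   fix x assume x: "x : V"
   show "(a \<oplus>\<^bsub>regular_ring V\<^esub> b) x * (q x * q' x) = p x * q' x + p' x * q x"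
    using * x by (auto simp: rr_simps(5) algebra_simps)
  qed (use * in "auto intro: rpf_intros")
 next
  fix a b assume ab: "a : Q i" "b : carrier (regular_ring V)"
  then obtain p q where *: "p : P i" "rpf q" "ALL x:V. q x ~= 0" "ALL x:V. a x * q x = p x" by (auto simp: Q_def)
  obtain p' q' where **: "rpf p'" "rpf q'" "!!x. x : V ==> q' x ~= 0" "!!x. x : V ==> b x = p' x / q' x"
   using ab(2) by (rule regular_carrierE) blast
  have "b \<otimes>\<^bsub>regular_ring V\<^esub> a : carrier (regular_ring V)" using ab by (auto simp: Q_def)
  then show "b \<otimes>\<^bsub>regular_ring V\<^esub> a : Q i"
  proof (rule QI)
   show "(%x. p x * p' x) : P i" by (intro polyprime_mult[OF P[OF i]] * **)
   fix x assume x: "x : V"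
   then show "(b \<otimes>\<^bsub>regular_ring V\<^esub> a) x * (q x * q' x) = p x * p' x"
    using * ** by (auto simp: rr_simps(2))
  qed (use * ** in "auto intro: rpf_intros")
 next
  have "\<one>\<^bsub>regular_ring V\<^esub> ~: Q i"
  proof
   assume "\<one>\<^bsub>regular_ring V\<^esub> : Q i"
   from QD[OF i this, of "%_. 1" "%_. 1"] have "(%_. 1) : P i" by (auto simp: rr_simps(3))
   from polyprime_zero[OF P[OF i] this] show False by simp
  qed
  then show "carrier (regular_ring V) ~= Q i" using one_closed by metis
 next
  fix a b assume ab: "a : carrier (regular_ring V)" "b : carrier (regular_ring V)" "a \<otimes>\<^bsub>regular_ring V\<^esub> b : Q i"
  obtain p q where *: "rpf p" "rpf q" "!!x. x : V ==> q x ~= 0" "!!x. x : V ==> a x = p x / q x"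
   using ab(1) by (rule regular_carrierE) blast
  obtain p' q' where **: "rpf p'" "rpf q'" "!!x. x : V ==> q' x ~= 0" "!!x. x : V ==> b x = p' x / q' x"
   using ab(2) by (rule regular_carrierE) blast
  have "(%x. p x * p' x) : P i"
   by (rule QD[OF i ab(3), of _ "%x. q x * q' x"]) (use * ** in "auto simp: rr_simps(2) intro: rpf_intros")
  then have "p : P i | p' : P i" using polyprime_prime[OF P[OF i]] * ** by blast
  then show "a : Q i | b : Q i"
   using QI[OF ab(1) _ *(2,3)] QI[OF ab(2) _ **(2,3)] *(3,4) **(3,4) by auto
 qed
 moreover have "Q i \<subset> Q (Suc i)" if i: "i < k" for i
 proof
  show "Q i \<subseteq> Q (Suc i)" using strict[OF i] unfolding Q_def by blast
  obtain f where f: "f : P (Suc i)" "f ~: P i" using strict[OF i] by blast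
  have r: "rpf f" using polyprime_rpf[OF P f(1)] i by simp
  have "restrict f V : Q (Suc i)"
   by (rule QI[OF restrict_regular[OF r] f(1), of "%_. 1"]) auto
  moreover have "restrict f V ~: Q i"
   using QD[of i "restrict f V" f "%_. 1"] i r f(2) by auto
  ultimately show "Q i ~= Q (Suc i)" by blast
 qed
 ultimately show ?thesis unfolding alg_dim_def by (intro krull_dim_ge[of k Q]) auto
qed

lemma alg_dim_chain:
 fixes V :: "(real ^ 'n) set"
 assumes "enat k <= alg_dim V" "k > 0"
 shows "EX P. (ALL i<=k. polyprime V (P i)) & (ALL i<k. P i \<subset> P (Suc i))"
proof -
 interpret cring "regular_ring V" by (rule cring_regular_ring)
 obtain P where P: "ALL i<=k. primeideal (P i) (regular_ring V)" "ALL i<k. P i \<subset> P (Suc i)"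
  using krull_dim_chain[OF assms(1)[unfolded alg_dim_def] assms(2)] by blast
 define Q where "Q i = {f. rpf f & restrict f V : P i}" for i
 have unit: "P i = carrier (regular_ring V)" if "i <= k" "restrict f V : P i" "rpf f" "!!x. x : V ==> f x ~= 0" for i f
 proof -
  interpret P: primeideal "P i" "regular_ring V" using P(1) that(1) by blast
  have "(\<lambda>x\<in>V. 1 / f x) : carrier (regular_ring V)"
   by (rule regular_carrierI[of "%_. 1" f]) (use that in auto)
  from P.I_r_closed[OF that(2) this] have "\<one>\<^bsub>regular_ring V\<^esub> : P i"
   using that(4) by (simp add: rr_simps(2,3) cong: restrict_cong)
  then show ?thesis by (rule P.one_imp_carrier)
 qed
 have "polyprime V (Q i)" if i: "i <= k" for i
 proof -
  interpret P: primeideal "P i" "regular_ring V" using P(1) i by blast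
  show ?thesis
   unfolding polyprime_def
  proof (intro conjI allI ballI impI)
   fix f assume "rpf f & (ALL x:V. f x = 0)"
   then have "rpf f" "restrict f V = \<zero>\<^bsub>regular_ring V\<^esub>"
    by (auto simp: rr_simps(4) restrict_def fun_eq_iff)
   then show "f : Q i" using P.zero_closed by (simp add: Q_def)
  next
   fix f g :: "real ^ 'n => real" assume *: "f : Q i" "g : Q i"
   then have "restrict f V \<oplus>\<^bsub>regular_ring V\<^esub> restrict g V : P i" by (auto simp: Q_def intro: P.a_closed)
   with * show "(%x. f x + g x) : Q i"
    by (simp add: Q_def rr_simps(5) rpf_intros cong: restrict_cong)
  next
   fix f g :: "real ^ 'n => real" assume *: "f : Q i" "rpf g"
   then have "restrict f V \<otimes>\<^bsub>regular_ring V\<^esub> restrict g V : P i"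
    by (auto simp: Q_def intro: P.I_r_closed restrict_regular)
   with * show "(%x. f x * g x) : Q i"
    by (simp add: Q_def rr_simps(2) rpf_intros cong: restrict_cong)
  next
   fix f g :: "real ^ 'n => real" assume *: "rpf f & rpf g & (%x. f x * g x) : Q i"
   then have "restrict f V \<otimes>\<^bsub>regular_ring V\<^esub> restrict g V : P i"
    by (simp add: Q_def rr_simps(2) cong: restrict_cong)
   from P.I_prime[OF _ _ this] * show "f : Q i | g : Q i" by (auto simp: Q_def intro: restrict_regular)
  next
   fix f assume "f : Q i"
   then show "EX x:V. f x = 0" using unit[OF i, of f] P.I_notcarr by (auto simp: Q_def)
  qed (auto simp: Q_def)
 qed
 moreover have "Q i \<subset> Q (Suc i)" if i: "i < k" for i
 proof
  show "Q i \<subseteq> Q (Suc i)" using P(2) i unfolding Q_def by blast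
  interpret P: primeideal "P i" "regular_ring V" using P(1) i by simp
  interpret S: primeideal "P (Suc i)" "regular_ring V" using P(1) i by simp
  obtain a where a: "a : P (Suc i)" "a ~: P i" using P(2) i by blast
  have ac: "a : carrier (regular_ring V)" using a(1) by (rule S.Icarr)
  then obtain p q where *: "rpf p" "rpf q" "!!x. x : V ==> q x ~= 0" "!!x. x : V ==> a x = p x / q x"
   by (rule regular_carrierE) blast
  have inv: "(\<lambda>x\<in>V. 1 / q x) : carrier (regular_ring V)"
   by (rule regular_carrierI[of "%_. 1" q]) (use * in auto)
  have 1: "restrict p V = a \<otimes>\<^bsub>regular_ring V\<^esub> restrict q V"
   using * by (auto simp: rr_simps(2) restrict_def fun_eq_iff)
  have 2: "a = restrict p V \<otimes>\<^bsub>regular_ring V\<^esub> (\<lambda>x\<in>V. 1 / q x)"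
   by (rule regular_eqI[OF ac m_closed[OF restrict_regular[OF *(1)] inv]])
     (use * in "auto simp: rr_simps(2)")
  have "restrict p V : P (Suc i)" unfolding 1 by (rule S.I_r_closed[OF a(1) restrict_regular[OF *(2)]])
  moreover have "restrict p V ~: P i" using P.I_r_closed[OF _ inv, of "restrict p V"] a(2) 2 by auto
  ultimately show "Q i ~= Q (Suc i)" using *(1) unfolding Q_def by blast
 qed
 ultimately show ?thesis by (intro exI[of _ Q]) auto
qed

subsection \<open>Krull's intersection theorem\<close>

text \<open>Membership in the \<open>k\<close>-th power of the ideal of polynomials vanishing at
  \<open>p\<close>. The inductive form lets later proofs treat one factor at a time.\<close>

inductive ordge :: "real ^ 'n => nat => (real ^ 'n => real) => bool" for p where
 zero: "rpf f ==> ordge p 0 f"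
| step: "ordge p k f ==> rpf g ==> g p = 0 ==> ordge p (Suc k) (%x. g x * f x)"
| add: "ordge p k f ==> ordge p k g ==> ordge p k (%x. f x + g x)"

lemma ordge_rpf: "ordge p k f ==> rpf f"
 by (induction rule: ordge.induct) (auto intro: rpf_intros)

lemma ordge_mult: "ordge p k f ==> rpf h ==> ordge p k (%x. h x * f x)"
proof (induction rule: ordge.induct)
 case (zero f)
 then show ?case by (intro ordge.zero rpf_intros)
next
 case (step k f g)
 have "ordge p (Suc k) (%x. g x * (h x * f x))" by (intro ordge.step step)
 then show ?case by (simp add: mult_ac)
next
 case (add k f g)
 have "ordge p k (%x. h x * f x + h x * g x)" by (intro ordge.add add)
 then show ?case by (simp add: ring_distribs)
qed

lemma ordge_null: "ordge p k (%x. 0)"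
proof (induction k)
 case (Suc k)
 from ordge.step[OF this, of "%_. 0"] show ?case by simp
qed (auto intro: ordge.zero)

text \<open>The sum of \<open>I\<close> and \<open>G\<close> in the local ring at \<open>p\<close>,
  taken back to polynomials; \<open>h\<close> is the denominator.\<close>

definition psat :: "real ^ 'n => (real ^ 'n => real) set => (real ^ 'n => real) set => (real ^ 'n => real) set" where
 "psat p I G = {f. rpf f & (EX h g. rpf h & h p ~= 0 & g : G & (%x. h x * f x - g x) : I)}"

lemma psatI: "rpf f ==> rpf h ==> h p ~= 0 ==> g : G ==> (%x. h x * f x - g x) : I ==> f : psat p I G"
 unfolding psat_def by blast

lemma psatE:
 assumes "f : psat p I G"
 obtains h g where "rpf f" "rpf h" "h p ~= 0" "g : G" "(%x. h x * f x - g x) : I"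
 using assms unfolding psat_def by blast

definition pmodule :: "(real ^ 'n => real) set => bool" where
 "pmodule G \<longleftrightarrow> G \<subseteq> Collect rpf & (%_. 0) : G & (ALL f:G. ALL g:G. (%x. f x + g x) : G)
   & (ALL f:G. ALL h. rpf h --> (%x. h x * f x) : G)"

lemma pmoduleD:
 assumes "pmodule G"
 shows "!!f. f : G ==> rpf f" "(%_. 0) : G" "!!f g. f : G ==> g : G ==> (%x. f x + g x) : G"
  "!!f h. f : G ==> rpf h ==> (%x. h x * f x) : G"
 using assms unfolding pmodule_def by (blast, blast, blast, blast)

lemma pmodule_rpf: "pmodule (Collect rpf)"
 by (auto simp: pmodule_def intro: real_polynomial_function.intros(3,4))

lemma pmodule_multiples:
 assumes G: "pmodule G" and u: "rpf u"
 shows "pmodule {%x. b x * u x | b. b : G}"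
 unfolding pmodule_def
proof (intro conjI ballI allI impI subsetI)
 fix g assume "g : {%x. b x * u x | b. b : G}"
 with u show "g : Collect rpf" by (auto intro: real_polynomial_function.intros(4) pmoduleD(1)[OF G])
next
 show "(%_. 0) : {%x. b x * u x | b. b : G}" by (intro CollectI exI[of _ "%_. 0"]) (auto intro: pmoduleD(2)[OF G])
next
 fix f g assume "f : {%x. b x * u x | b. b : G}" "g : {%x. b x * u x | b. b : G}"
 then obtain b c where "b : G" "f = (%x. b x * u x)" "c : G" "g = (%x. c x * u x)" by blast
 then show "(%x. f x + g x) : {%x. b x * u x | b. b : G}"
  by (intro CollectI exI[of _ "%x. b x + c x"]) (auto simp: ring_distribs intro: pmoduleD(3)[OF G])
next
 fix f and h :: "real ^ 'a => real" assume "f : {%x. b x * u x | b. b : G}" and h: "rpf h"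
 then obtain b where "b : G" "f = (%x. b x * u x)" by blast
 with h show "(%x. h x * f x) : {%x. b x * u x | b. b : G}"
  by (intro CollectI exI[of _ "%x. h x * b x"]) (simp_all add: mult.assoc pmoduleD(4)[OF G])
qed

lemma pideal_psat:
 fixes I :: "(real ^ 'n => real) set"
 assumes I: "pideal M p I" and G: "pmodule G"
 shows "pideal M p (psat p I G)"
 unfolding pideal_def
proof (intro conjI allI ballI impI)
 show "psat p I G \<subseteq> Collect rpf" by (auto simp: psat_def)
next
 fix f :: "real ^ 'n => real" assume f: "rpf f & (ALL x:M. f x = 0)"
 then have "f : I" using pideal_vanish[OF I] by simp
 with f show "f : psat p I G" by (intro psatI[of f "%_. 1" p "%_. 0"] pmoduleD(2)[OF G]) auto
next
 fix f g :: "real ^ 'n => real" assume "f : psat p I G" "g : psat p I G"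
 then obtain h u k v where *: "rpf f" "rpf h" "h p ~= 0" "u : G" "(%x. h x * f x - u x) : I" and
  **: "rpf g" "rpf k" "k p ~= 0" "v : G" "(%x. k x * g x - v x) : I" by (elim psatE)
 show "(%x. f x + g x) : psat p I G"
 proof (rule psatI)
  show "(%x. k x * u x + h x * v x) : G" by (intro pmoduleD[OF G] * **)
  have "(%x. k x * (h x * f x - u x) + h x * (k x * g x - v x)) : I"
   by (intro pideal_add[OF I] pideal_mult[OF I] * **)
  then show "(%x. h x * k x * (f x + g x) - (k x * u x + h x * v x)) : I"
   by (simp add: algebra_simps)
 qed (use * ** in "auto intro: rpf_intros")
next
 fix f g :: "real ^ 'n => real" assume "f : psat p I G" and g: "rpf g"
 then obtain h u where *: "rpf f" "rpf h" "h p ~= 0" "u : G" "(%x. h x * f x - u x) : I" by (elim psatE)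
 show "(%x. f x * g x) : psat p I G"
 proof (rule psatI)
  show "(%x. g x * u x) : G" by (intro pmoduleD[OF G] * g)
  have "(%x. g x * (h x * f x - u x)) : I" by (intro pideal_mult[OF I] * g)
  then show "(%x. h x * (f x * g x) - (g x * u x)) : I" by (simp add: algebra_simps)
 qed (use * g in "auto intro: rpf_intros")
next
 fix f k :: "real ^ 'n => real" assume k: "rpf f & rpf k & k p ~= 0 & (%x. k x * f x) : psat p I G"
 then obtain h u where *: "rpf h" "h p ~= 0" "u : G" "(%x. h x * (k x * f x) - u x) : I" by (elim conjE psatE)
 show "f : psat p I G"
  by (rule psatI[of f "%x. h x * k x" p u]) (use k * in "auto intro: rpf_intros simp: mult.assoc")
qed

lemma psat_base:
 assumes I: "pideal M p I" and G: "pmodule G" and f: "f : I"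
 shows "f : psat p I G"
 by (rule psatI[of f "%_. 1" p "%_. 0"]) (use assms pideal_rpf[OF I f] pmoduleD(2)[OF G] in auto)

lemma psat_module:
 assumes I: "pideal M p I" and G: "pmodule G" and f: "f : G"
 shows "f : psat p I G"
 by (rule psatI[of f "%_. 1" p f]) (use pmoduleD(1)[OF G f] f pideal_vanish[OF I, of "%_. 0"] in auto)

lemma acc_max:
 assumes acc: "acc_at M p" and K0: "pideal M p K0" "Q K0"
 shows "EX K. pideal M p K & Q K & (ALL K'. pideal M p K' & Q K' & K \<subseteq> K' --> K' = K)"
proof (rule ccontr)
 assume no: "\<not> ?thesis"
 have "EX I. ALL i. (pideal M p (I i) & Q (I i)) & I i \<subset> I (Suc i)"
 proof (rule dependent_nat_choice[where P = "%_ K. pideal M p K & Q K" and Q = "%_ K K'. K \<subset> K'"])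
  show "EX K. pideal M p K & Q K" using K0 by blast
  fix K and i :: nat assume "pideal M p K & Q K"
  with no show "EX K'. (pideal M p K' & Q K') & K \<subset> K'" by blast
 qed
 then obtain I where *: "ALL i. (pideal M p (I i) & Q (I i)) & I i \<subset> I (Suc i)" by (rule exE)
 then have I: "pideal M p (I i)" "I i \<subset> I (Suc i)" for i by simp_all
 then have "(ALL i. pideal M p (I i)) & (ALL i. I i \<subseteq> I (Suc i))" by auto
 then have "EX k. I (Suc k) = I k" using acc[unfolded acc_at_def, rule_format, of I] by simp
 with I(2) show False by (metis psubset_eq)
qed

locale param_point =
 fixes M :: "(real ^ 'n) set" and p :: "real ^ 'n" and n :: nat and X :: "nat => real ^ 'n => real"
 assumes p_in: "p : M" and acc: "acc_at M p"
  and X: "!!j. j < n ==> rpf (X j)" "!!j. j < n ==> X j p = 0"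
  and gen: "!!f. rpf f ==> f p = 0 ==> EX h c. rpf h & h p ~= 0 & (ALL j<n. rpf (c j)) &
    (ALL x:M. h x * f x = (\<Sum>j<n. c j x * X j x))"
begin

text \<open>A factor vanishing at \<open>p\<close> is, up to a unit, a combination of the
  parameters, so replacing it raises one exponent \<open>d i\<close>. Either this exponent has
  reached \<open>e i\<close>, and the product lies in \<open>K\<close>, or the sum of the truncated
  differences \<open>e j - d j\<close> drops along with \<open>k\<close>. For \<open>d = 0\<close>
  the result is that a high power of the maximal ideal lies in \<open>K\<close>.\<close>

lemma powers_absorb:
 assumes K: "pideal M p K" and e: "!!j. j < n ==> (%x. X j x ^ e j) : K"
  and R: "ordge p k R" and k: "(\<Sum>j<n. e j - d j) < k"
 shows "(%x. (\<Prod>j<n. X j x ^ d j) * R x) : K"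
 using R k
proof (induction arbitrary: d rule: ordge.induct)
 case (zero f)
 then show ?case by simp
next
 case (step k f g)
 obtain h c where h: "rpf h" "h p ~= 0" "!!j. j < n ==> rpf (c j)"
  "!!x. x : M ==> h x * g x = (\<Sum>j<n. c j x * X j x)"
  using gen[OF step.hyps(2,3)] by blast
 note rf = ordge_rpf[OF step.hyps(1)]
 have r: "rpf (%x. \<Prod>j<n. X j x ^ d j)" for d
  by (intro real_polynomial_function_prod real_polynomial_function_power X) auto
 have mono: "(%x. (\<Prod>j<n. X j x ^ (d(i := Suc (d i))) j) * f x) : K" if i: "i < n" for i
 proof (cases "Suc (d i) < e i")
  case True
  have "(\<Sum>j<n. e j - (d(i := Suc (d i))) j) < (\<Sum>j<n. e j - d j)"
   by (rule sum_strict_mono_ex1) (use i True in auto)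
  with step.prems have "(\<Sum>j<n. e j - (d(i := Suc (d i))) j) < k" by simp
  from step.IH[OF this] show ?thesis .
 next
  case False
  then have le: "e i <= Suc (d i)" by simp
  have "(%x. ((\<Prod>j\<in>{..<n} - {i}. X j x ^ d j) * X i x ^ (Suc (d i) - e i) * f x) * X i x ^ e i) : K"
   by (intro pideal_mult[OF K e[OF i]] rpf_intros rf) (use X i in auto)
  moreover have "((\<Prod>j\<in>{..<n} - {i}. X j x ^ d j) * X i x ^ (Suc (d i) - e i) * f x) * X i x ^ e i
    = (\<Prod>j<n. X j x ^ (d(i := Suc (d i))) j) * f x" for x
  proof -
   have "(\<Prod>j<n. X j x ^ (d(i := Suc (d i))) j) = X i x ^ Suc (d i) * (\<Prod>j\<in>{..<n} - {i}. X j x ^ d j)"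
    using i by (subst prod.remove[of _ i]) auto
   moreover have "X i x ^ Suc (d i) = X i x ^ (Suc (d i) - e i) * X i x ^ e i"
    using le by (metis le_add_diff_inverse2 power_add)
   ultimately show ?thesis by simp
  qed
  ultimately show ?thesis by simp
 qed
 have "(%x. \<Sum>i<n. c i x * ((\<Prod>j<n. X j x ^ (d(i := Suc (d i))) j) * f x)) : K"
  by (intro pideal_sum[OF K] pideal_mult[OF K] mono h) auto
 then have "(%x. h x * ((\<Prod>j<n. X j x ^ d j) * (g x * f x))) : K"
 proof (rule pideal_cong[OF K])
  show "rpf (%x. h x * ((\<Prod>j<n. X j x ^ d j) * (g x * f x)))"
   by (intro real_polynomial_function.intros(4) r rf h step)
  fix x assume x: "x : M"
  have pr: "(\<Prod>j<n. X j x ^ (d(i := Suc (d i))) j) = X i x * (\<Prod>j<n. X j x ^ d j)" if "i < n" for i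
  proof -
   have "(\<Prod>j<n. X j x ^ (d(i := Suc (d i))) j) = X i x ^ Suc (d i) * (\<Prod>j\<in>{..<n} - {i}. X j x ^ d j)"
    using that by (subst prod.remove[of _ i]) auto
   moreover have "(\<Prod>j<n. X j x ^ d j) = X i x ^ d i * (\<Prod>j\<in>{..<n} - {i}. X j x ^ d j)"
    using that by (subst prod.remove[of _ i]) auto
   ultimately show ?thesis by simp
  qed
  have "(\<Sum>i<n. c i x * ((\<Prod>j<n. X j x ^ (d(i := Suc (d i))) j) * f x))
    = (\<Sum>i<n. c i x * X i x) * ((\<Prod>j<n. X j x ^ d j) * f x)"
   unfolding sum_distrib_right
  proof (intro sum.cong refl)
   fix i assume "i : {..<n}"
   then show "c i x * ((\<Prod>j<n. X j x ^ (d(i := Suc (d i))) j) * f x)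
     = c i x * X i x * ((\<Prod>j<n. X j x ^ d j) * f x)"
    using pr[of i] by simp
  qed
  also have "... = h x * ((\<Prod>j<n. X j x ^ d j) * (g x * f x))" using h(4)[OF x] by (simp add: mult_ac)
  finally show "(\<Sum>i<n. c i x * ((\<Prod>j<n. X j x ^ (d(i := Suc (d i))) j) * f x))
    = h x * ((\<Prod>j<n. X j x ^ d j) * (g x * f x))" .
 qed
 moreover have "rpf (%x. (\<Prod>j<n. X j x ^ d j) * (g x * f x))"
  by (intro real_polynomial_function.intros(4) r rf step)
 ultimately show ?case using pideal_cancel[OF K _ h(1,2)] by blast
next
 case (add k f g)
 have "(%x. (\<Prod>j<n. X j x ^ d j) * f x + (\<Prod>j<n. X j x ^ d j) * g x) : K"
  by (intro pideal_add[OF K] add.IH add.prems)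
 then show ?case by (simp add: ring_distribs)
qed

text \<open>Krull's intersection theorem, by the classical argument with an ideal \<open>K\<close> that is maximal
  subject to \<open>K \<inter> (f) \<subseteq> \<mm>f\<close>.\<close>

theorem krull_intersection:
 assumes I: "pideal M p I" and f: "rpf f" and ord: "!!k. EX R. ordge p k R & (%x. f x - R x) : I"
 shows "f : I"
proof -
 have P0: "pmodule {g. rpf g & g p = 0}" by (auto simp: pmodule_def intro: rpf_intros)
 note G = pmodule_multiples[OF pmodule_rpf f] and G0 = pmodule_multiples[OF P0 f]
 \<comment> \<open>In the local ring, \<open>N\<close> is \<open>I\<close> plus the multiples of
   \<open>f\<close>, and \<open>mN\<close> is \<open>I\<close> plus the maximal ideal times
   \<open>f\<close>. The aim is \<open>f : mN\<close>.\<close>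
 define N where "N = psat p I {%x. b x * f x | b. b : Collect rpf}"
 define mN where "mN = psat p I {%x. b x * f x | b. b : {g. rpf g & g p = 0}}"
 have mN: "pideal M p mN" unfolding mN_def by (rule pideal_psat[OF I G0])
 have "(%x. 1 * f x) : {%x. b x * f x | b. b : Collect rpf}" by (intro CollectI exI[of _ "%_. 1"]) auto
 then have fN: "f : N" unfolding N_def using psat_module[OF I G] by simp
 have mN_I: "(%x. g x * a x) : mN" if g: "rpf g" "g p = 0" and a: "a : N" for g a
 proof -
  obtain h b where h: "rpf a" "rpf h" "h p ~= 0" "rpf b" "(%x. h x * a x - b x * f x) : I"
   using a unfolding N_def by (blast elim: psatE)
  show ?thesis unfolding mN_def
  proof (rule psatI[OF _ h(2,3)])
   show "(%x. (g x * b x) * f x) : {%x. b x * f x | b. b : {g. rpf g & g p = 0}}"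
    by (intro CollectI exI[of _ "%x. g x * b x"]) (use g h in "auto intro: rpf_intros")
   have "(%x. g x * (h x * a x - b x * f x)) : I" by (rule pideal_mult[OF I h(5) g(1)])
   then show "(%x. h x * (g x * a x) - (g x * b x) * f x) : I" by (simp add: algebra_simps)
  qed (intro rpf_intros g h)
 qed
 have "EX K. pideal M p K & (mN \<subseteq> K & K \<inter> N \<subseteq> mN) &
   (ALL K'. pideal M p K' & (mN \<subseteq> K' & K' \<inter> N \<subseteq> mN) & K \<subseteq> K' --> K' = K)"
  using acc_max[OF acc mN, of "%K. mN \<subseteq> K & K \<inter> N \<subseteq> mN"] by auto
 then obtain K where K: "pideal M p K" "mN \<subseteq> K" "K \<inter> N \<subseteq> mN" and
  Kmax: "!!K'. pideal M p K' ==> K' \<inter> N \<subseteq> mN ==> K \<subseteq> K' ==> K' = K"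
  by (metis (no_types, lifting) order_trans)
 have "EX e. (%x. X j x ^ e) : K" if j: "j < n" for j
 proof -
  \<comment> \<open>The colon ideals of \<open>K\<close> by the powers of \<open>X j\<close>
    stabilise. At that stage adding the power of \<open>X j\<close> to \<open>K\<close> keeps the
    intersection with \<open>N\<close> inside \<open>mN\<close>, so by maximality the power already
    lies in \<open>K\<close>.\<close>
  define C where "C i = {b. rpf b & (%x. X j x ^ i * b x) : K}" for i
  have Xi: "rpf (%x. X j x ^ i)" for i using X(1)[OF j] by (rule real_polynomial_function_power)
  have "pideal M p (C i)" for i
   unfolding pideal_def C_def
  proof (intro conjI allI ballI impI subsetI CollectI)
   fix f :: "real ^ 'n => real" assume "rpf f & (ALL x:M. f x = 0)"
   then show "(%x. X j x ^ i * f x) : K" by (intro pideal_vanish[OF K(1)] rpf_intros X j) auto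
  next
   fix f g :: "real ^ 'n => real"
   assume "f : {b. rpf b & (%x. X j x ^ i * b x) : K}" "g : {b. rpf b & (%x. X j x ^ i * b x) : K}"
   then have "(%x. X j x ^ i * f x + X j x ^ i * g x) : K" by (intro pideal_add[OF K(1)]) auto
   then show "(%x. X j x ^ i * (f x + g x)) : K" by (simp add: ring_distribs)
  next
   fix f g :: "real ^ 'n => real"
   assume "f : {b. rpf b & (%x. X j x ^ i * b x) : K}" "rpf g"
   then have "(%x. g x * (X j x ^ i * f x)) : K"
    using pideal_mult[OF K(1), of "%x. X j x ^ i * f x" g] by simp
   then show "(%x. X j x ^ i * (f x * g x)) : K" by (simp add: mult_ac)
  next
   fix f h :: "real ^ 'n => real"
   assume h: "rpf f & rpf h & h p ~= 0 & (%x. h x * f x) : {b. rpf b & (%x. X j x ^ i * b x) : K}"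
   then have "(%x. h x * (X j x ^ i * f x)) : K" by (simp add: mult_ac)
   then show "(%x. X j x ^ i * f x) : K"
    by (rule pideal_cancel[OF K(1), rotated 3]) (use h Xi in "auto intro: rpf_intros")
  qed (auto intro: rpf_intros)
  moreover have "C i \<subseteq> C (Suc i)" for i
  proof
   fix b assume "b : C i"
   then show "b : C (Suc i)" using pideal_mult[OF K(1) _ X(1)[OF j], of "%x. X j x ^ i * b x"]
    by (simp add: C_def mult_ac)
  qed
  ultimately obtain i where i: "C (Suc i) = C i" using acc unfolding acc_at_def by blast
  define H where "H = {%x. b x * X j x ^ i | b. b : Collect rpf}"
  have H: "pmodule H" unfolding H_def by (rule pmodule_multiples[OF pmodule_rpf Xi])
  have "psat p K H = K"
  proof (rule Kmax[OF pideal_psat[OF K(1) H]])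
   show "K \<subseteq> psat p K H" using psat_base[OF K(1) H] by blast
   show "psat p K H \<inter> N \<subseteq> mN"
   proof
    fix f assume f: "f : psat p K H \<inter> N"
    then obtain h b where *: "rpf f" "rpf h" "h p ~= 0" "rpf b" "(%x. h x * f x - b x * X j x ^ i) : K"
     unfolding H_def by (blast elim: psatE)
    have "(%x. X j x * f x) : K" using mN_I[OF X(1)[OF j] X(2)[OF j], of f] f K(2) by blast
    then have 1: "(%x. h x * (X j x * f x)) : K" by (rule pideal_mult[OF K(1) _ *(2)])
    have "(%x. - X j x * (h x * f x - b x * X j x ^ i)) : K"
     by (rule pideal_mult[OF K(1) *(5)]) (intro rpf_intros X j)
    from pideal_add[OF K(1) 1 this] have "(%x. X j x ^ Suc i * b x) : K" by (simp add: algebra_simps)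
    then have "b : C (Suc i)" using *(4) by (simp add: C_def)
    then have "b : C i" by (simp only: i)
    then have "(%x. X j x ^ i * b x) : K" by (simp add: C_def)
    from pideal_add[OF K(1) *(5) this] have "(%x. h x * f x) : K" by (simp add: mult_ac)
    then have "f : K" by (rule pideal_cancel[OF K(1) *(1-3)])
    with f K(3) show "f : mN" by blast
   qed
  qed
  moreover have "(%x. 1 * X j x ^ i) : H" unfolding H_def by (rule CollectI) (intro exI[of _ "%_. 1"], auto)
  then have "(%x. X j x ^ i) : psat p K H" using psat_module[OF K(1) H] by simp
  ultimately show ?thesis by auto
 qed
 then obtain e where e: "!!j. j < n ==> (%x. X j x ^ e j) : K" by metis
 have IK: "I \<subseteq> K" using psat_base[OF I G0] K(2) unfolding mN_def by blast
 \<comment> \<open>Modulo \<open>I\<close>, \<open>f\<close> is congruent to an element of a power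
   of the maximal ideal so high that \<open>K\<close> contains it.\<close>
 obtain R where R: "ordge p (Suc (\<Sum>j<n. e j)) R" "(%x. f x - R x) : I" using ord by blast
 have "R : K" using powers_absorb[OF K(1) e R(1), of "%_. 0"] by simp
 then have "(%x. (f x - R x) + R x) : K" using R(2) IK by (intro pideal_add[OF K(1)]) auto
 then have "f : mN" using fN K(3) by auto
 \<comment> \<open>As in Nakayama's lemma: \<open>h - g\<close> is non-zero at \<open>p\<close> and
   multiplies \<open>f\<close> into \<open>I\<close>.\<close>
 then obtain h g where h: "rpf h" "h p ~= 0" "rpf g" "g p = 0" "(%x. h x * f x - g x * f x) : I"
  unfolding mN_def by (blast elim: psatE)
 have "rpf (%x. h x - g x)" by (intro rpf_intros h)
 then show ?thesis using pideal_cancel[OF I f, of "%x. h x - g x"] h by (simp add: algebra_simps)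
qed

end

subsection \<open>Orders of vanishing\<close>

lemma rpf_line:
 fixes f :: "real ^ 'n => real"
 assumes "rpf f"
 shows "real_polynomial_function (%t. f (a + t *\<^sub>R b))"
proof -
 have "polynomial_function (%t :: real. a + t *\<^sub>R b)"
  by (intro polynomial_function_add polynomial_function_const polynomial_function_mult)
    (auto simp: polynomial_function_bounded_linear)
 from real_polynomial_function_compose[OF this assms] show ?thesis by (simp add: o_def)
qed

lemma real_poly_poly:
 assumes "real_polynomial_function (g :: real => real)"
 obtains q where "g = poly q"
proof -
 obtain a n where g: "g = (%x. \<Sum>i\<le>n. a i * x ^ i)"
  using assms real_polynomial_function_iff_sum by blast
 have "g = poly (\<Sum>i\<le>n. Polynomial.monom (a i) i)" unfolding g by (simp add: poly_sum poly_monom fun_eq_iff)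
 then show ?thesis by (rule that)
qed

text \<open>On the line through \<open>y\<close> and \<open>x0\<close> the polynomial has finitely
  many zeros. The nearby point is taken on this line so that it stays in every linear subspace
  containing both points, in particular in a coordinate slice.\<close>

lemma rpf_dense:
 fixes f :: "real ^ 'n => real"
 assumes f: "rpf f" "f x0 ~= 0" and U: "open U" "y : U"
 shows "EX t. y + t *\<^sub>R (x0 - y) : U & f (y + t *\<^sub>R (x0 - y)) ~= 0"
proof -
 obtain q where q: "(%t. f (y + t *\<^sub>R (x0 - y))) = poly q"
  using real_poly_poly[OF rpf_line[OF f(1)]] by blast
 have "poly q 1 = f x0" using fun_cong[OF q, of 1] by simp
 then have "q ~= 0" using f(2) by auto
 then have fin: "finite {t. poly q t = 0}" by (rule poly_roots_finite)
 have "open ((%t :: real. y + t *\<^sub>R (x0 - y)) -` U)"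
  by (intro open_vimage U continuous_intros)
 moreover have "0 : (%t :: real. y + t *\<^sub>R (x0 - y)) -` U" using U by simp
 ultimately obtain d where "d > 0" "ball 0 d \<subseteq> (%t. y + t *\<^sub>R (x0 - y)) -` U"
  unfolding open_contains_ball by blast
 then have d: "d > 0" "!!t. \<bar>t\<bar> < d ==> y + t *\<^sub>R (x0 - y) : U" by (auto simp: ball_def dist_real_def)
 have "infinite {0<..<d}" using d(1) by (simp add: infinite_Ioo)
 then have "\<not> {0<..<d} \<subseteq> {t. poly q t = 0}" using fin finite_subset by blast
 then obtain t where "0 < t" "t < d" "poly q t ~= 0"
  unfolding subset_iff greaterThanLessThan_iff mem_Collect_eq by blast
 then show ?thesis using d(2)[of t] fun_cong[OF q, of t] by auto
qed

lemma rpf_product_nonzero: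
 fixes f g :: "real ^ 'n => real"
 assumes "rpf f" "rpf g" "f a ~= 0" "g b ~= 0"
 shows "EX t. f (a + t *\<^sub>R (b - a)) ~= 0 & g (a + t *\<^sub>R (b - a)) ~= 0"
proof -
 have "open {x. f x ~= 0}"
  using assms(1) by (intro open_Collect_neq continuous_intros rpf_continuous)
 from rpf_dense[OF assms(2,4) this, of a] assms(3) show ?thesis by auto
qed

text \<open>\<open>m\<close> is the multiplicity of the root at \<open>S\<close>; the cofactor is
  bounded away from zero near \<open>S\<close>.\<close>

lemma real_poly_lower_bound:
 assumes g: "real_polynomial_function (g :: real => real)" and "g t0 ~= 0"
 shows "EX m c d. c > 0 & d > 0 & (ALL s. \<bar>s - S\<bar> < d --> c * \<bar>s - S\<bar> ^ m <= \<bar>g s\<bar>)"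
proof -
 obtain p where p: "g = poly p" using real_poly_poly[OF g] by blast
 then have "p ~= 0" using assms(2) by auto
 from order_decomp[OF this, of S] obtain q
  where q: "p = [:- S, 1:] ^ Polynomial.order S p * q" "\<not> [:- S, 1:] dvd q" by blast
 then have "poly q S ~= 0" by (simp add: poly_eq_0_iff_dvd)
 then have "S : {s. \<bar>poly q S\<bar> / 2 < \<bar>poly q s\<bar>}" by simp
 moreover have "open {s. \<bar>poly q S\<bar> / 2 < \<bar>poly q s\<bar>}"
  by (intro open_Collect_less continuous_intros)
 ultimately obtain d where "d > 0" "ball S d \<subseteq> {s. \<bar>poly q S\<bar> / 2 < \<bar>poly q s\<bar>}"
  unfolding open_contains_ball by blast
 then have d: "d > 0" "!!s. \<bar>s - S\<bar> < d ==> \<bar>poly q s\<bar> > \<bar>poly q S\<bar> / 2"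
  by (auto simp: ball_def dist_real_def abs_minus_commute subset_iff)
 have "\<bar>poly q S\<bar> / 2 * \<bar>s - S\<bar> ^ Polynomial.order S p <= \<bar>g s\<bar>" if "\<bar>s - S\<bar> < d" for s
 proof -
  have "g s = (s - S) ^ Polynomial.order S p * poly q s"
   unfolding p by (subst q(1)) (simp add: poly_power)
  then have "\<bar>g s\<bar> = \<bar>poly q s\<bar> * \<bar>s - S\<bar> ^ Polynomial.order S p" by (simp add: abs_mult power_abs)
  moreover have "\<bar>poly q S\<bar> / 2 * \<bar>s - S\<bar> ^ Polynomial.order S p <= \<bar>poly q s\<bar> * \<bar>s - S\<bar> ^ Polynomial.order S p"
   using d(2)[OF that] by (intro mult_right_mono) auto
  ultimately show ?thesis by simp
 qed
 with d(1) \<open>poly q S ~= 0\<close> show ?thesis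
  by (intro exI[of _ "Polynomial.order S p"] exI[of _ "\<bar>poly q S\<bar> / 2"] exI[of _ d]) auto
qed

lemma ordge_prod:
 assumes "ordge p a f" "ordge p b g"
 shows "ordge p (a + b) (%x. f x * g x)"
 using assms
proof (induction rule: ordge.induct)
 case (zero f)
 then show ?case using ordge_mult by simp
next
 case (step k f h)
 have "ordge p (Suc (k + b)) (%x. h x * (f x * g x))" by (intro ordge.step step)
 then show ?case by (simp add: mult_ac)
next
 case (add k f h)
 have "ordge p (k + b) (%x. f x * g x + h x * g x)" by (intro ordge.add add)
 then show ?case by (simp add: ring_distribs)
qed

lemma ordge_Suc0: "rpf f ==> f p = 0 ==> ordge p (Suc 0) f"
 using ordge.step[OF ordge.zero[of "%_. 1"], of f p] by simp

lemma pd_sum: "finite I ==> (!!i. i : I ==> f i differentiable at x) ==> pd j (%x. \<Sum>i\<in>I. f i x) x = (\<Sum>i\<in>I. pd j (f i) x)"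
 by (induction I rule: finite_induct) (simp_all add: pd_add)

lemma pd_cmult: "f differentiable at x ==> pd j (%x. c * f x) x = c * pd j f x"
 by (simp add: pd_mult)

text \<open>In the product case the remainder is made of multiples of the two given remainders and
  of one product of two functions of order one.\<close>

lemma ordge_taylor:
 fixes f :: "real ^ 'n => real"
 assumes "rpf f"
 shows "ordge p 2 (%x. f x - f p - (\<Sum>i\<in>UNIV. pd i f p * (x $ i - p $ i)))"
 using assms
proof induction
 case (linear f)
 have l: "linear f" using linear by (rule bounded_linear.linear)
 have pd: "pd i f p = f (axis i 1)" for i
  by (rule pd_unique'[OF bounded_linear_imp_has_derivative[OF linear]])
 have "f x - f p - (\<Sum>i\<in>UNIV. pd i f p * (x $ i - p $ i)) = 0" for x
  using linear_vec_expand[OF l, of "x - p"] linear_diff[OF l, of x p] by (simp add: pd)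
 then show ?case using ordge_null by simp
next
 case (const c)
 then show ?case using ordge_null by simp
next
 case (add f g)
 have "pd i (%x. f x + g x) p = pd i f p + pd i g p" for i
  using add.hyps by (intro pd_add) auto
 with ordge.add[OF add.IH] show ?case by (simp add: algebra_simps sum.distrib sum_subtractf)
next
 case (mult f g)
 define l where "l h x = (\<Sum>i\<in>UNIV. pd i h p * (x $ i - p $ i))" for h and x :: "real ^ 'n"
 have rl: "rpf (l h)" for h unfolding l_def[abs_def] by (intro rpf_intros) auto
 have lo: "ordge p (Suc 0) (l h)" for h by (rule ordge_Suc0[OF rl]) (simp add: l_def)
 have pm: "pd i (%x. f x * g x) p = f p * pd i g p + g p * pd i f p" for i
  using mult.hyps by (intro pd_mult) auto
 have "ordge p 2 (%x. g x * (f x - f p - l f x))" "ordge p 2 (%x. f p * (g x - g p - l g x))"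
  using mult.IH mult.hyps by (auto intro!: ordge_mult simp: l_def)
 moreover have "ordge p (Suc 0 + Suc 0) (%x. (g x - g p) * l f x)"
  by (intro ordge_prod lo ordge_Suc0 rpf_intros mult.hyps) simp
 ultimately have "ordge p 2 (%x. g x * (f x - f p - l f x) + f p * (g x - g p - l g x) + (g x - g p) * l f x)"
  by (intro ordge.add) (simp_all add: numeral_2_eq_2)
 moreover have "l (%x. f x * g x) x = f p * l g x + g p * l f x" for x
  by (simp add: l_def pm algebra_simps sum.distrib sum_distrib_left sum_subtractf)
 ultimately show ?case unfolding l_def[symmetric] by (simp add: algebra_simps)
qed

section \<open>Coordinate subspaces and algebraic independence\<close>

definition proj :: "'n set => real ^ 'n => real ^ 'n" where
 "proj J z = (\<chi> i. if i : J then z $ i else 0)"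

definition slice :: "'n set => (real ^ 'n) set" where
 "slice J = {z. ALL i. i ~: J --> z $ i = 0}"

lemma proj_nth [simp]: "proj J z $ i = (if i : J then z $ i else 0)"
 by (simp add: proj_def)

lemma proj_in_slice [simp]: "proj J z : slice J"
 by (simp add: slice_def)

lemma slice_line: "a : slice J ==> b : slice J ==> a + t *\<^sub>R (b - a) : slice J"
 by (auto simp: slice_def)

lemma slice_scale: "a : slice J ==> t *\<^sub>R a : slice J"
 by (auto simp: slice_def)

lemma zero_in_slice [simp]: "0 : slice J"
 by (simp add: slice_def)

lemma rpf_compose_vec:
 fixes q :: "real ^ 'm => real" and y :: "'m => real ^ 'n => real"
 assumes "rpf q" "!!b. rpf (y b)"
 shows "rpf (%x. q (\<chi> b. y b x))"
 using assms(1)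
proof induction
 case (linear f)
 have "f (\<chi> b. y b x) = (\<Sum>b\<in>UNIV. f (axis b 1) * y b x)" for x
  using linear_vec_expand[OF bounded_linear.linear[OF linear], of "\<chi> b. y b x"] by simp
 moreover have "rpf (%x. \<Sum>b\<in>UNIV. f (axis b 1) * y b x)" by (intro rpf_intros assms) simp
 ultimately show ?case by simp
qed (auto intro: rpf_intros)

lemma rpf_proj: "rpf q ==> rpf (%z. q (proj J z))"
 unfolding proj_def
proof (rule rpf_compose_vec)
 show "rpf (%z. if i : J then z $ i else 0)" for i by (cases "i : J") auto
qed

text \<open>In the product case the change from \<open>z\<close> to its projection is made in one
  factor at a time, as in the product rule.\<close>

lemma rpf_split_slice:
 fixes q :: "real ^ 'n => real"
 assumes "rpf q"
 shows "EX a. (ALL b. rpf (a b)) & (ALL z. q z = q (proj J z) + (\<Sum>b\<in>-J. z $ b * a b z))"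
 using assms
proof induction
 case (linear f)
 have l: "linear f" using linear by (rule bounded_linear.linear)
 have "f z = f (proj J z) + (\<Sum>b\<in>-J. z $ b * f (axis b 1))" for z
 proof -
  have "(\<Sum>i\<in>UNIV. f (axis i 1) * z $ i) = (\<Sum>i\<in>J. f (axis i 1) * z $ i) + (\<Sum>i\<in>-J. f (axis i 1) * z $ i)"
   using sum.union_disjoint[of J "-J" "%i. f (axis i 1) * z $ i"] by (simp add: Compl_partition)
  moreover have "(\<Sum>i\<in>UNIV. f (axis i 1) * proj J z $ i) = (\<Sum>i\<in>J. f (axis i 1) * z $ i)"
   by (rule sum.mono_neutral_cong_right) auto
  ultimately show ?thesis
   using linear_vec_expand[OF l, of z] linear_vec_expand[OF l, of "proj J z"] by (simp add: mult.commute)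
 qed
 then show ?case by (intro exI[of _ "%b z. f (axis b 1)"] conjI allI rpf_const)
next
 case (const c)
 show ?case by (intro exI[of _ "%b z. 0"]) auto
next
 case (add f g)
 obtain a where a: "ALL b. rpf (a b)" "ALL z. f z = f (proj J z) + (\<Sum>b\<in>-J. z $ b * a b z)" using add.IH(1) by blast
 obtain c where c: "ALL b. rpf (c b)" "ALL z. g z = g (proj J z) + (\<Sum>b\<in>-J. z $ b * c b z)" using add.IH(2) by blast
 have "f z + g z = f (proj J z) + g (proj J z) + (\<Sum>b\<in>-J. z $ b * (a b z + c b z))" for z
  using a(2)[rule_format, of z] c(2)[rule_format, of z] by (simp add: ring_distribs sum.distrib)
 moreover have "rpf (%z. a b z + c b z)" for b
  using a(1) c(1) by (intro real_polynomial_function.intros(3)) auto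
 ultimately show ?case
  by (intro exI[of _ "%b z. a b z + c b z"] conjI allI)
next
 case (mult f g)
 obtain a where a: "ALL b. rpf (a b)" "ALL z. f z = f (proj J z) + (\<Sum>b\<in>-J. z $ b * a b z)" using mult.IH(1) by blast
 obtain c where c: "ALL b. rpf (c b)" "ALL z. g z = g (proj J z) + (\<Sum>b\<in>-J. z $ b * c b z)" using mult.IH(2) by blast
 have "f z * g z = f (proj J z) * g (proj J z) + (\<Sum>b\<in>-J. z $ b * (a b z * g z + f (proj J z) * c b z))" for z
 proof -
  have "f z * g z = f (proj J z) * g (proj J z) + (f z - f (proj J z)) * g z + f (proj J z) * (g z - g (proj J z))"
   by (simp add: algebra_simps)
  also have "f z - f (proj J z) = (\<Sum>b\<in>-J. z $ b * a b z)" using a(2)[rule_format, of z] by simp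
  also have "g z - g (proj J z) = (\<Sum>b\<in>-J. z $ b * c b z)" using c(2)[rule_format, of z] by simp
  finally show ?thesis by (simp add: ring_distribs sum.distrib sum_distrib_left sum_distrib_right mult_ac)
 qed
 moreover have "rpf (%z. a b z * g z + f (proj J z) * c b z)" for b
  using a(1) c(1) mult.hyps by (intro real_polynomial_function.intros(3,4) rpf_proj) auto
 ultimately show ?case
  by (intro exI[of _ "%b z. a b z * g z + f (proj J z) * c b z"] conjI allI)
qed

lemma differentiable_zero_bound:
 fixes h :: "'a::euclidean_space => 'b::real_normed_vector"
 assumes "h differentiable (at 0)" "h 0 = 0"
 shows "EX C d. C > 0 & d > 0 & (ALL z. norm z < d --> norm (h z) <= C * norm z)"
proof -
 obtain h' where h': "(h has_derivative h') (at 0)" using assms(1) differentiable_def by blast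
 obtain K where K: "K > 0" "!!z. norm (h' z) <= norm z * K"
  using bounded_linear.pos_bounded[OF has_derivative_bounded_linear[OF h']] by blast
 obtain d where d: "d > 0" "!!z. norm z < d ==> norm (h z - h' z) <= 1 * norm z"
  using h' assms(2) unfolding has_derivative_at_alt by (auto dest!: spec[of _ 1])
 have "norm (h z) <= (1 + K) * norm z" if "norm z < d" for z
  using d(2)[OF that] K(2)[of z] norm_triangle_sub[of "h z" "h' z"] by (simp add: algebra_simps)
 with K(1) d(1) show ?thesis by (intro exI[of _ "1 + K"] exI[of _ d]) auto
qed

text \<open>A vector of the kernel is orthogonal to all rows, hence to itself.\<close>

lemma matrix_ker_trivial:
 fixes A :: "real ^ 'n ^ 'n"
 assumes "span (range (%b. A $ b)) = UNIV"
 shows "det A ~= 0"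
proof -
 have "x = 0" if "A *v x = 0" for x
 proof -
  have "ALL y:range (%b. A $ b). orthogonal x y"
   using that by (auto simp: vec_eq_iff matrix_vector_mul_component orthogonal_def inner_commute)
  then have "orthogonal x x" using orthogonal_to_span[of x "range (%b. A $ b)" x] assms by auto
  then show ?thesis by (simp add: orthogonal_def)
 qed
 then have "invertible A"
  unfolding invertible_left_inverse matrix_left_invertible_ker by blast
 then show ?thesis by (simp add: invertible_det_nz)
qed

text \<open>The \<open>y i\<close> witness the strict inclusions of the chain. A relation in
  \<open>P k\<close> loses its power of \<open>y (Suc k)\<close>, since \<open>P k\<close> is prime
  and does not contain this element; modulo \<open>P (Suc k)\<close> the variable itself becomes
  zero, which leaves a non-trivial relation in fewer variables.\<close>

lemma chain_independent:
 assumes P: "!!i. i <= n ==> polyprime M (P i)" and p: "!!f. f : P n ==> f p = 0"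
  and y: "!!i. 0 < i ==> i <= n ==> y i : P i" "!!i. i < n ==> y (Suc i) ~: P i"
  and mono: "!!i. i < n ==> P i \<subseteq> P (Suc i)"
  and f: "pfun {k<..n} f" "f ~= (%v. 0)" and "k <= n"
 shows "(%x. f (%i. y i x)) ~: P k"
proof -
 have ry: "rpf (y i)" if "0 < i" "i <= n" for i using polyprime_rpf[OF P y(1)] that by simp
 have "pfun {k<..n} f --> f ~= (%v. 0) --> (%x. f (%i. y i x)) ~: P k" using \<open>k <= n\<close>
 proof (induction k arbitrary: f rule: inc_induct)
  case base
  show ?case
  proof (intro impI notI)
   assume f: "pfun {n<..n} f" "f ~= (%v. 0)" "(%x. f (%i. y i x)) : P n"
   obtain v where "f v ~= 0" using f(2) by (auto simp: fun_eq_iff)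
   moreover have "f v = f (%i. y i p)" by (rule pfun_cong[OF f(1)]) simp
   ultimately show False using p[OF f(3)] by simp
  qed
 next
  case (step k)
  show ?case
  proof (intro impI notI)
   assume f: "pfun {k<..n} f" "f ~= (%v. 0)" "(%x. f (%i. y i x)) : P k"
   have k: "Suc k : {k<..n}" "{k<..n} - {Suc k} = {Suc k<..n}" using step.hyps by auto
   obtain e g g0 g1 where g: "f = (%v. v (Suc k) ^ e * g v)" "pfun {k<..n} g" "pfun {Suc k<..n} g0"
    "pfun {k<..n} g1" "g0 ~= (%v. 0)" "g = (%v. g0 v + v (Suc k) * g1 v)"
    by (rule pfun_factor[OF f(1,2) k(1), unfolded k(2)])
   have r: "rpf (%x. h (%i. y i x))" if "pfun {k<..n} h" for h
    by (rule pfun_rpf[OF that]) (use ry in auto)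
   have rk: "rpf (y (Suc k))" using ry step.hyps by simp
   have "(%x. y (Suc k) x ^ e * g (%i. y i x)) : P k" using f(3) unfolding g(1) .
   then have "(%x. y (Suc k) x ^ e) : P k | (%x. g (%i. y i x)) : P k"
    using step.hyps by (intro polyprime_prime[OF P] r g real_polynomial_function_power rk) auto
   then have "(%x. g (%i. y i x)) : P k"
    using polyprime_power[OF P[of k] rk, of e] y(2)[of k] step.hyps by auto
   then have 1: "(%x. g (%i. y i x)) : P (Suc k)" using mono step.hyps by auto
   have S: "Suc k <= n" using step.hyps by simp
   have "(%x. y (Suc k) x * (- g1 (%i. y i x))) : P (Suc k)"
    by (rule polyprime_mult[OF P[OF S] y(1)[OF zero_less_Suc S]]) (rule real_polynomial_function_minus[OF r[OF g(4)]])
   from polyprime_add[OF P[OF S] 1 this] have "(%x. g0 (%i. y i x)) : P (Suc k)"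
    unfolding g(6) by simp
   with step.IH g(3,5) show False by blast
  qed
 qed
 with f show ?thesis by blast
qed

subsection \<open>Charts and flat functions\<close>

lemma pmodule_span:
 fixes u :: "'n::finite => real ^ 'n => real"
 assumes u: "!!c. rpf (u c)"
 shows "pmodule {%x. \<Sum>c\<in>S. b c x * u c x | b. ALL c. rpf (b c)}"
 unfolding pmodule_def
proof (intro conjI ballI allI impI subsetI)
 fix g assume "g : {%x. \<Sum>c\<in>S. b c x * u c x | b. ALL c. rpf (b c)}"
 then obtain b where "ALL c. rpf (b c)" "g = (%x. \<Sum>c\<in>S. b c x * u c x)" by blast
 with u show "g : Collect rpf" by (auto intro!: rpf_intros)
next
 show "(%_. 0) : {%x. \<Sum>c\<in>S. b c x * u c x | b. ALL c. rpf (b c)}"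
  by (intro CollectI exI[of _ "%_ _. 0"]) auto
next
 fix f g :: "real ^ 'n => real"
 assume "f : {%x. \<Sum>c\<in>S. b c x * u c x | b. ALL c. rpf (b c)}" "g : {%x. \<Sum>c\<in>S. b c x * u c x | b. ALL c. rpf (b c)}"
 then obtain b d where bd: "ALL c. rpf (b c)" "f = (%x. \<Sum>c\<in>S. b c x * u c x)"
   "ALL c. rpf (d c)" "g = (%x. \<Sum>c\<in>S. d c x * u c x)" by blast
 then have "ALL c. rpf (%x. b c x + d c x)" by (auto intro: real_polynomial_function.intros(3))
 then show "(%x. f x + g x) : {%x. \<Sum>c\<in>S. b c x * u c x | b. ALL c. rpf (b c)}" unfolding bd(2,4)
  by (intro CollectI exI[of _ "%c x. b c x + d c x"]) (simp add: ring_distribs sum.distrib)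
next
 fix f h :: "real ^ 'n => real"
 assume "f : {%x. \<Sum>c\<in>S. b c x * u c x | b. ALL c. rpf (b c)}" and h: "rpf h"
 then obtain b where b: "ALL c. rpf (b c)" "f = (%x. \<Sum>c\<in>S. b c x * u c x)" by blast
 then have "ALL c. rpf (%x. h x * b c x)" using h by (auto intro: real_polynomial_function.intros(4))
 then show "(%x. h x * f x) : {%x. \<Sum>c\<in>S. b c x * u c x | b. ALL c. rpf (b c)}" unfolding b(2)
  by (intro CollectI exI[of _ "%c x. h x * b c x"]) (simp add: sum_distrib_left mult.assoc)
qed

text \<open>There is one polynomial coordinate for every ambient coordinate: those in
  \<open>J\<close> are parameters of the local ring, the others vanish on \<open>M\<close>. The
  derivative of the inverse map \<open>Psi\<close> has polynomial numerators \<open>D\<close> over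
  one polynomial denominator \<open>v\<close>, so that derivatives of a polynomial in the chart are
  again polynomials over \<open>v\<close> and can be iterated. That \<open>M\<close> fills the slice
  \<open>J\<close> near \<open>p\<close> is a result (\<open>M_slice\<close>) and not part of the
  locale.\<close>

locale chart = param_point M p n X
 for M :: "(real ^ 'n) set" and p n X +
 fixes tht :: "'n => real ^ 'n => real" and J :: "'n set" and idx :: "'n => nat"
  and Psi :: "real ^ 'n => real ^ 'n" and rho :: real
  and D :: "'n => 'n => real ^ 'n => real" and v :: "real ^ 'n => real"
 assumes tht: "!!b. rpf (tht b)" and tht_p: "!!b. tht b p = 0"
  and grad: "span (range (%b. \<chi> i. pd i (tht b) p)) = UNIV"
  and off: "!!b x. b ~: J ==> x : M ==> tht b x = 0"
  and idx: "inj_on idx J" "!!b. b : J ==> idx b < n" "!!b. b : J ==> tht b = X (idx b)"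
  and prime: "primeset M" and alg: "algebraic_set M"
  and chain: "EX P. (ALL i<=n. polyprime M (P i) & (ALL f:P i. f p = 0)) & (ALL i<n. P i \<subset> P (Suc i))"
  and rho: "rho > 0"
  and Psi_0: "Psi 0 = p" and tht_Psi: "!!z b. norm z < rho ==> tht b (Psi z) = z $ b"
  and open_U: "open (Psi ` ball 0 rho)"
  and rpf_D: "!!b i. rpf (D b i)" and rpf_v: "rpf v" and v_nz: "!!z. norm z < rho ==> v (Psi z) ~= 0"
  and Psi_deriv: "!!z. norm z < rho ==>
    (Psi has_derivative (%h. \<chi> i. \<Sum>b\<in>UNIV. h $ b * D b i (Psi z) / v (Psi z))) (at z)"
begin

lemma Psi_cont: "norm z < rho ==> isCont Psi z"
 using Psi_deriv has_derivative_continuous by blast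

lemma comp_cont: "norm z < rho ==> isCont f (Psi z) ==> isCont (%z. f (Psi z)) z"
 by (rule isCont_o2[OF Psi_cont])

lemma rpf_comp_cont: "rpf f ==> norm z < rho ==> isCont (%z. f (Psi z)) z"
 by (rule comp_cont) auto

lemma rpf_comp_continuous_on: "rpf f ==> continuous_on (ball 0 rho) (%z. f (Psi z))"
 by (intro continuous_at_imp_continuous_on ballI rpf_comp_cont) auto

lemma comp_deriv:
 assumes z: "norm z < rho" and f: "f differentiable at (Psi z)"
 shows "((%z. f (Psi z)) has_derivative (%h. \<Sum>b\<in>UNIV. h $ b * vf (D b) f (Psi z) / v (Psi z))) (at z)"
proof -
 have "((%z. f (Psi z)) has_derivative
   (%h. \<Sum>i\<in>UNIV. pd i f (Psi z) * (\<chi> i. \<Sum>b\<in>UNIV. h $ b * D b i (Psi z) / v (Psi z)) $ i)) (at z)"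
  using has_derivative_compose[OF Psi_deriv[OF z] has_derivative_pd[OF f]] by simp
 moreover have "(\<Sum>i\<in>UNIV. pd i f (Psi z) * (\<chi> i. \<Sum>b\<in>UNIV. h $ b * D b i (Psi z) / v (Psi z)) $ i)
   = (\<Sum>b\<in>UNIV. h $ b * vf (D b) f (Psi z) / v (Psi z))" for h
  unfolding vf_def vec_lambda_beta sum_distrib_left sum_divide_distrib
  by (subst sum.swap) (simp add: mult_ac)
 ultimately show ?thesis by simp
qed

lemma comp_deriv_path:
 assumes z: "norm (z + s *\<^sub>R w) < rho" and f: "f differentiable at (Psi (z + s *\<^sub>R w))"
 shows "((%s. f (Psi (z + s *\<^sub>R w))) has_real_derivative
   (\<Sum>b\<in>UNIV. w $ b * vf (D b) f (Psi (z + s *\<^sub>R w)) / v (Psi (z + s *\<^sub>R w)))) (at s)"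
proof -
 have "((%s. z + s *\<^sub>R w) has_derivative (%t. t *\<^sub>R w)) (at s)"
  by (auto intro!: derivative_eq_intros)
 from has_derivative_compose[OF this comp_deriv[OF z f]]
 have "((%s. f (Psi (z + s *\<^sub>R w))) has_derivative
   (%t. \<Sum>b\<in>UNIV. (t *\<^sub>R w) $ b * vf (D b) f (Psi (z + s *\<^sub>R w)) / v (Psi (z + s *\<^sub>R w)))) (at s)" .
 moreover have "(%t. \<Sum>b\<in>UNIV. (t *\<^sub>R w) $ b * vf (D b) f (Psi (z + s *\<^sub>R w)) / v (Psi (z + s *\<^sub>R w)))
   = (*) (\<Sum>b\<in>UNIV. w $ b * vf (D b) f (Psi (z + s *\<^sub>R w)) / v (Psi (z + s *\<^sub>R w)))"
  by (rule ext) (simp add: sum_distrib_left mult_ac)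
 ultimately show ?thesis unfolding has_field_derivative_def by simp
qed

text \<open>Points with \<open>z $ b\<close> non-zero are dense in the slice, and \<open>f\<close>
  is continuous in the chart.\<close>

lemma slice_cancel:
 assumes f: "rpf f" and b: "b : K" and z: "!!z. z : slice K ==> norm z < rho ==> z $ b * f (Psi z) = 0"
  and z0: "z0 : slice K" "norm z0 < rho"
 shows "f (Psi z0) = 0"
proof (rule ccontr)
 assume nz: "f (Psi z0) ~= 0"
 define U where "U = ball 0 rho \<inter> (%z. f (Psi z)) -` (- {0})"
 have "open U" unfolding U_def
  by (rule continuous_open_preimage[OF rpf_comp_continuous_on[OF f]]) auto
 moreover have "z0 : U" using nz z0 by (simp add: U_def)
 moreover have "(axis b 1 :: real ^ 'n) : slice K" using b by (auto simp: slice_def axis_def)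
 moreover have "(axis b 1 :: real ^ 'n) $ b ~= 0" by simp
 ultimately have "EX t. z0 + t *\<^sub>R (axis b 1 - z0) : U & (z0 + t *\<^sub>R (axis b 1 - z0)) $ b ~= 0"
  by (intro rpf_dense[where f = "%x. x $ b"]) (rule rpf_nth)
 then obtain t where t: "z0 + t *\<^sub>R (axis b 1 - z0) : U" "(z0 + t *\<^sub>R (axis b 1 - z0)) $ b ~= 0" by blast
 have "z0 + t *\<^sub>R (axis b 1 - z0) : slice K"
  by (rule slice_line) fact+
 moreover have "norm (z0 + t *\<^sub>R (axis b 1 - z0)) < rho" "f (Psi (z0 + t *\<^sub>R (axis b 1 - z0))) ~= 0"
  using t(1) unfolding U_def by simp_all
 ultimately show False using z[of "z0 + t *\<^sub>R (axis b 1 - z0)"] t(2) by (metis mult_eq_0_iff)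
qed

text \<open>The \<open>y i\<close> together with the coordinates outside \<open>K\<close> outnumber
  the ambient dimension, hence are dependent. The coordinates outside \<open>K\<close> are then set
  to zero one by one, each time after division by the largest power of the coordinate, so that a
  non-trivial relation among the \<open>y i\<close> is left on the slice.\<close>

lemma slice_dependent:
 fixes y :: "'i => real ^ 'n => real"
 assumes I: "finite I" "card K < card I" and y: "!!i. i : I ==> rpf (y i)"
 obtains f where "pfun I f" "f ~= (%v. 0)"
  "!!z. z : slice K ==> norm z < rho ==> f (%i. y i (Psi z)) = 0"
proof -
 define w where "w = case_sum tht y"
 have "EX f. pfun (Inl ` (- K - N) \<union> Inr ` I) f & f ~= (%v. 0) &
   (ALL z:slice (- N). norm z < rho --> f (%i. w i (Psi z)) = 0)" if "finite N" "N \<subseteq> - K" for N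
  using that
 proof (induction N rule: finite_induct)
  case empty
  have "card (Inl ` (- K) \<union> Inr ` I :: ('n + 'i) set) = card (- K) + card I"
   using I(1) by (subst card_Un_disjoint) (auto simp: card_image)
  moreover have "card (- K) + card K = CARD('n)"
   by (metis Compl_partition2 Compl_disjoint2 card_Un_disjoint finite)
  ultimately have "CARD('n) < card (Inl ` (- K) \<union> Inr ` I :: ('n + 'i) set)" using I(2) by simp
  moreover have "rpf (w i)" if "i : Inl ` (- K) \<union> Inr ` I" for i using that y tht by (auto simp: w_def)
  moreover have "finite (Inl ` (- K) \<union> Inr ` I)" using I(1) by simp
  ultimately obtain f where "pfun (Inl ` (- K) \<union> Inr ` I) f" "f ~= (%v. 0)" "!!x. f (%i. w i x) = 0"
   using algebraically_dependent[of "Inl ` (- K) \<union> Inr ` I" w] by metis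
  then show ?case by (intro exI[of _ f]) simp
 next
  case (insert b N)
  then obtain f where f: "pfun (Inl ` (- K - N) \<union> Inr ` I) f" "f ~= (%v. 0)"
   "!!z. z : slice (- N) ==> norm z < rho ==> f (%i. w i (Psi z)) = 0" by auto
  let ?I = "Inl ` (- K - N) \<union> Inr ` I"
  have b: "Inl b : ?I" "?I - {Inl b} = Inl ` (- K - insert b N) \<union> Inr ` I" using insert by auto
  obtain e g g0 g1 where g: "f = (%v. v (Inl b) ^ e * g v)" "pfun ?I g"
   "pfun (Inl ` (- K - insert b N) \<union> Inr ` I) g0" "pfun ?I g1" "g0 ~= (%v. 0)" "g = (%v. g0 v + v (Inl b) * g1 v)"
   by (rule pfun_factor[OF f(1,2) b(1), unfolded b(2)])
  have rw: "rpf (w i)" if "i : ?I" for i using that y tht by (auto simp: w_def)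
  have rg: "rpf (%x. g (%i. w i x))" by (rule pfun_rpf[OF g(2) rw])
  have 0: "z $ b ^ e * g (%i. w i (Psi z)) = 0" if "z : slice (- N)" "norm z < rho" for z
   using f(3)[OF that] tht_Psi[OF that(2)] unfolding g(1) by (simp add: w_def)
  have "g (%i. w i (Psi z)) = 0" if "z : slice (- N)" "norm z < rho" for z
  proof (rule slice_cancel[OF rg _ _ that])
   show "b : - N" using insert by simp
   fix z :: "real ^ 'n" assume "z : slice (- N)" "norm z < rho"
   from 0[OF this] show "z $ b * g (%i. w i (Psi z)) = 0" by (cases e) auto
  qed
  then have "g0 (%i. w i (Psi z)) = 0" if "z : slice (- insert b N)" "norm z < rho" for z
  proof -
   have "z : slice (- N)" using that(1) by (auto simp: slice_def)
   moreover have "w (Inl b) (Psi z) = 0" using that tht_Psi[OF that(2)] by (auto simp: w_def slice_def)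
   ultimately show ?thesis
    using \<open>!!z. z : slice (- N) ==> norm z < rho ==> g (%i. w i (Psi z)) = 0\<close>[of z] that(2) unfolding g(6) by simp
  qed
  with g(3,5) show ?case by blast
 qed
 from this[of "- K"] obtain f where f: "pfun (Inr ` I) f" "f ~= (%v. 0)"
   "!!z. z : slice K ==> norm z < rho ==> f (%i. w i (Psi z)) = 0" by auto
 define f' where "f' u = f (case_sum (%_. 0) u)" for u
 have "pfun I f'"
  using f(1) unfolding f'_def[abs_def]
  by (induction rule: pfun.induct) (auto intro: pfun.intros)
 moreover have "f (%i. u i) = f' (%i. u (Inr i))" for u
  unfolding f'_def by (rule pfun_cong[OF f(1)]) auto
 moreover from this f(2) have "f' ~= (%v. 0)" by (metis ext)
 ultimately show ?thesis using f(3) that[of f'] by (simp add: w_def)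
qed

section \<open>Functions of infinite order at the centre, leading forms\<close>

definition flat :: "'n set => (real ^ 'n => real) => bool" where
 "flat K f \<longleftrightarrow> rpf f & (ALL k. EX C d. d > 0 & (ALL z:slice K. norm z < d --> \<bar>f (Psi z)\<bar> <= C * norm z ^ k))"

lemma vanish_flat:
 assumes "rpf f" "d > 0" "!!z. z : slice K ==> norm z < d ==> f (Psi z) = 0"
 shows "flat K f"
 unfolding flat_def using assms by (auto intro!: exI[of _ 0] exI[of _ d])

lemma ordge_bound:
 assumes "ordge p k f"
 shows "EX C d. C > 0 & d > 0 & (ALL z. norm z < d --> \<bar>f (Psi z)\<bar> <= C * norm z ^ k)"
 using assms
proof induction
 case (zero f)
 have "isCont (%z. f (Psi z)) 0" using rpf_comp_cont[OF zero] rho by simp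
 then have "ALL e>0. EX d>0. ALL z. norm (z - 0) < d --> norm (f (Psi z) - f (Psi 0)) < e"
  unfolding continuous_at_eps_delta dist_norm .
 then obtain d where d: "d > 0" "!!z. norm z < d ==> \<bar>f (Psi z) - f (Psi 0)\<bar> < 1"
  by (auto dest!: spec[where x = "1::real"])
 then show ?case
  by (intro exI[of _ "\<bar>f (Psi 0)\<bar> + 1"] exI[of _ d]) (fastforce simp: abs_if split: if_splits)
next
 case (step k f g)
 obtain C d where C: "C > 0" "d > 0" "!!z. norm z < d ==> \<bar>f (Psi z)\<bar> <= C * norm z ^ k" using step.IH by blast
 have "(%z. g (Psi z)) differentiable (at 0)"
  using comp_deriv[OF _ rpf_differentiable[OF step.hyps(2)], of 0] rho
  unfolding differentiable_def[of "%z. g (Psi z)"] by auto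
 moreover have "g (Psi 0) = 0" using step.hyps Psi_0 by simp
 ultimately obtain C' d' where C': "C' > 0" "d' > 0" "!!z. norm z < d' ==> norm (g (Psi z)) <= C' * norm z"
  using differentiable_zero_bound[of "%z. g (Psi z)"] by blast
 have "\<bar>g (Psi z) * f (Psi z)\<bar> <= (C' * C) * norm z ^ Suc k" if "norm z < min d d'" for z
 proof -
  have "\<bar>g (Psi z)\<bar> * \<bar>f (Psi z)\<bar> <= (C' * norm z) * (C * norm z ^ k)"
   using C(3)[of z] C'(3)[of z] that C'(1) by (intro mult_mono) auto
  then show ?thesis by (simp add: abs_mult mult_ac)
 qed
 with C(1,2) C'(1,2) show ?case by (intro exI[of _ "C' * C"] exI[of _ "min d d'"]) auto
next
 case (add k f g)
 obtain C d where C: "C > 0" "d > 0" "!!z. norm z < d ==> \<bar>f (Psi z)\<bar> <= C * norm z ^ k" using add.IH(1) by blast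
 obtain C' d' where C': "C' > 0" "d' > 0" "!!z. norm z < d' ==> \<bar>g (Psi z)\<bar> <= C' * norm z ^ k" using add.IH(2) by blast
 have "\<bar>f (Psi z) + g (Psi z)\<bar> <= (C + C') * norm z ^ k" if "norm z < min d d'" for z
  using C(3)[of z] C'(3)[of z] that abs_triangle_ineq[of "f (Psi z)" "g (Psi z)"] by (simp add: ring_distribs)
 with C(1,2) C'(1,2) show ?case by (intro exI[of _ "C + C'"] exI[of _ "min d d'"]) auto
qed

definition hom :: "nat => (real ^ 'n => real) => bool" where
 "hom k q \<longleftrightarrow> rpf q & (ALL t z. q (t *\<^sub>R z) = t ^ k * q z)"

lemma rpf_comp_theta: "rpf q ==> rpf (%x. q (\<chi> b. tht b x))"
 by (rule rpf_compose_vec) (auto simp: tht)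

text \<open>The gradients of the coordinates at \<open>p\<close> span, so a combination of the
  coordinates removes the linear Taylor term.\<close>

lemma linear_part:
 assumes g: "rpf g" "g p = 0"
 shows "EX c. ordge p 2 (%x. g x - (\<Sum>b\<in>UNIV. c b * tht b x))"
proof -
 have "(\<chi> i. pd i g p) : span (range (%b. \<chi> i. pd i (tht b) p))" unfolding grad by simp
 then have "EX t u. finite t & t \<subseteq> range (%b. \<chi> i. pd i (tht b) p) & (\<chi> i. pd i g p) = (\<Sum>a\<in>t. u a *\<^sub>R a)"
  unfolding span_explicit mem_Collect_eq by (elim exE conjE) (intro exI conjI; assumption)
 then obtain t u where tu: "finite t" "t \<subseteq> range (%b. \<chi> i. pd i (tht b) p)" "(\<chi> i. pd i g p) = (\<Sum>a\<in>t. u a *\<^sub>R a)"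
  by (elim exE conjE)
 have "EX c. (\<chi> i. pd i g p) = (\<Sum>b\<in>UNIV. c b *\<^sub>R (\<chi> i. pd i (tht b) p))"
 proof -
  obtain S where S: "inj_on (%b. \<chi> i. pd i (tht b) p) S" "t = (%b. \<chi> i. pd i (tht b) p) ` S"
   using iffD1[OF subset_image_inj tu(2)] by (elim exE conjE)
  have "(\<Sum>a\<in>t. u a *\<^sub>R a) = (\<Sum>b\<in>S. u (\<chi> i. pd i (tht b) p) *\<^sub>R (\<chi> i. pd i (tht b) p))"
   unfolding S(2) by (subst sum.reindex[OF S(1)]) simp
  also have "... = (\<Sum>b\<in>UNIV. (if b : S then u (\<chi> i. pd i (tht b) p) else 0) *\<^sub>R (\<chi> i. pd i (tht b) p))"
   by (rule sum.mono_neutral_cong_left) auto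
  finally show ?thesis unfolding tu(3)
   by (intro exI[of _ "%b. if b : S then u (\<chi> i. pd i (tht b) p) else 0"])
 qed
 then obtain c where c: "(\<chi> i. pd i g p) = (\<Sum>b\<in>UNIV. c b *\<^sub>R (\<chi> i. pd i (tht b) p))" by blast
 define h where "h x = g x - (\<Sum>b\<in>UNIV. c b * tht b x)" for x
 have rh: "rpf h" unfolding h_def[abs_def] by (intro rpf_intros g tht) simp
 have "pd i h p = 0" for i
 proof -
  have "pd i (%x. g x + (- 1) * (\<Sum>b\<in>UNIV. c b * tht b x)) p = pd i g p + (- 1) * (\<Sum>b\<in>UNIV. c b * pd i (tht b) p)"
  proof -
   have d: "tht b differentiable at p" for b by (rule rpf_differentiable[OF tht])
   have d': "(%x. c b * tht b x) differentiable at p" for b by (intro rpf_differentiable rpf_cmult tht)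
   have s: "pd i (%x. \<Sum>b\<in>UNIV. c b * tht b x) p = (\<Sum>b\<in>UNIV. c b * pd i (tht b) p)"
    by (subst pd_sum) (simp_all add: d d' pd_cmult)
   have rs: "rpf (%x. \<Sum>b\<in>UNIV. c b * tht b x)" by (intro rpf_intros tht) simp_all
   have "pd i (%x. g x + (- 1) * (\<Sum>b\<in>UNIV. c b * tht b x)) p
     = pd i g p + pd i (%x. (- 1) * (\<Sum>b\<in>UNIV. c b * tht b x)) p"
    by (intro pd_add rpf_differentiable g rpf_cmult rs)
   also have "pd i (%x. (- 1) * (\<Sum>b\<in>UNIV. c b * tht b x)) p = (- 1) * (\<Sum>b\<in>UNIV. c b * pd i (tht b) p)"
    by (subst pd_cmult[OF rpf_differentiable[OF rs]]) (simp only: s)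
   finally show ?thesis .
  qed
  moreover have "pd i g p = (\<Sum>b\<in>UNIV. c b * pd i (tht b) p)"
   using arg_cong[OF c, of "%y. y $ i"] by simp
  ultimately show ?thesis unfolding h_def[abs_def] by simp
 qed
 moreover have "h p = 0" using g(2) tht_p by (simp add: h_def)
 ultimately have "ordge p 2 h" using ordge_taylor[OF rh, of p] by simp
 then show ?thesis unfolding h_def[abs_def] by blast
qed

lemma leading_form:
 assumes "ordge p k f"
 shows "EX q. hom k q & ordge p (Suc k) (%x. f x - q (\<chi> b. tht b x))"
 using assms
proof induction
 case (zero f)
 have "ordge p (Suc 0) (%x. f x - f p)" by (intro ordge_Suc0 rpf_intros zero) simp
 then show ?case by (intro exI[of _ "%_. f p"]) (auto simp: hom_def)
next
 case (step k f g)
 obtain q where q: "hom k q" "ordge p (Suc k) (%x. f x - q (\<chi> b. tht b x))" using step.IH by blast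
 obtain c where c: "ordge p 2 (%x. g x - (\<Sum>b\<in>UNIV. c b * tht b x))" using linear_part step.hyps by blast
 define l where "l z = (\<Sum>b\<in>UNIV. c b * z $ b)" for z :: "real ^ 'n"
 have "hom (Suc k) (%z. l z * q z)"
  using q(1) unfolding hom_def l_def
  by (auto intro!: rpf_intros simp: sum_distrib_left sum_distrib_right mult_ac)
 moreover have "ordge p (Suc (Suc k)) (%x. g x * f x - l (\<chi> b. tht b x) * q (\<chi> b. tht b x))"
 proof -
  have "ordge p (2 + k) (%x. (g x - l (\<chi> b. tht b x)) * f x)"
   using c by (intro ordge_prod step.hyps) (simp add: l_def)
  moreover have "ordge p (Suc 0 + Suc k) (%x. l (\<chi> b. tht b x) * (f x - q (\<chi> b. tht b x)))"
   by (intro ordge_prod q ordge_Suc0) (auto simp: l_def tht_p intro!: rpf_intros tht)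
  ultimately have "ordge p (Suc (Suc k)) (%x. (g x - l (\<chi> b. tht b x)) * f x + l (\<chi> b. tht b x) * (f x - q (\<chi> b. tht b x)))"
   by (intro ordge.add) simp_all
  then show ?thesis by (simp add: algebra_simps)
 qed
 ultimately show ?case by blast
next
 case (add k f g)
 obtain q where q: "hom k q" "ordge p (Suc k) (%x. f x - q (\<chi> b. tht b x))" using add.IH(1) by blast
 obtain r where r: "hom k r" "ordge p (Suc k) (%x. g x - r (\<chi> b. tht b x))" using add.IH(2) by blast
 have "hom k (%z. q z + r z)" using q(1) r(1) by (auto simp: hom_def ring_distribs intro: real_polynomial_function.intros(3))
 moreover have "ordge p (Suc k) (%x. f x + g x - (q (\<chi> b. tht b x) + r (\<chi> b. tht b x)))"
  using ordge.add[OF q(2) r(2)] by (simp add: algebra_simps)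
 ultimately show ?case by (intro exI[of _ "%z. q z + r z"]) auto
qed

text \<open>The algebraic counterpart of decay of order \<open>k\<close> along the slice: up to an
  element of order \<open>k\<close>, the function lies in the ideal of the coordinates outside
  \<open>K\<close>. For all \<open>k\<close> together this is the input of Krull's theorem.\<close>

definition expands :: "'n set => nat => (real ^ 'n => real) => bool" where
 "expands K k f \<longleftrightarrow> (EX R a. ordge p k R & (ALL b. rpf (a b)) & (ALL x. f x = R x + (\<Sum>b\<in>- K. tht b x * a b x)))"

lemma expands_bound:
 assumes "expands K k f"
 shows "EX C d. C > 0 & d > 0 & (ALL z:slice K. norm z < d --> \<bar>f (Psi z)\<bar> <= C * norm z ^ k)"
proof -
 obtain R a where R: "ordge p k R" "!!x. f x = R x + (\<Sum>b\<in>- K. tht b x * a b x)"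
  using assms unfolding expands_def by blast
 obtain C d where C: "C > 0" "d > 0" "!!z. norm z < d ==> \<bar>R (Psi z)\<bar> <= C * norm z ^ k"
  using ordge_bound[OF R(1)] by blast
 have "f (Psi z) = R (Psi z)" if "z : slice K" "norm z < rho" for z
 proof -
  have "(\<Sum>b\<in>- K. tht b (Psi z) * a b (Psi z)) = 0"
   using that tht_Psi[OF that(2)] by (intro sum.neutral) (auto simp: slice_def)
  then show ?thesis using R(2) by simp
 qed
 with C rho show ?thesis by (intro exI[of _ C] exI[of _ "min d rho"]) auto
qed

text \<open>The leading form restricted to the slice decides. If it is zero there, it is a
  combination of the coordinates outside \<open>K\<close> and can be absorbed; otherwise it
  describes the function up to higher order.\<close>

lemma expands_step:
 assumes "expands K k f"
 obtains "expands K (Suc k) f"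
 | q z C d where "hom k q" "z : slice K" "q z ~= 0" "C > 0" "d > 0"
   "!!z. z : slice K ==> norm z < d ==> \<bar>f (Psi z) - q z\<bar> <= C * norm z ^ Suc k"
proof -
 obtain R a where R: "ordge p k R" "!!b. rpf (a b)" "!!x. f x = R x + (\<Sum>b\<in>- K. tht b x * a b x)"
  using assms unfolding expands_def by blast
 obtain q where q: "hom k q" "ordge p (Suc k) (%x. R x - q (\<chi> b. tht b x))" using leading_form[OF R(1)] by blast
 show ?thesis
 proof (cases "EX z:slice K. q z ~= 0")
  case True
  then obtain z where z: "z : slice K" "q z ~= 0" by blast
  obtain C d where C: "C > 0" "d > 0"
   "!!z. norm z < d ==> \<bar>R (Psi z) - q (\<chi> b. tht b (Psi z))\<bar> <= C * norm z ^ Suc k"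
   using ordge_bound[OF q(2)] by blast
  have "\<bar>f (Psi z) - q z\<bar> <= C * norm z ^ Suc k" if "z : slice K" "norm z < min d rho" for z
  proof -
   have "(\<Sum>b\<in>- K. tht b (Psi z) * a b (Psi z)) = 0"
    using that tht_Psi[of z] by (intro sum.neutral) (auto simp: slice_def)
   moreover have "(\<chi> b. tht b (Psi z)) = z" using tht_Psi[of z] that by (simp add: vec_eq_iff)
   ultimately show ?thesis using R(3) C(3)[of z] that by simp
  qed
  with q(1) z C(1,2) rho show ?thesis by (intro that(2)[of q z C "min d rho"]) auto
 next
  case False
  have rq: "rpf q" using q(1) by (simp add: hom_def)
  obtain c where c: "ALL b. rpf (c b)" "ALL z. q z = q (proj K z) + (\<Sum>b\<in>- K. z $ b * c b z)"
   using rpf_split_slice[OF rq] by blast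
  have "q z = (\<Sum>b\<in>- K. z $ b * c b z)" for z
   using c(2)[rule_format, of z] False by simp
  then have "f x = (R x - q (\<chi> b. tht b x)) + (\<Sum>b\<in>- K. tht b x * (a b x + c b (\<chi> b. tht b x)))" for x
   using R(3)[of x] by (simp add: ring_distribs sum.distrib)
  moreover have "rpf (%x. a b x + c b (\<chi> b. tht b x))" for b
   using R(2) c(1) by (intro real_polynomial_function.intros(3) rpf_comp_theta) auto
  ultimately have "expands K (Suc k) f" unfolding expands_def using q(2)
   by (intro exI[of _ "%x. R x - q (\<chi> b. tht b x)"] exI[of _ "%b x. a b x + c b (\<chi> b. tht b x)"]) auto
  then show ?thesis by (rule that(1))
 qed
qed

lemma expands_0: "rpf f ==> expands K 0 f"
 unfolding expands_def by (intro exI[of _ f] exI[of _ "%_ _. 0"]) (auto intro: ordge.zero)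

lemma not_flat_form:
 assumes "rpf f" "\<not> flat K f"
 obtains k q z C d where "hom k q" "z : slice K" "q z ~= 0" "C > 0" "d > 0"
  "!!z. z : slice K ==> norm z < d ==> \<bar>f (Psi z) - q z\<bar> <= C * norm z ^ Suc k"
proof -
 have ex: "EX k. \<not> expands K k f"
  using assms expands_bound unfolding flat_def by blast
 define k where "k = (LEAST k. \<not> expands K k f)"
 have k: "\<not> expands K k f" unfolding k_def by (rule LeastI_ex[OF ex])
 have k': "expands K j f" if "j < k" for j using not_less_Least[of j] that unfolding k_def by blast
 obtain j where j: "k = Suc j" using k expands_0[OF assms(1)] by (cases k) auto
 show ?thesis
 proof (rule expands_step[OF k'[of j]])
  show "j < k" using j by simp
  show thesis if "expands K (Suc j) f" using that k j by simp
 qed (rule that)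
qed

text \<open>If the order stopped growing at \<open>k\<close>, a non-zero leading form of degree
  \<open>k\<close> would have to decay along a ray like the power \<open>k + 1\<close>.\<close>

lemma flat_expands:
 assumes "flat K f"
 shows "expands K k f"
proof (induction k)
 case 0
 then show ?case using assms expands_0 by (simp add: flat_def)
next
 case (Suc k)
 then show ?case
 proof (rule expands_step)
  fix q z C d assume q: "hom k q" "z : slice K" "q z ~= 0" "C > 0" "d > 0"
   "!!z. z : slice K ==> norm z < d ==> \<bar>f (Psi z) - q z\<bar> <= C * norm z ^ Suc k"
  obtain C' d' where C': "d' > 0" "!!z. z : slice K ==> norm z < d' ==> \<bar>f (Psi z)\<bar> <= C' * norm z ^ Suc k"
   using assms unfolding flat_def by blast
  have *: "\<bar>q z\<bar> <= t * ((C + C') * norm z ^ Suc k)" if t: "0 < t" "t * norm z < min d d'" for t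
  proof -
   have "norm (t *\<^sub>R z) < min d d'" using t by simp
   then have "\<bar>q (t *\<^sub>R z)\<bar> <= (C + C') * norm (t *\<^sub>R z) ^ Suc k"
    using q(6)[of "t *\<^sub>R z"] C'(2)[of "t *\<^sub>R z"] slice_scale[OF q(2), of t] by (simp add: ring_distribs abs_le_iff)
   then have "t ^ k * \<bar>q z\<bar> <= (C + C') * (t * norm z) ^ Suc k"
    using q(1) t by (simp add: hom_def abs_mult power_abs)
   also have "... = t ^ k * (t * ((C + C') * norm z ^ Suc k))" by (simp add: power_mult_distrib mult_ac)
   finally show ?thesis using t(1) by simp
  qed
  have ev: "eventually (%t. \<bar>q z\<bar> <= t * ((C + C') * norm z ^ Suc k)) (at_right 0)"
   unfolding eventually_at_right_field
  proof (intro exI[of _ "min d d' / (norm z + 1)"] conjI allI impI)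
   show "0 < min d d' / (norm z + 1)" using q(5) C'(1) by (intro divide_pos_pos) (auto intro: add_nonneg_pos)
   fix t assume t: "0 < t" "t < min d d' / (norm z + 1)"
   then have "t * (norm z + 1) < min d d'" by (simp add: pos_less_divide_eq add_nonneg_pos)
   then have "t * norm z < min d d'" using t(1) by (simp add: ring_distribs)
   then show "\<bar>q z\<bar> <= t * ((C + C') * norm z ^ Suc k)" by (rule *[OF t(1)])
  qed
  have "((%t. t * ((C + C') * norm z ^ Suc k)) \<longlongrightarrow> 0 * ((C + C') * norm z ^ Suc k)) (at_right 0)"
   by (intro tendsto_intros)
  from tendsto_lowerbound[OF this ev] have "\<bar>q z\<bar> <= 0" by simp
  with q(3) show ?thesis by simp
 qed
qed

text \<open>Leading forms multiply: along a ray on which both are non-zero the product has the exact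
  order \<open>k + j\<close>.\<close>

lemma flat_prime:
 assumes f: "rpf f" and g: "rpf g" and fg: "flat K (%x. f x * g x)"
 shows "flat K f | flat K g"
proof (rule ccontr)
 assume "\<not> ?thesis"
 then have nf: "\<not> flat K f" "\<not> flat K g" by auto
 obtain k q a C d where q: "hom k q" "a : slice K" "q a ~= 0" "C > 0" "d > 0"
  "!!z. z : slice K ==> norm z < d ==> \<bar>f (Psi z) - q z\<bar> <= C * norm z ^ Suc k"
  by (rule not_flat_form[OF f nf(1)]) blast
 obtain j r b C' d' where r: "hom j r" "b : slice K" "r b ~= 0" "C' > 0" "d' > 0"
  "!!z. z : slice K ==> norm z < d' ==> \<bar>g (Psi z) - r z\<bar> <= C' * norm z ^ Suc j"
  by (rule not_flat_form[OF g nf(2)]) blast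
 obtain t where t: "q (a + t *\<^sub>R (b - a)) ~= 0" "r (a + t *\<^sub>R (b - a)) ~= 0"
  using rpf_product_nonzero[of q r a b] q r by (auto simp: hom_def)
 define z where "z = a + t *\<^sub>R (b - a)"
 have z: "z : slice K" "q z ~= 0" "r z ~= 0" using t slice_line[OF q(2) r(2)] by (auto simp: z_def)
 obtain C3 d3 where 3: "d3 > 0" "!!z. z : slice K ==> norm z < d3 ==> \<bar>f (Psi z) * g (Psi z)\<bar> <= C3 * norm z ^ (Suc (k + j))"
  using fg unfolding flat_def by blast
 have lim: "((%s. f (Psi (s *\<^sub>R z)) / s ^ k) \<longlongrightarrow> q z) (at_right 0)"
  if "hom k q" "d > 0" "!!z. z : slice K ==> norm z < d ==> \<bar>f (Psi z) - q z\<bar> <= C * norm z ^ Suc k" for f q k C d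
 proof (rule LIM_zero_cancel, rule Lim_null_comparison)
  have pos: "min 1 (d / (norm z + 1)) > 0" using that(2) by (simp add: add_nonneg_pos)
  show "eventually (%s. norm (f (Psi (s *\<^sub>R z)) / s ^ k - q z) <= s * (C * norm z ^ Suc k)) (at_right 0)"
   unfolding eventually_at_right_field
  proof (intro exI[of _ "min 1 (d / (norm z + 1))"] conjI allI impI pos)
   fix s :: real assume s: "0 < s" "s < min 1 (d / (norm z + 1))"
   then have "s * (norm z + 1) < d" by (simp add: pos_less_divide_eq add_nonneg_pos)
   then have "norm (s *\<^sub>R z) < d" using s by (simp add: ring_distribs)
   from that(3)[OF slice_scale[OF z(1)] this]
   have "\<bar>f (Psi (s *\<^sub>R z)) - s ^ k * q z\<bar> <= C * (s * norm z) ^ Suc k"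
    using that(1) s by (simp add: hom_def)
   then have "\<bar>f (Psi (s *\<^sub>R z)) - s ^ k * q z\<bar> / s ^ k <= (C * (s * norm z) ^ Suc k) / s ^ k"
    using s by (intro divide_right_mono) auto
   moreover have "\<bar>f (Psi (s *\<^sub>R z)) - s ^ k * q z\<bar> / s ^ k = \<bar>f (Psi (s *\<^sub>R z)) / s ^ k - q z\<bar>"
    using s by (simp add: field_simps abs_if)
   moreover have "(C * (s * norm z) ^ Suc k) / s ^ k = s * (C * norm z ^ Suc k)"
    using s by (simp add: power_mult_distrib)
   ultimately show "norm (f (Psi (s *\<^sub>R z)) / s ^ k - q z) <= s * (C * norm z ^ Suc k)" by simp
  qed
  have "((%s. s * (C * norm z ^ Suc k)) \<longlongrightarrow> 0 * (C * norm z ^ Suc k)) (at_right 0)" by (intro tendsto_intros)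
  then show "((%s. s * (C * norm z ^ Suc k)) \<longlongrightarrow> 0) (at_right 0)" by simp
 qed
 have "((%s. (f (Psi (s *\<^sub>R z)) / s ^ k) * (g (Psi (s *\<^sub>R z)) / s ^ j)) \<longlongrightarrow> q z * r z) (at_right 0)"
  by (intro tendsto_mult lim[OF q(1,5,6)] lim[OF r(1,5,6)])
 \<comment> \<open>The decay of the product is the same limit statement with zero as leading
   form.\<close>
 moreover have "hom (k + j) (%z. 0)" by (auto simp: hom_def)
 then have "((%s. (f (Psi (s *\<^sub>R z)) * g (Psi (s *\<^sub>R z))) / s ^ (k + j)) \<longlongrightarrow> 0) (at_right 0)"
  using lim[of "k + j" "%z. 0" d3 "%x. f x * g x" C3] 3 by simp
 ultimately have "q z * r z = 0"
  by (intro tendsto_unique[OF trivial_limit_at_right_real]) (simp_all add: power_add)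
 with z show False by simp
qed

lemma vanishing_pideal: "pideal M p {f. rpf f & (ALL x:M. f x = 0)}"
 unfolding pideal_def
proof (intro conjI allI ballI impI)
 fix f h :: "real ^ 'n => real"
 assume "rpf f & rpf h & h p ~= 0 & (%x. h x * f x) : {f. rpf f & (ALL x:M. f x = 0)}"
 then show "f : {f. rpf f & (ALL x:M. f x = 0)}"
  using primesetD[OF prime, of h f] p_in by auto
qed (auto intro: rpf_intros)

text \<open>The coordinates outside \<open>J\<close> vanish on \<open>M\<close>, so modulo the ideal
  of \<open>M\<close> the function lies in every power of the maximal ideal, and Krull's theorem
  applies.\<close>

lemma flat_vanish_M:
 assumes "flat J f" "x : M"
 shows "f x = 0"
proof -
 have r: "rpf f" using assms(1) by (simp add: flat_def)
 have "f : {f. rpf f & (ALL x:M. f x = 0)}"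
 proof (rule krull_intersection[OF vanishing_pideal r])
  fix k
  obtain R a where R: "ordge p k R" "!!b. rpf (a b)" "!!x. f x = R x + (\<Sum>b\<in>- J. tht b x * a b x)"
   using flat_expands[OF assms(1), of k] unfolding expands_def by blast
  have "f x - R x = 0" if "x : M" for x
   using R(3)[of x] off[OF _ that] by simp
  then show "EX R. ordge p k R & (%x. f x - R x) : {f. rpf f & (ALL x:M. f x = 0)}"
   using R(1) r ordge_rpf[OF R(1)] by (intro exI[of _ R]) (auto intro: rpf_intros)
 qed
 with assms(2) show ?thesis by simp
qed

text \<open>Krull's theorem modulo the ideal of \<open>M\<close> and the \<open>tht c\<close> with
  \<open>c\<close> in \<open>S\<close>: this ideal contains all coordinates outside
  \<open>J - S\<close>.\<close>

lemma flat_divisible: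
 assumes "flat (J - S) f"
 shows "EX h g. rpf h & h p ~= 0 & (ALL c. rpf (g c)) & (ALL x:M. h x * f x = (\<Sum>c\<in>S. g c x * tht c x))"
proof -
 have r: "rpf f" using assms(1) by (simp add: flat_def)
 let ?I = "{f. rpf f & (ALL x:M. f x = 0)}" and ?G = "{%x. \<Sum>c\<in>S. b c x * tht c x | b. ALL c. rpf (b c)}"
 have G: "pmodule ?G" by (rule pmodule_span[OF tht])
 have "f : psat p ?I ?G"
 proof (rule krull_intersection[OF pideal_psat[OF vanishing_pideal G] r])
  fix k
  obtain R a where R: "ordge p k R" "!!b. rpf (a b)" "!!x. f x = R x + (\<Sum>b\<in>- (J - S). tht b x * a b x)"
   using flat_expands[OF assms(1), of k] unfolding expands_def by blast
  define u where "u x = (\<Sum>c\<in>S. a c x * tht c x)" for x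
  have "f x - R x - u x = 0" if "x : M" for x
  proof -
   have "(\<Sum>b\<in>- (J - S). tht b x * a b x) = (\<Sum>b\<in>S. tht b x * a b x)"
    using off[OF _ that] by (intro sum.mono_neutral_right) auto
   then show ?thesis using R(3)[of x] by (simp add: u_def mult.commute)
  qed
  moreover have uG: "u : ?G" unfolding u_def[abs_def] using R(2) by blast
  moreover have rR: "rpf (%x. f x - R x)" by (intro real_polynomial_function_diff r ordge_rpf[OF R(1)])
  moreover have "rpf (%x. f x - R x - u x)"
   by (intro real_polynomial_function_diff r ordge_rpf[OF R(1)] pmoduleD(1)[OF G uG])
  ultimately have "(%x. f x - R x) : psat p ?I ?G"
   by (intro psatI[of _ "%_. 1" p u]) simp_all
  with R(1) show "EX R. ordge p k R & (%x. f x - R x) : psat p ?I ?G" by blast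
 qed
 then obtain h u where hu: "rpf h" "h p ~= 0" "u : ?G" "(%x. h x * f x - u x) : ?I"
  by (rule psatE) blast
 from hu(3) obtain b where b: "ALL c. rpf (b c)" "u = (%x. \<Sum>c\<in>S. b c x * tht c x)" by blast
 from hu(4) b(2) have "ALL x:M. h x * f x = (\<Sum>c\<in>S. b c x * tht c x)" by simp
 with hu(1,2) b(1) show ?thesis by blast
qed

section \<open>Infinite order at the centre implies vanishing on the slice\<close>

definition pathder :: "real ^ 'n => (real ^ 'n => real) => real ^ 'n => real" where
 "pathder w f x = (\<Sum>b\<in>UNIV. w $ b * vf (D b) f x)"

lemma rpf_pathder: "rpf f ==> rpf (pathder w f)"
 unfolding pathder_def[abs_def] by (intro real_polynomial_function_sum rpf_cmult rpf_vf rpf_D) auto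

lemma path_deriv:
 assumes z: "norm (z + s *\<^sub>R w) < rho" and f: "rpf f"
 shows "((%s. f (Psi (z + s *\<^sub>R w))) has_real_derivative
   pathder w f (Psi (z + s *\<^sub>R w)) / v (Psi (z + s *\<^sub>R w))) (at s)"
 using comp_deriv_path[OF z rpf_differentiable[OF f]] by (simp add: pathder_def sum_divide_distrib)

lemma ray_deriv:
 assumes "norm (s *\<^sub>R w) < rho" "rpf f"
 shows "((%s. f (Psi (s *\<^sub>R w))) has_real_derivative
   pathder w f (Psi (s *\<^sub>R w)) / v (Psi (s *\<^sub>R w))) (at s)"
 using path_deriv[of 0 s w f] assms by simp

lemma ray_cont: "norm (s *\<^sub>R w) < rho ==> rpf f ==> isCont (%s. f (Psi (s *\<^sub>R w))) s"
 using ray_deriv DERIV_isCont by blast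

lemma ray_near:
 assumes "norm (s *\<^sub>R w) < rho"
 obtains d where "d > 0" "!!u. \<bar>u - s\<bar> < d ==> norm (u *\<^sub>R w) < rho"
proof -
 have "open {u. norm (u *\<^sub>R w) < rho}" by (intro open_Collect_less continuous_intros)
 then obtain d where "d > 0" "ball s d \<subseteq> {u. norm (u *\<^sub>R w) < rho}"
  using assms open_contains_ball by blast
 then show ?thesis by (intro that[of d]) (auto simp: dist_real_def abs_minus_commute subset_iff)
qed

text \<open>The derivative along the ray vanishes on the same segment and is again a polynomial over
  \<open>v\<close>, so the induction hypothesis applies to its numerator. The mean value estimate
  from \<open>S\<close> then gains one power.\<close>

lemma ray_vanish:
 assumes S: "0 < S" "norm (S *\<^sub>R w) < rho" and f: "rpf f" and 0: "!!s. 0 <= s ==> s <= S ==> f (Psi (s *\<^sub>R w)) = 0"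
 shows "EX C d. C > 0 & d > 0 & (ALL s. \<bar>s - S\<bar> < d --> \<bar>f (Psi (s *\<^sub>R w))\<bar> <= C * \<bar>s - S\<bar> ^ m)"
 using f 0
proof (induction m arbitrary: f)
 case 0
 have "isCont (%s. f (Psi (s *\<^sub>R w))) S" by (rule ray_cont[OF S(2) 0(1)])
 then have "ALL e>0. EX d>0. ALL s. norm (s - S) < d --> norm (f (Psi (s *\<^sub>R w)) - f (Psi (S *\<^sub>R w))) < e"
  unfolding continuous_at_eps_delta dist_norm .
 then obtain d where "d > 0" "ALL s. norm (s - S) < d --> norm (f (Psi (s *\<^sub>R w)) - f (Psi (S *\<^sub>R w))) < 1"
  using zero_less_one by blast
 moreover have "f (Psi (S *\<^sub>R w)) = 0" using 0(2)[of S] S(1) by simp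
 ultimately show ?case by (intro exI[of _ 1] exI[of _ d]) auto
next
 case (Suc m)
 have le: "norm (s *\<^sub>R w) < rho" if "0 <= s" "s <= S" for s
  using mult_right_mono[OF that(2), of "norm w"] S that(1) by simp
 have "pathder w f (Psi (s *\<^sub>R w)) = 0" if s: "0 <= s" "s <= S" for s
 proof -
  have "((%s. f (Psi (s *\<^sub>R w))) has_vector_derivative pathder w f (Psi (s *\<^sub>R w)) / v (Psi (s *\<^sub>R w))) (at s within cbox 0 S)"
   using ray_deriv[OF le[OF s] Suc.prems(1)] has_real_derivative_iff_has_vector_derivative has_vector_derivative_at_within by blast
  moreover have "((%s. f (Psi (s *\<^sub>R w))) has_vector_derivative 0) (at s within cbox 0 S)"
   by (rule has_vector_derivative_transform[of s _ _ "%_. 0"]) (use s Suc.prems(2) in auto)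
  ultimately have "pathder w f (Psi (s *\<^sub>R w)) / v (Psi (s *\<^sub>R w)) = 0"
   using vector_derivative_unique_within_closed_interval[OF S(1)] s by (metis cbox_interval atLeastAtMost_iff)
  then show ?thesis using v_nz[OF le[OF s]] by simp
 qed
 from Suc.IH[OF rpf_pathder[OF Suc.prems(1)] this]
 obtain C d where C: "C > 0" "d > 0" "!!s. \<bar>s - S\<bar> < d ==> \<bar>pathder w f (Psi (s *\<^sub>R w))\<bar> <= C * \<bar>s - S\<bar> ^ m"
  by blast
 obtain d1 where d1: "d1 > 0" "!!u. \<bar>u - S\<bar> < d1 ==> norm (u *\<^sub>R w) < rho" using ray_near[OF S(2)] by blast
 define e where "e = \<bar>v (Psi (S *\<^sub>R w))\<bar> / 2"
 have e: "e > 0" using v_nz[OF S(2)] by (simp add: e_def)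
 have "isCont (%s. v (Psi (s *\<^sub>R w))) S" by (rule ray_cont[OF S(2) rpf_v])
 then have "ALL e>0. EX d>0. ALL s. norm (s - S) < d --> norm (v (Psi (s *\<^sub>R w)) - v (Psi (S *\<^sub>R w))) < e"
  unfolding continuous_at_eps_delta dist_norm .
 then obtain d2 where d2: "d2 > 0" "!!s. \<bar>s - S\<bar> < d2 ==> \<bar>v (Psi (s *\<^sub>R w)) - v (Psi (S *\<^sub>R w))\<bar> < e"
  using e by auto
 have ve: "e <= \<bar>v (Psi (s *\<^sub>R w))\<bar>" if "\<bar>s - S\<bar> < d2" for s
  using d2(2)[OF that] unfolding e_def by (simp add: abs_if split: if_splits)
 have "\<bar>f (Psi (s *\<^sub>R w))\<bar> <= C / e * \<bar>s - S\<bar> ^ Suc m" if s: "\<bar>s - S\<bar> < min d (min d1 d2)" for s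
 proof -
  have seg: "\<bar>u - S\<bar> <= \<bar>s - S\<bar>" if "u : closed_segment S s" for u
   using dist_in_closed_segment[OF that] by (simp add: dist_real_def abs_minus_commute)
  have "norm (f (Psi (s *\<^sub>R w)) - f (Psi (S *\<^sub>R w))) <= C / e * \<bar>s - S\<bar> ^ m * norm (s - S)"
  proof (rule field_differentiable_bound[of "closed_segment S s"])
   fix u assume u: "u : closed_segment S s"
   note us = seg[OF u]
   show "((%s. f (Psi (s *\<^sub>R w))) has_field_derivative pathder w f (Psi (u *\<^sub>R w)) / v (Psi (u *\<^sub>R w)))
     (at u within closed_segment S s)"
    by (rule has_field_derivative_at_within[OF ray_deriv]) (use us s d1(2)[of u] Suc.prems(1) in auto)
   have "\<bar>pathder w f (Psi (u *\<^sub>R w))\<bar> / \<bar>v (Psi (u *\<^sub>R w))\<bar> <= (C * \<bar>u - S\<bar> ^ m) / e"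
    using C(3)[of u] ve[of u] us s e C(1) by (intro frac_le) auto
   also have "... <= C * \<bar>s - S\<bar> ^ m / e"
    using us C(1) e by (intro divide_right_mono mult_left_mono power_mono) auto
   finally show "norm (pathder w f (Psi (u *\<^sub>R w)) / v (Psi (u *\<^sub>R w))) <= C / e * \<bar>s - S\<bar> ^ m" by simp
  qed auto
  moreover have "f (Psi (S *\<^sub>R w)) = 0" using Suc.prems(2)[of S] S(1) by simp
  ultimately show ?thesis by (simp add: mult_ac)
 qed
 with C(1,2) d1(1) d2(1) e show ?case by (intro exI[of _ "C / e"] exI[of _ "min d (min d1 d2)"]) auto
qed

text \<open>The function \<open>f\<close> satisfies an algebraic relation \<open>G\<^sub>0 + f g\<^sub>1 = 0\<close> wherever it does not vanish, so
  there it decays along a ray no faster than a power; this contradicts the infinite order of its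
  zero at the last point of the ray before which it vanishes identically.\<close>

lemma flat_ray:
 assumes f: "flat K f" and z0: "z0 : slice K" "norm z0 < rho"
  and G: "rpf G" "G z0 ~= 0" and g: "rpf g"
  and rel: "!!z. z : slice K ==> norm z < rho ==> f (Psi z) ~= 0 ==> G z + f (Psi z) * g (Psi z) = 0"
 shows "f (Psi z0) = 0"
proof (rule ccontr)
 assume nz: "f (Psi z0) ~= 0"
 have rf: "rpf f" using f by (simp add: flat_def)
 define \<eta> where "\<eta> s = f (Psi (s *\<^sub>R z0))" for s
 \<comment> \<open>\<open>S\<close>, the supremum, is the last parameter up to which the function
   vanishes on the ray; beyond it non-zero values occur arbitrarily close.\<close>
 define Z where "Z = {s. 0 <= s & s <= 1 & (ALL u. 0 <= u & u <= s --> \<eta> u = 0)}"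
 have le: "norm (s *\<^sub>R z0) < rho" if "0 <= s" "s <= 1" for s
  using mult_right_mono[OF that(2), of "norm z0"] z0(2) that(1) by simp
 have "EX C d. d > 0 & (ALL z:slice K. norm z < d --> \<bar>f (Psi z)\<bar> <= C * norm z ^ 1)"
  using f unfolding flat_def by blast
 then have \<eta>0: "\<eta> 0 = 0" using zero_in_slice[of K] unfolding \<eta>_def by fastforce
 then have Z0: "0 : Z" by (auto simp: Z_def order_antisym_conv)
 have bdd: "bdd_above Z" by (rule bdd_aboveI[of _ 1]) (simp add: Z_def)
 define S where "S = Sup Z"
 have "S <= 1" unfolding S_def by (rule cSup_least) (use Z0 in blast, simp add: Z_def)
 with cSup_upper[OF Z0 bdd] have S: "0 <= S" "S <= 1" unfolding S_def by blast+
 have cont: "isCont \<eta> s" if "0 <= s" "s <= 1" for s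
  unfolding \<eta>_def using ray_cont[OF le[OF that] rf] .
 have below: "\<eta> u = 0" if u: "0 <= u" "u < S" for u
 proof -
  obtain s where "s : Z" "u < s" using u(2) less_cSup_iff[OF _ bdd] Z0 unfolding S_def by blast
  then show ?thesis using u(1) by (simp add: Z_def)
 qed
 have \<eta>S: "\<eta> S = 0"
 proof (cases "S = 0")
  case False
  then have "S > 0" using S by simp
  have "((%u. \<eta> u) \<longlongrightarrow> \<eta> S) (at_left S)" using cont[OF S] unfolding isCont_def by (rule filterlim_at_split[THEN iffD1, THEN conjunct1])
  moreover have "eventually (%u. \<eta> u = 0) (at_left S)"
   using eventually_at_left_real[OF \<open>S > 0\<close>] by eventually_elim (auto intro: below)
  then have "((%u. \<eta> u) \<longlongrightarrow> 0) (at_left S)" by (rule tendsto_eventually)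
  ultimately show ?thesis using tendsto_unique[OF trivial_limit_at_left_real] by blast
 qed (use \<eta>0 in simp)
 have le0: "\<eta> u = 0" if "0 <= u" "u <= S" for u using below \<eta>S that by (cases "u = S") auto
 have "S ~= 1" using nz \<eta>S by (auto simp: \<eta>_def)
 then have S1: "S < 1" using S by simp
 have above: "EX s>S. s < S + e & \<eta> s ~= 0 & s <= 1" if "e > 0" for e
 proof (rule ccontr)
  assume neg: "\<not> ?thesis"
  define s where "s = min 1 (S + e / 2)"
  have s: "S < s" "s <= 1" "s < S + e" using S1 that by (auto simp: s_def)
  have "\<eta> u = 0" if "0 <= u" "u <= s" for u
  proof (cases "u <= S")
   case False
   then show ?thesis using neg s that by (meson le_less_trans not_le order_trans)
  qed (use le0 that in simp)
  then have "s : Z" using s S by (simp add: Z_def)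
  from cSup_upper[OF this bdd] s(1) show False unfolding S_def by simp
 qed
 obtain m c d where c: "c > 0" "d > 0" "!!s. \<bar>s - S\<bar> < d ==> c * \<bar>s - S\<bar> ^ m <= \<bar>G (s *\<^sub>R z0)\<bar>"
 proof -
  have "real_polynomial_function (%s. G (s *\<^sub>R z0))" using rpf_line[OF G(1), of 0 z0] by simp
  moreover have "G (1 *\<^sub>R z0) ~= 0" using G(2) by simp
  ultimately show ?thesis
   using real_poly_lower_bound[of "%s. G (s *\<^sub>R z0)" 1 S] that by blast
 qed
 have "continuous_on {0..1} (%s. g (Psi (s *\<^sub>R z0)))"
  by (intro continuous_at_imp_continuous_on ballI ray_cont g le) auto
 from compact_imp_bounded[OF compact_continuous_image[OF this compact_Icc]]
 obtain B where B: "B > 0" "!!s. s : {0..1} ==> \<bar>g (Psi (s *\<^sub>R z0))\<bar> <= B"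
  unfolding bounded_pos by auto
 \<comment> \<open>At \<open>S = 0\<close> the decay comes from the infinite order at the centre, at
   \<open>S > 0\<close> from the vanishing on the segment before \<open>S\<close>. The exponent
   exceeds by one the order \<open>m\<close> of \<open>G\<close> at \<open>S\<close>.\<close>
 obtain C d' where C: "C > 0" "d' > 0" "!!s. \<bar>s - S\<bar> < d' ==> S <= s ==> \<bar>\<eta> s\<bar> <= C * \<bar>s - S\<bar> ^ Suc m"
 proof (cases "S = 0")
  case True
  obtain C d1 where C: "d1 > 0" "!!z. z : slice K ==> norm z < d1 ==> \<bar>f (Psi z)\<bar> <= C * norm z ^ Suc m"
   using f unfolding flat_def by blast
  show ?thesis
  proof (rule that[of "\<bar>C\<bar> * norm z0 ^ Suc m + 1" "d1 / (norm z0 + 1)"])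
   show "0 < d1 / (norm z0 + 1)" using C(1) by (intro divide_pos_pos add_nonneg_pos) auto
   fix s assume s: "\<bar>s - S\<bar> < d1 / (norm z0 + 1)" "S <= s"
   then have "s * (norm z0 + 1) < d1" using True by (simp add: pos_less_divide_eq add_nonneg_pos)
   then have "norm (s *\<^sub>R z0) < d1" using s True by (simp add: ring_distribs)
   then have "\<bar>\<eta> s\<bar> <= C * norm (s *\<^sub>R z0) ^ Suc m" unfolding \<eta>_def by (rule C(2)[OF slice_scale[OF z0(1)]])
   also have "... <= \<bar>C\<bar> * norm (s *\<^sub>R z0) ^ Suc m" by (intro mult_right_mono) auto
   also have "... = \<bar>C\<bar> * norm z0 ^ Suc m * s ^ Suc m" using s True by (simp add: power_mult_distrib)
   also have "... <= (\<bar>C\<bar> * norm z0 ^ Suc m + 1) * s ^ Suc m" using s True by (intro mult_right_mono) auto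
   finally show "\<bar>\<eta> s\<bar> <= (\<bar>C\<bar> * norm z0 ^ Suc m + 1) * \<bar>s - S\<bar> ^ Suc m" using s True by simp
  qed (auto intro: add_nonneg_pos)
 next
  case False
  then have "0 < S" using S by simp
  from ray_vanish[OF this le[OF S] rf, of "Suc m"] le0 that show ?thesis unfolding \<eta>_def by blast
 qed
 \<comment> \<open>Within this distance \<open>C * B * (s - S) ^ Suc m\<close> is smaller than the
   lower bound \<open>c * (s - S) ^ m\<close> of \<open>G\<close>.\<close>
 define e where "e = min (min d d') (c / (B * C))"
 have e: "e > 0" using c C B by (simp add: e_def)
 obtain s where s: "S < s" "s < S + e" "\<eta> s ~= 0" "s <= 1" using above[OF e] by blast
 have d: "\<bar>s - S\<bar> < d" "\<bar>s - S\<bar> < d'" "s - S < c / (B * C)" using s by (auto simp: e_def)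
 have s0: "0 <= s" using S s by simp
 have "G (s *\<^sub>R z0) + \<eta> s * g (Psi (s *\<^sub>R z0)) = 0"
  unfolding \<eta>_def by (rule rel) (use slice_scale[OF z0(1)] le[OF s0 s(4)] s(3) in "auto simp: \<eta>_def")
 then have "\<bar>G (s *\<^sub>R z0)\<bar> = \<bar>\<eta> s\<bar> * \<bar>g (Psi (s *\<^sub>R z0))\<bar>" by (metis abs_minus_cancel abs_mult add_eq_0_iff)
 also have "... <= (C * \<bar>s - S\<bar> ^ Suc m) * B"
  using C(3)[OF d(2)] B(2)[of s] s s0 C(1) by (intro mult_mono) auto
 finally have le: "\<bar>G (s *\<^sub>R z0)\<bar> <= (C * \<bar>s - S\<bar> ^ Suc m) * B" .
 have "\<bar>s - S\<bar> = s - S" using s(1) by simp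
 from order_trans[OF c(3)[OF d(1)] le, unfolded this]
 have "c * (s - S) ^ m <= C * (s - S) ^ Suc m * B" .
 then have "c * (s - S) ^ m <= (C * B * (s - S)) * (s - S) ^ m" by (simp add: mult_ac)
 moreover have "(s - S) ^ m > 0" using s(1) by simp
 ultimately have "c <= C * B * (s - S)" by (rule mult_right_le_imp_le)
 moreover have "(s - S) * (B * C) < c" using d(3) B(1) C(1) by (simp add: pos_less_divide_eq)
 ultimately show False by (simp add: mult_ac)
qed

text \<open>\<open>f\<close> and the coordinates in \<open>K\<close> are one more than the dimension
  of the slice, hence dependent there. Division by a power of \<open>f\<close> gives
  \<open>G0 + f * g1 = 0\<close> where \<open>f\<close> is non-zero, with \<open>G0\<close> a
  non-zero polynomial in the coordinates. Near \<open>z0\<close> there are points with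
  \<open>G0\<close> non-zero, and to these \<open>flat_ray\<close> applies.\<close>

lemma flat_vanish:
 assumes f: "flat K f" and z0: "z0 : slice K" "norm z0 < rho"
 shows "f (Psi z0) = 0"
proof (rule ccontr)
 assume nz: "f (Psi z0) ~= 0"
 have rf: "rpf f" using f by (simp add: flat_def)
 define y where "y = case_option f tht"
 have ry: "rpf (y i)" for i using rf tht by (cases i) (auto simp: y_def)
 let ?I = "insert None (Some ` K)"
 have "card K < card ?I" by (simp add: card_image)
 then obtain G where G: "pfun ?I G" "G ~= (%v. 0)"
  "!!z. z : slice K ==> norm z < rho ==> G (%i. y i (Psi z)) = 0"
  using slice_dependent[of ?I K y] ry by auto
 have IN: "?I - {None} = Some ` K" by auto
 obtain e g g0 g1 where g: "G = (%v. v None ^ e * g v)" "pfun ?I g" "pfun (Some ` K) g0" "pfun ?I g1"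
  "g0 ~= (%v. 0)" "g = (%v. g0 v + v None * g1 v)"
  by (rule pfun_factor[OF G(1,2), of None, unfolded IN]) auto
 define G0 where "G0 z = g0 (%i. case i of None => 0 | Some b => z $ b)" for z :: "real ^ 'n"
 have rG: "rpf G0"
  unfolding G0_def by (rule pfun_rpf[OF g(3)]) auto
 have rg: "rpf (%x. g1 (%i. y i x))" by (rule pfun_rpf[OF g(4) ry])
 have G0: "G0 z = g0 (%i. y i (Psi z))" if "norm z < rho" for z
  unfolding G0_def by (rule pfun_cong[OF g(3)]) (auto simp: y_def tht_Psi[OF that])
 have rel: "G0 z + f (Psi z) * g1 (%i. y i (Psi z)) = 0"
  if "z : slice K" "norm z < rho" "f (Psi z) ~= 0" for z
 proof -
  have "f (Psi z) ^ e * g (%i. y i (Psi z)) = 0" using G(3)[OF that(1,2)] unfolding g(1) by (simp add: y_def)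
  then have "g (%i. y i (Psi z)) = 0" using that(3) by simp
  then show ?thesis using G0[OF that(2)] unfolding g(6) by (simp add: y_def)
 qed
 obtain u where u: "g0 u ~= 0" using g(5) by (auto simp: fun_eq_iff)
 define x0 :: "real ^ 'n" where "x0 = (\<chi> b. if b : K then u (Some b) else 0)"
 have x0: "x0 : slice K" by (simp add: x0_def slice_def)
 have "G0 x0 = g0 u" unfolding G0_def by (rule pfun_cong[OF g(3)]) (auto simp: x0_def)
 then have nz0: "G0 x0 ~= 0" using u by simp
 define U where "U = ball 0 rho \<inter> (%z. f (Psi z)) -` (- {0})"
 have oU: "open U" unfolding U_def
  by (rule continuous_open_preimage[OF rpf_comp_continuous_on[OF rf]]) auto
 have "z0 : U" using nz z0 by (simp add: U_def)
 from rpf_dense[OF rG nz0 oU this] obtain t where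
  t: "z0 + t *\<^sub>R (x0 - z0) : U" "G0 (z0 + t *\<^sub>R (x0 - z0)) ~= 0" by blast
 have "f (Psi (z0 + t *\<^sub>R (x0 - z0))) = 0"
  by (rule flat_ray[OF f _ _ rG t(2) rg]) (use t(1) slice_line[OF z0(1) x0] rel in "auto simp: U_def")
 with t(1) show False by (simp add: U_def)
qed

section \<open>The germ of M in its chart\<close>

definition null :: "'n set => (real ^ 'n => real) => bool" where
 "null K f \<longleftrightarrow> rpf f & (ALL z:slice K. norm z < rho --> f (Psi z) = 0)"

lemma null_flat: "null K f \<longleftrightarrow> flat K f"
 using flat_vanish vanish_flat[OF _ rho] by (auto simp: null_def flat_def)

lemma chain_elements:
 obtains P y where "!!i. i <= n ==> polyprime M (P i)" "!!f. f : P n ==> f p = 0"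
  "!!i. 0 < i ==> i <= n ==> y i : P i" "!!i. i < n ==> y (Suc i) ~: P i"
  "!!i. i < n ==> P i \<subseteq> P (Suc i)"
proof -
 obtain P where P: "ALL i<=n. polyprime M (P i) & (ALL f:P i. f p = 0)" "ALL i<n. P i \<subset> P (Suc i)"
  using chain by blast
 have "EX y. i < n --> y : P (Suc i) & y ~: P i" for i using P(2) by blast
 then obtain y where y: "!!i. i < n ==> y i : P (Suc i) & y i ~: P i" by metis
 show ?thesis
 proof (rule that[of P "%i. y (i - 1)"])
  show "y (i - 1) : P i" if "0 < i" "i <= n" for i using y[of "i - 1"] that by simp
  show "y (Suc i - 1) ~: P i" if "i < n" for i using y[OF that] by simp
  show "P i \<subseteq> P (Suc i)" if "i < n" for i using P(2) that by blast
 qed (use P(1) in blast)+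
qed

text \<open>With fewer coordinates, the \<open>n\<close> elements of a chain of primes would be
  dependent along the slice. The relation then holds on \<open>M\<close> by
  \<open>flat_vanish_M\<close>, against \<open>chain_independent\<close>.\<close>

lemma card_J: "card J = n"
proof (rule ccontr)
 assume "card J ~= n"
 moreover have "card J <= card {..<n}" by (rule card_inj_on_le[OF idx(1)]) (use idx(2) in auto)
 ultimately have lt: "card J < n" by simp
 obtain P y where P: "!!i. i <= n ==> polyprime M (P i)" "!!f. f : P n ==> f p = 0"
  "!!i. 0 < i ==> i <= n ==> y i : P i" "!!i. i < n ==> y (Suc i) ~: P i"
  "!!i. i < n ==> P i \<subseteq> P (Suc i)" using chain_elements by blast
 have ry: "rpf (y i)" if "i : {0<..n}" for i using polyprime_rpf[OF P(1) P(3)] that by simp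
 obtain f where f: "pfun {0<..n} f" "f ~= (%v. 0)"
  "!!z. z : slice J ==> norm z < rho ==> f (%i. y i (Psi z)) = 0"
  using slice_dependent[of "{0<..n}" J y] lt ry by auto
 have r: "rpf (%x. f (%i. y i x))" by (rule pfun_rpf[OF f(1) ry])
 have "flat J (%x. f (%i. y i x))" by (rule vanish_flat[OF r rho f(3)])
 then have "(%x. f (%i. y i x)) : P 0" by (intro polyprime_vanish[OF P(1) r] flat_vanish_M) auto
 moreover have "(%x. f (%i. y i x)) ~: P 0"
  by (rule chain_independent[where M = M and n = n and P = P and y = y and k = 0 and p = p]) (use P f(1,2) in simp_all)
 ultimately show False by blast
qed

lemma flat_power: "rpf f ==> flat K (%x. f x ^ e) ==> flat K f"
proof (induction e)
 case 0
 then have "(1::real) = 0" using flat_vanish[OF 0(2), of 0] rho by simp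
 then show ?case by simp
next
 case (Suc e)
 have "rpf (%x. f x ^ e)" by (intro rpf_intros Suc.prems(1))
 from flat_prime[OF Suc.prems(1) this] Suc show ?case by auto
qed

text \<open>Counting again: \<open>h\<close> and the \<open>n\<close> chain elements are dependent
  along the slice of dimension \<open>n\<close>. If \<open>h\<close> had finite order, its powers
  could be cancelled from the relation, which would then hold on \<open>M\<close>; since
  \<open>h\<close> is zero there, a relation among the chain elements would remain.\<close>

lemma vanish_M_flat:
 assumes h: "rpf h" "!!x. x : M ==> h x = 0"
 shows "flat J h"
proof (rule ccontr)
 assume nf: "\<not> flat J h"
 obtain P y where P: "!!i. i <= n ==> polyprime M (P i)" "!!f. f : P n ==> f p = 0"
  "!!i. 0 < i ==> i <= n ==> y i : P i" "!!i. i < n ==> y (Suc i) ~: P i"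
  "!!i. i < n ==> P i \<subseteq> P (Suc i)" using chain_elements by blast
 define w where "w i = (if i = 0 then h else y i)" for i
 have rw: "rpf (w i)" if "i : {..n}" for i using polyprime_rpf[OF P(1) P(3)] that h(1) by (simp add: w_def)
 obtain G where G: "pfun {..n} G" "G ~= (%v. 0)"
  "!!z. z : slice J ==> norm z < rho ==> G (%i. w i (Psi z)) = 0"
  using slice_dependent[of "{..n}" J w] card_J rw by auto
 have I0: "{..n} - {0} = {0<..n}" by auto
 obtain e g g0 g1 where g: "G = (%v. v 0 ^ e * g v)" "pfun {..n} g" "pfun {0<..n} g0" "pfun {..n} g1"
  "g0 ~= (%v. 0)" "g = (%v. g0 v + v 0 * g1 v)"
  by (rule pfun_factor[OF G(1,2), of 0, unfolded I0]) auto
 have rG: "rpf (%x. G (%i. w i x))" by (rule pfun_rpf[OF G(1) rw])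
 have rg: "rpf (%x. g (%i. w i x))" by (rule pfun_rpf[OF g(2) rw])
 have "flat J (%x. G (%i. w i x))" by (rule vanish_flat[OF rG rho G(3)])
 then have "flat J (%x. h x ^ e * g (%i. w i x))" unfolding g(1) by (simp add: w_def)
 from flat_prime[OF _ rg this] flat_power[OF h(1), of J e] nf have fg: "flat J (%x. g (%i. w i x))"
  using h(1) by (auto intro: rpf_intros)
 have "g0 (%i. y i x) = 0" if "x : M" for x
 proof -
  have "g0 (%i. y i x) = g0 (%i. w i x)" by (rule pfun_cong[OF g(3)]) (simp add: w_def)
  then show ?thesis using flat_vanish_M[OF fg that] h(2)[OF that] unfolding g(6) by (simp add: w_def)
 qed
 moreover have r0: "rpf (%x. g0 (%i. y i x))" by (rule pfun_rpf[OF g(3)]) (use polyprime_rpf[OF P(1) P(3)] in simp)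
 ultimately have "(%x. g0 (%i. y i x)) : P 0" by (intro polyprime_vanish[OF P(1)]) auto
 moreover have "(%x. g0 (%i. y i x)) ~: P 0"
  by (rule chain_independent[where M = M and n = n and P = P and y = y and k = 0 and p = p]) (use P g(3,5) in simp_all)
 ultimately show False by blast
qed

lemma null_J: "null J f \<longleftrightarrow> rpf f & (ALL x:M. f x = 0)"
proof
 assume "null J f"
 then have "flat J f" by (simp only: null_flat)
 then show "rpf f & (ALL x:M. f x = 0)" using flat_vanish_M flat_def by blast
next
 assume "rpf f & (ALL x:M. f x = 0)"
 then show "null J f" unfolding null_flat by (intro vanish_M_flat) blast+
qed

lemma M_slice: "norm z < rho ==> Psi z : M \<longleftrightarrow> z : slice J"
proof
 assume z: "norm z < rho" "Psi z : M"
 show "z : slice J" using off[OF _ z(2)] tht_Psi[OF z(1)] by (auto simp: slice_def)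
next
 assume z: "norm z < rho" "z : slice J"
 obtain Q where Q: "ALL q:Q. rpf q" "M = {x. ALL q:Q. q x = 0}" using alg unfolding algebraic_set_def by blast
 have "q (Psi z) = 0" if "q : Q" for q
 proof -
  have "null J q" using null_J Q that by auto
  then show ?thesis using z by (simp add: null_def)
 qed
 then show "Psi z : M" using Q(2) by simp
qed

lemma null_prime: "rpf f ==> rpf g ==> null K (%x. f x * g x) ==> null K f | null K g"
 unfolding null_flat by (rule flat_prime)

lemma null_divisible:
 assumes "null (J - S) f"
 shows "EX h g. rpf h & h p ~= 0 & (ALL c. rpf (g c)) & (ALL x:M. h x * f x = (\<Sum>c\<in>S. g c x * tht c x))"
 using flat_divisible assms unfolding null_flat .

text \<open>A function that is not zero on the slice has only finite order of decay, and up to a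
  unit no higher power of \<open>z $ b\<close> can divide it.\<close>

lemma null_order:
 assumes f: "rpf f" "\<not> null K f"
 shows "EX m. ALL k h g. rpf h & h p ~= 0 & rpf g &
   (ALL z:slice K. norm z < rho --> h (Psi z) * f (Psi z) = (z $ b) ^ k * g (Psi z)) --> k < m"
proof -
 obtain m where m: "!!C d. d > 0 ==> EX z:slice K. norm z < d & \<not> \<bar>f (Psi z)\<bar> <= C * norm z ^ m"
  using f unfolding null_flat flat_def by metis
 have "k < m" if hg: "rpf h" "h p ~= 0" "rpf g"
  "!!z. z : slice K ==> norm z < rho ==> h (Psi z) * f (Psi z) = (z $ b) ^ k * g (Psi z)" for k h g
 proof (rule ccontr)
  assume "\<not> k < m"
  then have km: "m <= k" by simp
  have "isCont (%z. g (Psi z)) 0" "isCont (%z. h (Psi z)) 0"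
   using rpf_comp_cont[OF hg(3)] rpf_comp_cont[OF hg(1)] rho by auto
  then have c: "ALL e>0. EX d>0. ALL z. norm (z - 0) < d --> norm (g (Psi z) - g (Psi 0)) < e"
    "ALL e>0. EX d>0. ALL z. norm (z - 0) < d --> norm (h (Psi z) - h (Psi 0)) < e"
   unfolding continuous_at_eps_delta dist_norm .
  define e where "e = \<bar>h p\<bar> / 2"
  have e: "e > 0" using hg(2) by (simp add: e_def)
  obtain d1 where d1: "d1 > 0" "!!z. norm z < d1 ==> \<bar>g (Psi z) - g (Psi 0)\<bar> < 1"
   using c(1) by (auto dest!: spec[where x = "1::real"])
  obtain d2 where d2: "d2 > 0" "!!z. norm z < d2 ==> \<bar>h (Psi z) - h p\<bar> < e"
   using c(2) e Psi_0 by auto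
  define d where "d = min (min d1 d2) (min rho 1)"
  have "d > 0" using d1 d2 rho by (simp add: d_def)
  from m[OF this, of "(\<bar>g (Psi 0)\<bar> + 1) / e"] obtain z where
   z: "z : slice K" "norm z < d" "\<not> \<bar>f (Psi z)\<bar> <= (\<bar>g (Psi 0)\<bar> + 1) / e * norm z ^ m" by blast
  have zd: "norm z < d1" "norm z < d2" "norm z < rho" "norm z < 1" using z(2) by (auto simp: d_def)
  have "e <= \<bar>h (Psi z)\<bar>" using d2(2)[OF zd(2)] unfolding e_def by (simp add: abs_if split: if_splits)
  then have "e * \<bar>f (Psi z)\<bar> <= \<bar>h (Psi z) * f (Psi z)\<bar>" by (simp add: abs_mult mult_right_mono)
  also have "... = \<bar>z $ b\<bar> ^ k * \<bar>g (Psi z)\<bar>" using hg(4)[OF z(1) zd(3)] by (simp add: abs_mult power_abs)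
  also have "... <= norm z ^ m * (\<bar>g (Psi 0)\<bar> + 1)"
  proof (rule mult_mono)
   have "\<bar>z $ b\<bar> ^ k <= norm z ^ k" using component_le_norm_cart[of z b] by (intro power_mono) auto
   also have "... <= norm z ^ m" using zd(4) km by (intro power_decreasing) auto
   finally show "\<bar>z $ b\<bar> ^ k <= norm z ^ m" .
   show "\<bar>g (Psi z)\<bar> <= \<bar>g (Psi 0)\<bar> + 1" using d1(2)[OF zd(1)] by linarith
  qed auto
  finally have "\<bar>f (Psi z)\<bar> <= (\<bar>g (Psi 0)\<bar> + 1) / e * norm z ^ m" using e by (simp add: field_simps)
  with z(3) show False by simp
 qed
 then show ?thesis by (intro exI[of _ m]) blast
qed

text \<open>Mean value estimate between \<open>z\<close> and the point where the coordinates in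
  \<open>S\<close> are replaced by zero; on the smaller closed ball the derivatives are
  bounded.\<close>

lemma null_bound:
 assumes f: "null (K - S) f" and r: "r < rho"
 shows "EX C>0. ALL z:slice K. norm z <= r --> \<bar>f (Psi z)\<bar> <= C * (\<Sum>b\<in>S. \<bar>z $ b\<bar>)"
proof -
 have rf: "rpf f" using f by (simp add: null_def)
 have "ALL b. EX B>0. ALL z:cball 0 r. \<bar>vf (D b) f (Psi z) / v (Psi z)\<bar> <= B"
 proof
  fix b
  have "continuous_on (cball 0 r) (%z. vf (D b) f (Psi z) / v (Psi z))"
   by (intro continuous_on_divide continuous_at_imp_continuous_on ballI rpf_comp_cont rpf_vf rpf_D rf rpf_v)
    (use r v_nz in auto)
  from compact_imp_bounded[OF compact_continuous_image[OF this compact_cball]]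
  show "EX B>0. ALL z:cball 0 r. \<bar>vf (D b) f (Psi z) / v (Psi z)\<bar> <= B"
   unfolding bounded_pos by (auto simp del: abs_divide)
 qed
 then have "EX B. ALL b. B b > 0 & (ALL z:cball 0 r. \<bar>vf (D b) f (Psi z) / v (Psi z)\<bar> <= B b)" by (rule choice)
 then obtain B where B': "ALL b. B b > 0 & (ALL z:cball 0 r. \<bar>vf (D b) f (Psi z) / v (Psi z)\<bar> <= B b)" ..
 have B: "B b > 0" "norm z <= r ==> \<bar>vf (D b) f (Psi z) / v (Psi z)\<bar> <= B b" for b z
  using B'[rule_format, of b] by (auto simp del: abs_divide)
 define C where "C = (\<Sum>b\<in>UNIV. B b)"
 have C: "C > 0" unfolding C_def by (intro sum_pos B) auto
 have BC: "B b <= C" for b unfolding C_def by (rule member_le_sum) (use B(1) less_imp_le in auto)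
 have "\<bar>f (Psi z)\<bar> <= C * (\<Sum>b\<in>S. \<bar>z $ b\<bar>)" if z: "z : slice K" "norm z <= r" for z
 proof -
  define z1 where "z1 = proj (- S) z"
  define w where "w = z - z1"
  have w: "w $ b = (if b : S then z $ b else 0)" for b by (simp add: w_def z1_def)
  have n: "norm (z1 + s *\<^sub>R w) <= r" if "s : {0..1}" for s
  proof -
   have "\<bar>(z1 + s *\<^sub>R w) $ b\<bar> <= \<bar>z $ b\<bar>" for b
    using that by (auto simp: w z1_def abs_mult mult_left_le_one_le)
   then have "norm (z1 + s *\<^sub>R w) <= norm z" by (intro norm_le_componentwise_cart) simp
   then show ?thesis using z(2) by simp
  qed
  have "norm (f (Psi (z1 + 1 *\<^sub>R w)) - f (Psi (z1 + 0 *\<^sub>R w))) <= C * (\<Sum>b\<in>S. \<bar>z $ b\<bar>) * norm (1 - 0 :: real)"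
  proof (rule field_differentiable_bound[of "{0..1}"])
   fix s :: real assume s: "s : {0..1}"
   show "((%s. f (Psi (z1 + s *\<^sub>R w))) has_field_derivative pathder w f (Psi (z1 + s *\<^sub>R w)) / v (Psi (z1 + s *\<^sub>R w))) (at s within {0..1})"
    by (rule has_field_derivative_at_within[OF path_deriv]) (use n[OF s] r rf in auto)
   have "pathder w f (Psi (z1 + s *\<^sub>R w)) / v (Psi (z1 + s *\<^sub>R w))
     = (\<Sum>b\<in>UNIV. w $ b * (vf (D b) f (Psi (z1 + s *\<^sub>R w)) / v (Psi (z1 + s *\<^sub>R w))))"
    by (simp add: pathder_def sum_divide_distrib)
   also have "\<bar>...\<bar> <= (\<Sum>b\<in>UNIV. \<bar>w $ b\<bar> * C)"
   proof (rule order_trans[OF sum_abs], rule sum_mono)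
    fix b
    show "\<bar>w $ b * (vf (D b) f (Psi (z1 + s *\<^sub>R w)) / v (Psi (z1 + s *\<^sub>R w)))\<bar> <= \<bar>w $ b\<bar> * C"
     unfolding abs_mult by (intro mult_left_mono order_trans[OF B(2)[OF n[OF s]] BC]) auto
   qed
   also have "(\<Sum>b\<in>UNIV. \<bar>w $ b\<bar> * C) = (\<Sum>b\<in>S. \<bar>z $ b\<bar> * C)"
    by (rule sum.mono_neutral_cong_right) (auto simp: w)
   finally show "norm (pathder w f (Psi (z1 + s *\<^sub>R w)) / v (Psi (z1 + s *\<^sub>R w))) <= C * (\<Sum>b\<in>S. \<bar>z $ b\<bar>)"
    by (simp add: sum_distrib_left mult.commute)
  qed auto
  moreover have "f (Psi z1) = 0"
  proof -
   have "z1 : slice (K - S)" using z(1) by (auto simp: z1_def slice_def)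
   moreover have "norm z1 < rho" using n[of 0] r by simp
   ultimately show ?thesis using f by (simp add: null_def)
  qed
  ultimately show ?thesis by (simp add: w_def)
 qed
 with C show ?thesis by blast
qed

end

subsection \<open>Existence of charts\<close>

lemma rpf_det:
 fixes A :: "real ^ 'n => real ^ 'm ^ 'm"
 assumes "!!i j. rpf (%x. A x $ i $ j)"
 shows "rpf (%x. det (A x))"
 unfolding det_def by (intro rpf_intros assms) (simp_all add: finite_permutations)

definition jac :: "('n::finite => real ^ 'n => real) => real ^ 'n => real ^ 'n ^ 'n" where
 "jac tht x = (\<chi> b i. pd i (tht b) x)"

text \<open>The numerators in Cramer's rule: divided by the Jacobian determinant they are the
  entries of the inverse Jacobian matrix. This yields the polynomial \<open>D\<close> and
  \<open>v\<close> of a chart.\<close>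

definition cofield :: "('n::finite => real ^ 'n => real) => 'n => 'n => real ^ 'n => real" where
 "cofield tht b i x = det (\<chi> r c. if c = i then (if r = b then 1 else 0) else jac tht x $ r $ c)"

lemma rpf_jac: "(!!b. rpf (tht b)) ==> rpf (%x. jac tht x $ b $ i)"
 by (simp add: jac_def)

lemma rpf_det_jac: "(!!b. rpf (tht b)) ==> rpf (%x. det (jac tht x))"
 by (intro rpf_det rpf_jac)

lemma rpf_cofield: "(!!b. rpf (tht b)) ==> rpf (cofield tht b i)"
 unfolding cofield_def[abs_def]
proof (rule rpf_det)
 fix r c assume "!!b. rpf (tht b)"
 then show "rpf (%x. (\<chi> r c. if c = i then (if r = b then 1 else 0) else jac tht x $ r $ c) $ r $ c)"
  using rpf_jac[of tht r c] by (cases "c = i") simp_all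
qed

lemma jac_cofield:
 assumes "det (jac tht x) ~= 0"
 shows "jac tht x *v (\<chi> i. \<Sum>b\<in>UNIV. h $ b * cofield tht b i x / det (jac tht x)) = h"
proof -
 define y where "y b = (\<chi> i. cofield tht b i x / det (jac tht x))" for b
 have "jac tht x *v y b = axis b 1" for b
 proof (rule iffD2[OF cramer[OF assms]])
  show "y b = (\<chi> k. det (\<chi> i j. if j = k then (axis b 1 :: real ^ 'a) $ i else jac tht x $ i $ j) / det (jac tht x))"
   unfolding y_def cofield_def
   by (intro arg_cong[where f = vec_lambda] ext arg_cong2[where f = "(/)"] arg_cong[where f = det] refl)
    (simp add: axis_def)
 qed
 moreover have "(\<chi> i. \<Sum>b\<in>UNIV. h $ b * cofield tht b i x / det (jac tht x)) = (\<Sum>b\<in>UNIV. h $ b *\<^sub>R y b)"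
  by (simp add: y_def vec_eq_iff)
 ultimately have "jac tht x *v (\<chi> i. \<Sum>b\<in>UNIV. h $ b * cofield tht b i x / det (jac tht x)) = (\<Sum>b\<in>UNIV. h $ b *\<^sub>R axis b 1)"
  using linear_sum[OF matrix_vector_mul_linear, of "jac tht x" "%b. h $ b *\<^sub>R y b" UNIV]
  by (simp add: matrix_vector_mult_scaleR)
 also have "... = h" using basis_expansion[of h] by (simp add: scalar_mult_eq_scaleR)
 finally show ?thesis .
qed

lemma local_inverse:
 fixes tht :: "'n::finite => real ^ 'n => real"
 assumes tht: "!!b. rpf (tht b)" "!!b. tht b p = 0" and d: "det (jac tht p) ~= 0"
 obtains Psi rho where "rho > 0" "Psi 0 = p" "!!z b. norm z < rho ==> tht b (Psi z) = z $ b"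
  "open (Psi ` ball 0 rho)" "!!z. norm z < rho ==> det (jac tht (Psi z)) ~= 0"
  "!!z. norm z < rho ==> (Psi has_derivative
    (%h. \<chi> i. \<Sum>b\<in>UNIV. h $ b * cofield tht b i (Psi z) / det (jac tht (Psi z)))) (at z)"
proof -
 define \<Theta> where "\<Theta> x = (\<chi> b. tht b x)" for x
 define U where "U = {x. det (jac tht x) ~= 0}"
 define F where "F x = Blinfun ((*v) (jac tht x))" for x
 have F: "blinfun_apply (F x) = (*v) (jac tht x)" for x
  unfolding F_def by (rule bounded_linear_Blinfun_apply) (rule matrix_vector_mul_bounded_linear)
 have U: "open U" unfolding U_def
  by (intro open_Collect_neq continuous_on_const rpf_continuous rpf_det_jac tht)
 have der: "(\<Theta> has_derivative blinfun_apply (F x)) (at x)" for x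
 proof -
  have "((%x. \<chi> b. tht b x) has_derivative (%h. \<chi> b. \<Sum>i\<in>UNIV. pd i (tht b) x * h $ i)) (at x)"
   unfolding has_derivative_componentwise_within[where f = "%x. \<chi> b. tht b x"]
   by (auto simp: Basis_vec_def inner_axis intro!: has_derivative_pd rpf_differentiable tht)
  moreover have "(%h. \<chi> b. \<Sum>i\<in>UNIV. pd i (tht b) x * h $ i) = (*v) (jac tht x)"
   by (auto simp: fun_eq_iff matrix_vector_mult_def jac_def)
  ultimately show ?thesis unfolding F \<Theta>_def[abs_def] by simp
 qed
 have cF: "continuous_on U F"
 proof (rule continuous_on_blinfun_componentwise)
  fix e :: "real ^ 'n" assume "e : Basis"
  have "rpf (%x. (jac tht x *v e) $ b)" for b
   unfolding matrix_vector_mult_def by simp (intro rpf_intros rpf_jac tht; simp)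
  then show "continuous_on U (%x. blinfun_apply (F x) e)"
   unfolding F by (intro continuous_on_vec_lambda[of _ "%b x. (jac tht x *v e) $ b", unfolded vec_nth_inverse] rpf_continuous)
 qed
 have pU: "p : U" using d by (simp add: U_def)
 obtain A where A: "A ** jac tht p = mat 1"
  using d unfolding invertible_det_nz[symmetric] invertible_def by blast
 have inv: "Blinfun ((*v) A) o\<^sub>L F p = id_blinfun"
  by (rule blinfun_eqI)
   (simp add: F A bounded_linear_Blinfun_apply[OF matrix_vector_mul_bounded_linear] matrix_vector_mul_assoc)
 obtain U' V g g' where *: "open U'" "U' \<subseteq> U" "p : U'" "open V" "\<Theta> p : V" "homeomorphism U' V \<Theta> g"
  "!!y. y : V ==> (g has_derivative (g' y)) (at y)"
  "!!y. y : V ==> g' y = inv_into UNIV (blinfun_apply (F (g y)))"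
  by (rule inverse_function_theorem[OF U der cF pU inv]) blast
 have \<Theta>p: "\<Theta> p = 0" by (simp add: \<Theta>_def tht(2) vec_eq_iff)
 obtain rho where rho: "rho > 0" "ball 0 rho \<subseteq> V" using *(4,5) \<Theta>p open_contains_ball by metis
 have V: "z : V" if "norm z < rho" for z using rho(2) that by auto
 have gU: "g z : U'" "\<Theta> (g z) = z" if "z : V" for z
  using *(6) that unfolding homeomorphism_def by auto
 have gT: "g (\<Theta> x) = x" "\<Theta> x : V" if "x : U'" for x
  using *(6) that unfolding homeomorphism_def by auto
 show ?thesis
 proof (rule that[OF rho(1), of g])
  show "g 0 = p" using gT(1)[OF *(3)] \<Theta>p by simp
  show "tht b (g z) = z $ b" if "norm z < rho" for z b
   using gU(2)[OF V[OF that]] unfolding \<Theta>_def vec_eq_iff by simp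
  have "g ` ball 0 rho = U' \<inter> \<Theta> -` ball 0 rho"
  proof (intro equalityI subsetI)
   fix x assume "x : g ` ball 0 rho"
   then obtain z where "norm z < rho" "x = g z" by auto
   then show "x : U' \<inter> \<Theta> -` ball 0 rho" using gU[OF V] by simp
  next
   fix x assume "x : U' \<inter> \<Theta> -` ball 0 rho"
   then have "x = g (\<Theta> x)" "\<Theta> x : ball 0 rho" using gT by auto
   then show "x : g ` ball 0 rho" by (rule image_eqI)
  qed
  moreover have "open (U' \<inter> \<Theta> -` ball 0 rho)"
   by (intro continuous_open_preimage *(1) open_ball continuous_at_imp_continuous_on ballI has_derivative_continuous[OF der])
  ultimately show "open (g ` ball 0 rho)" by simp
  show nz: "det (jac tht (g z)) ~= 0" if "norm z < rho" for z
   using gU(1)[OF V[OF that]] *(2) by (auto simp: U_def)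
  show "(g has_derivative (%h. \<chi> i. \<Sum>b\<in>UNIV. h $ b * cofield tht b i (g z) / det (jac tht (g z)))) (at z)" if z: "norm z < rho" for z
  proof -
   have "inj ((*v) (jac tht (g z)))"
    using nz[OF z] by (simp add: inj_matrix_vector_mult invertible_det_nz)
   then have "g' z = (%h. \<chi> i. \<Sum>b\<in>UNIV. h $ b * cofield tht b i (g z) / det (jac tht (g z)))"
    unfolding *(8)[OF V[OF z]] F by (intro ext inv_f_eq jac_cofield nz[OF z])
   with *(7)[OF V[OF z]] show ?thesis by simp
  qed
 qed
qed

context param_point
begin

text \<open>Up to a unit and modulo functions vanishing on \<open>M\<close>, every
  \<open>x $ i - p $ i\<close> is a combination of the parameters. Differentiating at
  \<open>p\<close> shows that the gradients of the parameters and of the functions vanishing on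
  \<open>M\<close> span; the basis is built by exhausting the second kind first.\<close>

lemma parameters_exist:
 assumes M: "primeset M"
 obtains tht :: "'n => real ^ 'n => real" and J idx where "!!b. rpf (tht b)" "!!b. tht b p = 0"
  "span (range (%b. \<chi> i. pd i (tht b) p)) = UNIV"
  "!!b x. b ~: J ==> x : M ==> tht b x = 0"
  "inj_on idx J" "!!b. b : J ==> idx b < n" "!!b. b : J ==> tht b = X (idx b)"
proof -
 define G where "G f = (\<chi> i. pd i f p)" for f :: "real ^ 'n => real"
 define T where "T = G ` {h. rpf h & (ALL x:M. h x = 0)}"
 obtain B1 where B1: "B1 \<subseteq> T" "independent B1" "T \<subseteq> span B1"
  using maximal_independent_subset[of T] by blast
 obtain B where B: "B1 \<subseteq> B" "B \<subseteq> B1 \<union> G ` X ` {..<n}" "independent B" "B1 \<union> G ` X ` {..<n} \<subseteq> span B"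
  using maximal_independent_subset_extend[of B1 "B1 \<union> G ` X ` {..<n}"] B1(2) by blast
 have TB: "T \<subseteq> span B" using B1(3) span_mono[OF B(1)] by blast
 have axis: "axis i 1 : span B" for i
 proof -
  define f where "f x = x $ i - p $ i" for x :: "real ^ 'n"
  have rf: "rpf f" "f p = 0" unfolding f_def[abs_def] by (auto intro: rpf_intros)
  obtain h c where h: "rpf h" "h p ~= 0" "ALL j<n. rpf (c j)" "ALL x:M. h x * f x = (\<Sum>j<n. c j x * X j x)"
   using gen[OF rf] by blast
  define s where "s x = (\<Sum>j<n. c j x * X j x)" for x
  have rs: "rpf s" unfolding s_def[abs_def] using h(3) X(1) by (intro rpf_intros) auto
  have rhf: "rpf (%x. h x * f x)" by (intro rpf_intros h(1) rf(1))
  have rd: "rpf (%x. h x * f x + (- 1) * s x)" by (intro rpf_intros h(1) rf(1) rs)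
  have "G (%x. h x * f x + (- 1) * s x) : T"
   unfolding T_def using h(4) rd by (intro imageI) (simp add: s_def)
  moreover have "G (%x. h x * f x + (- 1) * s x) = h p *\<^sub>R axis i 1 - (\<Sum>j<n. c j p *\<^sub>R G (X j))"
  proof (rule vec_eq_iff[THEN iffD2], rule allI)
   fix k
   have "pd k (%x. h x * f x + (- 1) * s x) p = pd k (%x. h x * f x) p + pd k (%x. (- 1) * s x) p"
    by (intro pd_add rpf_differentiable rhf rpf_cmult rs)
   also have "pd k (%x. (- 1) * s x) p = (- 1) * pd k s p" by (rule pd_cmult[OF rpf_differentiable[OF rs]])
   also have "pd k s p = (\<Sum>j<n. pd k (%x. c j x * X j x) p)"
    unfolding s_def[abs_def] using h(3) X(1) by (intro pd_sum) (auto intro!: rpf_differentiable rpf_intros)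
   also have "... = (\<Sum>j<n. c j p * pd k (X j) p)"
    using h(3) X by (intro sum.cong refl) (simp add: pd_mult rpf_differentiable)
   also have "pd k (%x. h x * f x) p = h p * pd k f p"
    using h(1) rf by (simp add: pd_mult rpf_differentiable)
   also have "pd k f p = (if k = i then 1 else 0)"
   proof -
    have "pd k (%x. x $ i + - p $ i) p = (if k = i then 1 else 0)"
     by (subst pd_add) (auto simp: pd_nth rpf_differentiable)
    then show ?thesis by (simp add: f_def[abs_def])
   qed
   finally show "G (%x. h x * f x + (- 1) * s x) $ k = (h p *\<^sub>R axis i 1 - (\<Sum>j<n. c j p *\<^sub>R G (X j))) $ k"
    by (simp add: G_def axis_def)
  qed
  ultimately have "h p *\<^sub>R axis i 1 - (\<Sum>j<n. c j p *\<^sub>R G (X j)) : span B" using TB by auto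
  moreover have "(\<Sum>j<n. c j p *\<^sub>R G (X j)) : span B"
   using B(4) by (intro span_sum span_scale) auto
  ultimately have "h p *\<^sub>R axis i 1 : span B" using span_add by fastforce
  from span_scale[OF this, of "1 / h p"] h(2) show ?thesis by simp
 qed
 have spB: "span B = UNIV"
 proof -
  have "y : span B" for y :: "real ^ 'n"
   by (subst basis_expansion[of y, symmetric, unfolded scalar_mult_eq_scaleR]) (intro span_sum span_scale axis)
  then show ?thesis by blast
 qed
 have "card B = CARD('n)"
  using basis_card_eq_dim[of B UNIV] B(3) spB by simp
 moreover have "finite B" using B(3) by (rule independent_imp_finite)
 \<comment> \<open>The basis has as many elements as there are ambient coordinates and is indexed by
   them. The indices outside \<open>B1\<close> become \<open>J\<close>.\<close>
 ultimately obtain beta :: "'n => real ^ 'n" where beta: "bij_betw beta UNIV B"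
  using finite_same_card_bij[of "UNIV :: 'n set" B] by auto
 define J where "J = {b. beta b ~: B1}"
 have "EX j<n. G (X j) = beta b" if "b : J" for b
 proof -
  have "beta b : B" using bij_betw_apply[OF beta, of b] by simp
  moreover have "beta b ~: B1" using that by (simp add: J_def)
  ultimately have "beta b : G ` X ` {..<n}" using B(2) by (meson UnE subsetD)
  then show ?thesis unfolding image_image by (elim imageE) (intro exI conjI, auto)
 qed
 then obtain idx where idx: "!!b. b : J ==> idx b < n" "!!b. b : J ==> G (X (idx b)) = beta b" by metis
 have "EX h. rpf h & (ALL x:M. h x = 0) & G h = beta b" if "b ~: J" for b
 proof -
  have "beta b : G ` {h. rpf h & (ALL x:M. h x = 0)}" using B1(1) that unfolding J_def T_def by blast
  then show ?thesis by (elim imageE) (intro exI conjI; simp)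
 qed
 then have "ALL b:- J. EX h. rpf h & (ALL x:M. h x = 0) & G h = beta b" by simp
 then have "EX H. ALL b:- J. rpf (H b) & (ALL x:M. H b x = 0) & G (H b) = beta b" by (rule bchoice)
 then obtain H where H': "ALL b:- J. rpf (H b) & (ALL x:M. H b x = 0) & G (H b) = beta b" ..
 have H: "b ~: J ==> rpf (H b)" "b ~: J ==> x : M ==> H b x = 0" "b ~: J ==> G (H b) = beta b" for b x
  using H' by simp_all
 define tht where "tht b = (if b : J then X (idx b) else H b)" for b
 show ?thesis
 proof (rule that[of tht J idx])
  have e: "(%b. \<chi> i. pd i (tht b) p) = beta"
   using idx H(3) unfolding G_def tht_def by (intro ext) auto
  show "span (range (%b. \<chi> i. pd i (tht b) p)) = UNIV"
   unfolding e bij_betw_imp_surj_on[OF beta] by (rule spB)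
  show "inj_on idx J"
   using idx(2) beta unfolding bij_betw_def by (intro inj_onI) (metis injD)
 qed (use idx H X p_in in "auto simp: tht_def")
qed

lemma chart_exists:
 assumes "primeset M" "algebraic_set M"
  and "EX P. (ALL i<=n. polyprime M (P i) & (ALL f:P i. f p = 0)) & (ALL i<n. P i \<subset> P (Suc i))"
 obtains tht J idx Psi rho D v where "chart M p n X tht J idx Psi rho D v"
proof -
 obtain tht :: "'n => real ^ 'n => real" and J idx where
  1: "!!b. rpf (tht b)" "!!b. tht b p = 0" "span (range (%b. \<chi> i. pd i (tht b) p)) = UNIV"
  "!!b x. b ~: J ==> x : M ==> tht b x = 0"
  "inj_on idx J" "!!b. b : J ==> idx b < n" "!!b. b : J ==> tht b = X (idx b)"
  by (rule parameters_exist[OF assms(1)]) blast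
 have "det (jac tht p) ~= 0"
  by (rule matrix_ker_trivial) (use 1(3) in "simp add: jac_def")
 then obtain Psi rho where 2: "rho > 0" "Psi 0 = p" "!!z b. norm z < rho ==> tht b (Psi z) = z $ b"
  "open (Psi ` ball 0 rho)" "!!z. norm z < rho ==> det (jac tht (Psi z)) ~= 0"
  "!!z. norm z < rho ==> (Psi has_derivative
    (%h. \<chi> i. \<Sum>b\<in>UNIV. h $ b * cofield tht b i (Psi z) / det (jac tht (Psi z)))) (at z)"
  by (rule local_inverse[OF 1(1,2)]) blast
 have "chart M p n X tht J idx Psi rho (cofield tht) (%x. det (jac tht x))"
  by (unfold_locales; fact 1 2 assms rpf_cofield[OF 1(1)] rpf_det_jac[OF 1(1)])
 then show ?thesis by (rule that)
qed

end

lemma (in chart) chart_shrink: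
 assumes "0 < r" "r <= rho"
 shows "chart M p n X tht J idx Psi r D v"
proof (unfold_locales)
 have "Psi ` ball 0 r = Psi ` ball 0 rho \<inter> (%x. \<chi> b. tht b x) -` ball 0 r"
 proof -
  have "(\<chi> b. tht b (Psi z)) = z" if "norm z < rho" for z using tht_Psi[OF that] by (simp add: vec_eq_iff)
  then show ?thesis using assms by fastforce
 qed
 moreover have "open (Psi ` ball 0 rho \<inter> (%x. \<chi> b. tht b x) -` ball 0 r)"
  by (intro continuous_open_preimage open_U open_ball continuous_on_vec_lambda rpf_continuous tht)
 ultimately show "open (Psi ` ball 0 r)" by simp
 show "v (Psi z) ~= 0" if "norm z < r" for z using v_nz[of z] that assms(2) by simp
qed (use assms in "auto intro: tht tht_p grad[THEN equalityD2, THEN subsetD] off idx prime alg chain Psi_0 tht_Psi rpf_D rpf_v Psi_deriv ")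

lemma (in chart) chart_small:
 assumes "open N" "p : N"
 shows "EX r. chart M p n X tht J idx Psi r D v & r <= 1 & r <= rho & Psi ` ball 0 r \<subseteq> N"
proof -
 have "isCont Psi 0" using Psi_cont rho by simp
 moreover have "Psi 0 : N" using assms Psi_0 by simp
 ultimately obtain d where d: "d > 0" "Psi ` ball 0 d \<subseteq> N"
  using assms(1) by (metis continuous_at_ball open_contains_ball subset_trans)
 have "chart M p n X tht J idx Psi (min (min 1 d) rho) D v" by (rule chart_shrink) (use d rho in auto)
 then show ?thesis using d(2) by (intro exI[of _ "min (min 1 d) rho"]) auto
qed

subsection \<open>Atlases adapted to normal crossings\<close>

lemma (in localized) fr_pow:
 assumes L: "cring L" and "rpf f" "den g"
 shows "fr f g [^]\<^bsub>L\<^esub> (k::nat) = fr (%x. f x ^ k) (%x. g x ^ k)"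
proof (induction k)
 case 0
 then show ?case by (simp add: one_fr)
next
 case (Suc k)
 have "fr f g [^]\<^bsub>L\<^esub> Suc k = fr f g [^]\<^bsub>L\<^esub> k \<otimes>\<^bsub>L\<^esub> fr f g"
  by simp
 also have "... = fr (%x. f x ^ k * f x) (%x. g x ^ k * g x)"
  unfolding Suc.IH by (intro mult_fr assms den_power rpf_intros)
 finally show ?case by (simp add: mult.commute)
qed

lemma (in localized) fr_finprod:
 assumes L: "cring L" and "finite K" "!!k. k : K ==> rpf (f k) & den (g k)"
 shows "(\<Otimes>\<^bsub>L\<^esub>k\<in>K. fr (f k) (g k)) = fr (%x. \<Prod>k\<in>K. f k x) (%x. \<Prod>k\<in>K. g k x)"
 using assms(2,3)
proof (induction K rule: finite_induct)
 case empty
 interpret L: cring L by (rule L)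
 show ?case by (simp add: one_fr)
next
 case (insert k K)
 interpret L: cring L by (rule L)
 have "(\<Otimes>\<^bsub>L\<^esub>k\<in>insert k K. fr (f k) (g k)) = fr (f k) (g k) \<otimes>\<^bsub>L\<^esub> (\<Otimes>\<^bsub>L\<^esub>k\<in>K. fr (f k) (g k))"
  using insert by (intro L.finprod_insert) (auto intro: carrier_fr)
 also have "... = fr (%x. f k x * (\<Prod>k\<in>K. f k x)) (%x. g k x * (\<Prod>k\<in>K. g k x))"
 proof -
  have "(\<Otimes>\<^bsub>L\<^esub>k\<in>K. fr (f k) (g k)) = fr (%x. \<Prod>k\<in>K. f k x) (%x. \<Prod>k\<in>K. g k x)"
   using insert by blast
  moreover have "rpf (%x. \<Prod>k\<in>K. f k x)" using insert by (intro rpf_intros) auto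
  moreover have "den (%x. \<Prod>k\<in>K. g k x)" using insert by (intro den_prod) auto
  ultimately show ?thesis using insert.prems[of k] by (simp add: mult_fr)
 qed
 finally show ?case using insert by simp
qed

lemma nonsingular_local:
 fixes M :: "(real ^ 'n) set"
 assumes irr: "irreducible_algebraic_set M" "nonsingular M" "normal_crossings M F"
  and F: "!!f. f : F ==> rpf f" and p: "p : M"
 shows "EX n X. alg_dim M = enat n & param_point M p n X &
  (EX P. (ALL i<=n. polyprime M (P i) & (ALL f:P i. f p = 0)) & (ALL i<n. P i \<subset> P (Suc i))) &
  (ALL f:F. EX kap u m. rpf kap & kap p ~= 0 & rpf u & u p ~= 0 &
    (ALL x:M. kap x * f x = u x * (\<Prod>j<n. X j x ^ m j)))"
proof -
 have *: "regular_local_ring (local_ring_at M {p})" "krull_dim (local_ring_at M {p}) = alg_dim M"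
  using irr(2) p unfolding nonsingular_def by blast+
 interpret local_point M p
 proof (intro local_point.intro localized.intro local_point_axioms.intro)
  show "primeset M" by (rule irreducible_primeset[OF irr(1)])
  show "primeset {p}" by (rule primeset_singleton)
  show "{p} \<subseteq> M" using p by simp
  show "cring (local_ring_at M {p})" "EX! m. maximalideal m (local_ring_at M {p})"
   using *(1) unfolding regular_local_ring_def local_ring_def by blast+
 qed
 obtain xs where xs: "regular_system_of_parameters L xs"
  and nc: "!!f. f : F ==> EX a:Units L. EX m :: nat => nat. loc_map R J (restrict f M) =
    a \<otimes>\<^bsub>L\<^esub> (\<Otimes>\<^bsub>L\<^esub>i\<in>{..<length xs}. (xs ! i) [^]\<^bsub>L\<^esub> m i)"
  using irr(3) p unfolding normal_crossings_def Let_def by blast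
 have car: "set xs \<subseteq> carrier L" and kd: "krull_dim L = enat (length xs)"
  and mx: "maximalideal (Idl\<^bsub>L\<^esub> (set xs)) L"
  using xs unfolding regular_system_of_parameters_def by auto
 define n where "n = length xs"
 have "EX f g. rpf f & den g & xs ! j = fr f g" if "j < length xs" for j
 proof -
  have "xs ! j : carrier L" using car nth_mem[OF that] by (rule subsetD)
  then obtain f g where "rpf f" "den g" "xs ! j = fr f g" by (rule carrier_frE)
  then show ?thesis by (intro exI conjI)
 qed
 then have "ALL j:{..<length xs}. EX f g. rpf f & den g & xs ! j = fr f g" by blast
 from bchoice[OF this] obtain X where "ALL j:{..<length xs}. EX g. rpf (X j) & den g & xs ! j = fr (X j) g" ..
 from bchoice[OF this] obtain Y where "ALL j:{..<length xs}. rpf (X j) & den (Y j) & xs ! j = fr (X j) (Y j)" ..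
 then have X: "!!j. j < length xs ==> rpf (X j) & den (Y j) & xs ! j = fr (X j) (Y j)" by blast
 have noe: "noetherian_ring L" using *(1) unfolding regular_local_ring_def by blast
 show ?thesis
 proof (intro exI[of _ n] exI[of _ X] conjI ballI)
  show "alg_dim M = enat n" using *(2) kd by (simp add: n_def)
  show "param_point M p n X"
   using p noetherian_acc[OF noe] X maximal_generators[OF mx car X]
   unfolding n_def by unfold_locales blast+
  show "EX P. (ALL i<=n. polyprime M (P i) & (ALL f:P i. f p = 0)) & (ALL i<n. P i \<subset> P (Suc i))"
   by (rule poly_chain) (simp add: kd n_def)
  fix f assume f: "f : F"
  obtain a m where am: "a : Units L" "loc_map R J (restrict f M) =
    a \<otimes>\<^bsub>L\<^esub> (\<Otimes>\<^bsub>L\<^esub>i\<in>{..<length xs}. (xs ! i) [^]\<^bsub>L\<^esub> (m i :: nat))" using nc[OF f] by blast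
  have "a : carrier L" using am(1) by (simp add: Units_def)
  then obtain u w where u: "rpf u" "den w" "a = fr u w" by (rule carrier_frE)
  have up: "u p ~= 0" using unit_nonzero am(1) u by blast
  interpret L: cring L by (rule ring)
  have "(\<Otimes>\<^bsub>L\<^esub>i\<in>{..<length xs}. (xs ! i) [^]\<^bsub>L\<^esub> m i) = (\<Otimes>\<^bsub>L\<^esub>i\<in>{..<length xs}. fr (%x. X i x ^ m i) (%x. Y i x ^ m i))"
   using X by (intro L.finprod_cong') (auto simp: fr_pow[OF ring] intro!: carrier_fr rpf_intros den_power)
  also have "... = fr (%x. \<Prod>i<n. X i x ^ m i) (%x. \<Prod>i<n. Y i x ^ m i)"
   unfolding n_def using X by (intro fr_finprod[OF ring]) (auto intro!: rpf_intros den_power)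
  finally have *: "(\<Otimes>\<^bsub>L\<^esub>i\<in>{..<length xs}. (xs ! i) [^]\<^bsub>L\<^esub> m i) = fr (%x. \<Prod>i<n. X i x ^ m i) (%x. \<Prod>i<n. Y i x ^ m i)" .
  have eq: "fr f (%x. 1) = fr (%x. u x * (\<Prod>i<n. X i x ^ m i)) (%x. w x * (\<Prod>i<n. Y i x ^ m i))"
  proof -
   have "rpf (%x. \<Prod>i<n. X i x ^ m i)" using X by (intro rpf_intros) (auto simp: n_def)
   moreover have "den (%x. \<Prod>i<n. Y i x ^ m i)" using X by (intro den_prod den_power) (auto simp: n_def)
   ultimately show ?thesis
    using am(2) mult_fr[OF u(1,2)] unfolding loc_map_fr u(3) * by simp
  qed
  have dY: "den (%x. w x * (\<Prod>i<n. Y i x ^ m i))"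
   using X u(2) by (intro den_mult den_prod den_power) (auto simp: n_def)
  have rX: "rpf (%x. u x * (\<Prod>i<n. X i x ^ m i))"
   using X u(1) by (intro rpf_intros) (auto simp: n_def)
  from eq F[OF f] rX dY have "ALL x:M. f x * (w x * (\<Prod>i<n. Y i x ^ m i)) = u x * (\<Prod>i<n. X i x ^ m i) * 1"
   by (subst (asm) fr_eq_iff) auto
  then show "EX kap u m. rpf kap & kap p ~= 0 & rpf u & u p ~= 0 & (ALL x:M. kap x * f x = u x * (\<Prod>j<n. X j x ^ m j))"
   using dY u(1) up unfolding den_iff
   by (intro exI[of _ "%x. w x * (\<Prod>i<n. Y i x ^ m i)"] exI[of _ u] exI[of _ m]) (simp add: mult.commute)
 qed
qed

lemma (in chart) sign_constant:
 assumes u: "rpf u" and nz: "!!z. norm z < rho ==> u (Psi z) ~= 0" and z: "norm z < rho" "norm z' < rho"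
 shows "sgn (u (Psi z)) = sgn (u (Psi z'))"
proof (rule ccontr)
 assume ne: "sgn (u (Psi z)) ~= sgn (u (Psi z'))"
 have "connected ((%z. u (Psi z)) ` ball 0 rho)"
  by (intro connected_continuous_image rpf_comp_continuous_on u connected_ball)
 moreover have "u (Psi z) : (%z. u (Psi z)) ` ball 0 rho" "u (Psi z') : (%z. u (Psi z)) ` ball 0 rho"
  using z by auto
 moreover have "(u (Psi z) <= 0 & 0 <= u (Psi z')) | (u (Psi z') <= 0 & 0 <= u (Psi z))"
  using ne by (auto simp: sgn_if split: if_splits)
 ultimately have "0 : (%z. u (Psi z)) ` ball 0 rho"
  unfolding connected_iff_interval by blast
 with nz show False by auto
qed

lemma sgn_power_cong: "sgn a = sgn b ==> sgn (a ^ k) = sgn (b ^ k)" for a b :: real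
 by (induction k) (simp_all add: sgn_mult)

lemma sgn_prod_cong: "(!!b. b : K ==> sgn (f b) = sgn (g b)) ==> sgn (\<Prod>b\<in>K. f b) = sgn (\<Prod>b\<in>K. g b)"
 for f g :: "'b => real"
 by (induction K rule: infinite_finite_induct) (simp_all add: sgn_mult)

lemma sign_combination_cong:
 assumes "sign_combination F S" "!!f. f : F ==> sgn (f x) = sgn (f y)"
 shows "x : S \<longleftrightarrow> y : S"
 using assms(1)
proof induction
 case (pos f)
 then show ?case using assms(2)[of f] by (auto simp: sgn_if split: if_splits)
next
 case (zero f)
 then show ?case using assms(2)[of f] by (auto simp: sgn_if split: if_splits)
next
 case (neg f)
 then show ?case using assms(2)[of f] by (auto simp: sgn_if split: if_splits)
qed auto

text \<open>\<open>signs\<close> says that in a chart membership in \<open>A\<close> or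
  \<open>B\<close> depends only on the signs of the coordinates. \<open>h0\<close> vanishes on both
  frontiers and is in every chart a unit times a monomial, which confines the walls to coordinate
  hypersurfaces. Radii at most \<open>1\<close> keep the coordinates in the range where higher
  powers are smaller.\<close>

locale atlas =
 fixes M A B :: "(real ^ 'n) set" and n :: nat and h0 :: "real ^ 'n => real"
  and tht :: "real ^ 'n => 'n => real ^ 'n => real" and J :: "real ^ 'n => 'n set"
  and Psi :: "real ^ 'n => real ^ 'n => real ^ 'n" and rho :: "real ^ 'n => real"
 assumes prime: "primeset M" and alg: "algebraic_set M" and dim: "alg_dim M = enat n" and cpt: "compact M"
  and charts: "!!p. p : M ==> EX X idx D v. chart M p n X (tht p) (J p) idx (Psi p) (rho p) D v"
  and rho_le: "!!p. p : M ==> rho p <= 1"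
  and signs: "!!p S z z'. p : M ==> S = A | S = B ==> z : slice (J p) ==> z' : slice (J p) ==>
    norm z < rho p ==> norm z' < rho p ==> (!!b. b : J p ==> sgn (z $ b) = sgn (z' $ b)) ==>
    Psi p z : S ==> Psi p z' : S"
  and AM: "A \<subseteq> M" and BM: "B \<subseteq> M" and oA: "openin (top_of_set M) A" and oB: "openin (top_of_set M) B"
  and disj: "A \<inter> B = {}"
  and h0: "rpf h0" "!!x. x : top_of_set M frontier_of A \<union> top_of_set M frontier_of B ==> h0 x = 0"
  and h0_local: "!!p. p : M ==> EX kap u m. rpf kap & rpf u & (ALL z. norm z < rho p --> kap (Psi p z) ~= 0 & u (Psi p z) ~= 0)
    & (ALL x:M. kap x * h0 x = u x * (\<Prod>b\<in>J p. tht p b x ^ m b))"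

text \<open>Where no member of \<open>F\<close> vanishes, all signs are locally constant, so near
  such a point the set is everything or nothing.\<close>

lemma frontier_of_sign_combination:
 fixes M :: "(real ^ 'n) set"
 assumes "sign_combination F S" "finite F" "!!f. f : F ==> rpf f"
  and x: "x : top_of_set M frontier_of (M \<inter> S)"
 shows "(\<Prod>f\<in>F. f x) = 0"
proof (rule ccontr)
 assume nz: "(\<Prod>f\<in>F. f x) ~= 0"
 have xM: "x : M" using frontier_of_subset_topspace[of "top_of_set M" "M \<inter> S"] x by auto
 define N where "N = M \<inter> (\<Inter>f\<in>F. {y. f y * f x > 0})"
 have "open (\<Inter>f\<in>F. {y. f y * f x > 0})"
  using assms(2,3) by (intro open_INT ballI open_Collect_less continuous_on_mult continuous_on_const rpf_continuous) auto
 then have N: "openin (top_of_set M) N" unfolding N_def by (rule openin_open_Int)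
 have fx: "f x ~= 0" if "f : F" for f using nz that assms(2) by (meson prod_zero)
 have xN: "x : N" using xM fx by (auto simp: N_def zero_less_mult_iff not_less_iff_gr_or_eq)
 have same: "y : S \<longleftrightarrow> x : S" if "y : N" for y
 proof (rule sign_combination_cong[OF assms(1)])
  fix f assume "f : F"
  with that have "f y * f x > 0" by (simp add: N_def)
  then show "sgn (f y) = sgn (f x)" by (auto simp: zero_less_mult_iff)
 qed
 have "x : top_of_set M closure_of (M \<inter> S)" "x ~: top_of_set M interior_of (M \<inter> S)"
  using x by (auto simp: frontier_of_def)
 show False
 proof (cases "x : S")
  case True
  then have "N \<subseteq> M \<inter> S" using same by (auto simp: N_def)
  then have "x : top_of_set M interior_of (M \<inter> S)" using N xN interior_of_maximal by blast
  then show False using x by (simp add: frontier_of_def)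
 next
  case False
  have "x : top_of_set M closure_of (M \<inter> S)" using x by (simp add: frontier_of_def)
  then obtain y where "y : M \<inter> S" "y : N" using N xN unfolding in_closure_of by blast
  then show False using same False by blast
 qed
qed

lemma atlas_exists:
 fixes M A B :: "(real ^ 'n) set"
 assumes M: "irreducible_algebraic_set M" "compact M" "nonsingular M"
  and A: "openin (top_of_set M) A" and B: "openin (top_of_set M) B" and AB: "A \<inter> B = {}"
  and nc: "walls_at_normal_crossings M A B"
 obtains n h0 tht J Psi rho where "atlas M A B n h0 tht J Psi rho"
proof -
 obtain F where F: "finite F" "!!f. f : F ==> rpf f" "normal_crossings M F" "described_by M F A" "described_by M F B"
  using nc unfolding walls_at_normal_crossings_def by blast
 obtain SA SB where S: "sign_combination F SA" "A = M \<inter> SA" "sign_combination F SB" "B = M \<inter> SB"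
  using F(4,5) unfolding described_by_def by blast
 have pM: "primeset M" by (rule irreducible_primeset[OF M(1)])
 have aM: "algebraic_set M" "M ~= {}" using M(1) by (auto simp: irreducible_algebraic_set_def)
 then obtain p0 where p0: "p0 : M" by blast
 obtain n where n: "alg_dim M = enat n"
  using nonsingular_local[OF M(1,3) F(3,2) p0] by blast
 define good where "good p q \<longleftrightarrow> (case q of (tht, J, Psi, rho) =>
   (EX X idx D v. chart M p n X tht J idx Psi rho D v) & rho <= 1 &
   (ALL f:F. EX kap u m. rpf kap & rpf u & (ALL z. norm z < rho --> kap (Psi z) ~= 0 & u (Psi z) ~= 0)
    & (ALL x:M. kap x * f x = u x * (\<Prod>b\<in>J. tht b x ^ m b))))" for p and q :: "('n => real ^ 'n => real) \<times> 'n set \<times> (real ^ 'n => real ^ 'n) \<times> real"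
 have "EX q. good p q" if p: "p : M" for p
 proof -
  obtain n' X where n': "alg_dim M = enat n'" and pp: "param_point M p n' X"
   and ch: "EX P. (ALL i<=n'. polyprime M (P i) & (ALL f:P i. f p = 0)) & (ALL i<n'. P i \<subset> P (Suc i))"
   and fac: "ALL f:F. EX kap u m. rpf kap & kap p ~= 0 & rpf u & u p ~= 0 &
    (ALL x:M. kap x * f x = u x * (\<Prod>j<n'. X j x ^ m j))"
   using nonsingular_local[OF M(1,3) F(3,2) p] by blast
  have [simp]: "n' = n" using n n' by simp
  have "ALL f:F. EX kap u m. rpf kap & kap p ~= 0 & rpf u & u p ~= 0 & (ALL x:M. kap x * f x = u x * (\<Prod>j<n. X j x ^ m j))"
   using fac by simp
  from bchoice[OF this] obtain kap where
   "ALL f:F. EX u m. rpf (kap f) & kap f p ~= 0 & rpf u & u p ~= 0 & (ALL x:M. kap f x * f x = u x * (\<Prod>j<n. X j x ^ m j))" ..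
  from bchoice[OF this] obtain u where
   "ALL f:F. EX m. rpf (kap f) & kap f p ~= 0 & rpf (u f) & u f p ~= 0 & (ALL x:M. kap f x * f x = u f x * (\<Prod>j<n. X j x ^ m j))" ..
  from bchoice[OF this] obtain m where
   fac: "ALL f:F. rpf (kap f) & kap f p ~= 0 & rpf (u f) & u f p ~= 0 & (ALL x:M. kap f x * f x = u f x * (\<Prod>j<n. X j x ^ m f j))" ..
  obtain tht J idx Psi r D v where c: "chart M p n X tht J idx Psi r D v"
   by (rule param_point.chart_exists[OF pp pM aM(1) ch]) (simp only: \<open>n' = n\<close>)
  \<comment> \<open>On this neighbourhood the units in all factorisations remain non-zero; the chart
    is shrunk into it.\<close>
  define N where "N = (\<Inter>f\<in>F. {x. kap f x * u f x ~= 0})"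
  have "open N" unfolding N_def
   using fac F(1) by (intro open_INT ballI open_Collect_neq continuous_on_mult continuous_on_const rpf_continuous) auto
  moreover have "p : N" using fac by (simp add: N_def)
  ultimately obtain rho where rho: "chart M p n X tht J idx Psi rho D v" "rho <= 1" "Psi ` ball 0 rho \<subseteq> N"
   using chart.chart_small[OF c] by blast
  interpret c: chart M p n X tht J idx Psi rho D v by (rule rho(1))
  \<comment> \<open>By the dimension count every parameter is one of the coordinates, so monomials
    in the \<open>X j\<close> are monomials in the \<open>tht b\<close>.\<close>
  have bij: "bij_betw idx J {..<n}"
   unfolding bij_betw_def
  proof
   show "idx ` J = {..<n}"
    using c.idx(2) by (intro card_subset_eq) (auto simp: card_image[OF c.idx(1)] c.card_J)
  qed (rule c.idx(1))
  have prod: "(\<Prod>j<n. X j x ^ m f j) = (\<Prod>b\<in>J. tht b x ^ m f (idx b))" for f x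
   by (subst prod.reindex_bij_betw[OF bij, symmetric]) (simp add: c.idx(3))
  have "good p (tht, J, Psi, rho)"
   unfolding good_def prod.case
  proof (intro conjI ballI)
   show "EX X idx D v. chart M p n X tht J idx Psi rho D v" using rho(1) by blast
   fix f assume f: "f : F"
   have "kap f (Psi z) ~= 0 & u f (Psi z) ~= 0" if "norm z < rho" for z
    using rho(3) that f by (auto simp: N_def image_subset_iff)
   with fac f show "EX kap u m. rpf kap & rpf u & (ALL z. norm z < rho --> kap (Psi z) ~= 0 & u (Psi z) ~= 0)
    & (ALL x:M. kap x * f x = u x * (\<Prod>b\<in>J. tht b x ^ m b))"
    by (intro exI[of _ "kap f"] exI[of _ "u f"] exI[of _ "%b. m f (idx b)"]) (simp add: prod)
  qed (rule rho(2))
  then show ?thesis ..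
 qed
 then obtain q where q: "!!p. p : M ==> good p (q p)" by metis
 define tht where "tht p = fst (q p)" for p
 define J where "J p = fst (snd (q p))" for p
 define Psi where "Psi p = fst (snd (snd (q p)))" for p
 define rho where "rho p = snd (snd (snd (q p)))" for p
 have g: "EX X idx D v. chart M p n X (tht p) (J p) idx (Psi p) (rho p) D v" "rho p <= 1"
  "ALL f:F. EX kap u m. rpf kap & rpf u & (ALL z. norm z < rho p --> kap (Psi p z) ~= 0 & u (Psi p z) ~= 0)
    & (ALL x:M. kap x * f x = u x * (\<Prod>b\<in>J p. tht p b x ^ m b))" if "p : M" for p
  using q[OF that] unfolding good_def tht_def J_def Psi_def rho_def by (auto simp: split_def)
 have "atlas M A B n (%x. \<Prod>f\<in>F. f x) tht J Psi rho"
 proof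
  fix p S z z' assume p: "p : M" and SS: "S = A | S = B"
   and z: "z : slice (J p)" "z' : slice (J p)" "norm z < rho p" "norm z' < rho p"
   and sg: "!!b. b : J p ==> sgn (z $ b) = sgn (z' $ b)" and zS: "Psi p z : S"
  obtain X idx D v where "chart M p n X (tht p) (J p) idx (Psi p) (rho p) D v" using g(1)[OF p] by blast
  then interpret c: chart M p n X "tht p" "J p" idx "Psi p" "rho p" D v .
  have zM: "Psi p z : M" "Psi p z' : M" using c.M_slice z by auto
  have "sgn (f (Psi p z)) = sgn (f (Psi p z'))" if f: "f : F" for f
  proof -
   from bspec[OF g(3)[OF p] f] obtain kap u m where k0: "rpf kap & rpf u &
    (ALL z. norm z < rho p --> kap (Psi p z) ~= 0 & u (Psi p z) ~= 0) &
    (ALL x:M. kap x * f x = u x * (\<Prod>b\<in>J p. tht p b x ^ m b))" by (elim exE)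
   then have k: "rpf kap" "rpf u" "!!z. norm z < rho p ==> kap (Psi p z) ~= 0 & u (Psi p z) ~= 0"
    "!!x. x : M ==> kap x * f x = u x * (\<Prod>b\<in>J p. tht p b x ^ m b)" by simp_all
   have "sgn (kap (Psi p z)) * sgn (f (Psi p z)) = sgn (kap (Psi p z')) * sgn (f (Psi p z'))"
    unfolding sgn_mult[symmetric] k(4)[OF zM(1)] k(4)[OF zM(2)]
   proof (subst (1 2) sgn_mult, rule arg_cong2[where f = "(*)"])
    show "sgn (u (Psi p z)) = sgn (u (Psi p z'))" using c.sign_constant[OF k(2) _ z(3,4)] k(3) by blast
    show "sgn (\<Prod>b\<in>J p. tht p b (Psi p z) ^ m b) = sgn (\<Prod>b\<in>J p. tht p b (Psi p z') ^ m b)"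
     by (intro sgn_prod_cong sgn_power_cong) (simp add: c.tht_Psi z sg)
   qed
   moreover have "sgn (kap (Psi p z)) = sgn (kap (Psi p z'))" using c.sign_constant[OF k(1) _ z(3,4)] k(3) by blast
   moreover have "sgn (kap (Psi p z)) ~= 0" using k(3)[OF z(3)] by (simp add: sgn_0_0)
   ultimately show ?thesis by simp
  qed
  then have "Psi p z : SA \<longleftrightarrow> Psi p z' : SA" "Psi p z : SB \<longleftrightarrow> Psi p z' : SB"
   by (intro sign_combination_cong[OF S(1)] sign_combination_cong[OF S(3)]; blast)+
  with SS zS zM S(2,4) show "Psi p z' : S" by auto
 next
  fix x assume "x : top_of_set M frontier_of A \<union> top_of_set M frontier_of B"
  then show "(\<Prod>f\<in>F. f x) = 0"
   using frontier_of_sign_combination[OF S(1) F(1,2)] frontier_of_sign_combination[OF S(3) F(1,2)] S(2,4) by auto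
 next
  fix p assume p: "p : M"
  from bchoice[OF g(3)[OF p]] obtain kap where "ALL f:F. EX u m. rpf (kap f) & rpf u & (ALL z. norm z < rho p --> kap f (Psi p z) ~= 0 & u (Psi p z) ~= 0)
    & (ALL x:M. kap f x * f x = u x * (\<Prod>b\<in>J p. tht p b x ^ m b))" ..
  from bchoice[OF this] obtain u where "ALL f:F. EX m. rpf (kap f) & rpf (u f) & (ALL z. norm z < rho p --> kap f (Psi p z) ~= 0 & u f (Psi p z) ~= 0)
    & (ALL x:M. kap f x * f x = u f x * (\<Prod>b\<in>J p. tht p b x ^ m b))" ..
  from bchoice[OF this] obtain m where k: "ALL f:F. rpf (kap f) & rpf (u f) & (ALL z. norm z < rho p --> kap f (Psi p z) ~= 0 & u f (Psi p z) ~= 0)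
    & (ALL x:M. kap f x * f x = u f x * (\<Prod>b\<in>J p. tht p b x ^ m f b))" ..
  have "(\<Prod>f\<in>F. kap f x) * (\<Prod>f\<in>F. f x) = (\<Prod>f\<in>F. u f x) * (\<Prod>b\<in>J p. tht p b x ^ (\<Sum>f\<in>F. m f b))" if "x : M" for x
  proof -
   have "(\<Prod>f\<in>F. kap f x) * (\<Prod>f\<in>F. f x) = (\<Prod>f\<in>F. u f x * (\<Prod>b\<in>J p. tht p b x ^ m f b))"
    unfolding prod.distrib[symmetric] using k that by (intro prod.cong) auto
   also have "... = (\<Prod>f\<in>F. u f x) * (\<Prod>b\<in>J p. \<Prod>f\<in>F. tht p b x ^ m f b)"
    unfolding prod.distrib by (subst prod.swap) simp
   finally show ?thesis by (simp add: power_sum)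
  qed
  then show "EX kap u m. rpf kap & rpf u & (ALL z. norm z < rho p --> kap (Psi p z) ~= 0 & u (Psi p z) ~= 0)
    & (ALL x:M. kap x * (\<Prod>f\<in>F. f x) = u x * (\<Prod>b\<in>J p. tht p b x ^ m b))"
   using k F(1)
   by (intro exI[of _ "%x. \<Prod>f\<in>F. kap f x"] exI[of _ "%x. \<Prod>f\<in>F. u f x"] exI[of _ "%b. \<Sum>f\<in>F. m f b"])
    (auto intro!: rpf_intros)
 qed (use pM aM n M A B AB S F g in "auto intro!: rpf_intros")
 then show ?thesis by (rule that)
qed

subsection \<open>Strata\<close>

text \<open>A non-zero leading form is non-zero at some point of any open orthant, and along the ray
  through it the function could not be zero.\<close>

lemma (in chart) orthant_flat:
 assumes f: "rpf f" and \<sigma>: "!!c. c : K ==> \<sigma> c ~= (0::real)"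
  and 0: "!!z. z : slice K ==> norm z < d ==> (!!c. c : K ==> sgn (z $ c) = sgn (\<sigma> c)) ==> f (Psi z) = 0"
  and d: "d > 0"
 shows "flat K f"
proof (rule ccontr)
 assume nf: "\<not> flat K f"
 obtain k q a C d' where q: "hom k q" "a : slice K" "q a ~= 0" "C > 0" "d' > 0"
  "!!z. z : slice K ==> norm z < d' ==> \<bar>f (Psi z) - q z\<bar> <= C * norm z ^ Suc k"
  by (rule not_flat_form[OF f nf]) blast
 define z0 :: "real ^ 'n" where "z0 = (\<chi> c. if c : K then \<sigma> c else 0)"
 have z0: "z0 : slice K" by (simp add: z0_def slice_def)
 define U where "U = (\<Inter>c\<in>K. {z :: real ^ 'n. z $ c * \<sigma> c > 0})"
 have oU: "open U" unfolding U_def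
  by (intro open_INT ballI open_Collect_less continuous_intros) auto
 have zU: "z0 : U" using \<sigma> by (auto simp: U_def z0_def zero_less_mult_iff not_less_iff_gr_or_eq)
 obtain t where t: "z0 + t *\<^sub>R (a - z0) : U" "q (z0 + t *\<^sub>R (a - z0)) ~= 0"
  using rpf_dense[of q a U z0] q(1,3) oU zU by (auto simp: hom_def)
 define z where "z = z0 + t *\<^sub>R (a - z0)"
 have z: "z : slice K" "q z ~= 0" "z : U" using t slice_line[OF z0 q(2)] by (auto simp: z_def)
 have sz: "sgn ((s *\<^sub>R z) $ c) = sgn (\<sigma> c)" if "s > 0" "c : K" for s c
  using z(3) that by (auto simp: U_def sgn_mult zero_less_mult_iff dest!: bspec[of _ _ c])
 have bd: "\<bar>q z\<bar> <= s * (C * norm z ^ Suc k)" if s: "0 < s" "s * norm z < min d d'" for s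
 proof -
  have n: "norm (s *\<^sub>R z) < d" "norm (s *\<^sub>R z) < d'" using s by simp_all
  have "f (Psi (s *\<^sub>R z)) = 0" by (rule 0[OF slice_scale[OF z(1)] n(1) sz[OF s(1)]])
  with q(6)[OF slice_scale[OF z(1)] n(2)] have "\<bar>q (s *\<^sub>R z)\<bar> <= C * norm (s *\<^sub>R z) ^ Suc k" by simp
  then have "s ^ k * \<bar>q z\<bar> <= C * (s * norm z) ^ Suc k"
   using q(1) s(1) by (simp add: hom_def abs_mult power_abs)
  also have "... = s ^ k * (s * (C * norm z ^ Suc k))" by (simp add: power_mult_distrib mult_ac)
  finally show ?thesis using s(1) by simp
 qed
 have ev: "eventually (%s. \<bar>q z\<bar> <= s * (C * norm z ^ Suc k)) (at_right 0)"
  unfolding eventually_at_right_field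
 proof (intro exI[of _ "min d d' / (norm z + 1)"] conjI allI impI)
  show "0 < min d d' / (norm z + 1)" using q(5) d by (intro divide_pos_pos) (auto intro: add_nonneg_pos)
  fix s assume s: "0 < s" "s < min d d' / (norm z + 1)"
  then have "s * (norm z + 1) < min d d'" by (simp add: pos_less_divide_eq add_nonneg_pos)
  then have "s * norm z < min d d'" using s(1) by (simp add: ring_distribs)
  then show "\<bar>q z\<bar> <= s * (C * norm z ^ Suc k)" by (rule bd[OF s(1)])
 qed
 have "((%s. s * (C * norm z ^ Suc k)) \<longlongrightarrow> 0 * (C * norm z ^ Suc k)) (at_right 0)"
  by (intro tendsto_intros)
 from tendsto_lowerbound[OF this ev] have "\<bar>q z\<bar> <= 0" by simp
 with z(2) show False by simp
qed

lemma primeset_prod: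
 assumes W: "primeset W" and "finite K" "!!k. k : K ==> rpf (f k)" "!!x. x : W ==> (\<Prod>k\<in>K. f k x) = 0"
 shows "EX k:K. ALL x:W. f k x = 0"
 using assms(2-4)
proof (induction K rule: finite_induct)
 case empty
 then show ?case using W by (auto simp: primeset_def)
next
 case (insert k K)
 have "(ALL x:W. f k x = 0) | (ALL x:W. (\<Prod>k\<in>K. f k x) = 0)"
  by (rule primesetD[OF W]) (use insert in "auto intro!: rpf_intros")
 with insert show ?case by auto
qed

lemma polyprime_ideal:
 assumes "primeset Z" "Z \<subseteq> V"
 shows "polyprime V {f. rpf f & (ALL x:Z. f x = 0)}"
 unfolding polyprime_def
proof (intro conjI allI ballI impI subsetI)
 fix f :: "real ^ 'a => real" assume "f : {f. rpf f & (ALL x:Z. f x = 0)}"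
 then show "EX x:V. f x = 0" using assms by (auto simp: primeset_def)
next
 fix f g assume "rpf f & rpf g & (%x. f x * g x) : {f. rpf f & (ALL x:Z. f x = 0)}"
 then have fg: "rpf f" "rpf g" "!!x. x : Z ==> f x * g x = 0" by simp_all
 from primesetD[OF assms(1) fg] fg(1,2)
 show "f : {f. rpf f & (ALL x:Z. f x = 0)} | g : {f. rpf f & (ALL x:Z. f x = 0)}" by simp
qed (use assms in "auto intro: rpf_intros")

lemma irreducible_if_primeset:
 fixes V :: "(real ^ 'n) set"
 assumes "primeset V" "algebraic_set V"
 shows "irreducible_algebraic_set V"
 unfolding irreducible_algebraic_set_def
proof (intro conjI allI impI)
 show "V ~= {}" using assms(1) by (simp add: primeset_def)
 fix V1 V2 :: "(real ^ 'n) set" assume V: "algebraic_set V1 & algebraic_set V2 & V = V1 \<union> V2"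
 obtain P1 P2 where P: "ALL q:P1. rpf q" "V1 = {x. ALL q:P1. q x = 0}" "ALL q:P2. rpf q" "V2 = {x. ALL q:P2. q x = 0}"
  using V unfolding algebraic_set_def by blast
 show "V = V1 | V = V2"
 proof (rule ccontr)
  assume "\<not> ?thesis"
  then obtain x y where "x : V" "x ~: V1" "y : V" "y ~: V2" using V by blast
  then obtain f g where fg: "f : P1" "f x ~= 0" "g : P2" "g y ~= 0" using P by blast
  have "f u * g u = 0" if "u : V" for u using that V P fg by auto
  moreover have "rpf f" "rpf g" using fg P(1,3) by simp_all
  ultimately have "(ALL u:V. f u = 0) | (ALL u:V. g u = 0)" by (intro primesetD[OF assms(1)])
  with fg \<open>x : V\<close> \<open>y : V\<close> show False by auto
 qed
qed (rule assms(2))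

section \<open>Zariski closures of germs of strata\<close>

context atlas
begin

definition nul :: "real ^ 'n => 'n set => (real ^ 'n => real) => bool" where
 "nul p S f \<longleftrightarrow> rpf f & (ALL z:slice (J p - S). norm z < rho p --> f (Psi p z) = 0)"

text \<open>The Zariski closure of the germ at \<open>p\<close> of the coordinate stratum where the coordinates in
  \<open>S\<close> vanish.\<close>

definition C :: "real ^ 'n => 'n set => (real ^ 'n) set" where
 "C p S = {x. ALL f. nul p S f --> f x = 0}"

lemma chartE:
 assumes "p : M"
 obtains X idx D v where "chart M p n X (tht p) (J p) idx (Psi p) (rho p) D v"
 using charts[OF assms] by blast

lemma rho_pos: "p : M ==> rho p > 0"
 by (erule chartE) (rule chart.rho)

lemma rpf_tht: "p : M ==> rpf (tht p b)"
 by (erule chartE) (rule chart.tht)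

lemma Psi_0: "p : M ==> Psi p 0 = p"
 by (erule chartE) (rule chart.Psi_0)

lemma tht_Psi: "p : M ==> norm z < rho p ==> tht p b (Psi p z) = z $ b"
 by (erule chartE) (rule chart.tht_Psi)

lemma open_U: "p : M ==> open (Psi p ` ball 0 (rho p))"
 by (erule chartE) (rule chart.open_U)

lemma Psi_cont: "p : M ==> norm z < rho p ==> isCont (Psi p) z"
 by (erule chartE) (rule chart.Psi_cont)

lemma card_J: "p : M ==> card (J p) = n"
 by (erule chartE) (rule chart.card_J)

lemma M_slice: "p : M ==> norm z < rho p ==> Psi p z : M \<longleftrightarrow> z : slice (J p)"
 by (erule chartE) (rule chart.M_slice)

lemma nul_null:
 assumes "chart M p n X (tht p) (J p) idx (Psi p) (rho p) D v"
 shows "chart.null (Psi p) (rho p) (J p - S) f = nul p S f"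
 by (simp add: nul_def chart.null_def[OF assms])

lemma nul_rpf: "nul p S f ==> rpf f"
 by (simp add: nul_def)

lemma nul_mono: "S \<subseteq> T ==> nul p S f ==> nul p T f"
 unfolding nul_def slice_def by blast

lemma C_mono: "S \<subseteq> T ==> C p T \<subseteq> C p S"
 unfolding C_def using nul_mono by blast

lemma nul_M:
 assumes "p : M"
 shows "nul p {} f \<longleftrightarrow> rpf f & (ALL x:M. f x = 0)"
proof -
 obtain X idx D v where c: "chart M p n X (tht p) (J p) idx (Psi p) (rho p) D v" by (rule chartE[OF assms])
 show ?thesis using chart.null_J[OF c, of f] nul_null[OF c, of "{}" f] by simp
qed

lemma C_germ: "norm z < rho p ==> z : slice (J p - S) ==> Psi p z : C p S"
 by (auto simp: C_def nul_def)

lemma nul_C: "nul p S f \<longleftrightarrow> rpf f & (ALL x:C p S. f x = 0)"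
proof
 assume "nul p S f"
 then show "rpf f & (ALL x:C p S. f x = 0)" by (auto simp: C_def nul_def)
next
 assume "rpf f & (ALL x:C p S. f x = 0)"
 then show "nul p S f" using C_germ unfolding nul_def by blast
qed

lemma C_base: "p : M ==> p : C p S"
 using C_germ[of 0 p S] rho_pos[of p] Psi_0[of p] by simp

lemma C_empty: "p : M ==> C p {} = M"
proof
 assume p: "p : M"
 obtain Q where Q: "ALL q:Q. rpf q" "M = {x. ALL q:Q. q x = 0}" using alg unfolding algebraic_set_def by blast
 show "M \<subseteq> C p {}" using nul_M[OF p] by (auto simp: C_def)
 show "C p {} \<subseteq> M"
 proof
  fix x assume x: "x : C p {}"
  have "q x = 0" if "q : Q" for q
  proof -
   have "ALL y:M. q y = 0" using Q(2) that by blast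
   then have "nul p {} q" using nul_M[OF p] Q(1) that by blast
   then show ?thesis using x unfolding C_def by blast
  qed
  then show "x : M" using Q(2) by blast
 qed
qed

lemma C_M: "p : M ==> C p S \<subseteq> M"
 using C_empty[of p] C_mono[of "{}" S p] by simp

lemma C_alg: "algebraic_set (C p S)"
 unfolding algebraic_set_def
 by (intro exI[of _ "Collect (nul p S)"]) (auto simp: C_def nul_def)

lemma C_prime:
 assumes p: "p : M"
 shows "primeset (C p S)"
 unfolding primeset_def
proof (intro conjI allI impI)
 show "C p S ~= {}" using C_base[OF p] by blast
 fix f g :: "real ^ 'n => real" assume fg: "rpf f & rpf g & (ALL x:C p S. f x * g x = 0)"
 then have "nul p S (%x. f x * g x)" by (simp add: nul_C real_polynomial_function.intros(4))
 moreover obtain X idx D v where "chart M p n X (tht p) (J p) idx (Psi p) (rho p) D v" by (rule chartE[OF p])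
 ultimately have "nul p S f | nul p S g"
  using chart.null_prime[of M p n X "tht p" "J p" idx "Psi p" "rho p" D v f g "J p - S"] fg
  by (simp only: nul_null simp_thms)
 then show "(ALL x:C p S. f x = 0) | (ALL x:C p S. g x = 0)" by (auto simp: nul_C)
qed

lemma C_irreducible: "p : M ==> irreducible_algebraic_set (C p S)"
 by (intro irreducible_if_primeset C_prime C_alg)

lemma C_divide:
 assumes "p : M" "nul p S f"
 obtains h g where "rpf h" "h p ~= 0" "!!c. rpf (g c)" "!!x. x : M ==> h x * f x = (\<Sum>c\<in>S. g c x * tht p c x)"
proof -
 obtain X idx D v where c: "chart M p n X (tht p) (J p) idx (Psi p) (rho p) D v" by (rule chartE[OF assms(1)])
 have "EX h g. rpf h & h p ~= 0 & (ALL c. rpf (g c)) & (ALL x:M. h x * f x = (\<Sum>c\<in>S. g c x * tht p c x))"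
  by (rule chart.null_divisible[OF c]) (simp only: nul_null[OF c] assms(2))
 with that show ?thesis by blast
qed

lemma nul_tht: "p : M ==> c : S ==> nul p S (tht p c)"
 by (auto simp: nul_def rpf_tht tht_Psi slice_def)

lemma tht_C: "p : M ==> c : S ==> x : C p S ==> tht p c x = 0"
 using nul_tht nul_C by blast

lemma not_nul_tht:
 assumes p: "p : M" and b: "b : J p" "b ~: S"
 shows "\<not> nul p S (tht p b)"
proof
 assume n: "nul p S (tht p b)"
 define z :: "real ^ 'n" where "z = (rho p / 2) *\<^sub>R axis b 1"
 have "z : slice (J p - S)" using b by (auto simp: z_def slice_def axis_def)
 moreover have "norm z < rho p" using rho_pos[OF p] by (simp add: z_def)
 ultimately have z: "z : slice (J p - S)" "norm z < rho p" .
 then have "z $ b = 0" using n tht_Psi[OF p z(2)] by (auto simp: nul_def)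
 then show False using rho_pos[OF p] by (simp add: z_def)
qed

text \<open>A neighbourhood of the centre suffices, because infinite order there already forces
  vanishing on the whole slice.\<close>

lemma C_near:
 assumes q: "q : M" and N: "open N" "q : N" and f: "rpf f" "!!x. x : C q S ==> x : N ==> f x = 0"
 shows "nul q S f"
proof -
 obtain X idx D v where "chart M q n X (tht q) (J q) idx (Psi q) (rho q) D v" by (rule chartE[OF q])
 then interpret c: chart M q n X "tht q" "J q" idx "Psi q" "rho q" D v .
 have "isCont (Psi q) 0" using Psi_cont[OF q, of 0] rho_pos[OF q] by simp
 moreover have "Psi q 0 : N" using N Psi_0[OF q] by simp
 ultimately obtain d where d: "d > 0" "Psi q ` ball 0 d \<subseteq> N"
  using N(1) by (metis continuous_at_ball open_contains_ball subset_trans)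
 have "c.flat (J q - S) f"
 proof (rule c.vanish_flat[OF f(1), of "min d (rho q)"])
  show "min d (rho q) > 0" using d(1) rho_pos[OF q] by simp
  fix z assume z: "z : slice (J q - S)" "norm z < min d (rho q)"
  show "f (Psi q z) = 0"
   by (rule f(2)) (use z C_germ d(2) in auto)
 qed
 then show ?thesis unfolding c.null_flat[symmetric] by (simp add: nul_def c.null_def)
qed

lemma orthant_nul:
 assumes p: "p : M" and f: "rpf f" and \<sigma>: "!!c. c : J p - S ==> \<sigma> c ~= (0::real)"
  and 0: "!!z. z : slice (J p - S) ==> norm z < d ==> norm z < rho p ==>
    (!!c. c : J p - S ==> sgn (z $ c) = sgn (\<sigma> c)) ==> f (Psi p z) = 0"
  and d: "d > 0"
 shows "nul p S f"
proof -
 obtain X idx D v where "chart M p n X (tht p) (J p) idx (Psi p) (rho p) D v" by (rule chartE[OF p])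
 then interpret c: chart M p n X "tht p" "J p" idx "Psi p" "rho p" D v .
 have "c.flat (J p - S) f"
  by (rule c.orthant_flat[OF f \<sigma>, where d = "min d (rho p)"]) (use 0 d rho_pos[OF p] in auto)
 then show ?thesis unfolding c.null_flat[symmetric] by (simp add: nul_def c.null_def)
qed

text \<open>\<open>k\<close> is the largest exponent for which such a factorisation exists;
  \<open>null_order\<close> bounds it. If the cofactor vanished on the next stratum,
  \<open>C_divide\<close> would produce one more factor \<open>tht p b\<close>.\<close>

lemma C_order:
 assumes p: "p : M" and H: "rpf H" "\<not> nul p S H" and b: "b : J p" "b ~: S"
 obtains k beta H' where "rpf beta" "beta p ~= 0" "rpf H'" "!!x. x : C p S ==> beta x * H x = tht p b x ^ k * H' x"
  "\<not> nul p (insert b S) H'"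
proof -
 obtain X idx D v where "chart M p n X (tht p) (J p) idx (Psi p) (rho p) D v" by (rule chartE[OF p])
 then interpret c: chart M p n X "tht p" "J p" idx "Psi p" "rho p" D v .
 define Q where "Q k \<longleftrightarrow> (EX h g. rpf h & h p ~= 0 & rpf g & (ALL x:C p S. h x * H x = tht p b x ^ k * g x))" for k
 have "\<not> c.null (J p - S) H" using H(2) by (simp add: nul_def c.null_def)
 from c.null_order[OF H(1) this] obtain m where m: "ALL k h g. rpf h & h p ~= 0 & rpf g &
   (ALL z:slice (J p - S). norm z < rho p --> h (Psi p z) * H (Psi p z) = (z $ b) ^ k * g (Psi p z)) --> k < m" by blast
 have bd: "k < m" if Qk: "Q k" for k
 proof -
  obtain h g where hg: "rpf h" "h p ~= 0" "rpf g" "ALL x:C p S. h x * H x = tht p b x ^ k * g x"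
   using Qk unfolding Q_def by (elim exE conjE)
  have "h (Psi p z) * H (Psi p z) = (z $ b) ^ k * g (Psi p z)" if "z : slice (J p - S)" "norm z < rho p" for z
   using hg(4) C_germ[OF that(2,1)] tht_Psi[OF p that(2)] by simp
  with m[rule_format, of h g k] hg(1-3) show ?thesis by blast
 qed
 have "Q 0" unfolding Q_def by (intro exI[of _ "%_. 1"] exI[of _ H]) (simp add: H)
 define k where "k = (GREATEST k. Q k)"
 have le: "j <= m" if "Q j" for j using bd[OF that] by simp
 have k: "Q k" unfolding k_def by (rule GreatestI_nat[of Q, OF \<open>Q 0\<close> le])
 have k': "j <= k" if "Q j" for j unfolding k_def by (rule Greatest_le_nat[of Q, OF that le])
 obtain h g where hg: "rpf h" "h p ~= 0" "rpf g" "ALL x:C p S. h x * H x = tht p b x ^ k * g x"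
  using k unfolding Q_def by (elim exE conjE)
 show ?thesis
 proof (rule that[OF hg(1-3)])
  show "h x * H x = tht p b x ^ k * g x" if "x : C p S" for x using hg(4) that by blast
  show "\<not> nul p (insert b S) g"
  proof
   assume "nul p (insert b S) g"
   then obtain h' u where u: "rpf h'" "h' p ~= 0" "!!c. rpf (u c)"
    "!!x. x : M ==> h' x * g x = (\<Sum>c\<in>insert b S. u c x * tht p c x)"
    by (rule C_divide[OF p]) blast
   have "h' x * h x * H x = tht p b x ^ Suc k * u b x" if x: "x : C p S" for x
   proof -
    have "(\<Sum>c\<in>insert b S. u c x * tht p c x) = u b x * tht p b x"
     using tht_C[OF p _ x] b(2) by (subst sum.insert) auto
    moreover have "x : M" using C_M[OF p] x by (rule subsetD)
    ultimately have "h' x * g x = u b x * tht p b x" using u(4) by (simp only:)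
    moreover have "h' x * h x * H x = tht p b x ^ k * (h' x * g x)" using hg(4) x by (simp add: mult_ac)
    ultimately show ?thesis by (simp add: mult_ac)
   qed
   then have "Q (Suc k)" unfolding Q_def using hg u
    by (intro exI[of _ "%x. h' x * h x"] exI[of _ "u b"]) (auto intro: rpf_intros)
   from k'[OF this] show False by simp
  qed
 qed
qed

text \<open>Through a given point a stratum is determined by the hypersurfaces that cut it out. That
  \<open>q\<close> lies on \<open>C p S\<close> is essential, since the intersection of the
  hypersurfaces may have several components.\<close>

lemma C_eq:
 assumes p: "p : M" and q: "q : M" and ST: "(%b. C p {b}) ` S = (%c. C q {c}) ` T" and qp: "q : C p S"
 shows "C q T = C p S"
proof -
 have sub: "C p S \<subseteq> C q T" if p: "p : M" and q: "q : M" and ST: "(%c. C q {c}) ` T \<subseteq> (%b. C p {b}) ` S"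
  and qp: "q : C p S" for p q S T
 proof -
  have "f x = 0" if f: "nul q T f" and x: "x : C p S" for f x
  proof -
   obtain h g where h: "rpf h" "h q ~= 0" "!!c. rpf (g c)" "!!x. x : M ==> h x * f x = (\<Sum>c\<in>T. g c x * tht q c x)"
    by (rule C_divide[OF q f]) blast
   have "tht q c y = 0" if c: "c : T" and y: "y : C p S" for c y
   proof -
    obtain b where "b : S" "C q {c} = C p {b}" using ST c by blast
    then have "y : C q {c}" using C_mono[of "{b}" S p] y by auto
    then show ?thesis by (rule tht_C[OF q singletonI])
   qed
   then have "h y * f y = 0" if "y : C p S" for y
    using h(4)[of y] C_M[OF p] that by auto
   from primesetD[OF C_prime[OF p] h(1) nul_rpf[OF f] this] h(2) qp x show ?thesis by blast
  qed
  then show ?thesis unfolding C_def[of q T] by blast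
 qed
 have 1: "C p S \<subseteq> C q T" using sub[OF p q _ qp] ST by simp
 then have "p : C q T" using C_base[OF p] by blast
 then have "C q T \<subseteq> C p S" using sub[OF q p] ST by simp
 with 1 show ?thesis by blast
qed

lemma C_inj:
 assumes "p : M" "b : J p" "C p {b} = C p {c}"
 shows "b = c"
 using not_nul_tht[of p b "{c}"] nul_tht[of p b "{b}"] assms by (auto simp: nul_C)

end

subsection \<open>Walls and chambers\<close>

lemma polyprime_superset:
 assumes "polyprime V P" "V \<subseteq> M"
 shows "polyprime M P"
 using assms unfolding polyprime_def by (meson subsetD)

context atlas
begin

abbreviation "bd S \<equiv> top_of_set M frontier_of S"

lemma bd_M: "bd S \<subseteq> M"
 using frontier_of_subset_topspace[of "top_of_set M" S] by simp

lemma zariski_bd: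
 assumes "S = A | S = B"
 shows "zariski_closure (bd S) \<subseteq> {x : M. h0 x = 0}"
 unfolding zariski_closure_def
 by (rule hull_minimal) (use bd_M[of S] h0 assms algebraic_set_zeros[OF alg h0(1)] in auto)

lemma wall_props:
 assumes "W : walls M A B"
 shows "primeset W" "algebraic_set W" "W \<subseteq> M" "!!x. x : W ==> h0 x = 0" "alg_dim W + 1 = enat n" "W ~= {}"
proof -
 have W: "irreducible_algebraic_set W" "W \<subseteq> zariski_closure (bd A) \<union> zariski_closure (bd B)" "alg_dim W + 1 = enat n"
  using assms dim by (auto simp: walls_def irreducible_component_def)
 show "primeset W" by (rule irreducible_primeset[OF W(1)])
 show "algebraic_set W" "W ~= {}" using W(1) by (auto simp: irreducible_algebraic_set_def)
 show "W \<subseteq> M" "!!x. x : W ==> h0 x = 0" using W(2) zariski_bd by blast+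
 show "alg_dim W + 1 = enat n" by (rule W(3))
qed

text \<open>In the chart \<open>h0\<close> is a unit times a monomial, so an irreducible set on
  which it vanishes and which meets the chart must lie in the zeros of one coordinate.\<close>

lemma h0_factor:
 assumes V: "primeset V" "V \<subseteq> M" "!!x. x : V ==> h0 x = 0" and p: "p : M"
  and z: "norm z < rho p" "Psi p z : V"
 obtains b where "b : J p" "!!y. y : V ==> tht p b y = 0"
proof -
 obtain kap u m where k: "rpf kap & rpf u & (ALL z. norm z < rho p --> kap (Psi p z) ~= 0 & u (Psi p z) ~= 0)
    & (ALL x:M. kap x * h0 x = u x * (\<Prod>b\<in>J p. tht p b x ^ m b))" using h0_local[OF p] by (elim exE)
 have "u x * (\<Prod>b\<in>J p. tht p b x ^ m b) = 0" if "x : V" for x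
  using k V(2,3) that by (metis mult_zero_right subsetD)
 moreover have r: "rpf (%x. \<Prod>b\<in>J p. tht p b x ^ m b)" by (intro rpf_intros rpf_tht p) simp
 ultimately have "(ALL x:V. u x = 0) | (ALL x:V. (\<Prod>b\<in>J p. tht p b x ^ m b) = 0)"
  using k by (intro primesetD[OF V(1)]) blast+
 then have "ALL x:V. (\<Prod>b\<in>J p. tht p b x ^ m b) = 0" using k z by blast
 then have "EX b:J p. ALL x:V. tht p b x ^ m b = 0"
  by (intro primeset_prod[OF V(1)]) (auto intro!: rpf_intros rpf_tht p)
 then obtain b where "b : J p" "ALL x:V. tht p b x ^ m b = 0" by blast
 with that[of b] show ?thesis by simp
qed

lemma hypersurface_sub:
 assumes p: "p : M" and V: "primeset V" "V \<subseteq> M" "p : V" "!!y. y : V ==> tht p b y = 0"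
 shows "V \<subseteq> C p {b}"
proof -
 have "f x = 0" if f: "nul p {b} f" and x: "x : V" for f x
 proof -
  obtain h g where h: "rpf h" "h p ~= 0" "!!c. rpf (g c)" "!!x. x : M ==> h x * f x = (\<Sum>c\<in>{b}. g c x * tht p c x)"
   by (rule C_divide[OF p f]) blast
  have "h y * f y = 0" if "y : V" for y using h(4)[of y] V(2,4) that by auto
  from primesetD[OF V(1) h(1) nul_rpf[OF f] this] h(2) V(3) x show ?thesis by blast
 qed
 then show ?thesis by (auto simp: C_def)
qed

text \<open>Otherwise the ideal of \<open>C p {b}\<close> lies strictly between those of
  \<open>M\<close> and \<open>V\<close>, which makes a chain of primes longer than
  \<open>n\<close>.\<close>

lemma hypersurface_eq:
 assumes p: "p : M" "b : J p" and V: "primeset V" "algebraic_set V" "V \<subseteq> C p {b}" "alg_dim V + 1 = enat n"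
 shows "V = C p {b}"
proof (rule ccontr)
 assume "V ~= C p {b}"
 then obtain x where x: "x : C p {b}" "x ~: V" using V(3) by blast
 obtain Q where Q: "ALL q:Q. rpf q" "V = {x. ALL q:Q. q x = 0}" using V(2) unfolding algebraic_set_def by blast
 obtain f where f: "f : Q" "f x ~= 0" using x(2) Q by blast
 have VM: "V \<subseteq> M" using V(3) C_M[OF p(1)] by blast
 obtain k where k: "alg_dim V = enat k" using V(4) by (cases "alg_dim V") auto
 have n: "n = Suc k" using V(4) k by (simp add: one_enat_def)
 define I where "I Z = {f. rpf f & (ALL x:Z. f x = 0)}" for Z :: "(real ^ 'n) set"
 have pI: "polyprime V (I V)" unfolding I_def by (rule polyprime_ideal[OF V(1) order_refl])
 have "EX R. (ALL i<=k. polyprime V (R i)) & (ALL i<k. R i \<subset> R (Suc i))"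
 proof (cases "k = 0")
  case True
  then show ?thesis using pI by (intro exI[of _ "%_. I V"]) auto
 next
  case False
  then show ?thesis using alg_dim_chain[of k V] k by simp
 qed
 then obtain R where R: "ALL i<=k. polyprime V (R i)" "ALL i<k. R i \<subset> R (Suc i)" by blast
 define P where "P i = (if i = 0 then I M else if i = 1 then I (C p {b}) else R (i - 2))" for i
 have "enat (k + 2) <= alg_dim M"
 proof (rule alg_dim_ge)
  show "polyprime M (P i)" if "i <= k + 2" for i
   using that R(1) polyprime_ideal[OF prime order_refl] polyprime_ideal[OF C_prime[OF p(1)] C_M[OF p(1)]]
    polyprime_superset[OF _ VM]
   unfolding P_def I_def by auto
  show "P i \<subset> P (Suc i)" if "i < k + 2" for i
  proof -
   consider "i = 0" | "i = 1" | j where "i = Suc (Suc j)" by (metis One_nat_def not0_implies_Suc)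
   then show ?thesis
   proof cases
    case 1
    have "I M \<subseteq> I (C p {b})" using C_M[OF p(1)] by (auto simp: I_def)
    moreover have "tht p b : I (C p {b})" "tht p b ~: I M"
     using nul_tht[OF p(1), of b "{b}"] not_nul_tht[OF p, of "{}"] nul_M[OF p(1)] by (auto simp: I_def nul_C)
    ultimately show ?thesis using 1 by (auto simp: P_def)
   next
    case 2
    have "I (C p {b}) \<subseteq> I V" using V(3) by (auto simp: I_def)
    also have "I V \<subseteq> R 0" using R(1) polyprime_vanish[of V "R 0"] by (auto simp: I_def)
    finally have "I (C p {b}) \<subseteq> R 0" .
    moreover have "f : R 0" using R(1) Q f by (intro polyprime_vanish[of V "R 0"]) auto
    moreover have "f ~: I (C p {b})" using f x by (auto simp: I_def)
    ultimately show ?thesis using 2 by (auto simp: P_def)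
   next
    case 3
    then show ?thesis using that R(2) by (auto simp: P_def)
   qed
  qed
 qed
 then show False using dim n by simp
qed

text \<open>In particular a wall that meets the chart passes through its centre. At the meeting
  point \<open>q\<close> the wall is a coordinate hypersurface of the chart of \<open>q\<close>; a
  polynomial vanishing on the hypersurface of \<open>p\<close> vanishes on the wall near
  \<open>q\<close>, hence on all of it by \<open>C_near\<close>.\<close>

lemma wall_at:
 assumes W: "W : walls M A B" and p: "p : M" and z: "norm z < rho p" "Psi p z : W"
 obtains b where "b : J p" "W = C p {b}"
proof -
 note Wp = wall_props[OF W]
 define q where "q = Psi p z"
 have q: "q : M" "q : W" using z(2) Wp(3) by (auto simp: q_def)
 have "Psi q 0 : W" "norm (0 :: real ^ 'n) < rho q" using Psi_0[OF q(1)] rho_pos[OF q(1)] q(2) by auto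
 then obtain c where c: "c : J q" "!!y. y : W ==> tht q c y = 0"
  using h0_factor[OF Wp(1,3,4) q(1)] by blast
 have Wq: "W = C q {c}"
  using hypersurface_eq[OF q(1) c(1) Wp(1,2) hypersurface_sub[OF q(1) Wp(1,3) q(2) c(2)] Wp(5)] .
 obtain b where b: "b : J p" "!!y. y : W ==> tht p b y = 0"
  using h0_factor[OF Wp(1,3,4) p z] by blast
 have "f x = 0" if f: "nul p {b} f" and x: "x : W" for f x
 proof -
  have "nul q {c} f"
  proof (rule C_near[OF q(1) open_U[OF p] _ nul_rpf[OF f]])
   show "q : Psi p ` ball 0 (rho p)" using z(1) by (auto simp: q_def)
   fix y assume y: "y : C q {c}" "y : Psi p ` ball 0 (rho p)"
   then obtain z' where z': "norm z' < rho p" "y = Psi p z'" by auto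
   have "z' : slice (J p)" using M_slice[OF p z'(1)] y(1) Wq Wp(3) z'(2) by blast
   moreover have "z' $ b = 0" using b(2)[of y] y(1) Wq tht_Psi[OF p z'(1)] z'(2) by simp
   ultimately have "z' : slice (J p - {b})" by (auto simp: slice_def)
   then show "f y = 0" using f z' by (simp add: nul_def)
  qed
  then show ?thesis using x Wq by (simp add: nul_C)
 qed
 then have "W \<subseteq> C p {b}" by (auto simp: C_def)
 from hypersurface_eq[OF p b(1) Wp(1,2) this Wp(5)] b(1) that show ?thesis by blast
qed

lemma wall_through:
 assumes "W : walls M A B" "p : W"
 obtains b where "b : J p" "W = C p {b}"
proof -
 have p: "p : M" using assms wall_props(3) by blast
 show ?thesis
  by (rule wall_at[OF assms(1) p, of 0]) (use that assms(2) Psi_0[OF p] rho_pos[OF p] in auto)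
qed

lemma open_half:
 assumes p: "p : M"
 shows "open (Psi p ` ball 0 (rho p / 2))"
proof -
 obtain X idx D v where "chart M p n X (tht p) (J p) idx (Psi p) (rho p) D v" by (rule chartE[OF p])
 from chart.chart_shrink[OF this, of "rho p / 2"] rho_pos[OF p]
 show ?thesis by (auto dest: chart.open_U)
qed

text \<open>Half of the radius leaves closed balls inside the charts, on which all constants can be
  chosen uniformly.\<close>

lemma finite_cover:
 obtains D where "finite D" "D \<subseteq> M" "M \<subseteq> (\<Union>p\<in>D. Psi p ` ball 0 (rho p / 2))"
proof -
 have "p : Psi p ` ball 0 (rho p / 2)" if "p : M" for p
  by (rule image_eqI[of _ _ 0]) (use Psi_0[OF that] rho_pos[OF that] in auto)
 then have "M \<subseteq> (\<Union>p\<in>M. Psi p ` ball 0 (rho p / 2))" by blast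
 then obtain D where "D \<subseteq> M" "finite D" "M \<subseteq> (\<Union>p\<in>D. Psi p ` ball 0 (rho p / 2))"
  using open_half compactE_image[OF cpt, of M "%p. Psi p ` ball 0 (rho p / 2)"] by blast
 with that show ?thesis by blast
qed

lemma finite_walls: "finite (walls M A B)"
proof -
 obtain D where D: "finite D" "D \<subseteq> M" "M \<subseteq> (\<Union>p\<in>D. Psi p ` ball 0 (rho p / 2))" by (rule finite_cover)
 have "walls M A B \<subseteq> (\<Union>p\<in>D. (%b. C p {b}) ` J p)"
 proof
  fix W assume W: "W : walls M A B"
  obtain q where q: "q : W" using wall_props(6)[OF W] by blast
  then obtain p z where p: "p : D" "norm z < rho p / 2" "q = Psi p z"
   using D(3) wall_props(3)[OF W] by fastforce
  have pM: "p : M" using p(1) D(2) by blast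
  have "norm z < rho p" using p(2) rho_pos[OF pM] by simp
  then obtain b where "b : J p" "W = C p {b}" by (rule wall_at[OF W pM]) (use q p in auto)
  then show "W : (\<Union>p\<in>D. (%b. C p {b}) ` J p)" using p(1) by blast
 qed
 moreover have "finite (\<Union>p\<in>D. (%b. C p {b}) ` J p)" using D(1) by simp
 ultimately show ?thesis by (rule finite_subset)
qed

text \<open>The lower bound adds the coordinates other than \<open>b\<close> one at a time. For the
  upper bound, a chain of length \<open>n\<close> would be prolonged below by the ideal of
  \<open>M\<close>.\<close>

lemma alg_dim_hypersurface:
 assumes p: "p : M" "b : J p"
 shows "alg_dim (C p {b}) + 1 = enat n"
proof -
 have n: "n = Suc (n - 1)" using card_J[OF p(1)] p(2) by (cases n) auto
 define I where "I Z = {f. rpf f & (ALL x:Z. f x = 0)}" for Z :: "(real ^ 'n) set"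
 obtain l where l: "set l = J p - {b}" "distinct l" using finite_distinct_list[of "J p - {b}"] by auto
 have len: "length l = n - 1" using distinct_card[OF l(2)] l(1) card_J[OF p(1)] p(2) by simp
 have "enat (n - 1) <= alg_dim (C p {b})"
 proof (rule alg_dim_ge)
  fix i
  define S where "S i = insert b (set (take i l))" for i
  show "polyprime (C p {b}) (I (C p (S i)))"
   unfolding I_def by (rule polyprime_ideal[OF C_prime[OF p(1)] C_mono]) (simp add: S_def)
  show "I (C p (S i)) \<subset> I (C p (S (Suc i)))" if i: "i < n - 1"
  proof -
   have li: "l ! i : J p" "l ! i ~: S i"
    using nth_mem[of i l] i len l by (auto simp: S_def in_set_conv_nth nth_eq_iff_index_eq)
   have S: "S (Suc i) = insert (l ! i) (S i)" using i len by (auto simp: S_def take_Suc_conv_app_nth)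
   have "C p (S (Suc i)) \<subseteq> C p (S i)" unfolding S by (rule C_mono) blast
   then have "I (C p (S i)) \<subseteq> I (C p (S (Suc i)))" by (auto simp: I_def)
   moreover have "tht p (l ! i) : I (C p (S (Suc i)))" "tht p (l ! i) ~: I (C p (S i))"
    using nul_tht[OF p(1), of "l ! i" "S (Suc i)"] not_nul_tht[OF p(1) li] by (auto simp: I_def nul_C S)
   ultimately show ?thesis by blast
  qed
 qed
 moreover have "\<not> enat n <= alg_dim (C p {b})"
 proof
  assume "enat n <= alg_dim (C p {b})"
  then obtain R where R: "ALL i<=n. polyprime (C p {b}) (R i)" "ALL i<n. R i \<subset> R (Suc i)"
   using alg_dim_chain[of n "C p {b}"] n by auto
  define P where "P i = (if i = 0 then I M else R (i - 1))" for i
  have "enat (Suc n) <= alg_dim M"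
  proof (rule alg_dim_ge)
   fix i
   show "polyprime M (P i)" if "i <= Suc n"
   proof (cases i)
    case 0
    then show ?thesis using polyprime_ideal[OF prime order_refl] by (simp add: P_def I_def)
   next
    case (Suc j)
    then have "polyprime M (R j)"
     by (intro polyprime_superset[OF _ C_M[OF p(1), of "{b}"]]) (use R(1) that in auto)
    then show ?thesis using Suc by (simp add: P_def)
   qed
   show "P i \<subset> P (Suc i)" if "i < Suc n"
   proof (cases i)
    case 0
    have "I (C p {b}) \<subseteq> R 0" using R(1) polyprime_vanish[of "C p {b}" "R 0"] by (auto simp: I_def)
    moreover have "I M \<subseteq> I (C p {b})" using C_M[OF p(1)] by (auto simp: I_def)
    moreover have "tht p b : I (C p {b})" "tht p b ~: I M"
     using nul_tht[OF p(1), of b "{b}"] not_nul_tht[OF p, of "{}"] nul_M[OF p(1)] by (auto simp: I_def nul_C)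
    ultimately show ?thesis using 0 by (auto simp: P_def)
   next
    case (Suc j)
    then show ?thesis using that R(2) by (auto simp: P_def)
   qed
  qed
  then show False using dim by simp
 qed
 ultimately have "alg_dim (C p {b}) = enat (n - 1)"
 proof (cases "alg_dim (C p {b})")
  case (enat m)
  assume "enat (n - 1) <= alg_dim (C p {b})" "\<not> enat n <= alg_dim (C p {b})"
  then show ?thesis using enat n by simp
 qed simp
 then show ?thesis using n by (simp add: one_enat_def)
qed

section \<open>Crossing coordinate hypersurfaces, chambers\<close>

definition flip :: "'n set => real ^ 'n => real ^ 'n" where
 "flip D z = (\<chi> c. if c : D then - z $ c else z $ c)"

lemma norm_flip [simp]: "norm (flip D z) = norm z"
 by (rule antisym; rule norm_le_componentwise_cart) (auto simp: flip_def)

lemma flip_slice: "z : slice K ==> flip D z : slice K"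
 by (auto simp: flip_def slice_def)

text \<open>A point of the open face between the two orthants has points of \<open>S\<close> on one
  side and points outside \<open>S\<close> on the other, so it is a frontier point. By
  \<open>orthant_nul\<close> the face is Zariski dense in \<open>C p {b}\<close>.\<close>

lemma flip_wall:
 assumes p: "p : M" "b : J p" and S: "S = A | S = B"
  and z: "z : slice (J p)" "norm z < rho p" "!!c. c : J p ==> z $ c ~= 0"
  and in_S: "Psi p z : S" and out: "Psi p (flip {b} z) ~: S"
 shows "C p {b} : walls M A B"
proof -
 have fr: "Psi p y : bd S" if y: "y : slice (J p - {b})" "norm y < rho p"
   "!!c. c : J p - {b} ==> sgn (y $ c) = sgn (z $ c)" for y
 proof -
  have yb: "y $ b = 0" and yJ: "y : slice (J p)" using y(1) by (auto simp: slice_def)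
  have near: "EX e>0. norm (y + (s * e) *\<^sub>R axis b 1) < rho p & Psi p (y + (s * e) *\<^sub>R axis b 1) : T"
   if T: "open T" "Psi p y : T" and s: "\<bar>s\<bar> = 1" for T s
  proof -
   have "isCont (Psi p) y" by (rule Psi_cont[OF p(1) y(2)])
   then obtain d where d: "d > 0" "Psi p ` ball y d \<subseteq> T"
    using T by (metis continuous_at_ball open_contains_ball subset_trans)
   define e where "e = min d (rho p - norm y) / 2"
   have e: "e > 0" "e < d" "e < rho p - norm y" using d(1) y(2) by (auto simp: e_def)
   have "norm (y + (s * e) *\<^sub>R axis b 1) <= norm y + e"
    using norm_triangle_ineq[of y "(s * e) *\<^sub>R axis b 1"] s e(1) by (simp add: abs_mult)
   moreover have "y + (s * e) *\<^sub>R axis b 1 : ball y d"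
    using s e(1,2) by (simp add: dist_norm abs_mult)
   ultimately show ?thesis using e d(2) by (intro exI[of _ e]) auto
  qed
  have sl: "y + t *\<^sub>R axis b 1 : slice (J p)" for t using yJ p(2) by (auto simp: slice_def axis_def)
  define s where "s = sgn (z $ b)"
  have s: "\<bar>s\<bar> = 1" "\<bar>- s\<bar> = 1" using z(3)[OF p(2)] by (auto simp: s_def sgn_if)
  have in1: "Psi p (y + (s * e) *\<^sub>R axis b 1) : S" if "e > 0" "norm (y + (s * e) *\<^sub>R axis b 1) < rho p" for e
  proof (rule signs[OF p(1) S z(1) sl z(2) that(2) _ in_S])
   fix c assume "c : J p"
   then show "sgn (z $ c) = sgn ((y + (s * e) *\<^sub>R axis b 1) $ c)"
    using y(3)[of c] yb that(1) by (cases "c = b") (auto simp: s_def sgn_mult axis_def)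
  qed
  have in2: "Psi p (y + (- s * e) *\<^sub>R axis b 1) ~: S" if "e > 0" "norm (y + (- s * e) *\<^sub>R axis b 1) < rho p" for e
  proof
   assume a: "Psi p (y + (- s * e) *\<^sub>R axis b 1) : S"
   have "Psi p (flip {b} z) : S"
   proof (rule signs[OF p(1) S sl flip_slice[OF z(1)] that(2) _ _ a])
    show "norm (flip {b} z) < rho p" using z(2) by simp
    fix c assume "c : J p"
    then show "sgn ((y + (- s * e) *\<^sub>R axis b 1) $ c) = sgn (flip {b} z $ c)"
     using y(3)[of c] yb that(1) by (cases "c = b") (auto simp: s_def sgn_mult axis_def flip_def sgn_minus)
   qed
   with out show False by simp
  qed
  have yM: "Psi p y : M" using M_slice[OF p(1) y(2)] yJ by simp
  have "Psi p y : top_of_set M closure_of S"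
   unfolding in_closure_of
  proof (intro conjI allI impI)
   fix T assume "Psi p y : T & openin (top_of_set M) T"
   then obtain T' where T': "open T'" "T = M \<inter> T'" "Psi p y : T'" by (auto simp: openin_open)
   from near[OF T'(1,3) s(1)] obtain e where e: "e > 0" "norm (y + (s * e) *\<^sub>R axis b 1) < rho p"
    "Psi p (y + (s * e) *\<^sub>R axis b 1) : T'" by blast
   have "Psi p (y + (s * e) *\<^sub>R axis b 1) : M" using M_slice[OF p(1) e(2)] sl by blast
   with e in1[OF e(1,2)] T'(2) show "EX y. y : S & y : T" by blast
  qed (use yM in simp)
  moreover have "Psi p y ~: top_of_set M interior_of S"
  proof
   assume "Psi p y : top_of_set M interior_of S"
   then obtain T where "openin (top_of_set M) T" "Psi p y : T" "T \<subseteq> S" by (auto simp: interior_of_def)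
   then obtain T' where T': "open T'" "M \<inter> T' \<subseteq> S" "Psi p y : T'" by (auto simp: openin_open)
   from near[OF T'(1,3) s(2)] obtain e where e: "e > 0" "norm (y + (- s * e) *\<^sub>R axis b 1) < rho p"
    "Psi p (y + (- s * e) *\<^sub>R axis b 1) : T'" by blast
   have "Psi p (y + (- s * e) *\<^sub>R axis b 1) : M" using M_slice[OF p(1) e(2)] sl by blast
   with e in2[OF e(1,2)] T'(2) show False by blast
  qed
  ultimately show ?thesis by (simp add: frontier_of_def)
 qed
 have nulS: "nul p {b} f" if f: "rpf f" "!!x. x : bd S ==> f x = 0" for f
  by (rule orthant_nul[OF p(1) f(1), of "{b}" "%c. z $ c" 1]) (use z(3) fr f(2) in auto)
 have CE: "C p {b} \<subseteq> zariski_closure (bd A) \<union> zariski_closure (bd B)"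
 proof -
  have "C p {b} \<subseteq> V" if V: "algebraic_set V" "bd S \<subseteq> V" for V
  proof -
   obtain Q where Q: "ALL q:Q. rpf q" "V = {x. ALL q:Q. q x = 0}" using V(1) unfolding algebraic_set_def by blast
   have "nul p {b} q" if "q : Q" for q by (rule nulS) (use Q V(2) that in auto)
   then show ?thesis unfolding Q(2) C_def by blast
  qed
  then have "C p {b} \<subseteq> zariski_closure (bd S)" unfolding zariski_closure_def hull_def by blast
  then show ?thesis using S by blast
 qed
 \<comment> \<open>Maximality: a larger irreducible set in the zeros of \<open>h0\<close> lies in
   the zeros of some coordinate of \<open>J p\<close>, and \<open>b\<close> is the only one of these
   that vanishes on \<open>C p {b}\<close>.\<close>
 have "V' = C p {b}" if V': "irreducible_algebraic_set V'" "C p {b} \<subseteq> V'"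
   "V' \<subseteq> zariski_closure (bd A) \<union> zariski_closure (bd B)" for V'
 proof -
  have pV: "primeset V'" by (rule irreducible_primeset[OF V'(1)])
  have VM: "V' \<subseteq> M" and h: "!!x. x : V' ==> h0 x = 0" using V'(3) zariski_bd by blast+
  have pp: "p : V'" using C_base[OF p(1)] V'(2) by blast
  then have "Psi p 0 : V'" "norm (0 :: real ^ 'n) < rho p" using Psi_0[OF p(1)] rho_pos[OF p(1)] by auto
  then obtain c where c: "c : J p" "!!y. y : V' ==> tht p c y = 0" using h0_factor[OF pV VM h p(1)] by blast
  then have "nul p {b} (tht p c)" using V'(2) rpf_tht[OF p(1)] by (auto simp: nul_C)
  then have "c = b" using not_nul_tht[OF p(1) c(1), of "{b}"] by auto
  then have "V' \<subseteq> C p {b}" using hypersurface_sub[OF p(1) pV VM pp] c(2) by blast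
  with V'(2) show ?thesis by blast
 qed
 with CE C_irreducible[OF p(1)] alg_dim_hypersurface[OF p] show ?thesis
  unfolding walls_def irreducible_component_def dim by blast
qed

definition Wb :: "real ^ 'n => 'n set" where
 "Wb p = {b : J p. C p {b} : walls M A B}"

text \<open>By \<open>flip_wall\<close> a coordinate that does not define a wall can change its sign
  without leaving \<open>S\<close>, so such coordinates are flipped one after another.\<close>

lemma chamber:
 assumes p: "p : M" and S: "S = A | S = B"
  and z: "z : slice (J p)" "norm z < rho p" "!!b. b : Wb p ==> z $ b ~= 0" "Psi p z : S"
  and y: "y : slice (J p)" "norm y < rho p" "!!b. b : J p ==> y $ b ~= 0"
  and sg: "!!b. b : Wb p ==> sgn (z $ b) = sgn (y $ b)"
 shows "Psi p y : S"
proof -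
 have "openin (top_of_set M) S" using S oA oB by blast
 then obtain T where T: "open T" "S = M \<inter> T" by (auto simp: openin_open)
 have "isCont (Psi p) z" by (rule Psi_cont[OF p z(2)])
 moreover have "Psi p z : T" using z(4) T(2) by blast
 ultimately obtain d where d: "d > 0" "Psi p ` ball z d \<subseteq> T"
  using T(1) by (metis continuous_at_ball open_contains_ball subset_trans)
 \<comment> \<open>Zero coordinates of \<open>z\<close> are moved to \<open>e\<close>. The norm of
   the change is at most \<open>CARD('n) * e\<close>, so the point stays in the open set
   \<open>S\<close> and in the chart.\<close>
 define e where "e = min d (rho p - norm z) / (2 * (real CARD('n) + 1))"
 have e: "e > 0" using d z(2) by (simp add: e_def)
 have eC: "real CARD('n) * e < min d (rho p - norm z)"
 proof -
  have "real CARD('n) * e < 2 * (real CARD('n) + 1) * e" using e by simp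
  also have "... = min d (rho p - norm z)" unfolding e_def by simp
  finally show ?thesis .
 qed
 define w :: "real ^ 'n" where "w = (\<chi> b. if b : J p & z $ b = 0 then e else 0)"
 have "norm w <= (\<Sum>b\<in>UNIV. norm (w $ b))" by (simp add: norm_le_l1_cart)
 also have "... <= (\<Sum>b\<in>(UNIV :: 'n set). e)" by (rule sum_mono) (use e in "auto simp: w_def")
 finally have nw: "norm w < min d (rho p - norm z)" using eC by simp
 define z1 where "z1 = z + w"
 have z1: "z1 : slice (J p)" "norm z1 < rho p" "!!b. b : J p ==> z1 $ b ~= 0"
  using z(1) nw norm_triangle_ineq[of z w] e by (auto simp: z1_def w_def slice_def)
 have "Psi p z1 : T" using d(2) nw by (auto simp: z1_def dist_norm)
 moreover have "Psi p z1 : M" using M_slice[OF p z1(2)] z1(1) by blast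
 ultimately have z1S: "Psi p z1 : S" using T(2) by blast
 have z1sg: "sgn (z1 $ b) = sgn (z $ b)" if "b : Wb p" for b
  using z(3)[OF that] by (simp add: z1_def w_def)
 have fl: "Psi p (flip D z1) : S" if "finite D" "D \<subseteq> J p - Wb p" for D
  using that
 proof (induction D rule: finite_induct)
  case empty
  have "flip {} z1 = z1" by (simp add: flip_def vec_eq_iff)
  then show ?case using z1S by simp
 next
  case (insert b D)
  have eq: "flip (insert b D) z1 = flip {b} (flip D z1)" using insert(2) by (auto simp: flip_def vec_eq_iff)
  show ?case
  proof (rule ccontr)
   assume out: "Psi p (flip (insert b D) z1) ~: S"
   have "C p {b} : walls M A B"
   proof (rule flip_wall[OF p _ S flip_slice[OF z1(1)] _ _ _ out[unfolded eq]])
    show "norm (flip D z1) < rho p" using z1(2) by simp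
    show "Psi p (flip D z1) : S" using insert by blast
    show "flip D z1 $ c ~= 0" if "c : J p" for c using z1(3)[OF that] by (simp add: flip_def)
   qed (use insert in blast)
   then show False using insert.prems by (auto simp: Wb_def)
  qed
 qed
 define D where "D = {b : J p. sgn (z1 $ b) ~= sgn (y $ b)}"
 have DW: "D \<subseteq> J p - Wb p" using z1sg sg by (auto simp: D_def)
 show ?thesis
 proof (rule signs[OF p S flip_slice[OF z1(1)] y(1) _ y(2) _ fl[OF _ DW]])
  show "norm (flip D z1) < rho p" using z1(2) by simp
  show "sgn (flip D z1 $ b) = sgn (y $ b)" if "b : J p" for b
   using z1(3)[OF that] y(3)[OF that] that by (auto simp: flip_def D_def sgn_if split: if_splits)
 qed simp
qed

end

subsection \<open>Separation on the walls\<close>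

lemma primeset_cancel:
 assumes Z: "primeset Z" and r: "rpf a" "rpf b" "rpf c" and eq: "!!x. x : Z ==> a x * b x = a x * c x"
  and a: "y : Z" "a y ~= 0" and x: "x : Z"
 shows "b x = c x"
proof -
 have "(ALL x:Z. a x = 0) | (ALL x:Z. b x - c x = 0)"
  by (rule primesetD[OF Z r(1)]) (use r eq in "auto intro: rpf_intros simp: right_diff_distrib")
 with a x show ?thesis by auto
qed

lemma primeset_nonzero_mult:
 assumes "primeset Z" "rpf f" "rpf g" "EX x:Z. f x ~= 0" "EX x:Z. g x ~= 0"
 shows "EX x:Z. f x * g x ~= 0"
 using primesetD[OF assms(1-3)] assms(4,5) by blast

lemma (in localized) cring_local:
 assumes "ring L"
 shows "cring L"
proof -
 interpret ring L by (rule assms)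
 show ?thesis
 proof
  fix x y assume x: "x : carrier L" and y: "y : carrier L"
  obtain f g where fg: "rpf f" "den g" "x = fr f g" using x by (rule carrier_frE)
  obtain f' g' where fg': "rpf f'" "den g'" "y = fr f' g'" using y by (rule carrier_frE)
  show "x \<otimes>\<^bsub>L\<^esub> y = y \<otimes>\<^bsub>L\<^esub> x"
   unfolding fg(3) fg'(3) mult_fr[OF fg(1,2) fg'(1,2)] mult_fr[OF fg'(1,2) fg(1,2)] by (simp add: mult.commute)
 qed
qed

text \<open>If \<open>r\<close> were non-zero somewhere on \<open>W\<close>, the uniformizer would
  be a unit. If it were a local equation times a function vanishing on \<open>W\<close>, maximality
  of the ideal it generates would make the local equation a multiple of it, and that function would
  be a unit.\<close>

lemma (in localized) uniformizer_numerator: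
 assumes t: "uniformizer L (fr r s)" and rs: "rpf r" "den s"
 shows "!!x. x : W ==> r x = 0"
  and "!!tht h kap. rpf tht ==> ALL x:W. tht x = 0 ==> EX x:M. tht x ~= 0 ==> den h ==> rpf kap ==>
   ALL x:M. h x * r x = tht x * kap x ==> EX x:W. kap x ~= 0"
proof -
 have mx: "maximalideal (PIdl\<^bsub>L\<^esub> (fr r s)) L" and car: "fr r s : carrier L"
  using t unfolding uniformizer_def by auto
 interpret mx: maximalideal "PIdl\<^bsub>L\<^esub> (fr r s)" L by (rule mx)
 have cr: "cring L" by (rule cring_local) (rule mx.ring_axioms)
 interpret cring L by (rule cr)
 show r0: "r x = 0" if x: "x : W" for x
 proof (rule ccontr)
  assume "r x ~= 0"
  then have dr: "den r" using rs(1) x by (auto simp: den_def)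
  have "fr s r \<otimes>\<^bsub>L\<^esub> fr r s = \<one>\<^bsub>L\<^esub>"
   using dr rs den_rpf[OF rs(2)]
   by (simp add: mult_fr one_fr, subst fr_eq_iff) (auto intro: rpf_intros den_mult)
  then have "\<one>\<^bsub>L\<^esub> : PIdl\<^bsub>L\<^esub> (fr r s)"
   unfolding cgenideal_def using carrier_fr[OF den_rpf[OF rs(2)] dr] by force
  then have "PIdl\<^bsub>L\<^esub> (fr r s) = carrier L" by (rule mx.one_imp_carrier)
  then show False using mx.I_notcarr by simp
 qed
 fix tht h kap assume tht: "rpf tht" "ALL x:W. tht x = 0" "EX x:M. tht x ~= 0" and h: "den h" and k: "rpf kap"
  and eq: "ALL x:M. h x * r x = tht x * kap x"
 show "EX x:W. kap x ~= 0"
 proof (rule ccontr)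
  assume k0: "\<not> ?thesis"
  have th: "fr tht (%x. 1) : carrier L" by (rule carrier_fr[OF tht(1) den_one])
  have idl: "ideal (PIdl\<^bsub>L\<^esub> (fr tht (%x. 1))) L" by (rule cgenideal_ideal[OF th])
  have dhs: "den (%x. h x * s x)" by (rule den_mult[OF h rs(2)])
  have "fr r s = fr kap (%x. h x * s x) \<otimes>\<^bsub>L\<^esub> fr tht (%x. 1)"
   unfolding mult_fr[OF k dhs tht(1) den_one]
   using rs k tht(1) dhs eq by (subst fr_eq_iff) (auto intro: rpf_intros simp: mult_ac)
  then have "fr r s : PIdl\<^bsub>L\<^esub> (fr tht (%x. 1))"
   unfolding cgenideal_def using carrier_fr[OF k dhs] by blast
  then have sub: "PIdl\<^bsub>L\<^esub> (fr r s) \<subseteq> PIdl\<^bsub>L\<^esub> (fr tht (%x. 1))" by (rule ring.cgenideal_minimal[OF cring.axioms(1)[OF cr] idl])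
  have "PIdl\<^bsub>L\<^esub> (fr tht (%x. 1)) ~= carrier L"
  proof
   assume "PIdl\<^bsub>L\<^esub> (fr tht (%x. 1)) = carrier L"
   then have "\<one>\<^bsub>L\<^esub> : PIdl\<^bsub>L\<^esub> (fr tht (%x. 1))" by simp
   then obtain y where "y : carrier L" "\<one>\<^bsub>L\<^esub> = y \<otimes>\<^bsub>L\<^esub> fr tht (%x. 1)" unfolding cgenideal_def by blast
   then obtain f g where fg: "rpf f" "den g" "fr (%x. 1) (%x. 1) = fr f g \<otimes>\<^bsub>L\<^esub> fr tht (%x. 1)"
    unfolding one_fr by (metis carrier_frE)
   then have "ALL x:M. 1 * (g x * 1) = (f x * tht x) * 1"
    using tht(1) unfolding mult_fr[OF fg(1,2) tht(1) den_one]
    by (subst (asm) fr_eq_iff) (auto intro: rpf_intros simp: den_mult)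
   then show False using fg(2) tht(2) WM by (auto simp: den_def)
  qed
  then have "PIdl\<^bsub>L\<^esub> (fr tht (%x. 1)) = PIdl\<^bsub>L\<^esub> (fr r s)"
   using mx.I_maximal[OF idl sub] additive_subgroup.a_subset[OF ideal.axioms(1)[OF idl]] by blast
  moreover have "fr tht (%x. 1) : PIdl\<^bsub>L\<^esub> (fr tht (%x. 1))" by (rule ring.cgenideal_self[OF cring.axioms(1)[OF cr] th])
  ultimately obtain y where y: "y : carrier L" "fr tht (%x. 1) = y \<otimes>\<^bsub>L\<^esub> fr r s" unfolding cgenideal_def by blast
  obtain a c where ac: "rpf a" "den c" "y = fr a c" using y(1) by (rule carrier_frE)
  have dcs: "den (%x. c x * s x)" by (rule den_mult[OF ac(2) rs(2)])
  have rar: "rpf (%x. a x * r x)" by (intro rpf_intros ac(1) rs(1))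
  have e2: "ALL x:M. tht x * (c x * s x) = (a x * r x) * 1"
   using y(2) unfolding ac(3) mult_fr[OF ac(1,2) rs] fr_eq_iff[OF tht(1) den_one rar dcs] .
  obtain y0 where y0: "y0 : M" "tht y0 ~= 0" using tht(3) by blast
  have "h x * (c x * s x) = a x * kap x" if x: "x : M" for x
  proof (rule primeset_cancel[OF M tht(1) _ _ _ y0 x])
   show "rpf (%x. h x * (c x * s x))" by (intro rpf_intros den_rpf[OF h] den_rpf[OF ac(2)] den_rpf[OF rs(2)])
   show "rpf (%x. a x * kap x)" by (intro rpf_intros ac(1) k)
   fix x assume x: "x : M"
   have "tht x * (h x * (c x * s x)) = h x * (a x * r x)" using bspec[OF e2 x] by (simp add: mult_ac)
   also have "... = a x * (h x * r x)" by simp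
   also have "... = tht x * (a x * kap x)" using bspec[OF eq x] by (simp add: mult_ac)
   finally show "tht x * (h x * (c x * s x)) = tht x * (a x * kap x)" .
  qed
  then have "h x * (c x * s x) = 0" if "x : W" for x using k0 subsetD[OF WM that] that by simp
  moreover have "den (%x. h x * (c x * s x))" by (rule den_mult[OF h dcs])
  ultimately show False unfolding den_def by blast
 qed
qed

context atlas
begin

text \<open>A polynomial that vanishes on a relatively open part of \<open>M\<close> vanishes on all
  of \<open>M\<close>, by \<open>C_near\<close> for the empty set of coordinates.\<close>

lemma dense_nonzero:
 assumes S: "openin (top_of_set M) S" and h: "rpf h" "y : M" "h y ~= 0" and x: "x : closure S"
 shows "x : closure {y : S. h y ~= 0}"
proof -
 have "S \<subseteq> closure {y : S. h y ~= 0}"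
 proof
  fix q assume q: "q : S"
  obtain T where T: "open T" "S = M \<inter> T" using S by (auto simp: openin_open)
  have qM: "q : M" using q T by blast
  show "q : closure {y : S. h y ~= 0}"
  proof (rule ccontr)
   assume nq: "q ~: closure {y : S. h y ~= 0}"
   define N where "N = T - closure {y : S. h y ~= 0}"
   have "open N" "q : N" using T q nq by (auto simp: N_def intro: open_Diff)
   moreover have "h x = 0" if "x : C q {}" "x : N" for x
   proof (rule ccontr)
    assume "h x ~= 0"
    moreover have "x : S" using that C_empty[OF qM] T(2) unfolding N_def by auto
    ultimately have "x : closure {y : S. h y ~= 0}" by (intro subsetD[OF closure_subset]) simp
    then show False using that(2) by (simp add: N_def)
   qed
   ultimately have "nul q {} h" using C_near[OF qM _ _ h(1)] by blast
   then show False using h nul_M[OF qM] by blast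
  qed
 qed
 from closure_mono[OF this] x show ?thesis by auto
qed

lemma closure_sign:
 assumes S: "openin (top_of_set M) S" and h: "rpf h" "y : M" "h y ~= 0" and g: "rpf g"
  and pos: "!!x. x : S ==> h x ~= 0 ==> g x >= 0" and x: "x : closure S"
 shows "g x >= 0"
proof -
 have "closed {x. 0 <= g x}" by (intro closed_Collect_le rpf_continuous g continuous_on_const)
 then have "closure {y : S. h y ~= 0} \<subseteq> {x. 0 <= g x}" using pos by (intro closure_minimal) auto
 with dense_nonzero[OF S h x] show ?thesis by blast
qed

lemma wall_localized: "W : walls M A B ==> localized M W"
 using wall_props[of W] prime by unfold_locales auto

lemma regular_continuous:
 fixes f :: "real ^ 'n => real"
 assumes "f : carrier (regular_ring M)"
 shows "continuous_on M f"
proof -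
 obtain P Q where *: "rpf P" "rpf Q" "!!x. x : M ==> Q x ~= 0" "!!x. x : M ==> f x = P x / Q x"
  using assms by (rule regular_carrierE) blast
 have "continuous_on M (%x. P x / Q x)" using * by (intro continuous_on_divide rpf_continuous) auto
 then show ?thesis using *(4) by (simp cong: continuous_on_cong)
qed

lemma open_frac:
 assumes "W : walls M A B" "t : carrier (local_ring_at M W)"
 shows "openin (top_of_set M) (frac_pos M t)" "openin (top_of_set M) (frac_neg M t)"
proof -
 interpret L: localized M W by (rule wall_localized[OF assms(1)])
 obtain r s where rs: "rpf r" "L.den s" "t = L.fr r s" using assms(2) by (rule L.carrier_frE)
 have car: "f : carrier (regular_ring M) & g : carrier (regular_ring M)" if "(f, g) : t" for f g
  using that L.fr_mem[OF rs(1,2), of f g] unfolding rs(3) by blast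
 have op: "openin (top_of_set M) {x : M. c * (f x * g x) > 0}" if "(f, g) : t" for f g c
 proof -
  have "continuous_on M (%x. c * (f x * g x))"
   using car[OF that] by (intro continuous_on_mult continuous_on_const regular_continuous) auto
  from continuous_openin_preimage_gen[OF this, of "{0<..}"] show ?thesis
   by (simp add: vimage_def Int_def)
 qed
 have div: "(b ~= 0 & a / b > 0) = (1 * (a * b) > 0)" "(b ~= 0 & a / b < 0) = ((- 1) * (a * b) > 0)" for a b :: real
  by (auto simp: zero_less_divide_iff zero_less_mult_iff divide_less_0_iff mult_less_0_iff)
 have "frac_pos M t = (\<Union>fg\<in>t. {x : M. 1 * (fst fg x * snd fg x) > 0})"
  unfolding frac_pos_def div by (auto simp del: mult_1)
 moreover have "frac_neg M t = (\<Union>fg\<in>t. {x : M. (- 1) * (fst fg x * snd fg x) > 0})"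
  unfolding frac_neg_def div by (auto simp del: mult_minus1)
 ultimately show "openin (top_of_set M) (frac_pos M t)" "openin (top_of_set M) (frac_neg M t)"
  using op[of _ _ 1] op[of _ _ "- 1"] by (auto intro!: openin_Union)
qed

lemma frac_sign:
 assumes L: "localized M W" and rs: "rpf r" "localized.den W s" and x: "x : M" "s x ~= 0"
 shows "x : frac_pos M (localized.fr M W r s) \<longleftrightarrow> r x * s x > 0"
  "x : frac_neg M (localized.fr M W r s) \<longleftrightarrow> r x * s x < 0"
proof -
 interpret L: localized M W by (rule L)
 have val: "f x / g x = r x / s x" if "(f, g) : L.fr r s" "g x ~= 0" for f g
  using that L.fr_mem[OF rs, of f g] x by (simp add: frac_eq_eq)
 have mem: "(restrict r M, restrict s M) : L.fr r s" by (rule L.fr_self[OF rs])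
 have p: "x : frac_pos M (L.fr r s) \<longleftrightarrow> r x / s x > 0"
  using val mem x unfolding frac_pos_def by (auto intro!: bexI[OF _ mem])
 have n: "x : frac_neg M (L.fr r s) \<longleftrightarrow> r x / s x < 0"
  using val mem x unfolding frac_neg_def by (auto intro!: bexI[OF _ mem])
 show "x : frac_pos M (L.fr r s) \<longleftrightarrow> r x * s x > 0" "x : frac_neg M (L.fr r s) \<longleftrightarrow> r x * s x < 0"
  unfolding p n by (simp_all add: zero_less_divide_iff zero_less_mult_iff divide_less_0_iff mult_less_0_iff)
qed

text \<open>The factor \<open>G\<close> records the sign of the uniformizer \<open>t\<close> relative to the local equation of the
  wall at \<open>p\<close>.\<close>

lemma uniformizer_sign:
 assumes W: "W : walls M A B" and t: "uniformizer (local_ring_at M W) t"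
 obtains r s where "rpf r" "rpf s" "EX x:W. s x ~= 0"
  "!!x. x : M ==> s x ~= 0 ==> x : frac_pos M t \<longleftrightarrow> r x * s x > 0"
  "!!x. x : M ==> s x ~= 0 ==> x : frac_neg M t \<longleftrightarrow> r x * s x < 0"
  "!!p b. p : M ==> b : J p ==> W = C p {b} ==> EX h kap. rpf h & rpf kap & h p ~= 0 & (EX x:W. kap x ~= 0) &
    (ALL x:M. h x * r x = tht p b x * kap x)"
proof -
 have Lo: "localized M W" by (rule wall_localized[OF W])
 interpret L: localized M W by (rule Lo)
 have "t : carrier (local_ring_at M W)" using t by (simp add: uniformizer_def)
 then obtain r s where rs: "rpf r" "L.den s" "t = L.fr r s" by (rule L.carrier_frE)
 note num = L.uniformizer_numerator[OF t[unfolded rs(3)] rs(1,2)]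
 show ?thesis
 proof (rule that[OF rs(1) L.den_rpf[OF rs(2)]])
  show "EX x:W. s x ~= 0" using rs(2) by (simp add: L.den_def)
  show "x : frac_pos M t \<longleftrightarrow> r x * s x > 0" "x : frac_neg M t \<longleftrightarrow> r x * s x < 0" if "x : M" "s x ~= 0" for x
   unfolding rs(3) by (rule frac_sign[OF Lo rs(1,2) that])+
  fix p b assume p: "p : M" "b : J p" and WC: "W = C p {b}"
  have "nul p {b} r" using num(1) rs(1) WC by (simp add: nul_C)
  then obtain h g where h: "rpf h" "h p ~= 0" "!!c. rpf (g c)" "!!x. x : M ==> h x * r x = (\<Sum>c\<in>{b}. g c x * tht p c x)"
   by (rule C_divide[OF p(1)]) blast
  have e: "ALL x:M. h x * r x = tht p b x * g b x" using h(4) by simp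
  have "EX x:W. g b x ~= 0"
  proof (rule num(2)[OF rpf_tht[OF p(1)] _ _ _ h(3) e])
   show "ALL x:W. tht p b x = 0" using tht_C[OF p(1)] WC by blast
   show "EX x:M. tht p b x ~= 0"
    using not_nul_tht[OF p, of "{}"] nul_M[OF p(1)] rpf_tht[OF p(1)] by blast
   show "L.den h" using h(1,2) C_base[OF p(1), of "{b}"] unfolding L.den_def WC[symmetric] by blast
  qed
  with h(1-3) e show "EX h kap. rpf h & rpf kap & h p ~= 0 & (EX x:W. kap x ~= 0) & (ALL x:M. h x * r x = tht p b x * kap x)"
   by blast
 qed
qed

section \<open>Restricting a separating function to a wall\<close>

lemma separableI:
 fixes V :: "(real ^ 'n) set"
 assumes "rpf g" "EX x:V. g x ~= 0" "S \<subseteq> V" "T \<subseteq> V" "!!x. x : S ==> g x >= 0" "!!x. x : T ==> g x <= 0"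
 shows "generically_separable V S T"
 unfolding generically_separable_def
proof (intro bexI[of _ "restrict g V"] conjI)
 show "restrict g V : carrier (regular_ring V)" by (rule restrict_regular[OF assms(1)])
 show "restrict g V ~= \<zero>\<^bsub>regular_ring V\<^esub>" 
 proof
  obtain x where x: "x : V" "g x ~= 0" using assms(2) by blast
  assume "restrict g V = \<zero>\<^bsub>regular_ring V\<^esub>"
  from fun_cong[OF this, of x] x show False by (simp add: rr_simps)
 qed
qed (use assms in "auto simp: subset_iff")

text \<open>Multiplying a quotient by the square of its denominator keeps the sign and yields a
  polynomial.\<close>

lemma separableE:
 fixes V :: "(real ^ 'n) set"
 assumes "generically_separable V S T" "S \<subseteq> V" "T \<subseteq> V"
 obtains g where "rpf g" "EX x:V. g x ~= 0" "!!x. x : S ==> g x >= 0" "!!x. x : T ==> g x <= 0"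
proof -
 obtain f where f: "f : carrier (regular_ring V)" "f ~= \<zero>\<^bsub>regular_ring V\<^esub>" "!!x. x : S ==> f x >= 0" "!!x. x : T ==> f x <= 0"
  using assms(1) unfolding generically_separable_def by blast
 obtain P Q where *: "rpf P" "rpf Q" "!!x. x : V ==> Q x ~= 0" "!!x. x : V ==> f x = P x / Q x" "f : extensional V"
  using f(1) by (rule regular_carrierE) blast
 show ?thesis
 proof (rule that[of "%x. P x * Q x"])
  show "rpf (%x. P x * Q x)" by (intro rpf_intros *)
  show "EX x:V. P x * Q x ~= 0"
  proof (rule ccontr)
   assume n: "\<not> ?thesis"
   have "f x = 0" if x: "x : V" for x
   proof -
    have "P x * Q x = 0" using n x by blast
    then show ?thesis using *(3,4)[OF x] by simp
   qed
   then have "f = (\<lambda>x\<in>V. 0)" using *(5) by (auto simp: extensional_def)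
   then show False using f(2) by (simp add: rr_simps)
  qed
  show "P x * Q x >= 0" if "x : S" for x
   using f(3)[OF that] *(4)[of x] that assms(2) by (auto simp: zero_le_divide_iff zero_le_mult_iff)
  show "P x * Q x <= 0" if "x : T" for x
   using f(4)[OF that] *(4)[of x] that assms(3) by (auto simp: divide_le_0_iff mult_le_0_iff)
 qed
qed

text \<open>\<open>k\<close> is the order of \<open>f\<close> along the wall. Off the wall
  \<open>beta * H\<close> has the sign of \<open>f\<close> if \<open>k\<close> is even, and the sign
  of \<open>f\<close> times the local equation if \<open>k\<close> is odd; the factor
  \<open>G\<close> then exchanges the local equation for the uniformizer.\<close>

lemma separable_on_walls:
 assumes f: "rpf f" "EX x:M. f x ~= 0" "!!x. x : A ==> f x >= 0" "!!x. x : B ==> f x <= 0"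
  and W: "W : walls M A B" and t: "uniformizer (local_ring_at M W) t"
 shows "generically_separable W (shadow W A) (shadow W B) |
   generically_separable W (shadow W (twist M t A B)) (shadow W (twist M t B A))"
proof -
 obtain p where pW: "p : W" using wall_props(6)[OF W] by blast
 then have p: "p : M" using wall_props(3)[OF W] by blast
 obtain b where b: "b : J p" "W = C p {b}" by (rule wall_through[OF W pW])
 have "\<not> nul p {} f" using f(2) nul_M[OF p] by blast
 then obtain k beta H where k: "rpf beta" "beta p ~= 0" "rpf H" "!!x. x : M ==> beta x * f x = tht p b x ^ k * H x" "\<not> nul p {b} H"
  by (rule C_order[OF p f(1) _ b(1) empty_iff[THEN iffD1, THEN notI]]) (use C_empty[OF p] in auto)
 have H: "EX x:W. H x ~= 0" using k(3,5) b(2) by (simp add: nul_C)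
 have bH: "EX x:W. beta x * H x ~= 0"
  by (rule primeset_nonzero_mult[OF wall_props(1)[OF W] k(1,3) _ H]) (use k(2) pW in blast)
 have rbH: "rpf (%x. beta x * H x)" by (intro rpf_intros k)
 have nz: "EX x:M. tht p b x ~= 0" using not_nul_tht[OF p b(1), of "{}"] nul_M[OF p] rpf_tht[OF p] by blast
 have sq: "tht p b x ^ k * (beta x * H x) = (beta x)\<^sup>2 * f x" if "x : M" for x
  using k(4)[OF that] by (simp add: power2_eq_square mult_ac)
 show ?thesis
 proof (cases "even k")
  case True
  obtain y where y: "y : M" "tht p b y ~= 0" using nz by blast
  have "generically_separable W (shadow W A) (shadow W B)"
  proof (rule separableI[OF rbH bH])
   fix x assume "x : shadow W A"
   then have x: "x : closure A" by (simp add: shadow_def)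
   show "beta x * H x >= 0"
   proof (rule closure_sign[OF oA rpf_tht[OF p] y rbH _ x])
    fix x assume x: "x : A" "tht p b x ~= 0"
    have "0 <= tht p b x ^ k * (beta x * H x)" using sq[of x] f(3)[OF x(1)] AM x(1) by auto
    moreover have "tht p b x ^ k > 0" using x(2) True by (simp add: zero_less_power_eq)
    ultimately show "0 <= beta x * H x" by (simp add: zero_le_mult_iff)
   qed
  next
   fix x assume "x : shadow W B"
   then have x: "x : closure B" by (simp add: shadow_def)
   have "- (beta x * H x) >= 0"
   proof (rule closure_sign[OF oB rpf_tht[OF p] y _ _ x])
    show "rpf (%x. - (beta x * H x))" by (intro rpf_intros k)
    fix x assume x: "x : B" "tht p b x ~= 0"
    have "tht p b x ^ k * (beta x * H x) <= 0" using sq[of x] f(4)[OF x(1)] BM x(1) by (auto simp: mult_nonneg_nonpos)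
    moreover have "tht p b x ^ k > 0" using x(2) True by (simp add: zero_less_power_eq)
    ultimately show "0 <= - (beta x * H x)" by (auto simp: mult_le_0_iff)
   qed
   then show "beta x * H x <= 0" by simp
  qed (auto simp: shadow_def)
  then show ?thesis ..
 next
  case False
  obtain r s where rs: "rpf r" "rpf s" "EX x:W. s x ~= 0"
   "!!x. x : M ==> s x ~= 0 ==> x : frac_pos M t \<longleftrightarrow> r x * s x > 0"
   "!!x. x : M ==> s x ~= 0 ==> x : frac_neg M t \<longleftrightarrow> r x * s x < 0"
   "!!p b. p : M ==> b : J p ==> W = C p {b} ==> EX h kap. rpf h & rpf kap & h p ~= 0 & (EX x:W. kap x ~= 0) &
    (ALL x:M. h x * r x = tht p b x * kap x)" by (rule uniformizer_sign[OF W t]) blast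
  obtain h kap where h: "rpf h" "rpf kap" "h p ~= 0" "EX x:W. kap x ~= 0" "!!x. x : M ==> h x * r x = tht p b x * kap x"
   using rs(6)[OF p b] by blast
  define G where "G x = kap x * (h x * s x)" for x
  have rG: "rpf G" unfolding G_def[abs_def] by (intro rpf_intros h rs)
  have rhs: "rpf (%x. h x * s x)" by (intro rpf_intros h rs)
  have hs: "EX x:W. h x * s x ~= 0"
   by (rule primeset_nonzero_mult[OF wall_props(1)[OF W] h(1) rs(2) _ rs(3)]) (use h(3) pW in blast)
  have nG: "EX x:W. G x ~= 0" unfolding G_def
   by (rule primeset_nonzero_mult[OF wall_props(1)[OF W] h(2) rhs h(4) hs])
  define g where "g x = (beta x * H x) * G x" for x
  have rg: "rpf g" unfolding g_def[abs_def] by (intro rpf_intros k rG)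
  have ng: "EX x:W. g x ~= 0" unfolding g_def
   by (rule primeset_nonzero_mult[OF wall_props(1)[OF W] rbH rG bH nG])
  have "EX x:M. tht p b x * (h x * s x) ~= 0"
   by (rule primeset_nonzero_mult[OF prime rpf_tht[OF p] rhs nz]) (use hs wall_props(3)[OF W] in blast)
  then obtain y where y: "y : M" "tht p b y * (h y * s y) ~= 0" by blast
  have rT: "rpf (%x. tht p b x * (h x * s x))" by (intro rpf_intros rpf_tht p h rs)
  have sg: "tht p b x * G x = (h x)\<^sup>2 * (r x * s x)" if "x : M" for x
   using h(5)[OF that] by (simp add: G_def power2_eq_square mult_ac)
  \<comment> \<open>The power of the local equation is even on the left. On the right
    \<open>tht p b x * G x\<close> has the sign of \<open>r x * s x\<close> by \<open>sg\<close>, so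
    the sign of \<open>g\<close> is that of \<open>f\<close> on one side of the uniformizer and the
    opposite on the other.\<close>
  have key: "(tht p b x * tht p b x ^ k) * g x = (tht p b x * G x) * ((beta x)\<^sup>2 * f x)" if "x : M" for x
   using sq[OF that] by (simp add: g_def mult_ac)
  have even: "tht p b x * tht p b x ^ k > 0" if "tht p b x ~= 0" for x
   using that False zero_less_power_eq[of "tht p b x" "Suc k"] by simp
  have open_frac: "openin (top_of_set M) (frac_pos M t)" "openin (top_of_set M) (frac_neg M t)"
   using open_frac[OF W] t by (auto simp: uniformizer_def)
  have tw: "openin (top_of_set M) (twist M t A B)" "openin (top_of_set M) (twist M t B A)"
   unfolding twist_def using oA oB open_frac by (auto intro!: openin_Un openin_Int)
  have ev: "0 <= c * g x" if x: "x : M" "tht p b x * (h x * s x) ~= 0" and c: "0 <= c * ((r x * s x) * f x)" for x c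
  proof -
   have "(tht p b x * tht p b x ^ k) * (c * g x) = (h x)\<^sup>2 * (beta x)\<^sup>2 * (c * ((r x * s x) * f x))"
   proof -
    have "(tht p b x * tht p b x ^ k) * (c * g x) = c * ((tht p b x * tht p b x ^ k) * g x)" by simp
    also have "... = c * (((h x)\<^sup>2 * (r x * s x)) * ((beta x)\<^sup>2 * f x))" by (simp only: key[OF x(1)] sg[OF x(1)])
    finally show ?thesis by (simp only: mult_ac)
   qed
   also have "0 <= ..." by (rule mult_nonneg_nonneg[OF _ c]) simp
   finally have "0 <= (tht p b x * tht p b x ^ k) * (c * g x)" .
   then show ?thesis using even[of x] x(2) by (simp add: zero_le_mult_iff)
  qed
  have "generically_separable W (shadow W (twist M t A B)) (shadow W (twist M t B A))"
  proof (rule separableI[OF rg ng])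
   fix x assume "x : shadow W (twist M t A B)"
   then have x: "x : closure (twist M t A B)" by (simp add: shadow_def)
   show "g x >= 0"
   proof (rule closure_sign[OF tw(1) rT y rg _ x])
    fix x assume x: "x : twist M t A B" "tht p b x * (h x * s x) ~= 0"
    have xM: "x : M" using x(1) AM BM by (auto simp: twist_def)
    have "0 <= 1 * ((r x * s x) * f x)"
    proof -
     have sx: "s x ~= 0" using x(2) by auto
     have "(0 < r x * s x & 0 <= f x) | (r x * s x < 0 & f x <= 0)"
      using x(1) f(3,4) rs(4,5)[OF xM sx] unfolding twist_def by blast
     then show ?thesis by (auto intro: mult_nonneg_nonneg mult_nonpos_nonpos simp del: mult.assoc)
    qed
    from ev[OF xM x(2) this] show "0 <= g x" by simp
   qed
  next
   fix x assume "x : shadow W (twist M t B A)"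
   then have x: "x : closure (twist M t B A)" by (simp add: shadow_def)
   have "- g x >= 0"
   proof (rule closure_sign[OF tw(2) rT y _ _ x])
    show "rpf (%x. - g x)" by (intro rpf_intros rg)
    fix x assume x: "x : twist M t B A" "tht p b x * (h x * s x) ~= 0"
    have xM: "x : M" using x(1) AM BM by (auto simp: twist_def)
    have "0 <= (- 1) * ((r x * s x) * f x)"
    proof -
     have sx: "s x ~= 0" using x(2) by auto
     have "(0 < r x * s x & f x <= 0) | (r x * s x < 0 & 0 <= f x)"
      using x(1) f(3,4) rs(4,5)[OF xM sx] unfolding twist_def by blast
     then have "r x * s x * f x <= 0" by (auto intro: mult_nonneg_nonpos mult_nonpos_nonneg)
     then show ?thesis by simp
    qed
    from ev[OF xM x(2) this] show "0 <= - g x" by simp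
   qed
   then show "g x <= 0" by simp
  qed (auto simp: shadow_def)
  then show ?thesis ..
 qed
qed

subsection \<open>Orders along flags of strata\<close>

definition sg :: "(real ^ 'n) set => real" where
 "sg S = (if S = A then 1 else - 1)"

definition sprod :: "'n list => nat list => real ^ 'n => real" where
 "sprod bs ks z = prod_list (map (%(b, k). sgn (z $ b) ^ k) (zip bs ks))"

text \<open>\<open>z\<close> is a sample point of \<open>S\<close> off the walls, and
  \<open>y\<close> is a point of the stratum of \<open>bs\<close> whose remaining wall coordinates
  have the signs of \<open>z\<close>. Passing from \<open>z\<close> to \<open>y\<close> only the
  signs at \<open>bs\<close> are lost; they enter through the exponents \<open>ks\<close>.\<close>

definition signs_ok :: "real ^ 'n => 'n list => nat list => (real ^ 'n => real) => bool" where
 "signs_ok p bs ks H \<longleftrightarrow> (ALL S z y. (S = A | S = B) & z : slice (J p) & norm z < rho p & (ALL c:Wb p. z $ c ~= 0) &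
   Psi p z : S & y : slice (J p - set bs) & norm y < rho p & (ALL c:J p - set bs. y $ c ~= 0) &
   (ALL c:Wb p - set bs. sgn (y $ c) = sgn (z $ c)) --> 0 <= sg S * sprod bs ks z * H (Psi p y))"

text \<open>Equality up to factors that vanish identically on no irreducible subset through both
  \<open>p\<close> and \<open>q\<close>. This is weaker than being units at both points, but it
  survives restriction to smaller strata.\<close>

definition linked :: "real ^ 'n => real ^ 'n => (real ^ 'n) set => (real ^ 'n => real) => (real ^ 'n => real) => bool" where
 "linked p q V H H' \<longleftrightarrow> (EX u u'. rpf u & rpf u' & (ALL x:V. u x * H x = u' x * H' x) &
   (ALL Z. primeset Z & Z \<subseteq> V & p : Z & q : Z --> (EX x:Z. u x ~= 0) & (EX x:Z. u' x ~= 0)))"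

text \<open>The parity \<open>\<epsilon>\<close> will be \<open>0\<close> for separable shadows and
  \<open>1\<close> for separable counter-shadows. The function depends on the centre
  \<open>p\<close> because a uniformizer has to be compared with the local equation at
  \<open>p\<close>.\<close>

definition start :: "(real ^ 'n) set => nat => (real ^ 'n => real ^ 'n => real) => bool" where
 "start W \<epsilon> H \<longleftrightarrow> (ALL p:W. rpf (H p) & (EX x:W. H p x ~= 0) &
   (ALL b:J p. W = C p {b} --> signs_ok p [b] [\<epsilon>] (H p)) & (ALL q:W. linked p q W (H p) (H q)))"

lemma path_ev:
 assumes "norm y < r"
 shows "eventually (%e. 0 < e & norm (y + (e * s) *\<^sub>R (axis b 1 :: real ^ 'n)) < r) (at_right 0)"
proof -
 have "((%e. norm (y + (e * s) *\<^sub>R (axis b 1 :: real ^ 'n))) \<longlongrightarrow> norm (y + (0 * s) *\<^sub>R (axis b 1 :: real ^ 'n))) (at_right 0)"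
  by (intro tendsto_intros)
 from order_tendstoD(2)[OF this, of r] assms
 have "eventually (%e. norm (y + (e * s) *\<^sub>R (axis b 1 :: real ^ 'n)) < r) (at_right 0)" by simp
 then show ?thesis using eventually_at_right_less[of "0 :: real"] by eventually_elim auto
qed

lemma path_tendsto:
 assumes "p : M" "norm y < rho p"
 shows "((%e. Psi p (y + (e * s) *\<^sub>R axis b 1)) \<longlongrightarrow> Psi p y) (at_right 0)"
proof (rule isCont_tendsto_compose[OF Psi_cont[OF assms]])
 have "((%e. y + (e * s) *\<^sub>R axis b 1) \<longlongrightarrow> y + (0 * s) *\<^sub>R axis b 1) (at_right 0)" by (intro tendsto_intros)
 then show "((%e. y + (e * s) *\<^sub>R axis b 1) \<longlongrightarrow> y) (at_right 0)" by simp
qed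

lemma path_closure:
 assumes "p : M" "norm y < rho p" "eventually (%e. Psi p (y + (e * s) *\<^sub>R axis b 1) : S) (at_right 0)"
 shows "Psi p y : closure S"
proof (rule Lim_in_closed_set[OF closed_closure _ _ path_tendsto[OF assms(1,2), of s b]])
 show "eventually (%e. Psi p (y + (e * s) *\<^sub>R axis b 1) : closure S) (at_right 0)"
  using assms(3) by eventually_elim (rule subsetD[OF closure_subset])
qed simp

lemma path_rpf:
 assumes "p : M" "norm y < rho p" "rpf F"
 shows "((%e. F (Psi p (y + (e * s) *\<^sub>R axis b 1))) \<longlongrightarrow> F (Psi p y)) (at_right 0)"
 by (rule isCont_tendsto_compose[OF rpf_isCont[OF assms(3)] path_tendsto[OF assms(1,2)]])

lemma path_nonneg:
 assumes "p : M" "norm y < rho p" "rpf F"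
  and "eventually (%e. 0 <= F (Psi p (y + (e * s) *\<^sub>R axis b 1))) (at_right 0)"
 shows "0 <= F (Psi p y)"
 by (rule tendsto_lowerbound[OF path_rpf[OF assms(1-3)] assms(4)]) simp

lemma path_slice: "y : slice (K - insert b S) ==> b : K ==> b ~: S ==> y + t *\<^sub>R axis b 1 : slice (K - S)"
 by (auto simp: slice_def axis_def)

lemma path_coord: "(y + t *\<^sub>R axis b 1 :: real ^ 'n) $ c = (if c = b then y $ b + t else y $ c)"
 by (simp add: axis_def)

lemma Wb_J: "b : Wb p ==> b : J p"
 by (simp add: Wb_def)

text \<open>A small step from the wall point \<open>y\<close> in the direction of the sign of
  \<open>z $ b\<close> enters the chamber of \<open>z\<close>.\<close>

lemma path_chamber:
 assumes p: "p : M" "b : Wb p" and S: "S = A | S = B" and z: "z : slice (J p)" "norm z < rho p" "ALL c:Wb p. z $ c ~= 0" "Psi p z : S"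
  and y: "y : slice (J p - {b})" "norm y < rho p" "ALL c:J p - {b}. y $ c ~= 0"
  "ALL c:Wb p - {b}. sgn (y $ c) = sgn (z $ c)"
 shows "eventually (%e. 0 < e & norm (y + (e * sgn (z $ b)) *\<^sub>R axis b 1) < rho p & Psi p (y + (e * sgn (z $ b)) *\<^sub>R axis b 1) : S) (at_right 0)"
 using path_ev[OF y(2), of "sgn (z $ b)" b]
proof eventually_elim
 case (elim e)
 have yb: "y $ b = 0" using y(1) by (simp add: slice_def)
 have zb: "z $ b ~= 0" using z(3) p(2) by blast
 have "Psi p (y + (e * sgn (z $ b)) *\<^sub>R axis b 1) : S"
 proof (rule chamber[OF p(1) S z(1,2) _ z(4)])
  show "y + (e * sgn (z $ b)) *\<^sub>R axis b 1 : slice (J p)"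
   using path_slice[of y "J p" b "{}"] y(1) Wb_J[OF p(2)] by simp
  show "(y + (e * sgn (z $ b)) *\<^sub>R axis b 1) $ c ~= 0" if "c : J p" for c
   unfolding path_coord using y(3) that elim zb yb by (cases "c = b") (simp_all add: sgn_0_0)
  show "sgn (z $ c) = sgn ((y + (e * sgn (z $ b)) *\<^sub>R axis b 1) $ c)" if "c : Wb p" for c
   unfolding path_coord using y(4) that elim yb by (cases "c = b") (simp_all add: sgn_mult)
 qed (use elim z in auto)
 with elim show ?case by blast
qed

text \<open>Dividing each local equation by the other gives
  \<open>h x * h' x = g b x * g' c x\<close> on \<open>M\<close>. As \<open>h\<close> is non-zero at
  \<open>p\<close> and \<open>h'\<close> at \<open>q\<close>, no factor is identically zero on an
  irreducible set through both points.\<close>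

lemma tht_compare:
 assumes p: "p : M" "b : J p" and q: "q : M" "c : J q" and eq: "C p {b} = C q {c}"
 obtains h kap where "rpf h" "rpf kap" "!!x. x : M ==> h x * tht q c x = kap x * tht p b x"
  "!!Z. primeset Z ==> Z \<subseteq> M ==> p : Z ==> q : Z ==> (EX x:Z. h x ~= 0) & (EX x:Z. kap x ~= 0)"
proof -
 have "nul p {b} (tht q c)" using nul_tht[OF q(1), of c "{c}"] eq by (simp add: nul_C)
 then obtain h g where h: "rpf h" "h p ~= 0" "!!c. rpf (g c)" "!!x. x : M ==> h x * tht q c x = (\<Sum>c\<in>{b}. g c x * tht p c x)"
  by (rule C_divide[OF p(1)]) blast
 have "nul q {c} (tht p b)" using nul_tht[OF p(1), of b "{b}"] eq by (simp add: nul_C)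
 then obtain h' g' where h': "rpf h'" "h' q ~= 0" "!!c. rpf (g' c)" "!!x. x : M ==> h' x * tht p b x = (\<Sum>d\<in>{c}. g' d x * tht q d x)"
  by (rule C_divide[OF q(1)]) blast
 obtain y where y: "y : M" "tht p b y ~= 0"
  using not_nul_tht[OF p, of "{}"] nul_M[OF p(1)] rpf_tht[OF p(1)] by blast
 have hh: "h x * h' x = g b x * g' c x" if "x : M" for x
 proof (rule primeset_cancel[OF prime rpf_tht[OF p(1)] _ _ _ y that])
  show "rpf (%x. h x * h' x)" "rpf (%x. g b x * g' c x)" by (intro rpf_intros h h')+
  fix x assume x: "x : M"
  have "tht p b x * (h x * h' x) = h x * (h' x * tht p b x)" by simp
  also have "... = g' c x * (h x * tht q c x)" using h'(4)[OF x] by simp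
  also have "... = tht p b x * (g b x * g' c x)" using h(4)[OF x] by simp
  finally show "tht p b x * (h x * h' x) = tht p b x * (g b x * g' c x)" .
 qed
 show ?thesis
 proof (rule that[OF h(1) h(3)[of b]])
  show "h x * tht q c x = g b x * tht p b x" if "x : M" for x using h(4)[OF that] by simp
  fix Z :: "(real ^ 'n) set" assume Z: "primeset Z" "Z \<subseteq> M" "p : Z" "q : Z"
  have "EX x:Z. h x * h' x ~= 0"
   by (rule primeset_nonzero_mult[OF Z(1) h(1) h'(1)]) (use h(2) h'(2) Z in blast)+
  then have "EX x:Z. g b x ~= 0" using hh Z(2) by force
  then show "(EX x:Z. h x ~= 0) & (EX x:Z. g b x ~= 0)" using h(2) Z by blast
 qed
qed

lemma shadow_start:
 assumes W: "W : walls M A B" and sep: "generically_separable W (shadow W A) (shadow W B)"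
 shows "EX \<epsilon> H. start W \<epsilon> H"
proof -
 obtain g where g: "rpf g" "EX x:W. g x ~= 0" "!!x. x : shadow W A ==> g x >= 0" "!!x. x : shadow W B ==> g x <= 0"
  by (rule separableE[OF sep]) (auto simp: shadow_def)
 have "start W 0 (%p. g)"
  unfolding start_def
 proof (intro ballI conjI impI g)
  fix p b assume pW: "p : W" and b: "b : J p" and Wb: "W = C p {b}"
  have p: "p : M" using pW wall_props(3)[OF W] by blast
  have bW: "b : Wb p" using W Wb b by (simp add: Wb_def)
  show "signs_ok p [b] [0] g"
   unfolding signs_ok_def
  proof (intro allI impI, elim conjE)
   fix S z y assume S: "S = A | S = B" and z: "z : slice (J p)" "norm z < rho p" "ALL c:Wb p. z $ c ~= 0" "Psi p z : S"
    and y: "y : slice (J p - set [b])" "norm y < rho p" "ALL c:J p - set [b]. y $ c ~= 0"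
    "ALL c:Wb p - set [b]. sgn (y $ c) = sgn (z $ c)"
   have "Psi p y : closure S"
    by (rule path_closure[OF p y(2) eventually_mono[OF path_chamber[OF p bW S z]]]) (use y in auto)
   moreover have "Psi p y : W" using C_germ[OF y(2), of "{b}"] y(1) Wb by simp
   ultimately have "Psi p y : shadow W S" by (simp add: shadow_def)
   then show "0 <= sg S * sprod [b] [0] z * g (Psi p y)" using S g(3,4) by (auto simp: sg_def sprod_def)
  qed
 next
  fix p q show "linked p q W g g" unfolding linked_def
   by (intro exI[of _ "%_. 1"]) (auto simp: primeset_def)
 qed
 then show ?thesis by blast
qed

text \<open>When \<open>y\<close> is approached from the chamber of \<open>z\<close>, the
  uniformizer has the sign of \<open>sgn (z $ b) * G p (Psi p y)\<close>. Hence \<open>y\<close>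
  lies in a known counter-shadow, and \<open>g\<close> times \<open>G p\<close> obeys the sign
  condition with exponent \<open>1\<close>.\<close>

lemma counter_shadow_start:
 assumes W: "W : walls M A B" and t: "uniformizer (local_ring_at M W) t"
  and sep: "generically_separable W (shadow W (twist M t A B)) (shadow W (twist M t B A))"
 shows "EX \<epsilon> H. start W \<epsilon> H"
proof -
 obtain g where g: "rpf g" "EX x:W. g x ~= 0" "!!x. x : shadow W (twist M t A B) ==> g x >= 0"
  "!!x. x : shadow W (twist M t B A) ==> g x <= 0"
  by (rule separableE[OF sep]) (auto simp: shadow_def)
 obtain r s where rs: "rpf r" "rpf s" "EX x:W. s x ~= 0"
   "!!x. x : M ==> s x ~= 0 ==> x : frac_pos M t \<longleftrightarrow> r x * s x > 0"
   "!!x. x : M ==> s x ~= 0 ==> x : frac_neg M t \<longleftrightarrow> r x * s x < 0"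
   "!!p b. p : M ==> b : J p ==> W = C p {b} ==> EX h kap. rpf h & rpf kap & h p ~= 0 & (EX x:W. kap x ~= 0) &
    (ALL x:M. h x * r x = tht p b x * kap x)" by (rule uniformizer_sign[OF W t]) blast
 note pW = wall_props(1)[OF W] and WM = wall_props(3)[OF W]
 define Q where "Q p q \<longleftrightarrow> (case q of (b, h, kap) => b : J p & W = C p {b} & rpf h & rpf kap & h p ~= 0 & (EX x:W. kap x ~= 0) &
   (ALL x:M. h x * r x = tht p b x * kap x))" for p q
 have "EX q. Q p q" if pW: "p : W" for p
 proof -
  have p: "p : M" using pW WM by blast
  obtain b where b: "b : J p" "W = C p {b}" by (rule wall_through[OF W pW])
  from rs(6)[OF p b] obtain h kap where "rpf h & rpf kap & h p ~= 0 & (EX x:W. kap x ~= 0) & (ALL x:M. h x * r x = tht p b x * kap x)"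
   by (elim exE)
  then show ?thesis using b by (intro exI[of _ "(b, h, kap)"]) (simp add: Q_def)
 qed
 then obtain qq where qq: "!!p. p : W ==> Q p (qq p)" by metis
 define bb where "bb p = fst (qq p)" for p
 define h where "h p = fst (snd (qq p))" for p
 define kap where "kap p = snd (snd (qq p))" for p
 have d: "bb p : J p" "W = C p {bb p}" "rpf (h p)" "rpf (kap p)" "h p p ~= 0" "EX x:W. kap p x ~= 0"
  "!!x. x : M ==> h p x * r x = tht p (bb p) x * kap p x" if "p : W" for p
  using qq[OF that] unfolding Q_def bb_def h_def kap_def by (auto simp: split_def)
 define G where "G p x = kap p x * (h p x * s x)" for p x
 define H where "H p x = g x * G p x" for p x
 have rG: "rpf (G p)" if "p : W" for p unfolding G_def[abs_def] by (intro rpf_intros d[OF that] rs)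
 have nG: "EX x:W. G p x ~= 0" if p: "p : W" for p
  unfolding G_def
  by (intro primeset_nonzero_mult pW rpf_intros d[OF p] rs) (use d(5)[OF p] p in blast)
 have "start W 1 H"
  unfolding start_def
 proof (intro ballI conjI impI)
  fix p assume p: "p : W"
  show "rpf (H p)" unfolding H_def[abs_def] by (intro rpf_intros g rG p)
  show "EX x:W. H p x ~= 0" unfolding H_def by (intro primeset_nonzero_mult pW g rG nG p)
 next
  fix p b assume p': "p : W" and b: "b : J p" and Wb: "W = C p {b}"
  have p: "p : M" using p' WM by blast
  have bb: "bb p = b" using C_inj[OF p d(1)[OF p'], of b] d(2)[OF p'] Wb by simp
  have bW: "b : Wb p" using W Wb b by (simp add: Wb_def)
  show "signs_ok p [b] [1] (H p)"
   unfolding signs_ok_def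
  proof (intro allI impI, elim conjE)
   fix S z y assume S: "S = A | S = B" and z: "z : slice (J p)" "norm z < rho p" "ALL c:Wb p. z $ c ~= 0" "Psi p z : S"
    and y: "y : slice (J p - set [b])" "norm y < rho p" "ALL c:J p - set [b]. y $ c ~= 0"
    "ALL c:Wb p - set [b]. sgn (y $ c) = sgn (z $ c)"
   have zb: "z $ b ~= 0" using z(3) bW by blast
   have yb: "y $ b = 0" using y(1) by (simp add: slice_def)
   let ?s = "sgn (z $ b)"
   show "0 <= sg S * sprod [b] [1] z * H p (Psi p y)"
   proof (cases "G p (Psi p y) = 0")
    case False
    have "((%e. G p (Psi p (y + (e * ?s) *\<^sub>R axis b 1)) * G p (Psi p y)) \<longlongrightarrow> G p (Psi p y) * G p (Psi p y)) (at_right 0)"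
     by (intro tendsto_intros path_rpf p y(2) rG p')
    moreover have "0 < G p (Psi p y) * G p (Psi p y)" using False not_real_square_gt_zero by blast
    ultimately have "eventually (%e. 0 < G p (Psi p (y + (e * ?s) *\<^sub>R axis b 1)) * G p (Psi p y)) (at_right 0)"
     by (rule order_tendstoD(1))
    moreover have "eventually (%e. 0 < e & norm (y + (e * ?s) *\<^sub>R axis b 1) < rho p & Psi p (y + (e * ?s) *\<^sub>R axis b 1) : S) (at_right 0)"
     by (rule path_chamber[OF p bW S z]) (use y in auto)
    ultimately have ev: "eventually (%e. Psi p (y + (e * ?s) *\<^sub>R axis b 1) : S \<inter>
      (if ?s * G p (Psi p y) > 0 then frac_pos M t else frac_neg M t)) (at_right 0)"
    proof eventually_elim
     case (elim e)
     let ?y = "y + (e * ?s) *\<^sub>R axis b 1" let ?x = "Psi p ?y"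
     have xM: "?x : M" using elim(2) S AM BM by auto
     have sx: "s ?x ~= 0" "h p ?x ~= 0" using elim(1) by (auto simp: G_def)
     have th: "tht p b ?x = e * ?s" using tht_Psi[OF p, of ?y b] elim(2) yb by (simp add: path_coord)
     have "(h p ?x)\<^sup>2 * (r ?x * s ?x) = tht p b ?x * G p ?x"
      using d(7)[OF p' xM] unfolding bb by (simp add: G_def power2_eq_square mult_ac)
     then have rsx: "(h p ?x)\<^sup>2 * (r ?x * s ?x) = e * (?s * G p ?x)" by (simp add: th mult_ac)
     have h2: "(h p ?x)\<^sup>2 > 0" using sx(2) by simp
     show ?case
     proof (cases "?s * G p (Psi p y) > 0")
      case True
      then have "?s * G p ?x > 0" using elim(1) by (auto simp: zero_less_mult_iff)
      then have "(h p ?x)\<^sup>2 * (r ?x * s ?x) > 0" unfolding rsx using elim(2) by simp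
      then have "r ?x * s ?x > 0" using h2 by (simp add: zero_less_mult_iff[of "(h p ?x)\<^sup>2"])
      then show ?thesis using rs(4)[OF xM sx(1)] elim(2) True by simp
     next
      case no: False
      then have "?s * G p (Psi p y) < 0" using False zb by (simp add: not_less order_le_less sgn_0_0)
      then have "?s * G p ?x < 0" using elim(1) by (auto simp: zero_less_mult_iff mult_less_0_iff)
      then have "(h p ?x)\<^sup>2 * (r ?x * s ?x) < 0" unfolding rsx using elim(2) by (simp add: mult_less_0_iff)
      then have "r ?x * s ?x < 0" using h2 by (simp add: mult_less_0_iff[of "(h p ?x)\<^sup>2"])
      then show ?thesis using rs(5)[OF xM sx(1)] elim(2) no by simp
     qed
    qed
    have cl: "Psi p y : closure (S \<inter> (if ?s * G p (Psi p y) > 0 then frac_pos M t else frac_neg M t))"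
     by (rule path_closure[OF p y(2) ev])
    have yW: "Psi p y : W" using C_germ[OF y(2), of "{b}"] y(1) Wb by simp
    have AB: "S = A | (S = B & S ~= A)" using S by blast
    have "0 <= (sg S * g (Psi p y)) * (?s * G p (Psi p y))"
    proof (cases "?s * G p (Psi p y) > 0")
     case True
     have "0 <= sg S * g (Psi p y)"
      using AB
     proof
      assume "S = A"
      moreover have "A \<inter> frac_pos M t \<subseteq> twist M t A B" by (auto simp: twist_def)
      from closure_mono[OF this] have "Psi p y : shadow W (twist M t A B)" using cl True yW \<open>S = A\<close> by (auto simp: shadow_def)
      ultimately show ?thesis using g(3) by (auto simp: sg_def)
     next
      assume "S = B & S ~= A"
      moreover have "B \<inter> frac_pos M t \<subseteq> twist M t B A" by (auto simp: twist_def)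
      from closure_mono[OF this] have "Psi p y : shadow W (twist M t B A)" using cl True yW \<open>S = B & S ~= A\<close> by (auto simp: shadow_def)
      ultimately show ?thesis using g(4) by (auto simp: sg_def)
     qed
     then show ?thesis by (rule mult_nonneg_nonneg) (use True in linarith)
    next
     case no: False
     have "sg S * g (Psi p y) <= 0"
      using AB
     proof
      assume "S = A"
      moreover have "A \<inter> frac_neg M t \<subseteq> twist M t B A" by (auto simp: twist_def)
      from closure_mono[OF this] have "Psi p y : shadow W (twist M t B A)" using cl no yW \<open>S = A\<close> by (auto simp: shadow_def)
      ultimately show ?thesis using g(4) by (auto simp: sg_def)
     next
      assume "S = B & S ~= A"
      moreover have "B \<inter> frac_neg M t \<subseteq> twist M t A B" by (auto simp: twist_def)
      from closure_mono[OF this] have "Psi p y : shadow W (twist M t A B)" using cl no yW \<open>S = B & S ~= A\<close> by (auto simp: shadow_def)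
      ultimately show ?thesis using g(3) by (auto simp: sg_def)
     qed
     then show ?thesis by (rule mult_nonpos_nonpos) (use no in linarith)
    qed
    then show ?thesis by (simp add: sprod_def H_def mult_ac)
   qed (simp add: H_def)
  qed
 next
  fix p q assume p: "p : W" and q: "q : W"
  have pM: "p : M" and qM: "q : M" using p q WM by auto
  obtain k \<mu> where k: "rpf k" "rpf \<mu>" "!!x. x : M ==> k x * tht q (bb q) x = \<mu> x * tht p (bb p) x"
   "!!Z. primeset Z ==> Z \<subseteq> M ==> p : Z ==> q : Z ==> (EX x:Z. k x ~= 0) & (EX x:Z. \<mu> x ~= 0)"
   by (rule tht_compare[OF pM d(1)[OF p] qM d(1)[OF q]]) (use d(2)[OF p] d(2)[OF q] in auto)
  obtain y where y: "y : M" "tht p (bb p) y ~= 0"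
   using not_nul_tht[OF pM d(1)[OF p], of "{}"] nul_M[OF pM] rpf_tht[OF pM] by blast
  have eq: "h q x * (k x * kap p x) = h p x * (\<mu> x * kap q x)" if "x : M" for x
  proof (rule primeset_cancel[OF prime rpf_tht[OF pM] _ _ _ y that])
   show "rpf (%x. h q x * (k x * kap p x))" "rpf (%x. h p x * (\<mu> x * kap q x))" by (intro rpf_intros k d p q)+
   fix x assume x: "x : M"
   have "tht p (bb p) x * (h q x * (k x * kap p x)) = h q x * (k x * (h p x * r x))" using d(7)[OF p x] by simp
   also have "... = h p x * (k x * (h q x * r x))" by simp
   also have "... = h p x * ((k x * tht q (bb q) x) * kap q x)" using d(7)[OF q x] by simp
   also have "... = tht p (bb p) x * (h p x * (\<mu> x * kap q x))" using k(3)[OF x] by simp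
   finally show "tht p (bb p) x * (h q x * (k x * kap p x)) = tht p (bb p) x * (h p x * (\<mu> x * kap q x))" .
  qed
  show "linked p q W (H p) (H q)" unfolding linked_def
  proof (rule exI[of _ "%x. h q x * (h q x * k x)"], rule exI[of _ "%x. h p x * (h p x * \<mu> x)"],
    intro conjI ballI allI impI)
   show "rpf (%x. h q x * (h q x * k x))" "rpf (%x. h p x * (h p x * \<mu> x))" by (intro rpf_intros k d p q)+
   fix x assume "x : W"
   then have x: "x : M" using WM by blast
   have "h q x * (h q x * k x) * H p x = (g x * s x * h p x * h q x) * (h q x * (k x * kap p x))" by (simp add: H_def G_def)
   also have "... = h p x * (h p x * \<mu> x) * H q x" unfolding eq[OF x] by (simp add: H_def G_def)
   finally show "h q x * (h q x * k x) * H p x = h p x * (h p x * \<mu> x) * H q x" .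
  next
   fix Z :: "(real ^ 'n) set" assume "primeset Z & Z \<subseteq> W & p : Z & q : Z"
   then have Z: "primeset Z" "Z \<subseteq> M" "p : Z" "q : Z" using WM by auto
   have n: "EX x:Z. h p x ~= 0" "EX x:Z. h q x ~= 0" using d(5)[OF p] d(5)[OF q] Z by auto
   show "EX x:Z. h q x * (h q x * k x) ~= 0" "EX x:Z. h p x * (h p x * \<mu> x) ~= 0"
    using k(4)[OF Z] n by (intro primeset_nonzero_mult[OF Z(1)] rpf_intros k d p q; blast)+
  qed
 qed
 then show ?thesis by blast
qed

end

section \<open>Orders of vanishing and the sign rule\<close>

locale started = atlas +
 fixes \<epsilon> :: "(real ^ 'a) set => nat" and H1 :: "(real ^ 'a) set => real ^ 'a => real ^ 'a => real"
 assumes start: "!!W. W : walls M A B ==> start W (\<epsilon> W) (H1 W)"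
begin

text \<open>\<open>ords p bs ks H\<close>: the successive orders of vanishing of the separating function of the first
  wall along the flag of strata cut out by \<open>bs\<close> are \<open>ks\<close>, with leading coefficient \<open>H\<close> on the last
  stratum.\<close>

inductive ords :: "real ^ 'a => 'a list => nat list => (real ^ 'a => real) => bool" for p where
 base: "b : Wb p ==> ords p [b] [\<epsilon> (C p {b})] (H1 (C p {b}) p)"
| step: "ords p bs ks H ==> b : Wb p ==> b ~: set bs ==> rpf beta ==> beta p ~= 0 ==> rpf H' ==>
  (!!x. x : C p (set bs) ==> beta x * H x = tht p b x ^ k * H' x) ==> \<not> nul p (insert b (set bs)) H' ==>
  ords p (bs @ [b]) (ks @ [k]) (%x. beta x * H' x)"

lemma start_wall:
 assumes p: "p : M" and b: "b : Wb p"
 shows "rpf (H1 (C p {b}) p)" "\<not> nul p {b} (H1 (C p {b}) p)" "signs_ok p [b] [\<epsilon> (C p {b})] (H1 (C p {b}) p)"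
  "!!q. q : C p {b} ==> linked p q (C p {b}) (H1 (C p {b}) p) (H1 (C p {b}) q)"
 using start[of "C p {b}"] b C_base[OF p, of "{b}"] unfolding start_def Wb_def by (auto simp: nul_C)

lemma ords_props:
 assumes p: "p : M" and "ords p bs ks H"
 shows "rpf H & \<not> nul p (set bs) H & set bs \<subseteq> Wb p & length ks = length bs & distinct bs & bs ~= []"
 using assms(2)
proof induction
 case (base b)
 then show ?case using start_wall[OF p base] by simp
next
 case (step bs ks H b beta H' k)
 have "\<not> nul p (insert b (set bs)) (%x. beta x * H' x)"
  using primesetD[OF C_prime[OF p] step.hyps(4,6), of "insert b (set bs)"] step.hyps C_base[OF p, of "insert b (set bs)"]
  unfolding nul_C by blast
 with step show ?case by (auto intro: real_polynomial_function.intros(4))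
qed

lemma ords_exists:
 assumes p: "p : M"
 shows "bs ~= [] ==> distinct bs ==> set bs \<subseteq> Wb p ==> EX ks H. ords p bs ks H"
proof (induction bs rule: rev_induct)
 case (snoc b bs)
 show ?case
 proof (cases "bs = []")
  case True
  then show ?thesis using snoc.prems base[of b p] by auto
 next
  case False
  then obtain ks H where o: "ords p bs ks H" using snoc by auto
  note op = ords_props[OF p o]
  have b: "b : J p" "b ~: set bs" "b : Wb p" using snoc.prems Wb_J by auto
  obtain k beta H' where "rpf beta" "beta p ~= 0" "rpf H'" "!!x. x : C p (set bs) ==> beta x * H x = tht p b x ^ k * H' x"
   "\<not> nul p (insert b (set bs)) H'"
   by (rule C_order[OF p _ _ b(1,2), of H]) (use op in auto)
  from step[OF o b(3,2) this(1,2,3,4,5)] show ?thesis by blast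
 qed
qed simp

lemma ords_take:
 assumes "ords p bs ks H" "0 < i" "i <= length bs" "p : M"
 shows "EX H. ords p (take i bs) (take i ks) H"
 using assms(1-3)
proof (induction)
 case (base b)
 then have "i = 1" by simp
 then show ?case using ords.base[OF base.hyps] by auto
next
 case (step bs ks H b beta H' k)
 have len: "length ks = length bs" using ords_props[OF assms(4) step.hyps(1)] by blast
 show ?case
 proof (cases "i <= length bs")
  case True
  then show ?thesis using step.IH step.prems len by simp
 next
  case False
  then have "i = Suc (length bs)" using step.prems by simp
  then show ?thesis using ords.step[OF step.hyps] len by auto
 qed
qed

text \<open>Along a common flag two factorisations differ by factors that are not identically zero
  on the next stratum. If the exponents differed, cancelling the smaller power of the local equation
  would make one of the leading coefficients vanish there.\<close>

lemma ords_unique: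
 assumes p: "p : M" and q: "q : M" and "ords p bs ks H"
 shows "ords q cs ls H' ==> map (%b. C p {b}) bs = map (%c. C q {c}) cs ==> q : C p (set bs) ==>
  ks = ls & linked p q (C p (set bs)) H H'"
 using assms(3)
proof (induction arbitrary: cs ls H')
 case (base b)
 from base.prems(1) show ?case
 proof cases
  case (base c)
  then have eq: "C p {b} = C q {c}" using \<open>map _ [b] = map _ cs\<close> by simp
  then show ?thesis using base start_wall(4)[OF p \<open>b : Wb p\<close>, of q] \<open>q : C p (set [b])\<close> by simp
 next
  case (step cs' ls' H c)
  then have "cs' = []" using \<open>map _ [b] = map _ cs\<close> by (cases cs') auto
  then show ?thesis using ords_props[OF q step(4)] by simp
 qed
next
 case (step bs ks H b beta H0 k)
 note st_prems = step.prems and st_hyps = step.hyps and st_IH = step.IH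
 note op = ords_props[OF p step.hyps(1)]
 from step.prems(1) show ?case
 proof cases
  case (base c)
  then have "length bs = 0" using step.prems(2) by simp
  then show ?thesis using op by simp
 next
  case (step cs' ls' H2 c beta' H0' k')
  note oq = ords_props[OF q step(4)]
  have maps: "map (%b. C p {b}) bs = map (%c. C q {c}) cs'" "C p {b} = C q {c}"
   using st_prems(2) step(1) by simp_all
  have qin: "q : C p (set bs)" using st_prems(3) C_mono[of "set bs" "set (bs @ [b])" p] by auto
  have IH: "ks = ls' & linked p q (C p (set bs)) H H2" by (rule st_IH[OF step(4) maps(1) qin])
  then have ks: "ks = ls'" ..
  obtain u u' where u0: "rpf u & rpf u' & (ALL x:C p (set bs). u x * H x = u' x * H2 x) &
   (ALL Z. primeset Z & Z \<subseteq> C p (set bs) & p : Z & q : Z --> (EX x:Z. u x ~= 0) & (EX x:Z. u' x ~= 0))"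
   using conjunct2[OF IH] unfolding linked_def by (elim exE)
  then have u: "rpf u" "rpf u'" "!!x. x : C p (set bs) ==> u x * H x = u' x * H2 x"
   "!!Z. primeset Z ==> Z \<subseteq> C p (set bs) ==> p : Z ==> q : Z ==> (EX x:Z. u x ~= 0) & (EX x:Z. u' x ~= 0)"
   by simp_all
  have im: "(%b. C p {b}) ` set bs = (%c. C q {c}) ` set cs'" using arg_cong[OF maps(1), of set] by simp
  \<comment> \<open>As \<open>q\<close> lies on \<open>C p (set bs)\<close>, both flags run through
    the same component of the intersection of their walls.\<close>
  have Zeq: "C q (set cs') = C p (set bs)" by (rule C_eq[OF p q im qin])
  have im': "(%b. C p {b}) ` insert b (set bs) = (%c. C q {c}) ` insert c (set cs')" using im maps(2) by simp
  have qin': "q : C p (insert b (set bs))" using st_prems(3) by simp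
  have Zeq': "C q (insert c (set cs')) = C p (insert b (set bs))" by (rule C_eq[OF p q im' qin'])
  let ?Z = "C p (set bs)" and ?Z' = "C p (insert b (set bs))"
  have sub: "?Z' \<subseteq> ?Z" by (rule C_mono) blast
  have bJ: "b : J p" "c : J q" using st_hyps(2) step(5) by (auto intro: Wb_J)
  obtain h kap where h: "rpf h" "rpf kap" "!!x. x : M ==> h x * tht q c x = kap x * tht p b x"
   "!!Z. primeset Z ==> Z \<subseteq> M ==> p : Z ==> q : Z ==> (EX x:Z. h x ~= 0) & (EX x:Z. kap x ~= 0)"
   by (rule tht_compare[OF p bJ(1) q bJ(2) maps(2)]) blast
  have rel: "tht p b x ^ k * (u x * beta' x * h x ^ k' * H0 x) = tht p b x ^ k' * (u' x * beta x * kap x ^ k' * H0' x)"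
   if x: "x : ?Z" for x
  proof -
   have xM: "x : M" using C_M[OF p] x by blast
   have "tht p b x ^ k * (u x * beta' x * h x ^ k' * H0 x) = (beta x * H x) * (u x * beta' x * h x ^ k')"
    using st_hyps(7)[OF x] by simp
   also have "... = (u x * H x) * (beta x * beta' x * h x ^ k')" by simp
   also have "... = (beta' x * H2 x) * (u' x * beta x * h x ^ k')" unfolding u(3)[OF x] by simp
   also have "... = (h x * tht q c x) ^ k' * (u' x * beta x * H0' x)"
    using step(10)[of x] x Zeq by (simp add: power_mult_distrib)
   also have "... = tht p b x ^ k' * (u' x * beta x * kap x ^ k' * H0' x)" unfolding h(3)[OF xM] by (simp add: power_mult_distrib)
   finally show ?thesis .
  qed
  \<comment> \<open>Once the local equation at \<open>q\<close> is exchanged for the one at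
    \<open>p\<close>, both sides are powers of \<open>tht p b\<close> times functions that are not
    identically zero on the next stratum.\<close>
  define L where "L x = u x * beta' x * h x ^ k' * H0 x" for x
  define R where "R x = u' x * beta x * kap x ^ k' * H0' x" for x
  have rL: "rpf L" "rpf R" unfolding L_def[abs_def] R_def[abs_def] by (intro rpf_intros u st_hyps step h)+
  have rel': "tht p b x ^ k * L x = tht p b x ^ k' * R x" if "x : ?Z" for x
   using rel[OF that] by (simp only: L_def R_def)
  have pZ: "primeset ?Z" "primeset ?Z'" by (rule C_prime[OF p])+
  have ZM: "?Z \<subseteq> M" "?Z' \<subseteq> M" by (rule C_M[OF p])+
  have pq: "p : ?Z'" "q : ?Z'" "p : ?Z" using C_base[OF p] qin' by auto
  have ne: "EX x:?Z'. u x ~= 0" "EX x:?Z'. u' x ~= 0" "EX x:?Z'. h x ^ k' ~= 0" "EX x:?Z'. kap x ^ k' ~= 0"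
   "EX x:?Z'. beta x ~= 0" "EX x:?Z'. beta' x ~= 0" "EX x:?Z'. H0 x ~= 0" "EX x:?Z'. H0' x ~= 0"
   using u(4)[OF pZ(2) sub pq(1,2)] h(4)[OF pZ(2) ZM(2) pq(1,2)] st_hyps(5,6,8) step(7,8,9,11) pq Zeq'
   by (auto simp: nul_C)
  have nL: "EX x:?Z'. L x ~= 0" unfolding L_def
   by (intro primeset_nonzero_mult pZ rpf_intros u h st_hyps step ne)
  have nR: "EX x:?Z'. R x ~= 0" unfolding R_def
   by (intro primeset_nonzero_mult pZ rpf_intros u h st_hyps step ne)
  have nultht: "\<not> nul p (set bs) (tht p b)" by (rule not_nul_tht[OF p bJ(1) st_hyps(3)])
  then obtain y where y: "y : ?Z" "tht p b y ~= 0" using rpf_tht[OF p] by (auto simp: nul_C)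
  have cancel: "a x = c x" if "rpf a" "rpf c" "!!x. x : ?Z ==> tht p b x ^ i * a x = tht p b x ^ i * c x" "x : ?Z" for a c i x
  proof (rule primeset_cancel[OF pZ(1) _ that(1-3) y(1) _ that(4)])
   show "rpf (%x. tht p b x ^ i)" by (intro rpf_intros rpf_tht p)
   show "tht p b y ^ i ~= 0" using y(2) by (rule power_not_zero)
  qed
  have tht0: "tht p b x = 0" if "x : ?Z'" for x using tht_C[OF p _ that] by simp
  have kk: "k = k'"
  proof (rule ccontr)
   assume "k ~= k'"
   then consider i where "k' = k + Suc i" | i where "k = k' + Suc i" by (metis less_imp_Suc_add add_Suc_right nat_neq_iff)
   then show False
   proof cases
    case 1
    have "L x = tht p b x ^ Suc i * R x" if "x : ?Z" for x
    proof (rule cancel[OF rL(1) _ _ that])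
     show "rpf (%x. tht p b x ^ Suc i * R x)" by (intro rpf_intros rpf_tht p rL)
     fix x assume "x : ?Z"
     from rel'[OF this] show "tht p b x ^ k * L x = tht p b x ^ k * (tht p b x ^ Suc i * R x)"
      unfolding 1 power_add by (simp only: mult_ac)
    qed
    then show False using nL sub tht0 by force
   next
    case 2
    have "R x = tht p b x ^ Suc i * L x" if "x : ?Z" for x
    proof (rule cancel[OF rL(2) _ _ that])
     show "rpf (%x. tht p b x ^ Suc i * L x)" by (intro rpf_intros rpf_tht p rL)
     fix x assume "x : ?Z"
     from rel'[OF this] show "tht p b x ^ k' * R x = tht p b x ^ k' * (tht p b x ^ Suc i * L x)"
      unfolding 2 power_add by (simp only: mult_ac)
    qed
    then show False using nR sub tht0 by force
   qed
  qed
  have LR: "L x = R x" if "x : ?Z" for x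
   by (rule cancel[OF rL _ that]) (use rel' kk in simp)
  have "linked p q ?Z' (%x. beta x * H0 x) (%x. beta' x * H0' x)"
   unfolding linked_def
  proof (rule exI[of _ "%x. u x * beta' x * h x ^ k' * beta' x"],
    rule exI[of _ "%x. u' x * beta x * kap x ^ k' * beta x"], intro conjI ballI allI impI)
   show "rpf (%x. u x * beta' x * h x ^ k' * beta' x)" "rpf (%x. u' x * beta x * kap x ^ k' * beta x)"
    by (intro rpf_intros u h st_hyps step)+
   fix x assume "x : ?Z'"
   then have x: "x : ?Z" using sub by blast
   have "u x * beta' x * h x ^ k' * beta' x * (beta x * H0 x) = L x * (beta x * beta' x)" by (simp add: L_def)
   also have "... = u' x * beta x * kap x ^ k' * beta x * (beta' x * H0' x)" unfolding LR[OF x] by (simp add: R_def)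
   finally show "u x * beta' x * h x ^ k' * beta' x * (beta x * H0 x) = u' x * beta x * kap x ^ k' * beta x * (beta' x * H0' x)" .
  next
   fix Z :: "(real ^ 'a) set" assume "primeset Z & Z \<subseteq> ?Z' & p : Z & q : Z"
   then have Z: "primeset Z" "Z \<subseteq> ?Z" "p : Z" "q : Z" "Z \<subseteq> M" using sub ZM by auto
   have n: "EX x:Z. u x ~= 0" "EX x:Z. u' x ~= 0" "EX x:Z. h x ^ k' ~= 0" "EX x:Z. kap x ^ k' ~= 0" "EX x:Z. beta x ~= 0" "EX x:Z. beta' x ~= 0"
    using u(4)[OF Z(1-4)] h(4)[OF Z(1,5,3,4)] st_hyps(5) step(8) Z by auto
   show "EX x:Z. u x * beta' x * h x ^ k' * beta' x ~= 0" "EX x:Z. u' x * beta x * kap x ^ k' * beta x ~= 0"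
    by (intro primeset_nonzero_mult Z(1) rpf_intros u h st_hyps step n)+
  qed
  then show ?thesis using ks kk step(1-3) by simp
 qed
qed

lemma sprod_snoc:
 assumes "length bs = length ks"
 shows "sprod (bs @ [b]) (ks @ [k]) z = sprod bs ks z * sgn (z $ b) ^ k"
 using assms by (simp add: sprod_def)

text \<open>The sign on the smaller stratum is a limit of signs on the larger one along a path that
  leaves in the direction of \<open>z $ b\<close>; the power of the local equation contributes
  \<open>sgn (z $ b) ^ k\<close>. The leading coefficient in \<open>ords\<close> is
  \<open>beta x * H' x\<close> and not \<open>H' x\<close>, so that only the square of
  \<open>beta\<close> enters.\<close>

lemma ords_signs:
 assumes p: "p : M" and "ords p bs ks H"
 shows "signs_ok p bs ks H"
 using assms(2)
proof induction
 case (base b)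
 then show ?case by (rule start_wall(3)[OF p])
next
 case (step bs ks H b beta H' k)
 note op = ords_props[OF p step.hyps(1)]
 have bJ: "b : J p" using step.hyps(2) by (rule Wb_J)
 show ?case unfolding signs_ok_def
 proof (intro allI impI, elim conjE)
  fix S z y assume S: "S = A | S = B" and z: "z : slice (J p)" "norm z < rho p" "ALL c:Wb p. z $ c ~= 0" "Psi p z : S"
   and y: "y : slice (J p - set (bs @ [b]))" "norm y < rho p" "ALL c:J p - set (bs @ [b]). y $ c ~= 0"
   "ALL c:Wb p - set (bs @ [b]). sgn (y $ c) = sgn (z $ c)"
  have yb: "y $ b = 0" using y(1) by (simp add: slice_def)
  have zb: "z $ b ~= 0" using z(3) step.hyps(2) by blast
  let ?s = "sgn (z $ b)"
  define c where "c = sg S * sprod bs ks z * ?s ^ k"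
  have r: "rpf (%x. c * (beta x * H' x))" by (intro rpf_cmult rpf_intros step.hyps)
  have "0 <= c * (beta (Psi p y) * H' (Psi p y))"
  proof (rule path_nonneg[OF p y(2) r, of ?s b])
   show "eventually (%e. 0 <= c * (beta (Psi p (y + (e * ?s) *\<^sub>R axis b 1)) * H' (Psi p (y + (e * ?s) *\<^sub>R axis b 1)))) (at_right 0)"
    using path_ev[OF y(2), of ?s b]
   proof eventually_elim
    case (elim e)
    let ?y = "y + (e * ?s) *\<^sub>R axis b 1"
    have sl: "?y : slice (J p - set bs)" using path_slice[of y "J p" b "set bs"] y(1) bJ step.hyps(3) by simp
    have "0 <= sg S * sprod bs ks z * H (Psi p ?y)"
    proof (rule step.IH[unfolded signs_ok_def, rule_format], intro conjI ballI)
     show "?y $ c ~= 0" if "c : J p - set bs" for c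
      unfolding path_coord using y(3) that elim zb yb by (cases "c = b") (simp_all add: sgn_0_0)
     show "sgn (?y $ c) = sgn (z $ c)" if "c : Wb p - set bs" for c
      unfolding path_coord using y(4) that elim yb by (cases "c = b") (simp_all add: sgn_mult)
    qed (use S z sl elim in auto)
    then have "0 <= (beta (Psi p ?y))\<^sup>2 * (sg S * sprod bs ks z * H (Psi p ?y))" by simp
    also have "... = sg S * sprod bs ks z * beta (Psi p ?y) * (beta (Psi p ?y) * H (Psi p ?y))"
     by (simp add: power2_eq_square)
    also have "beta (Psi p ?y) * H (Psi p ?y) = (e * ?s) ^ k * H' (Psi p ?y)"
     using step.hyps(7)[of "Psi p ?y"] C_germ[OF _ sl] elim tht_Psi[OF p, of ?y b] yb by (simp add: path_coord)
    finally have "0 <= e ^ k * (c * (beta (Psi p ?y) * H' (Psi p ?y)))"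
     by (simp add: c_def power_mult_distrib mult_ac)
    moreover have "e ^ k > 0" using elim by simp
    ultimately show ?case by (simp add: zero_le_mult_iff)
   qed
  qed
  then show "0 <= sg S * sprod (bs @ [b]) (ks @ [k]) z * (beta (Psi p y) * H' (Psi p y))"
   using op by (simp add: c_def sprod_snoc mult_ac)
 qed
qed

text \<open>A choice is harmless: by \<open>ords_unique\<close> the orders do not depend on the
  factorisations made along the flag.\<close>

definition kk :: "real ^ 'a => 'a list => nat list" where
 "kk p bs = (SOME ks. EX H. ords p bs ks H)"

lemma kk:
 assumes "p : M" "bs ~= []" "distinct bs" "set bs \<subseteq> Wb p"
 shows "EX H. ords p bs (kk p bs) H"
 unfolding kk_def by (rule someI_ex[OF ords_exists[OF assms]])

lemma kk_eq:
 assumes p: "p : M" "distinct bs" "set bs \<subseteq> Wb p" and q: "q : M" "distinct cs" "set cs \<subseteq> Wb q"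
  and eq: "map (%b. C p {b}) bs = map (%c. C q {c}) cs" and qin: "q : C p (set bs)" and "bs ~= []"
 shows "kk p bs = kk q cs"
proof -
 have "cs ~= []" using eq \<open>bs ~= []\<close> by auto
 then show ?thesis using kk[OF p(1) \<open>bs ~= []\<close> p(2,3)] kk[OF q(1) _ q(2,3)] ords_unique[OF p(1) q(1) _ _ eq qin] by blast
qed

lemma length_kk:
 assumes "p : M" "bs ~= []" "distinct bs" "set bs \<subseteq> Wb p"
 shows "length (kk p bs) = length bs"
 using kk[OF assms] ords_props[OF assms(1)] by blast

lemma kk_take:
 assumes p: "p : M" "distinct bs" "set bs \<subseteq> Wb p" and i: "0 < i" "i <= length bs"
 shows "kk p (take i bs) = take i (kk p bs)"
proof -
 have ne: "bs ~= []" "take i bs ~= []" using i by auto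
 obtain H where H: "ords p bs (kk p bs) H" using kk[OF p(1) ne(1) p(2,3)] by blast
 obtain H' where H': "ords p (take i bs) (take i (kk p bs)) H'" using ords_take[OF H i p(1)] by blast
 have "set (take i bs) \<subseteq> Wb p" using p(3) set_take_subset[of i bs] by blast
 then obtain H2 where "ords p (take i bs) (kk p (take i bs)) H2" using kk[OF p(1) ne(2)] p(2) by auto
 from ords_unique[OF p(1) p(1) this H' refl] C_base[OF p(1)] show ?thesis by blast
qed

lemma sprod_unit:
 assumes "ALL b:set bs. z $ b ~= 0"
 shows "sprod bs ks z = 1 | sprod bs ks z = - 1"
 using assms
proof (induction bs arbitrary: ks)
 case (Cons b bs)
 show ?case
 proof (cases ks)
  case (Cons k ks')
  have "sgn (z $ b) ^ k = 1 | sgn (z $ b) ^ k = - 1"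
   using Cons.prems by (cases "z $ b > 0"; cases "even k") (auto simp: sgn_if)
  moreover have "sprod (b # bs) ks z = sgn (z $ b) ^ k * sprod bs ks' z" using Cons by (simp add: sprod_def)
  ultimately show ?thesis using Cons.IH[of ks'] Cons.prems by auto
 qed (simp add: sprod_def)
qed (simp add: sprod_def)

text \<open>After a full flag no wall coordinate is left, so all sample points \<open>z\<close> are
  compared with one and the same point \<open>y\<close> of the last stratum. The leading coefficient
  is non-zero at a suitable \<open>y\<close>, and its sign there is \<open>s\<close>.\<close>

theorem sign_rule:
 assumes p: "p : M" and bs: "distinct bs" "set bs = Wb p"
 obtains s :: real where "s = 1 | s = - 1" "!!S z. S = A | S = B ==> z : slice (J p) ==> norm z < rho p ==>
   (ALL b:Wb p. z $ b ~= 0) ==> Psi p z : S ==> sg S * sprod bs (kk p bs) z = s"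
proof -
 have ex: "EX s. (s = 1 | s = - 1) & (ALL S z. (S = A | S = B) & z : slice (J p) & norm z < rho p &
   (ALL b:Wb p. z $ b ~= 0) & Psi p z : S --> sg S * sprod bs (kk p bs) z = s)"
 proof (cases "bs = []")
  case True
  \<comment> \<open>Without walls through \<open>p\<close>, \<open>chamber\<close> carries every
    point of \<open>A\<close> or \<open>B\<close> in the chart to this one point, so only one of the
    disjoint sets can meet the chart.\<close>
  define y :: "real ^ 'a" where "y = (\<chi> b. if b : J p then rho p / (2 * (real CARD('a) + 1)) else 0)"
  have "norm y <= (\<Sum>b\<in>UNIV. norm (y $ b))" by (simp add: norm_le_l1_cart)
  also have "... <= (\<Sum>b\<in>(UNIV :: 'a set). rho p / (2 * (real CARD('a) + 1)))"
   by (rule sum_mono) (use rho_pos[OF p] in "auto simp: y_def")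
  also have "... < rho p" using rho_pos[OF p] by (simp add: divide_simps)
  finally have y: "norm y < rho p" .
  have yS: "Psi p y : S" if "S = A | S = B" "z : slice (J p)" "norm z < rho p" "Psi p z : S" for S z
   by (rule chamber[OF p that(1-3) _ that(4) _ y])
    (use True bs(2) rho_pos[OF p] in "auto simp: y_def slice_def")
  show ?thesis
  proof (cases "Psi p y : A")
   case yA: True
   then have "Psi p y ~: B" using disj by blast
   then show ?thesis using yS True by (intro exI[of _ 1]) (auto simp: sprod_def sg_def)
  next
   case False
   then show ?thesis using yS True by (intro exI[of _ "- 1"]) (auto simp: sprod_def sg_def)
  qed
 next
  case False
  obtain H where H: "ords p bs (kk p bs) H" using kk[OF p False bs(1)] bs(2) by auto
  note op = ords_props[OF p H]
  have "EX y. y : slice (J p - set bs) & norm y < rho p & (ALL c:J p - set bs. y $ c > 0) & H (Psi p y) ~= 0"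
  proof (rule ccontr)
   assume n: "\<not> ?thesis"
   have "nul p (set bs) H"
   proof (rule orthant_nul[OF p _ _ _ zero_less_one, where \<sigma> = "%_. 1"])
    fix z :: "real ^ 'a" assume z: "z : slice (J p - set bs)" "norm z < rho p" "!!c. c : J p - set bs ==> sgn (z $ c) = sgn 1"
    have "z $ c > 0" if "c : J p - set bs" for c using z(3)[OF that] by (simp add: sgn_1_pos)
    then show "H (Psi p z) = 0" using n z by blast
   qed (use op in auto)
   then show False using op by blast
  qed
  then obtain y where y: "y : slice (J p - set bs)" "norm y < rho p" "!!c. c : J p - set bs ==> y $ c > 0" "H (Psi p y) ~= 0"
   by blast
  have y': "ALL c:J p - set bs. y $ c ~= 0" using y(3) by force
  have "sg S * sprod bs (kk p bs) z = sgn (H (Psi p y))"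
   if S: "S = A | S = B" and z: "z : slice (J p)" "norm z < rho p" "ALL b:Wb p. z $ b ~= 0" "Psi p z : S" for S z
  proof -
   have "0 <= sg S * sprod bs (kk p bs) z * H (Psi p y)"
    by (rule ords_signs[OF p H, unfolded signs_ok_def, rule_format])
     (use S z y(1,2) y' bs(2) in auto)
   moreover have "sg S = 1 | sg S = - 1" by (simp add: sg_def)
   ultimately show ?thesis using sprod_unit[of bs z "kk p bs"] z(3) bs(2) y(4) by (auto simp: sgn_if split: if_splits)
  qed
  then show ?thesis using y(4) by (intro exI[of _ "sgn (H (Psi p y))"]) (auto simp: sgn_if)
 qed
 then obtain s :: real where s: "(s = 1 | s = - 1) & (ALL S z. (S = A | S = B) & z : slice (J p) & norm z < rho p &
   (ALL b:Wb p. z $ b ~= 0) & Psi p z : S --> sg S * sprod bs (kk p bs) z = s)" by (elim exE)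
 show ?thesis
 proof (rule that)
  show "s = 1 | s = - 1" using s by (rule conjunct1)
  show "sg S * sprod bs (kk p bs) z = s" if "S = A | S = B" "z : slice (J p)" "norm z < rho p"
   "ALL b:Wb p. z $ b ~= 0" "Psi p z : S" for S z
   using conjunct2[OF s] that by simp
 qed
qed

end

subsection \<open>Monomials along flags\<close>

text \<open>Summation by parts for exponents: \<open>a\<close> puts its weight earlier, on smaller
  variables. The induction carries the surplus of exponents so far as a power of a bound
  \<open>m\<close> for the variables already treated.\<close>

lemma monomial_le:
 fixes y :: "nat => real"
 assumes y: "!!i. i < r ==> 0 <= y i" "!!i j. i <= j ==> j < r ==> y i <= y j" "!!i. i < r ==> y i <= 1"
  and ab: "!!l. l < r ==> (\<Sum>i\<le>l. b i) <= (\<Sum>i\<le>l. a i :: nat)"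
 shows "(\<Prod>i<r. y i ^ a i) <= (\<Prod>i<r. y i ^ b i)"
proof -
 have "(\<Prod>i<k. y i ^ a i) <= (\<Prod>i<k. y i ^ b i) * m ^ ((\<Sum>i<k. a i) - (\<Sum>i<k. b i))"
  if "k <= r" "!!i. i < k ==> y i <= m" "0 <= m" "m <= 1" for k m
  using that
 proof (induction k arbitrary: m)
  case (Suc k)
  have yk: "0 <= y k" "y k <= 1" "y k <= m" using y Suc.prems by auto
  let ?S = "(\<Sum>i<k. a i) - (\<Sum>i<k. b i)" and ?T = "(\<Sum>i<Suc k. a i) - (\<Sum>i<Suc k. b i)"
  have S: "(\<Sum>i<k. b i) <= (\<Sum>i<k. a i)"
  proof (cases k)
   case (Suc l)
   then show ?thesis using ab[of l] Suc.prems(1) \<open>Suc k <= r\<close> by (simp add: lessThan_Suc_atMost)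
  qed simp
  have T: "(\<Sum>i<Suc k. b i) <= (\<Sum>i<Suc k. a i)" using ab[of k] Suc.prems(1) unfolding lessThan_Suc_atMost by simp
  have pos: "0 <= (\<Prod>i<k. y i ^ b i)" using y(1) Suc.prems(1) by (intro prod_nonneg) auto
  have "(\<Prod>i<Suc k. y i ^ a i) <= ((\<Prod>i<k. y i ^ b i) * y k ^ ?S) * y k ^ a k"
   unfolding prod.lessThan_Suc
   by (rule mult_right_mono[OF Suc.IH]) (use Suc.prems yk y(2,3) in auto)
  also have "... = (\<Prod>i<k. y i ^ b i) * y k ^ (?S + a k)" by (simp add: power_add)
  also have "?S + a k = b k + ?T" using S T by simp
  also have "(\<Prod>i<k. y i ^ b i) * y k ^ (b k + ?T) = (\<Prod>i<Suc k. y i ^ b i) * y k ^ ?T" by (simp add: power_add)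
  also have "... <= (\<Prod>i<Suc k. y i ^ b i) * m ^ ?T"
   using pos yk by (intro mult_left_mono power_mono) auto
  finally show ?case .
 qed simp
 from this[of r 1] y(3) show ?thesis by simp
qed

lemma sum_distinct_nat:
 fixes S :: "nat set"
 assumes "finite S" "S \<subseteq> {m..}"
 shows "\<Sum>{m..<m + card S} <= \<Sum>S & (S ~= {m..<m + card S} --> \<Sum>{m..<m + card S} < \<Sum>S)"
 using assms
proof (induction "card S" arbitrary: S)
 case 0
 then show ?case by simp
next
 case (Suc k)
 have ne: "S ~= {}" using Suc.hyps(2) by auto
 define x where "x = Max S"
 have x: "x : S" "!!y. y : S ==> y <= x" using ne Suc.prems(1) by (auto simp: x_def)
 have c: "card (S - {x}) = k" using Suc.hyps(2) x(1) Suc.prems(1) by simp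
 have sub: "S \<subseteq> {m..<Suc x}" using x(2) Suc.prems(2) by (auto simp: less_Suc_eq_le)
 have "Suc k <= Suc x - m" using card_mono[OF _ sub] Suc.hyps(2) by simp
 then have xm: "m + k <= x" using x(1) Suc.prems(2) by auto
 have IH: "\<Sum>{m..<m + k} <= \<Sum>(S - {x})" using Suc.hyps(1)[of "S - {x}"] Suc.prems c by auto
 have eq: "\<Sum>S = x + \<Sum>(S - {x})" using x(1) Suc.prems(1) by (simp add: sum.remove)
 have eq': "\<Sum>{m..<m + Suc k} = m + k + \<Sum>{m..<m + k}" by simp
 have "S = {m..<m + Suc k}" if "x = m + k"
  by (rule card_subset_eq) (use sub that Suc.hyps(2) in auto)
 then show ?case unfolding Suc.hyps(2)[symmetric] eq eq' using IH xm by fastforce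
qed

text \<open>As long as the positions do not fill a segment, the partial sum of positions exceeds the
  minimal one, which gains at least \<open>2 * N\<close> in the exponents and pays for the total of
  at most \<open>N\<close> in \<open>e\<close>. From the index \<open>K\<close> on, the additional
  factor \<open>y K ^ N\<close> pays instead.\<close>

lemma flag_monomial:
 fixes y :: "nat => real" and p e :: "nat => nat"
 assumes y: "!!i. i < r ==> 0 <= y i" "!!i j. i <= j ==> j < r ==> y i <= y j" "!!i. i < r ==> y i <= 1"
  and p: "inj_on p {..<r}" "!!i. i < r ==> l <= p i" and N: "r <= N" and e: "!!i. i < r ==> e i <= 1"
  and K: "!!k. k < r ==> k < K ==> p ` {..k} ~= {l..<l + Suc k}"
 shows "(\<Prod>i<r. y i ^ (2 * N * p i + (if i = K then N else 0))) <= (\<Prod>i<r. y i ^ (2 * N * (l + i) + e i))"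
proof (rule monomial_le[OF y])
 fix k assume k: "k < r"
 have inj: "inj_on p {..k}" by (rule inj_on_subset[OF p(1)]) (use k in auto)
 have sp: "\<Sum>(p ` {..k}) = (\<Sum>i\<le>k. p i)" by (rule sum.reindex_cong[OF inj]) auto
 have cp: "card (p ` {..k}) = Suc k" by (simp add: card_image[OF inj])
 have sl: "\<Sum>{l..<l + Suc k} = (\<Sum>i\<le>k. l + i)"
  by (rule sum.reindex_bij_witness[of _ "%i. l + i" "%i. i - l"]) auto
 have "p ` {..k} \<subseteq> {l..}" using p(2) k by auto
 from sum_distinct_nat[OF _ this] have D: "(\<Sum>i\<le>k. l + i) <= (\<Sum>i\<le>k. p i)"
   "p ` {..k} ~= {l..<l + Suc k} ==> (\<Sum>i\<le>k. l + i) < (\<Sum>i\<le>k. p i)"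
  unfolding cp sp sl by auto
 have "(\<Sum>i\<le>k. e i) <= (\<Sum>i\<le>k. 1)" by (rule sum_mono) (use e k in auto)
 then have se: "(\<Sum>i\<le>k. e i) <= N" using k N by simp
 have L: "(\<Sum>i\<le>k. 2 * N * (l + i) + e i) = 2 * N * (\<Sum>i\<le>k. l + i) + (\<Sum>i\<le>k. e i)"
  unfolding sum.distrib[of "%i. 2 * N * (l + i)" e] sum_distrib_left[of "2 * N" "%i. l + i"] ..
 have R: "(\<Sum>i\<le>k. 2 * N * p i + (if i = K then N else 0)) = 2 * N * (\<Sum>i\<le>k. p i) + (if K <= k then N else 0)"
  by (simp add: sum.distrib sum_distrib_left)
 show "(\<Sum>i\<le>k. 2 * N * (l + i) + e i) <= (\<Sum>i\<le>k. 2 * N * p i + (if i = K then N else 0))"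
 proof (cases "K <= k")
  case True
  have "2 * N * (\<Sum>i\<le>k. l + i) <= 2 * N * (\<Sum>i\<le>k. p i)" using D(1) by (rule mult_le_mono2)
  then show ?thesis unfolding L R if_P[OF True] using se by (rule add_mono)
 next
  case False
  then have "Suc (\<Sum>i\<le>k. l + i) <= (\<Sum>i\<le>k. p i)" using D(2) K[OF k] by simp
  then have "2 * N * Suc (\<Sum>i\<le>k. l + i) <= 2 * N * (\<Sum>i\<le>k. p i)" by (rule mult_le_mono2)
  then show ?thesis unfolding L R if_not_P[OF False] mult_Suc_right using se by linarith
 qed
qed

lemma sorted_enumeration:
 fixes y :: "'b => real"
 assumes "finite V"
 obtains bs where "distinct bs" "set bs = V" "!!i j. i <= j ==> j < length bs ==> y (bs ! i) <= y (bs ! j)"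
proof -
 obtain xs where xs: "set xs = V" "distinct xs" using finite_distinct_list[OF assms] by blast
 have "sorted (map y (sort_key y xs))" by simp
 then have "y (sort_key y xs ! i) <= y (sort_key y xs ! j)" if "i <= j" "j < length (sort_key y xs)" for i j
  using sorted_nth_mono[of "map y (sort_key y xs)" i j] that by simp
 with xs that[of "sort_key y xs"] show ?thesis by simp
qed

lemma image_set_take: "k <= length xs ==> f ` set (take k xs) = (%i. f (xs ! i)) ` {..<k}"
 by (simp add: nth_image[symmetric] image_image atLeast0LessThan)

lemma prod_set_nth: "distinct bs ==> (\<Prod>b\<in>set bs. f b) = (\<Prod>i<length bs. f (bs ! i))"
 by (rule prod.reindex_bij_betw[symmetric]) (rule bij_betw_nth, auto)

text \<open>Here \<open>y\<close> are the distances to the walls near a point and \<open>P\<close> their positions in a flag of which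
  only the initial segment \<open>ts\<close> passes through the point.\<close>

lemma dominated_by_flag:
 fixes y :: "'b => real" and P :: "'b => nat" and m :: "nat => nat"
 assumes V: "finite V" "card V <= N" and y: "!!b. b : V ==> 0 <= y b" "!!b. b : V ==> y b <= 1"
  and P: "inj_on P V" and ts: "distinct ts" "set ts \<subseteq> V" "!!i. i < length ts ==> P (ts ! i) = i"
  and X: "0 <= X" "X <= 1 | X <= (\<Sum>b\<in>{b:V. P b <= length ts}. y b) ^ N"
   "(EX b:V. P b = length ts) ==> X <= (\<Sum>b\<in>{b:V. P b <= length ts}. y b) ^ N"
 obtains l bs where "l <= length ts" "distinct bs" "set bs = V" "take l bs = take l ts"
  "!!e. (!!i. i < l ==> e i = m i) ==> (!!i. e i <= 1) ==>
   (\<Prod>i<length ts. y (ts ! i) ^ m i) * (\<Prod>b\<in>V. y b ^ (2 * N * P b)) * X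
    <= real N ^ N * (\<Prod>i<length bs. y (bs ! i) ^ (2 * N * i + e i))"
proof -
 obtain bs0 where b0: "distinct bs0" "set bs0 = V" "!!i j. i <= j ==> j < length bs0 ==> y (bs0 ! i) <= y (bs0 ! j)"
  by (rule sorted_enumeration[OF V(1), of y]) blast
 define r where "r = length bs0"
 have rV: "r = card V" using distinct_card[OF b0(1)] b0(2) by (simp add: r_def)
 have jr: "length ts <= r" using distinct_card[OF ts(1)] card_mono[OF V(1) ts(2)] rV by simp
 \<comment> \<open>\<open>l\<close> is the largest length at which the nearest walls are, as a set,
   the first walls of \<open>ts\<close>. Up to \<open>l\<close> the new flag copies
   \<open>ts\<close>, which preserves the parities; afterwards it follows the distances.\<close>
 define Q where "Q l \<longleftrightarrow> l <= length ts & set (take l bs0) = set (take l ts)" for l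
 have "Q 0" by (simp add: Q_def)
 define l where "l = (GREATEST l. Q l)"
 have bdl: "!!l. Q l ==> l <= length ts" by (simp add: Q_def)
 have Ql: "Q l" unfolding l_def by (rule GreatestI_nat[of Q, OF \<open>Q 0\<close> bdl])
 have lmax: "k <= l" if "Q k" for k unfolding l_def by (rule Greatest_le_nat[of Q, OF that bdl])
 have lj: "l <= length ts" and ls: "set (take l bs0) = set (take l ts)" using Ql by (auto simp: Q_def)
 have lr: "l <= r" using lj jr by simp
 define bs where "bs = take l ts @ drop l bs0"
 have len: "length bs = r" using lj lr by (simp add: bs_def r_def)
 have dis: "distinct bs"
  unfolding bs_def distinct_append using ts(1) b0(1) ls[symmetric] set_take_disj_set_drop_if_distinct[OF b0(1), of l l]
  by simp
 have set: "set bs = V" unfolding bs_def set_append ls[symmetric] set_append[symmetric] append_take_drop_id by (rule b0(2))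
 have take: "take l bs = take l ts" using lj by (simp add: bs_def)
 have nth1: "bs ! i = ts ! i" if "i < l" for i using that lj by (simp add: bs_def nth_append)
 have nth2: "bs ! (l + i) = bs0 ! (l + i)" if "i < r - l" for i using that lj by (simp add: bs_def nth_append r_def)
 have bV: "bs0 ! i : V" if "i < r" for i using b0(2) that unfolding r_def by auto
 define R where "R = r - l"
 define p where "p i = P (bs0 ! (l + i))" for i
 define v where "v i = y (bs0 ! (l + i))" for i
 have inj0: "inj_on (%i. P (bs0 ! i)) {..<r}"
 proof (rule inj_onI)
  fix i k assume i: "i : {..<r}" "k : {..<r}" "P (bs0 ! i) = P (bs0 ! k)"
  then have "bs0 ! i = bs0 ! k" using inj_onD[OF P] bV by blast
  then show "i = k" using i b0(1) by (simp add: r_def nth_eq_iff_index_eq)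
 qed
 have Ptake: "(%i. P (bs0 ! i)) ` {..<l} = {..<l}"
 proof -
  have "(%i. P (bs0 ! i)) ` {..<l} = P ` set (take l bs0)"
   using lr by (simp add: image_set_take r_def)
  also have "... = id ` {..<l}"
   unfolding ls image_set_take[OF lj] by (rule image_cong) (use ts(3) lj in auto)
  also have "... = {..<l}" by simp
  finally show ?thesis .
 qed
 have pl: "l <= p i" if "i < R" for i
 proof (rule ccontr)
  assume "\<not> ?thesis"
  then have "p i : (%i. P (bs0 ! i)) ` {..<l}" unfolding Ptake by simp
  then obtain k where "k < l" "P (bs0 ! k) = P (bs0 ! (l + i))" unfolding p_def by auto
  moreover have "l + i < r" using that lr unfolding R_def by linarith
  ultimately have "k = l + i" using inj_onD[OF inj0, of k "l + i"] by simp
  with \<open>k < l\<close> show False by simp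
 qed
 have pinj: "inj_on p {..<R}"
 proof (rule inj_onI)
  fix i k assume i: "i : {..<R}" "k : {..<R}" "p i = p k"
  have "l + i = l + k"
   by (rule inj_onD[OF inj0]) (use i in "simp_all add: p_def R_def less_diff_conv add.commute")
  then show "i = k" by simp
 qed
 \<comment> \<open>If the positions after \<open>l\<close> complete an initial segment, maximality
   of \<open>l\<close> makes this segment contain the position \<open>length ts\<close>. A wall with
   that position then exists, and the strong bound on \<open>X\<close> is available.\<close>
 have full: "length ts <= l + k & P ` set (take (l + Suc k) bs0) = {..<l + Suc k}"
  if k: "k < R" "p ` {..k} = {l..<l + Suc k}" for k
 proof -
  have "P ` set (take (l + Suc k) bs0) = (%i. P (bs0 ! i)) ` {..<l + Suc k}"
   using k(1) lr by (intro image_set_take) (simp add: r_def R_def)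
  also have "{..<l + Suc k} = {..<l} \<union> (%i. l + i) ` {..k}"
  proof (intro equalityI subsetI)
   fix x assume x: "x : {..<l + Suc k}"
   show "x : {..<l} \<union> (%i. l + i) ` {..k}"
   proof (cases "x < l")
    case False
    then have "x = l + (x - l)" "x - l : {..k}" using x by auto
    then show ?thesis by blast
   qed simp
  qed auto
  also have "(%i. P (bs0 ! i)) ` ... = {..<l} \<union> p ` {..k}"
   unfolding image_Un Ptake image_image p_def by (rule refl)
  also have "... = {..<l + Suc k}" using k(2) by auto
  finally have *: "P ` set (take (l + Suc k) bs0) = {..<l + Suc k}" .
  have "length ts <= l + k"
  proof (rule ccontr)
   assume n: "\<not> ?thesis"
   then have "P ` set (take (l + Suc k) ts) = id ` {..<l + Suc k}"
    by (subst image_set_take) (auto intro!: image_cong simp: ts(3))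
   then have "P ` set (take (l + Suc k) ts) = {..<l + Suc k}" by simp
   with * have "P ` set (take (l + Suc k) bs0) = P ` set (take (l + Suc k) ts)" by simp
   then have "set (take (l + Suc k) bs0) = set (take (l + Suc k) ts)"
    by (rule inj_on_image_eq_iff[OF P, THEN iffD1, rotated 2])
     (use b0(2) ts(2) set_take_subset[of "l + Suc k" bs0] set_take_subset[of "l + Suc k" ts] in auto)
   then have "Q (l + Suc k)" using n by (simp add: Q_def)
   from lmax[OF this] show False by simp
  qed
  with * show ?thesis by blast
 qed
 have RN: "R <= N" using V(2) rV by (simp add: R_def)
 have vm: "v i <= v j" if "i <= j" "j < R" for i j
  unfolding v_def by (rule b0(3)) (use that lr in "auto simp: R_def r_def")
 have v01: "0 <= v i" "v i <= 1" if "i < R" for i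
  using y bV[of "l + i"] that lr by (auto simp: v_def R_def)
 have vprod: "(\<Prod>i<R. v i ^ (2 * N * p i)) * X <= real N ^ N * (\<Prod>i<R. v i ^ (2 * N * (l + i) + e (l + i)))"
  if e: "!!i. e i <= 1" for e :: "nat => nat"
 proof -
  let ?G = "%k. k < R & p ` {..k} = {l..<l + Suc k}"
  have Y: "(\<Sum>b\<in>{b:V. P b <= length ts}. y b) ^ N <= (real N * u) ^ N"
   if "!!b. b : V ==> P b <= length ts ==> y b <= u" "0 <= u" for u
  proof (rule power_mono)
   have "(\<Sum>b\<in>{b:V. P b <= length ts}. y b) <= (\<Sum>b\<in>{b:V. P b <= length ts}. u)"
    by (rule sum_mono) (use that in auto)
   also have "... <= real N * u"
    using card_mono[OF V(1), of "{b:V. P b <= length ts}"] V(2) that(2) by (auto intro!: mult_right_mono)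
   finally show "(\<Sum>b\<in>{b:V. P b <= length ts}. y b) <= real N * u" .
   show "0 <= (\<Sum>b\<in>{b:V. P b <= length ts}. y b)" by (rule sum_nonneg) (use y in auto)
  qed
  have pp: "0 <= (\<Prod>i<R. v i ^ (2 * N * p i))" using v01 by (intro prod_nonneg) auto
  show ?thesis
  proof (cases "EX k. ?G k")
   case True
   \<comment> \<open>The first index at which the exponents alone do not suffice. All walls in the
     sum bounding \<open>X\<close> are among the nearest ones up to this index, so the sum is at
     most \<open>real N * v K\<close>.\<close>
   define K where "K = (LEAST k. ?G k)"
   have K: "?G K" unfolding K_def by (rule LeastI_ex[OF True])
   have K': "\<not> ?G k" if "k < K" for k using not_less_Least[of k ?G] that unfolding K_def by blast
   have f: "length ts <= l + K" "P ` set (take (l + Suc K) bs0) = {..<l + Suc K}" using full K by blast+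
   have "length ts : P ` set (take (l + Suc K) bs0)" unfolding f(2) using f(1) by simp
   then have "EX b:V. P b = length ts" using b0(2) set_take_subset[of "l + Suc K" bs0] by auto
   then have "X <= (\<Sum>b\<in>{b:V. P b <= length ts}. y b) ^ N" by (rule X(3))
   also have "... <= (real N * v K) ^ N"
   proof (rule Y)
    fix b assume b: "b : V" "P b <= length ts"
    then have "P b : P ` set (take (l + Suc K) bs0)" unfolding f(2) using f(1) by simp
    then have "b : set (take (l + Suc K) bs0)"
     using inj_on_image_mem_iff[OF P b(1)] b0(2) set_take_subset[of "l + Suc K" bs0] by blast
    then obtain i where "i < l + Suc K" "i < length bs0" "b = bs0 ! i" by (auto simp: in_set_conv_nth)
    moreover have "l + K < length bs0" using K lr unfolding R_def r_def by linarith
    ultimately show "y b <= v K" unfolding v_def using b0(3)[of i "l + K"] by simp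
   qed (use v01 K in blast)
   finally have X': "X <= real N ^ N * v K ^ N" by (simp add: power_mult_distrib)
   have "(\<Prod>i<R. v i ^ (2 * N * p i)) * X <= (\<Prod>i<R. v i ^ (2 * N * p i)) * (real N ^ N * v K ^ N)"
    by (rule mult_left_mono[OF X' pp])
   also have "... = real N ^ N * (\<Prod>i<R. v i ^ (2 * N * p i + (if i = K then N else 0)))"
   proof -
    have "(\<Prod>i<R. v i ^ (if i = K then N else 0)) = (\<Prod>i<R. if i = K then v i ^ N else 1)"
     by (rule prod.cong) auto
    also have "... = v K ^ N" using K by (simp add: prod.delta)
    finally show ?thesis by (simp add: power_add prod.distrib)
   qed
   also have "... <= real N ^ N * (\<Prod>i<R. v i ^ (2 * N * (l + i) + e (l + i)))"
    by (intro mult_left_mono flag_monomial v01 vm pinj pl RN e) (use K' in auto)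
   finally show ?thesis .
  next
   case False
   have X1: "X <= real N ^ N"
   proof (cases "N = 0")
    case True
    then show ?thesis using X(2) by simp
   next
    case N: False
    have "(\<Sum>b\<in>{b:V. P b <= length ts}. y b) ^ N <= (real N * 1) ^ N" by (rule Y) (use y in auto)
    moreover have "1 <= real N ^ N" using N by simp
    ultimately show ?thesis using X(2) by auto
   qed
   have "(\<Prod>i<R. v i ^ (2 * N * p i)) * X <= (\<Prod>i<R. v i ^ (2 * N * p i)) * real N ^ N"
    by (rule mult_left_mono[OF X1 pp])
   also have "(\<Prod>i<R. v i ^ (2 * N * p i)) = (\<Prod>i<R. v i ^ (2 * N * p i + (if i = R then N else 0)))"
    by (rule prod.cong) auto
   also have "... <= (\<Prod>i<R. v i ^ (2 * N * (l + i) + e (l + i)))"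
    by (intro flag_monomial v01 vm pinj pl RN e) (use False in auto)
   finally show ?thesis by (simp add: mult.commute mult_right_mono)
  qed
 qed
 have split: "(\<Prod>i<r. f i) = (\<Prod>i<l. f i) * (\<Prod>i<R. f (l + i))" for f :: "nat => real"
 proof -
  have "{..<r} = {..<l} \<union> (%i. l + i) ` {..<R}"
  proof (intro equalityI subsetI)
   fix x assume x: "x : {..<r}"
   show "x : {..<l} \<union> (%i. l + i) ` {..<R}"
   proof (cases "x < l")
    case False
    then have "x = l + (x - l)" "x - l : {..<R}" using x by (auto simp: R_def)
    then show ?thesis by blast
   qed simp
  qed (use lr in "auto simp: R_def")
  then have "(\<Prod>i<r. f i) = prod f ({..<l} \<union> (%i. l + i) ` {..<R})" by simp
  also have "... = prod f {..<l} * prod f ((%i. l + i) ` {..<R})" by (rule prod.union_disjoint) auto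
  finally have "(\<Prod>i<r. f i) = prod f {..<l} * prod f ((%i. l + i) ` {..<R})" .
  then show ?thesis by (simp add: prod.reindex)
 qed
 show ?thesis
 proof (rule that[OF lj dis set take])
  fix e :: "nat => nat" assume e: "!!i. i < l ==> e i = m i" "!!i. e i <= 1"
  have tV: "ts ! i : V" if "i < length ts" for i using ts(2) that by auto
  have "(\<Prod>i<length ts. y (ts ! i) ^ m i) = (\<Prod>i<l. y (ts ! i) ^ m i) * (\<Prod>i\<in>{l..<length ts}. y (ts ! i) ^ m i)"
   using lj by (subst prod.union_disjoint[symmetric]) (auto intro!: prod.cong)
  also have "... <= (\<Prod>i<l. y (ts ! i) ^ m i) * 1"
   using y tV lj by (intro mult_left_mono prod_le_1 prod_nonneg) (auto intro: power_le_one)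
  finally have mt: "(\<Prod>i<length ts. y (ts ! i) ^ m i) <= (\<Prod>i<l. y (ts ! i) ^ m i)" by simp
  have Vp: "(\<Prod>b\<in>V. y b ^ (2 * N * P b)) = (\<Prod>i<l. y (ts ! i) ^ (2 * N * i)) * (\<Prod>i<R. v i ^ (2 * N * p i))"
   unfolding set[symmetric] prod_set_nth[OF dis] len split
   by (intro arg_cong2[where f = "(*)"] prod.cong refl) (use lj in "auto simp: nth1 nth2 ts(3) v_def p_def R_def")
  have bp: "(\<Prod>i<length bs. y (bs ! i) ^ (2 * N * i + e i))
    = (\<Prod>i<l. y (ts ! i) ^ m i) * (\<Prod>i<l. y (ts ! i) ^ (2 * N * i)) * (\<Prod>i<R. v i ^ (2 * N * (l + i) + e (l + i)))"
   unfolding len split prod.distrib[symmetric]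
   by (intro arg_cong2[where f = "(*)"] prod.cong refl) (auto simp: nth1 nth2 e(1) v_def R_def power_add mult.commute)
  have nn: "0 <= (\<Prod>i<l. y (ts ! i) ^ m i)" "0 <= (\<Prod>i<l. y (ts ! i) ^ (2 * N * i))"
   "0 <= (\<Prod>i<R. v i ^ (2 * N * p i)) * X"
   using y tV lj v01 X(1) by (auto intro!: prod_nonneg mult_nonneg_nonneg)
  have "(\<Prod>i<length ts. y (ts ! i) ^ m i) * (\<Prod>b\<in>V. y b ^ (2 * N * P b)) * X
    = (\<Prod>i<length ts. y (ts ! i) ^ m i) * ((\<Prod>i<l. y (ts ! i) ^ (2 * N * i)) * ((\<Prod>i<R. v i ^ (2 * N * p i)) * X))"
   unfolding Vp by (simp add: mult_ac)
  also have "... <= (\<Prod>i<l. y (ts ! i) ^ m i) * ((\<Prod>i<l. y (ts ! i) ^ (2 * N * i)) * ((\<Prod>i<R. v i ^ (2 * N * p i)) * X))"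
   by (rule mult_right_mono[OF mt]) (intro mult_nonneg_nonneg nn)
  also have "... <= (\<Prod>i<l. y (ts ! i) ^ m i) * ((\<Prod>i<l. y (ts ! i) ^ (2 * N * i)) * (real N ^ N * (\<Prod>i<R. v i ^ (2 * N * (l + i) + e (l + i)))))"
   by (intro mult_left_mono vprod e(2) nn)
  also have "... = real N ^ N * (\<Prod>i<length bs. y (bs ! i) ^ (2 * N * i + e i))" unfolding bp by (simp add: mult_ac)
  finally show "(\<Prod>i<length ts. y (ts ! i) ^ m i) * (\<Prod>b\<in>V. y b ^ (2 * N * P b)) * X
    <= real N ^ N * (\<Prod>i<length bs. y (bs ! i) ^ (2 * N * i + e i))" .
 qed
qed

subsection \<open>Gluing\<close>

lemma prod_upper:
 fixes f g :: "'i => 'z => real"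
 assumes "finite I" "!!i. i : I ==> EX C>=0. ALL z:K. f i z <= C * g i z"
  and "!!i z. i : I ==> z : K ==> 0 <= f i z" "!!i z. i : I ==> z : K ==> 0 <= g i z"
 shows "EX C>=0. ALL z:K. (\<Prod>i\<in>I. f i z) <= C * (\<Prod>i\<in>I. g i z)"
 using assms
proof (induction I rule: finite_induct)
 case empty
 show ?case by (intro exI[of _ 1]) simp
next
 case (insert i I)
 obtain C where C: "C >= 0" "ALL z:K. f i z <= C * g i z" using insert.prems(1)[of i] by auto
 obtain C' where C': "C' >= 0" "ALL z:K. (\<Prod>i\<in>I. f i z) <= C' * (\<Prod>i\<in>I. g i z)" using insert by auto
 have "(\<Prod>i\<in>insert i I. f i z) <= (C * C') * (\<Prod>i\<in>insert i I. g i z)" if z: "z : K" for z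
 proof -
  have "f i z * (\<Prod>i\<in>I. f i z) <= (C * g i z) * (C' * (\<Prod>i\<in>I. g i z))"
   using C C' z insert.prems(2,3) by (intro mult_mono mult_nonneg_nonneg prod_nonneg) auto
  then show ?thesis using insert by (simp add: mult_ac)
 qed
 with C C' show ?case by (intro exI[of _ "C * C'"]) auto
qed

lemma prod_lower:
 fixes f g :: "'i => 'z => real"
 assumes "finite I" "!!i. i : I ==> EX c>0. ALL z:K. c * g i z <= f i z"
  and "!!i z. i : I ==> z : K ==> 0 <= g i z"
 shows "EX c>0. ALL z:K. c * (\<Prod>i\<in>I. g i z) <= (\<Prod>i\<in>I. f i z)"
 using assms
proof (induction I rule: finite_induct)
 case empty
 show ?case by (intro exI[of _ 1]) simp
next
 case (insert i I)
 obtain c where c: "c > 0" "ALL z:K. c * g i z <= f i z" using insert.prems(1)[of i] by auto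
 obtain c' where c': "c' > 0" "ALL z:K. c' * (\<Prod>i\<in>I. g i z) <= (\<Prod>i\<in>I. f i z)" using insert by auto
 have "(c * c') * (\<Prod>i\<in>insert i I. g i z) <= (\<Prod>i\<in>insert i I. f i z)" if z: "z : K" for z
 proof -
  have g: "0 <= c * g i z" "0 <= c' * (\<Prod>i\<in>I. g i z)"
   using c c' z insert.prems(2) by (auto intro!: mult_nonneg_nonneg prod_nonneg)
  then have "(c * g i z) * (c' * (\<Prod>i\<in>I. g i z)) <= f i z * (\<Prod>i\<in>I. f i z)"
   using c(2) c'(2) z by (intro mult_mono) (auto intro: order_trans)
  then show ?thesis using insert by (simp add: mult_ac)
 qed
 with c c' show ?case by (intro exI[of _ "c * c'"]) auto
qed

context started
begin

definition flags :: "(real ^ 'a) set => ((real ^ 'a) \<times> 'a list) set" where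
 "flags D = {(s, cs). s : D & distinct cs & set cs = Wb s}"

definition KK :: "real ^ 'a => (real ^ 'a) set" where
 "KK t = {z : slice (J t). norm z <= rho t / 2}"

lemma KK: "t : M ==> z : KK t ==> z : slice (J t) & norm z < rho t & norm z <= rho t / 2 & Psi t z : M & \<bar>z $ b\<bar> <= 1"
proof -
 assume t: "t : M" and z: "z : KK t"
 have "norm z < rho t" using z rho_pos[OF t] by (simp add: KK_def)
 moreover have "\<bar>z $ b\<bar> <= 1" using component_le_norm_cart[of z b] calculation rho_le[OF t] by linarith
 ultimately show ?thesis using z M_slice[OF t] by (simp add: KK_def)
qed

lemma finite_flags: "finite D ==> finite (flags D)"
 using finite_lists_length_le[of "UNIV :: 'a set" "CARD('a)"]
 by (intro finite_subset[of "flags D" "D \<times> {cs. set cs \<subseteq> UNIV & length cs <= CARD('a)}"])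
  (auto simp: flags_def distinct_card[symmetric] intro!: card_mono)

lemma flag_coordinates:
 assumes t: "t : M" and ws: "distinct ws" "!!W. W : set ws ==> W : walls M A B & t : W"
 obtains ts where "map (%b. C t {b}) ts = ws" "distinct ts" "set ts \<subseteq> Wb t"
proof -
 have "ALL W:set ws. EX b. b : J t & W = C t {b}"
 proof
  fix W assume "W : set ws"
  then have "W : walls M A B" "t : W" using ws(2) by auto
  then obtain b where "b : J t" "W = C t {b}" by (rule wall_through)
  then show "EX b. b : J t & W = C t {b}" by blast
 qed
 then obtain f where f: "ALL W:set ws. f W : J t & W = C t {f W}" by metis
 have m: "map (%b. C t {b}) (map f ws) = ws" using f by (simp add: map_idI)
 moreover have "distinct (map f ws)" using ws(1) m distinct_map by metis
 moreover have "set (map f ws) \<subseteq> Wb t" using f ws(2) by (auto simp: Wb_def)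
 ultimately show ?thesis by (rule that)
qed

lemma inj_walls: "t : M ==> inj_on (%b. C t {b}) (Wb t)"
 using C_inj Wb_J by (auto simp: inj_on_def)

lemma rpf_bounded: "rpf f ==> EX C>=1. ALL x:M. \<bar>f x\<bar> <= C"
proof -
 assume "rpf f"
 from compact_imp_bounded[OF compact_continuous_image[OF rpf_continuous[OF this] cpt]]
 obtain K where "ALL y:f ` M. norm y <= K" unfolding bounded_iff by blast
 then show ?thesis by (intro exI[of _ "max 1 K"]) (auto simp: le_max_iff_disj)
qed

lemma chart_bound:
 assumes t: "t : M" and f: "nul t S f"
 shows "EX C>0. ALL z:KK t. \<bar>f (Psi t z)\<bar> <= C * (\<Sum>b\<in>S. \<bar>z $ b\<bar>)"
proof -
 obtain X idx E v where c: "chart M t n X (tht t) (J t) idx (Psi t) (rho t) E v" by (rule chartE[OF t])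
 show ?thesis using chart.null_bound[OF c, of "J t" S f "rho t / 2"] f rho_pos[OF t]
  by (auto simp: nul_null[OF c] KK_def)
qed

text \<open>Here the common point need not be one of the two centres; both strata are compared with
  the stratum cut out at \<open>q\<close> by the same walls.\<close>

lemma C_mem_eq:
 assumes p: "p : M" and t: "t : M" and S: "S \<subseteq> Wb p" and ST: "(%b. C p {b}) ` S = (%c. C t {c}) ` T"
  and q: "q : C p S" "q : C t T"
 shows "C p S = C t T"
proof -
 have qM: "q : M" using q C_M[OF p] by blast
 define R where "R = {c : J q. C q {c} : (%b. C p {b}) ` S}"
 have "(%c. C q {c}) ` R = (%b. C p {b}) ` S"
 proof (intro equalityI subsetI)
  fix W assume W: "W : (%b. C p {b}) ` S"
  then obtain b where b: "b : S" "W = C p {b}" by blast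
  have "W : walls M A B" using b S by (auto simp: Wb_def)
  moreover have "q : W" using q(1) C_mono[of "{b}" S p] b by auto
  ultimately obtain c where "c : J q" "W = C q {c}" by (rule wall_through)
  with W show "W : (%c. C q {c}) ` R" unfolding R_def by blast
 qed (auto simp: R_def)
 then have "C q R = C p S" "C q R = C t T" using C_eq[OF p qM _ q(1), of R] C_eq[OF t qM _ q(2), of R] ST by simp_all
 then show ?thesis by simp
qed

lemma walls_split:
 assumes "t : M"
 shows "(\<Prod>W\<in>walls M A B. f W) = (\<Prod>b\<in>Wb t. f (C t {b})) * (\<Prod>W\<in>{W:walls M A B. t ~: W}. f W)"
proof -
 have "(%b. C t {b}) ` Wb t = {W:walls M A B. t : W}"
 proof (intro equalityI subsetI)
  fix W assume "W : {W:walls M A B. t : W}"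
  then show "W : (%b. C t {b}) ` Wb t" using wall_through[of W t] by (auto simp: Wb_def)
 qed (use C_base[OF assms] in "auto simp: Wb_def")
 then have "(\<Prod>b\<in>Wb t. f (C t {b})) = (\<Prod>W\<in>{W:walls M A B. t : W}. f W)"
  using prod.reindex[OF inj_walls[OF assms], of f] by simp
 moreover have "walls M A B = {W:walls M A B. t : W} \<union> {W:walls M A B. t ~: W}" by blast
 ultimately show ?thesis using finite_walls
  by (metis (no_types, lifting) prod.union_disjoint finite_Un disjoint_iff mem_Collect_eq)
qed

lemma sprod_prod:
 "length bs = length ks ==> sprod bs ks z = (\<Prod>i<length bs. sgn (z $ (bs ! i)) ^ (ks ! i))"
proof (induction bs ks rule: list_induct2)
 case (Cons b bs k ks)
 have "sprod (b # bs) (k # ks) z = sgn (z $ b) ^ k * sprod bs ks z" by (simp add: sprod_def)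
 then show ?case using Cons.IH by (simp add: prod.lessThan_Suc_shift del: prod.lessThan_Suc)
qed (simp add: sprod_def)

end

text \<open>A flag \<open>(s, cs)\<close> orders the walls through the centre \<open>s\<close>. Its function \<open>FF (s, cs)\<close> should be small on
  the chart at \<open>t\<close> compared with the flags at \<open>t\<close>. Here \<open>hh W\<close> is a non-negative equation of \<open>W\<close> that is used to the
  power given by the position of \<open>W\<close>, and \<open>ex\<close> handles the centres \<open>t\<close> that lie on the next wall of the flag
  but on another component of its intersection with the preceding stratum.\<close>

locale glued = started +
 fixes D :: "(real ^ 'a) set" and hh :: "(real ^ 'a) set => real ^ 'a => real"
  and pos :: "(real ^ 'a) \<times> 'a list => (real ^ 'a) set => nat" and ex :: "(real ^ 'a) \<times> 'a list => real ^ 'a => real"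
 assumes D: "finite D" "D \<subseteq> M" "M \<subseteq> (\<Union>p\<in>D. Psi p ` ball 0 (rho p / 2))"
  and hh: "!!W. W : walls M A B ==> rpf (hh W)" "!!W x. 0 <= hh W x"
  and hh_up: "!!t b. t : D ==> b : Wb t ==> EX K>=0. ALL z:KK t. hh (C t {b}) (Psi t z) <= K * (z $ b)\<^sup>2"
  and hh_low: "!!t b z. t : D ==> b : Wb t ==> z : KK t ==> (z $ b)\<^sup>2 <= hh (C t {b}) (Psi t z)"
  and hh_off: "!!t W. t : D ==> W : walls M A B ==> t ~: W ==> EX c>0. ALL z:KK t. c <= hh W (Psi t z)"
  and pos_inj: "!!L. L : flags D ==> inj_on (pos L) (walls M A B)"
  and pos_nth: "!!s cs i. (s, cs) : flags D ==> i < length cs ==> pos (s, cs) (C s {cs ! i}) = i"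
  and pos_skip: "!!s cs W. (s, cs) : flags D ==> pos (s, cs) W ~= length cs"
  and ex: "!!L. L : flags D ==> rpf (ex L)" "!!L x. 0 <= ex L x"
  and ex_own: "!!s cs. (s, cs) : flags D ==> EX c>0. ALL z:KK s. c <= ex (s, cs) (Psi s z)"
  and ex_bad: "!!s cs t i. (s, cs) : flags D ==> t : D ==> i < length cs ==> t : C s (set (take i cs)) ==>
    t : C s {cs ! i} ==> t ~: C s (set (take (Suc i) cs)) ==>
    EX K>=0. ALL z:KK t. ex (s, cs) (Psi t z) <= K * (\<Sum>b\<in>{b:Wb t. pos (s, cs) (C t {b}) <= i}. \<bar>z $ b\<bar>)"
begin

definition mm :: "real ^ 'a => 'a list => nat => nat" where
 "mm s cs i = kk s cs ! i mod 2"

text \<open>In a chart \<open>hh W\<close> is comparable to the square of the coordinate of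
  \<open>W\<close>, so a wall at position \<open>i\<close> contributes the exponent
  \<open>2 * CARD('a) * i\<close>. \<open>CARD('a)\<close> is the \<open>N\<close> of
  \<open>dominated_by_flag\<close>, and the gaps of \<open>2 * CARD('a)\<close> leave room for the
  parity exponents.\<close>

definition FF :: "(real ^ 'a) \<times> 'a list => real ^ 'a => real" where
 "FF L x = (\<Prod>i<length (snd L). tht (fst L) (snd L ! i) x ^ mm (fst L) (snd L) i) *
   (\<Prod>W\<in>walls M A B. hh W x ^ (CARD('a) * pos L W)) * ex L x ^ CARD('a)"

definition GG :: "real ^ 'a => 'a list => real ^ 'a => real" where
 "GG t bs z = (\<Prod>i<length bs. \<bar>z $ (bs ! i)\<bar> ^ (2 * CARD('a) * i + mm t bs i))"

lemma mm_le: "mm s cs i <= 1"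
 by (simp add: mm_def)

lemma flagsD:
 assumes "(s, cs) : flags D"
 shows "s : D" "s : M" "distinct cs" "set cs = Wb s" "length cs <= CARD('a)"
 using assms D(2) distinct_card[of cs] card_mono[of UNIV "set cs"] by (auto simp: flags_def)

lemma FF_rpf: "L : flags D ==> rpf (FF L)"
 unfolding FF_def[abs_def] using finite_walls D(2)
 by (intro rpf_intros rpf_tht hh ex) (auto simp: flags_def)

text \<open>On the chart of its own centre the function is a non-negative factor \<open>v\<close>
  times the coordinates of odd order. The walls that miss the centre and \<open>ex\<close> are
  bounded away from zero there.\<close>

lemma FF_own:
 assumes L: "(t, bs) : flags D"
 shows "EX c>0. ALL z:KK t. EX v. c * GG t bs z <= v * (\<Prod>i<length bs. \<bar>z $ (bs ! i)\<bar> ^ mm t bs i) & 0 <= v &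
   FF (t, bs) (Psi t z) = v * (\<Prod>i<length bs. (z $ (bs ! i)) ^ mm t bs i)"
proof -
 note f = flagsD[OF L]
 let ?P = "%x. (\<Prod>W\<in>walls M A B. hh W x ^ (CARD('a) * pos (t, bs) W)) * ex (t, bs) x ^ CARD('a)"
 have "EX c>0. ALL z:KK t. c * (\<Prod>W\<in>{W:walls M A B. t ~: W}. 1) <= (\<Prod>W\<in>{W:walls M A B. t ~: W}. hh W (Psi t z) ^ (CARD('a) * pos (t, bs) W))"
 proof (rule prod_lower)
  fix W assume "W : {W:walls M A B. t ~: W}"
  then obtain c where c: "c > 0" "ALL z:KK t. c <= hh W (Psi t z)" using hh_off[OF f(1)] by blast
  then show "EX c>0. ALL z:KK t. c * 1 <= hh W (Psi t z) ^ (CARD('a) * pos (t, bs) W)"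
   by (intro exI[of _ "c ^ (CARD('a) * pos (t, bs) W)"]) (auto intro: power_mono)
 qed (use finite_walls in auto)
 then obtain c where c: "c > 0" "ALL z:KK t. c <= (\<Prod>W\<in>{W:walls M A B. t ~: W}. hh W (Psi t z) ^ (CARD('a) * pos (t, bs) W))" by auto
 obtain c' where c': "c' > 0" "ALL z:KK t. c' <= ex (t, bs) (Psi t z)" using ex_own[OF L] by blast
 show ?thesis
 proof (rule exI[of _ "c * c' ^ CARD('a)"], intro conjI ballI)
  fix z assume z: "z : KK t"
  note zz = KK[OF f(2) z]
  have "(\<Prod>i<length bs. \<bar>z $ (bs ! i)\<bar> ^ (2 * CARD('a) * i)) <= (\<Prod>i<length bs. hh (C t {bs ! i}) (Psi t z) ^ (CARD('a) * i))"
  proof (rule prod_mono, intro conjI)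
   fix i assume "i : {..<length bs}"
   then have "bs ! i : Wb t" using f(4) nth_mem by blast
   from power_mono[OF hh_low[OF f(1) this z], of "CARD('a) * i"]
   show "\<bar>z $ (bs ! i)\<bar> ^ (2 * CARD('a) * i) <= hh (C t {bs ! i}) (Psi t z) ^ (CARD('a) * i)"
    by (simp add: power_mult[symmetric] mult.assoc power_even_abs)
  qed simp
  also have "... = (\<Prod>b\<in>Wb t. hh (C t {b}) (Psi t z) ^ (CARD('a) * pos (t, bs) (C t {b})))"
   unfolding f(4)[symmetric] prod_set_nth[OF f(3)] using pos_nth[OF L] by (intro prod.cong) auto
  finally have A: "(\<Prod>i<length bs. \<bar>z $ (bs ! i)\<bar> ^ (2 * CARD('a) * i)) <= ..." .
  have P: "(c * c' ^ CARD('a)) * (\<Prod>i<length bs. \<bar>z $ (bs ! i)\<bar> ^ (2 * CARD('a) * i)) <= ?P (Psi t z)"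
  proof -
   have "(\<Prod>i<length bs. \<bar>z $ (bs ! i)\<bar> ^ (2 * CARD('a) * i)) * c * c' ^ CARD('a) <= ?P (Psi t z)"
    unfolding walls_split[OF f(2)] using A c c' z hh(2)
    by (intro mult_mono power_mono mult_nonneg_nonneg prod_nonneg) (auto intro!: prod_nonneg less_imp_le)
   then show ?thesis by (simp add: mult_ac)
  qed
  show "EX v. c * c' ^ CARD('a) * GG t bs z <= v * (\<Prod>i<length bs. \<bar>z $ (bs ! i)\<bar> ^ mm t bs i) & 0 <= v &
   FF (t, bs) (Psi t z) = v * (\<Prod>i<length bs. (z $ (bs ! i)) ^ mm t bs i)"
  proof (intro exI[of _ "?P (Psi t z)"] conjI)
   have "c * c' ^ CARD('a) * GG t bs z = (c * c' ^ CARD('a) * (\<Prod>i<length bs. \<bar>z $ (bs ! i)\<bar> ^ (2 * CARD('a) * i))) * (\<Prod>i<length bs. \<bar>z $ (bs ! i)\<bar> ^ mm t bs i)"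
    by (simp add: GG_def power_add prod.distrib)
   also have "... <= ?P (Psi t z) * (\<Prod>i<length bs. \<bar>z $ (bs ! i)\<bar> ^ mm t bs i)"
    by (rule mult_right_mono[OF P]) (intro prod_nonneg, auto)
   finally show "c * c' ^ CARD('a) * GG t bs z <= ..." .
   show "0 <= ?P (Psi t z)" using hh(2) ex(2) by (intro mult_nonneg_nonneg prod_nonneg) auto
   show "FF (t, bs) (Psi t z) = ?P (Psi t z) * (\<Prod>i<length bs. (z $ (bs ! i)) ^ mm t bs i)"
    using zz tht_Psi[OF f(2)] by (simp add: FF_def mult_ac)
  qed
 qed (use c c' in simp)
qed

text \<open>\<open>j\<close> tells how far the flag of \<open>s\<close> runs through
  \<open>t\<close>. Its first \<open>j\<close> walls are coordinates at \<open>t\<close>, and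
  \<open>dominated_by_flag\<close> provides a flag at \<open>t\<close> that shares an initial part
  with them. That flag depends on \<open>z\<close>, hence the sum over all flags at
  \<open>t\<close>.\<close>

lemma FF_upper:
 assumes L: "(s, cs) : flags D" and tD: "t : D"
 shows "EX C>=0. ALL z:KK t. \<bar>FF (s, cs) (Psi t z)\<bar> <= C * (\<Sum>bs | (t, bs) : flags D. GG t bs z)"
proof -
 note f = flagsD[OF L]
 have t: "t : M" using tD D(2) by blast
 define j where "j = (GREATEST j. j <= length cs & t : C s (set (take j cs)))"
 have Q0: "0 <= length cs & t : C s (set (take 0 cs))" using C_empty[OF f(2)] t by simp
 have "j <= length cs & t : C s (set (take j cs))"
  unfolding j_def by (rule GreatestI_nat[where P = "%j. j <= length cs & t : C s (set (take j cs))" and b = "length cs", OF Q0]) simp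
 then have j: "j <= length cs" "t : C s (set (take j cs))" by auto
 have jmax: "i <= j" if "i <= length cs" "t : C s (set (take i cs))" for i
  unfolding j_def by (rule Greatest_le_nat[where b = "length cs" and P = "%j. j <= length cs & t : C s (set (take j cs))"]) (use that in auto)
 have W: "C s {cs ! i} : walls M A B" if "i < length cs" for i using f(4) nth_mem[OF that] by (auto simp: Wb_def)
 have wsd: "distinct (map (%c. C s {c}) (take j cs))"
  using f(3) inj_on_subset[OF inj_walls[OF f(2)], of "set (take j cs)"] set_take_subset[of j cs] f(4)
  by (simp add: distinct_map)
 have wst: "W : walls M A B & t : W" if Wj: "W : set (map (%c. C s {c}) (take j cs))" for W
 proof -
  obtain c where c: "c : set (take j cs)" "W = C s {c}" using Wj by auto
  then show ?thesis using j(2) C_mono[of "{c}" "set (take j cs)" s] set_take_subset[of j cs] f(4) by (auto simp: Wb_def)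
 qed
 obtain ts where ts: "map (%b. C t {b}) ts = map (%c. C s {c}) (take j cs)" "distinct ts" "set ts \<subseteq> Wb t"
  by (rule flag_coordinates[OF t wsd wst])
 have lt: "length ts = j" using arg_cong[OF ts(1), of length] j(1) by simp
 have tsn: "C t {ts ! i} = C s {cs ! i}" if "i < j" for i
  using arg_cong[OF ts(1), of "%l. l ! i"] that lt j(1) by simp
 let ?P = "%b. pos (s, cs) (C t {b})"
 have Pinj: "inj_on ?P (Wb t)"
  using comp_inj_on[OF inj_walls[OF t] inj_on_subset[OF pos_inj[OF L]]] by (auto simp: Wb_def o_def)
 \<comment> \<open>The next wall of the flag may pass through \<open>t\<close> although
   \<open>t\<close> is not on the next stratum. Then the decay of \<open>ex\<close> near
   \<open>t\<close> supplies the bound on \<open>X\<close>.\<close>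
 let ?bad = "EX b:Wb t. ?P b = j"
 let ?S = "%z. \<Sum>b\<in>{b:Wb t. ?P b <= j}. \<bar>z $ b\<bar>"
 have exB: "EX K>=0. ALL z:KK t. ex (s, cs) (Psi t z) <= K * (if ?bad then ?S z else 1)"
 proof (cases ?bad)
  case True
  then obtain b where b: "b : Wb t" "?P b = j" by blast
  \<comment> \<open>No wall has the position \<open>length cs\<close>, so a wall at position
    \<open>j\<close> belongs to the flag.\<close>
  have jl: "j < length cs" using pos_skip[OF L, of "C t {b}"] b(2) j(1) by (cases "j = length cs") auto
  have "C t {b} = C s {cs ! j}"
   by (rule inj_onD[OF pos_inj[OF L]]) (use b pos_nth[OF L jl] W[OF jl] in "auto simp: Wb_def")
  then have "t : C s {cs ! j}" using C_base[OF t, of "{b}"] by simp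
  moreover have "t ~: C s (set (take (Suc j) cs))" using jmax[of "Suc j"] jl by auto
  ultimately show ?thesis using ex_bad[OF L tD jl j(2)] True by simp
 next
  case False
  obtain K where "K >= 1" "ALL x:M. \<bar>ex (s, cs) x\<bar> <= K" using rpf_bounded[OF ex(1)[OF L]] by blast
  moreover have "!!z. z : KK t ==> Psi t z : M" using KK[OF t] by blast
  ultimately show ?thesis using False by (intro exI[of _ K]) (auto dest!: abs_le_D1)
 qed
 then obtain Ce where Ce: "Ce >= 0" "ALL z:KK t. ex (s, cs) (Psi t z) <= Ce * (if ?bad then ?S z else 1)" by blast
 have hB: "EX K>=0. ALL z:KK t. (\<Prod>b\<in>Wb t. hh (C t {b}) (Psi t z) ^ (CARD('a) * ?P b)) <= K * (\<Prod>b\<in>Wb t. \<bar>z $ b\<bar> ^ (2 * CARD('a) * ?P b))"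
 proof (rule prod_upper)
  fix b assume "b : Wb t"
  then obtain K where K: "K >= 0" "ALL z:KK t. hh (C t {b}) (Psi t z) <= K * (z $ b)\<^sup>2" using hh_up[OF tD] by blast
  show "EX K>=0. ALL z:KK t. hh (C t {b}) (Psi t z) ^ (CARD('a) * ?P b) <= K * \<bar>z $ b\<bar> ^ (2 * CARD('a) * ?P b)"
  proof (intro exI[of _ "K ^ (CARD('a) * ?P b)"] conjI ballI)
   fix z assume "z : KK t"
   then have "hh (C t {b}) (Psi t z) ^ (CARD('a) * ?P b) <= (K * \<bar>z $ b\<bar>\<^sup>2) ^ (CARD('a) * ?P b)" using K hh(2) by (intro power_mono) auto
   then show "hh (C t {b}) (Psi t z) ^ (CARD('a) * ?P b) <= K ^ (CARD('a) * ?P b) * \<bar>z $ b\<bar> ^ (2 * CARD('a) * ?P b)"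
    by (simp only: power_mult_distrib power_mult[symmetric] mult.assoc)
  qed (use K in simp)
 qed (use hh(2) in auto)
 then obtain Ch where Ch: "Ch >= 0" "ALL z:KK t. (\<Prod>b\<in>Wb t. hh (C t {b}) (Psi t z) ^ (CARD('a) * ?P b)) <= Ch * (\<Prod>b\<in>Wb t. \<bar>z $ b\<bar> ^ (2 * CARD('a) * ?P b))" by blast
 have "rpf (%x. \<Prod>W\<in>{W:walls M A B. t ~: W}. hh W x ^ (CARD('a) * pos (s, cs) W))"
  using finite_walls by (intro rpf_intros hh) auto
 then obtain Co where Co: "Co >= 1" "!!x. x : M ==> \<bar>\<Prod>W\<in>{W:walls M A B. t ~: W}. hh W x ^ (CARD('a) * pos (s, cs) W)\<bar> <= Co"
  using rpf_bounded by blast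
 have tB: "EX C>=0. ALL z:KK t. (\<Prod>i<length cs. \<bar>tht s (cs ! i) (Psi t z)\<bar> ^ mm s cs i) <= C * (\<Prod>i<length cs. if i < j then \<bar>z $ (ts ! i)\<bar> ^ mm s cs i else 1)"
 proof (rule prod_upper)
  fix i assume i: "i : {..<length cs}"
  have m: "mm s cs i = 0 | mm s cs i = 1" using mm_le[of s cs i] by linarith
  obtain K where K: "K >= 1" "ALL x:M. \<bar>tht s (cs ! i) x\<bar> <= K" using rpf_bounded[OF rpf_tht[OF f(2)]] by blast
  have KM: "!!z. z : KK t ==> Psi t z : M" using KK[OF t] by blast
  show "EX C>=0. ALL z:KK t. \<bar>tht s (cs ! i) (Psi t z)\<bar> ^ mm s cs i <= C * (if i < j then \<bar>z $ (ts ! i)\<bar> ^ mm s cs i else 1)"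
  proof (cases "i < j")
   case True
   have "nul t {ts ! i} (tht s (cs ! i))" using nul_tht[OF f(2), of "cs ! i" "{cs ! i}"] tsn[OF True] by (simp add: nul_C)
   from chart_bound[OF t this] obtain K' where "K' > 0" "ALL z:KK t. \<bar>tht s (cs ! i) (Psi t z)\<bar> <= K' * \<bar>z $ (ts ! i)\<bar>" by auto
   moreover have "K' * y <= max 1 K' * y" if "0 <= y" for y using that by (intro mult_right_mono) auto
   ultimately have "ALL z:KK t. \<bar>tht s (cs ! i) (Psi t z)\<bar> <= max 1 K' * \<bar>z $ (ts ! i)\<bar>" by (meson abs_ge_zero order_trans)
   with True m show ?thesis by (intro exI[of _ "max 1 K'"]) auto
  next
   case False
   then show ?thesis using K KM m by (intro exI[of _ K]) auto
  qed
 qed auto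
 then obtain Ct where Ct: "Ct >= 0" "ALL z:KK t. (\<Prod>i<length cs. \<bar>tht s (cs ! i) (Psi t z)\<bar> ^ mm s cs i) <= Ct * (\<Prod>i<length cs. if i < j then \<bar>z $ (ts ! i)\<bar> ^ mm s cs i else 1)" by blast
 have fin: "finite {bs. (t, bs) : flags D}"
  using finite_flags[OF D(1)] finite_imageI[of "flags D" snd] by (rule_tac finite_subset[of _ "snd ` flags D"]) force+
 show ?thesis
 proof (intro exI[of _ "Ct * (Ch * Co) * Ce ^ CARD('a) * real CARD('a) ^ CARD('a)"] conjI ballI)
  fix z assume z: "z : KK t"
  have zz: "z : slice (J t)" "norm z < rho t" "Psi t z : M" "!!b. \<bar>z $ b\<bar> <= 1" using KK[OF t z] by auto
  define X where "X = (if ?bad then ?S z ^ CARD('a) else 1)"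
  have cW: "card (Wb t) <= CARD('a)" by (rule card_mono) auto
  obtain l bs where bs: "l <= length ts" "distinct bs" "set bs = Wb t" "take l bs = take l ts"
   "!!e. (!!i. i < l ==> e i = mm s cs i) ==> (!!i. e i <= 1) ==>
    (\<Prod>i<length ts. \<bar>z $ (ts ! i)\<bar> ^ mm s cs i) * (\<Prod>b\<in>Wb t. \<bar>z $ b\<bar> ^ (2 * CARD('a) * ?P b)) * X
     <= real CARD('a) ^ CARD('a) * (\<Prod>i<length bs. \<bar>z $ (bs ! i)\<bar> ^ (2 * CARD('a) * i + e i))"
  proof (rule dominated_by_flag[of "Wb t" "CARD('a)" "%b. \<bar>z $ b\<bar>" ?P ts X "mm s cs"])
   show "?P (ts ! i) = i" if "i < length ts" for i using that lt tsn[of i] pos_nth[OF L, of i] j(1) by simp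
  qed (use cW zz ts Pinj in "auto simp: X_def lt intro!: zero_le_power sum_nonneg")
  have bsL: "(t, bs) : flags D" using bs tD by (simp add: flags_def)
  \<comment> \<open>Up to \<open>l\<close> both flags run through the same strata, so
    \<open>kk_eq\<close> gives the same orders and hence the same parities.\<close>
  have em: "mm t bs i = mm s cs i" if i: "i < l" for i
  proof -
   have l: "0 < l" "l <= j" "l <= length cs" "l <= length bs" using i bs(1) lt j(1) arg_cong[OF bs(4), of length] by auto
   have "kk t (take l bs) = take l (kk t bs)" by (rule kk_take[OF t bs(2)]) (use bs(3) l in auto)
   moreover have "kk s (take l cs) = take l (kk s cs)" by (rule kk_take[OF f(2,3)]) (use f(4) l in auto)
   moreover have "kk s (take l cs) = kk t (take l bs)" unfolding bs(4)
   proof (rule kk_eq[OF f(2) _ _ t])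
    show "map (%b. C s {b}) (take l cs) = map (%c. C t {c}) (take l ts)"
     using arg_cong[OF ts(1), of "take l"] l by (simp add: take_map[symmetric] min_def)
    show "t : C s (set (take l cs))" using j(2) C_mono[OF set_take_subset_set_take[OF l(2)], of s cs] by blast
    show "set (take l cs) \<subseteq> Wb s" "set (take l ts) \<subseteq> Wb t"
     using set_take_subset[of l cs] set_take_subset[of l ts] f(4) ts(3) by blast+
   qed (use l f(3) ts(2) in auto)
   ultimately have "take l (kk t bs) = take l (kk s cs)" by simp
   from arg_cong[OF this, of "%xs. xs ! i"] i show ?thesis by (simp add: mm_def)
  qed
  have "(\<Prod>i<length ts. \<bar>z $ (ts ! i)\<bar> ^ mm s cs i) * (\<Prod>b\<in>Wb t. \<bar>z $ b\<bar> ^ (2 * CARD('a) * ?P b)) * X <= real CARD('a) ^ CARD('a) * GG t bs z"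
   unfolding GG_def by (rule bs(5)[OF em mm_le])
  also have "... <= real CARD('a) ^ CARD('a) * (\<Sum>bs | (t, bs) : flags D. GG t bs z)"
   by (intro mult_left_mono member_le_sum) (use bsL fin in "auto simp: GG_def intro!: prod_nonneg")
  finally have dom: "(\<Prod>i<length ts. \<bar>z $ (ts ! i)\<bar> ^ mm s cs i) * (\<Prod>b\<in>Wb t. \<bar>z $ b\<bar> ^ (2 * CARD('a) * ?P b)) * X <= ..." .
  have pj: "(\<Prod>i<length cs. if i < j then \<bar>z $ (ts ! i)\<bar> ^ mm s cs i else 1) = (\<Prod>i<length ts. \<bar>z $ (ts ! i)\<bar> ^ mm s cs i)"
   using j(1) by (intro prod.mono_neutral_cong_right) (auto simp: lt)
  have eX: "ex (s, cs) (Psi t z) ^ CARD('a) <= Ce ^ CARD('a) * X"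
  proof -
   have "ex (s, cs) (Psi t z) ^ CARD('a) <= (Ce * (if ?bad then ?S z else 1)) ^ CARD('a)" using Ce z ex(2) by (intro power_mono) auto
   moreover have "X = (if ?bad then ?S z else 1) ^ CARD('a)" by (simp add: X_def)
   ultimately show ?thesis by (simp only: power_mult_distrib)
  qed
  have "\<bar>FF (s, cs) (Psi t z)\<bar> = (\<Prod>i<length cs. \<bar>tht s (cs ! i) (Psi t z)\<bar> ^ mm s cs i) *
    ((\<Prod>b\<in>Wb t. hh (C t {b}) (Psi t z) ^ (CARD('a) * ?P b)) * \<bar>\<Prod>W\<in>{W:walls M A B. t ~: W}. hh W (Psi t z) ^ (CARD('a) * pos (s, cs) W)\<bar>) * ex (s, cs) (Psi t z) ^ CARD('a)"
   unfolding FF_def walls_split[OF t] using hh(2) ex(2) by (simp add: abs_mult abs_prod power_abs)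
  also have "... <= (Ct * (\<Prod>i<length ts. \<bar>z $ (ts ! i)\<bar> ^ mm s cs i)) * ((Ch * (\<Prod>b\<in>Wb t. \<bar>z $ b\<bar> ^ (2 * CARD('a) * ?P b))) * Co) * (Ce ^ CARD('a) * X)"
   using Ct Ch Co zz(3) eX z hh(2) ex(2) Ce(1) pj
   by (intro mult_mono mult_nonneg_nonneg) (auto intro!: prod_nonneg mult_nonneg_nonneg)
  also have "... = (Ct * (Ch * Co) * Ce ^ CARD('a)) * ((\<Prod>i<length ts. \<bar>z $ (ts ! i)\<bar> ^ mm s cs i) * (\<Prod>b\<in>Wb t. \<bar>z $ b\<bar> ^ (2 * CARD('a) * ?P b)) * X)"
   by (simp only: mult_ac)
  also have "... <= (Ct * (Ch * Co) * Ce ^ CARD('a)) * (real CARD('a) ^ CARD('a) * (\<Sum>bs | (t, bs) : flags D. GG t bs z))"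
   by (rule mult_left_mono[OF dom]) (use Ct Ch Co Ce in auto)
  finally show "\<bar>FF (s, cs) (Psi t z)\<bar> <= Ct * (Ch * Co) * Ce ^ CARD('a) * real CARD('a) ^ CARD('a) * (\<Sum>bs | (t, bs) : flags D. GG t bs z)"
   by (simp only: mult.assoc)
 qed (use Ct Ch Co Ce in auto)
qed

end

section \<open>Signed sums in the charts and polynomial coefficients\<close>

lemma uniform_lower:
 assumes "finite I" "!!i. i : I ==> EX c>0 :: real. P i c" "!!i c c'. P i c ==> 0 < c' ==> c' <= c ==> P i c'"
 shows "EX c>0. ALL i:I. P i c"
 using assms(1,2)
proof (induction I rule: finite_induct)
 case (insert i I)
 obtain c where "c > 0" "P i c" using insert.prems[of i] by auto
 moreover obtain c' where "c' > 0" "ALL i:I. P i c'" using insert by auto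
 ultimately show ?case by (intro exI[of _ "min c c'"]) (auto intro: assms(3))
qed (auto intro: exI[of _ 1])

context glued
begin

lemma fin_flags: "finite (flags D)" "finite {bs. (t, bs) : flags D}"
proof -
 show "finite (flags D)" by (rule finite_flags[OF D(1)])
 then have "finite (snd ` flags D)" by simp
 then show "finite {bs. (t, bs) : flags D}" by (rule rev_finite_subset) force
qed

lemma sprod_parity:
 assumes L: "(t, bs) : flags D" and z: "ALL b:Wb t. z $ b ~= 0"
 shows "(\<Prod>i<length bs. (z $ (bs ! i)) ^ mm t bs i) = sprod bs (kk t bs) z * (\<Prod>i<length bs. \<bar>z $ (bs ! i)\<bar> ^ mm t bs i)"
proof -
 note f = flagsD[OF L]
 have "length bs = length (kk t bs) | bs = []" using length_kk[OF f(2) _ f(3)] f(4) by auto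
 then show ?thesis
 proof
  assume l: "length bs = length (kk t bs)"
  show ?thesis unfolding sprod_prod[OF l] prod.distrib[symmetric]
  proof (rule prod.cong)
   fix i assume "i : {..<length bs}"
   then have nz: "z $ (bs ! i) ~= 0" using z f(4) by auto
   have "sgn a ^ k * \<bar>a\<bar> ^ (k mod 2) = a ^ (k mod 2)" if "a ~= 0" for a :: real and k
    using that by (cases "even k"; cases "a > 0") (auto simp: sgn_if parity_cases odd_iff_mod_2_eq_one even_iff_mod_2_eq_zero)
   from this[OF nz] show "(z $ (bs ! i)) ^ mm t bs i = sgn (z $ (bs ! i)) ^ (kk t bs ! i) * \<bar>z $ (bs ! i)\<bar> ^ mm t bs i"
    by (simp add: mm_def)
  qed simp
 qed (simp add: sprod_def)
qed

lemma off_walls: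
 assumes t: "t : M" and z: "z : KK t" and h: "h0 (Psi t z) ~= 0" and b: "b : Wb t"
 shows "z $ b ~= 0"
proof
 assume "z $ b = 0"
 then have "Psi t z : C t {b}" using KK[OF t z] by (intro C_germ) (auto simp: slice_def)
 with h show False using wall_props(4) b by (auto simp: Wb_def)
qed

lemma GG_pos: "(t, bs) : flags D ==> ALL b:Wb t. z $ b ~= 0 ==> 0 < GG t bs z"
 unfolding GG_def using flagsD(4)[of t bs] by (intro prod_pos ballI zero_less_power) auto

lemma GG_nonneg: "0 <= GG t bs z"
 unfolding GG_def by (intro prod_nonneg) auto

text \<open>Off the walls the sign of the function is the product \<open>sprod\<close> by
  \<open>sprod_parity\<close>, and \<open>sign_rule\<close> identifies this product with the sign
  attached to \<open>A\<close> or \<open>B\<close>, up to the constant \<open>s\<close>.\<close>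

lemma own_sign:
 assumes L: "(t, bs) : flags D"
 shows "EX s. (s = 1 | s = - 1) & (EX c>0. ALL z:KK t. ALL S. S = A | S = B --> Psi t z : S --> h0 (Psi t z) ~= 0 -->
  c * GG t bs z <= sg S * (s * FF (t, bs) (Psi t z)))"
proof -
 note f = flagsD[OF L]
 obtain s :: real where s: "s = 1 | s = - 1" "!!S z. S = A | S = B ==> z : slice (J t) ==> norm z < rho t ==>
   (ALL b:Wb t. z $ b ~= 0) ==> Psi t z : S ==> sg S * sprod bs (kk t bs) z = s"
  by (rule sign_rule[OF f(2,3,4)]) blast
 obtain c where c: "c > 0" "!!z. z : KK t ==> EX v. c * GG t bs z <= v * (\<Prod>i<length bs. \<bar>z $ (bs ! i)\<bar> ^ mm t bs i) & 0 <= v &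
   FF (t, bs) (Psi t z) = v * (\<Prod>i<length bs. (z $ (bs ! i)) ^ mm t bs i)" using FF_own[OF L] by blast
 have "c * GG t bs z <= sg S * (s * FF (t, bs) (Psi t z))"
  if z: "z : KK t" and S: "S = A | S = B" "Psi t z : S" "h0 (Psi t z) ~= 0" for z S
 proof -
  have nz: "ALL b:Wb t. z $ b ~= 0" using off_walls[OF f(2) z S(3)] by blast
  have e: "sg S * sprod bs (kk t bs) z = s" using s(2)[OF S(1) _ _ nz S(2)] KK[OF f(2) z] by blast
  have "sg S * s * sprod bs (kk t bs) z = s * s" using e by (simp add: mult_ac)
  also have "... = 1" using s(1) by auto
  finally have e1: "sg S * s * sprod bs (kk t bs) z = 1" .
  obtain v where v: "c * GG t bs z <= v * (\<Prod>i<length bs. \<bar>z $ (bs ! i)\<bar> ^ mm t bs i)"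
   "FF (t, bs) (Psi t z) = v * (\<Prod>i<length bs. (z $ (bs ! i)) ^ mm t bs i)" using c(2)[OF z] by blast
  have "sg S * (s * FF (t, bs) (Psi t z)) = (sg S * s * sprod bs (kk t bs) z) * (v * (\<Prod>i<length bs. \<bar>z $ (bs ! i)\<bar> ^ mm t bs i))"
   unfolding v(2) sprod_parity[OF L nz] by (simp only: mult_ac)
  then show ?thesis using v(1) unfolding e1 by simp
 qed
 with s(1) c(1) show ?thesis by blast
qed

lemma total_upper:
 assumes tD: "t : D"
 shows "EX K>0. ALL z:KK t. (\<Sum>L\<in>flags D. \<bar>FF L (Psi t z)\<bar>) <= K * (\<Sum>bs | (t, bs) : flags D. GG t bs z)"
proof -
 have "ALL L:flags D. EX K>=0. ALL z:KK t. \<bar>FF L (Psi t z)\<bar> <= K * (\<Sum>bs | (t, bs) : flags D. GG t bs z)"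
  using FF_upper[OF _ tD] by (auto simp: split_paired_all)
 then obtain K where K: "ALL L:flags D. 0 <= K L & (ALL z:KK t. \<bar>FF L (Psi t z)\<bar> <= K L * (\<Sum>bs | (t, bs) : flags D. GG t bs z))"
  by (rule bchoice[THEN exE])
 show ?thesis
 proof (rule exI[of _ "1 + sum K (flags D)"], intro conjI ballI)
  show "0 < 1 + sum K (flags D)" using sum_nonneg[of "flags D" K] K by auto
  fix z assume z: "z : KK t"
  have "(\<Sum>L\<in>flags D. \<bar>FF L (Psi t z)\<bar>) <= (\<Sum>L\<in>flags D. K L * (\<Sum>bs | (t, bs) : flags D. GG t bs z))"
   by (rule sum_mono) (use K z in blast)
  also have "... = sum K (flags D) * (\<Sum>bs | (t, bs) : flags D. GG t bs z)" by (rule sum_distrib_right[symmetric])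
  also have "... <= (1 + sum K (flags D)) * (\<Sum>bs | (t, bs) : flags D. GG t bs z)"
   by (intro mult_right_mono sum_nonneg GG_nonneg) simp
  finally show "(\<Sum>L\<in>flags D. \<bar>FF L (Psi t z)\<bar>) <= ..." .
 qed
qed

text \<open>On its chart the signed functions of the flags at \<open>t\<close> do not cancel, so
  their sum dominates the sum of their monomials, which by \<open>total_upper\<close> controls the
  functions of all flags.\<close>

lemma local_separation:
 "EX s. ALL t:D. EX c>0. ALL z:KK t. ALL S. S = A | S = B --> Psi t z : S --> h0 (Psi t z) ~= 0 -->
  0 < (\<Sum>L\<in>flags D. \<bar>FF L (Psi t z)\<bar>) &
  c * (\<Sum>L\<in>flags D. \<bar>FF L (Psi t z)\<bar>) <= sg S * (\<Sum>bs | (t, bs) : flags D. s (t, bs) * FF (t, bs) (Psi t z))"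
proof -
 have "ALL L:flags D. EX s. (s = 1 | s = - 1) & (EX c>0. ALL z:KK (fst L). ALL S. S = A | S = B --> Psi (fst L) z : S --> h0 (Psi (fst L) z) ~= 0 -->
  c * GG (fst L) (snd L) z <= sg S * (s * FF L (Psi (fst L) z)))"
  using own_sign by (auto simp: split_paired_all)
 then obtain s where s: "ALL L:flags D. (s L = 1 | s L = - 1) & (EX c>0. ALL z:KK (fst L). ALL S. S = A | S = B --> Psi (fst L) z : S --> h0 (Psi (fst L) z) ~= 0 -->
  c * GG (fst L) (snd L) z <= sg S * (s L * FF L (Psi (fst L) z)))"
  by (rule bchoice[THEN exE])
 have "EX c>0. ALL z:KK t. ALL S. S = A | S = B --> Psi t z : S --> h0 (Psi t z) ~= 0 -->
   0 < (\<Sum>L\<in>flags D. \<bar>FF L (Psi t z)\<bar>) &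
   c * (\<Sum>L\<in>flags D. \<bar>FF L (Psi t z)\<bar>) <= sg S * (\<Sum>bs | (t, bs) : flags D. s (t, bs) * FF (t, bs) (Psi t z))" if tD: "t : D" for t
 proof -
  have t: "t : M" using tD D(2) by blast
  let ?G = "%z. \<Sum>bs | (t, bs) : flags D. GG t bs z"
  obtain K where K: "K > 0" "!!z. z : KK t ==> (\<Sum>L\<in>flags D. \<bar>FF L (Psi t z)\<bar>) <= K * ?G z"
   using total_upper[OF tD] by blast
  have "EX c>0. ALL bs:{bs. (t, bs) : flags D}. ALL z:KK t. ALL S. S = A | S = B --> Psi t z : S --> h0 (Psi t z) ~= 0 -->
   c * GG t bs z <= sg S * (s (t, bs) * FF (t, bs) (Psi t z))"
  proof (rule uniform_lower[OF fin_flags(2)])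
   fix bs assume "bs : {bs. (t, bs) : flags D}"
   then show "EX c>0. ALL z:KK t. ALL S. S = A | S = B --> Psi t z : S --> h0 (Psi t z) ~= 0 -->
    c * GG t bs z <= sg S * (s (t, bs) * FF (t, bs) (Psi t z))" using s[rule_format, of "(t, bs)"] by simp
  next
   fix bs c c' assume c: "ALL z:KK t. ALL S. S = A | S = B --> Psi t z : S --> h0 (Psi t z) ~= 0 -->
    c * GG t bs z <= sg S * (s (t, bs) * FF (t, bs) (Psi t z))" "c' <= c"
   show "ALL z:KK t. ALL S. S = A | S = B --> Psi t z : S --> h0 (Psi t z) ~= 0 -->
    c' * GG t bs z <= sg S * (s (t, bs) * FF (t, bs) (Psi t z))"
   proof (intro ballI allI impI)
    fix z S assume "z : KK t" "S = A | S = B" "Psi t z : S" "h0 (Psi t z) ~= 0"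
    then have "c * GG t bs z <= sg S * (s (t, bs) * FF (t, bs) (Psi t z))" using c(1) by blast
    moreover have "c' * GG t bs z <= c * GG t bs z" by (rule mult_right_mono[OF c(2) GG_nonneg])
    ultimately show "c' * GG t bs z <= sg S * (s (t, bs) * FF (t, bs) (Psi t z))" by (rule order_trans[rotated])
   qed
  qed
  then obtain c where c: "c > 0" "ALL bs:{bs. (t, bs) : flags D}. ALL z:KK t. ALL S. S = A | S = B --> Psi t z : S --> h0 (Psi t z) ~= 0 -->
   c * GG t bs z <= sg S * (s (t, bs) * FF (t, bs) (Psi t z))" by (elim exE conjE)
  note c2 = c(2)[rule_format, OF CollectI]
  obtain bs0 where bs0: "(t, bs0) : flags D"
   using finite_distinct_list[of "Wb t"] tD by (auto simp: flags_def)
  show ?thesis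
  proof (rule exI[of _ "c / K"], intro conjI ballI allI impI)
   fix z S assume a: "z : KK t" "S = A | S = B" "Psi t z : S" "h0 (Psi t z) ~= 0"
   have "0 < c * GG t bs0 z" using c(1) GG_pos[OF bs0] off_walls[OF t a(1,4)] by (intro mult_pos_pos) auto
   also have "... <= sg S * (s (t, bs0) * FF (t, bs0) (Psi t z))" by (rule c2[OF bs0 a])
   finally have "FF (t, bs0) (Psi t z) ~= 0" by auto
   then have "0 < \<bar>FF (t, bs0) (Psi t z)\<bar>" by simp
   then show "0 < (\<Sum>L\<in>flags D. \<bar>FF L (Psi t z)\<bar>)" by (rule sum_pos2[OF fin_flags(1) bs0]) simp
   have "c / K * (\<Sum>L\<in>flags D. \<bar>FF L (Psi t z)\<bar>) <= c / K * (K * ?G z)"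
    by (rule mult_left_mono[OF K(2)[OF a(1)]]) (use c K in simp)
   also have "... = (\<Sum>bs | (t, bs) : flags D. c * GG t bs z)" using K(1) by (simp add: sum_distrib_left)
   also have "... <= (\<Sum>bs | (t, bs) : flags D. sg S * (s (t, bs) * FF (t, bs) (Psi t z)))"
    by (rule sum_mono) (rule c2[OF _ a], simp)
   also have "... = sg S * (\<Sum>bs | (t, bs) : flags D. s (t, bs) * FF (t, bs) (Psi t z))" by (rule sum_distrib_left[symmetric])
   finally show "c / K * (\<Sum>L\<in>flags D. \<bar>FF L (Psi t z)\<bar>) <= ..." .
  qed (use c K in simp)
 qed
 then show ?thesis by (intro exI[of _ s]) blast
qed

text \<open>The distance to the complement of the open set. The set is bounded, so the complement is
  non-empty and the distance detects it.\<close>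

lemma bump:
 assumes t: "t : M"
 obtains phi :: "real ^ 'a => real" where "continuous_on UNIV phi" "!!x. 0 <= phi x" "!!x. 0 < phi x \<longleftrightarrow> x : Psi t ` ball 0 (rho t / 2)"
proof -
 let ?O = "Psi t ` ball 0 (rho t / 2)"
 note o = open_half[OF t]
 have "continuous_on (cball 0 (rho t / 2)) (Psi t)"
  using Psi_cont[OF t] rho_pos[OF t] by (intro continuous_at_imp_continuous_on ballI) auto
 then have "compact (Psi t ` cball 0 (rho t / 2))" by (rule compact_continuous_image) simp
 then have "bounded ?O" by (rule bounded_subset[OF compact_imp_bounded]) auto
 then have ne: "- ?O ~= {}" using not_bounded_UNIV by (metis double_complement Compl_empty_eq)
 show ?thesis
 proof (rule that[of "%x. infdist x (- ?O)"])
  show "continuous_on UNIV (%x. infdist x (- ?O))" by (intro continuous_intros)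
  fix x
  show "0 < infdist x (- ?O) \<longleftrightarrow> x : ?O"
   using in_closed_iff_infdist_zero[OF _ ne, of x] o infdist_nonneg[of x "- ?O"] by (auto simp: closed_def less_le)
 qed (rule infdist_nonneg)
qed

lemma h0_nonzero: "EX x:M. h0 x ~= 0"
proof (rule ccontr)
 assume a: "\<not> ?thesis"
 obtain p where p: "p : M" using prime by (auto simp: primeset_def)
 obtain b where b: "b : J p" "!!y. y : M ==> tht p b y = 0"
  by (rule h0_factor[OF prime subset_refl _ p, of 0]) (use a p Psi_0[OF p] rho_pos[OF p] in auto)
 then show False using not_nul_tht[OF p b(1), of "{}"] nul_M[OF p] rpf_tht[OF p] by blast
qed

text \<open>The margin is proportional to the sum \<open>?T\<close> of all absolute values, so a
  uniform error in the coefficients is harmless even where every \<open>FF L\<close> is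
  small.\<close>

theorem glued_separation:
 obtains f where "rpf f" "!!S x. S = A | S = B ==> x : S ==> h0 x ~= 0 ==> 0 < sg S * f x"
proof -
 obtain s where s: "ALL t:D. EX c>0. ALL z:KK t. ALL S. S = A | S = B --> Psi t z : S --> h0 (Psi t z) ~= 0 -->
  0 < (\<Sum>L\<in>flags D. \<bar>FF L (Psi t z)\<bar>) &
  c * (\<Sum>L\<in>flags D. \<bar>FF L (Psi t z)\<bar>) <= sg S * (\<Sum>bs | (t, bs) : flags D. s (t, bs) * FF (t, bs) (Psi t z))"
  using local_separation ..
 from bchoice[OF s] obtain c where c: "ALL t:D. 0 < c t & (ALL z:KK t. ALL S. S = A | S = B --> Psi t z : S --> h0 (Psi t z) ~= 0 -->
  0 < (\<Sum>L\<in>flags D. \<bar>FF L (Psi t z)\<bar>) &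
  c t * (\<Sum>L\<in>flags D. \<bar>FF L (Psi t z)\<bar>) <= sg S * (\<Sum>bs | (t, bs) : flags D. s (t, bs) * FF (t, bs) (Psi t z)))" ..
 have "ALL t:D. EX phi :: real ^ 'a => real. continuous_on UNIV phi & (ALL x. 0 <= phi x) & (ALL x. 0 < phi x \<longleftrightarrow> x : Psi t ` ball 0 (rho t / 2))"
 proof
  fix t assume "t : D"
  then have "t : M" using D(2) by blast
  then obtain phi :: "real ^ 'a => real" where "continuous_on UNIV phi" "!!x. 0 <= phi x" "!!x. 0 < phi x \<longleftrightarrow> x : Psi t ` ball 0 (rho t / 2)"
   by (rule bump) blast
  then show "EX phi :: real ^ 'a => real. continuous_on UNIV phi & (ALL x. 0 <= phi x) & (ALL x. 0 < phi x \<longleftrightarrow> x : Psi t ` ball 0 (rho t / 2))" by blast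
 qed
 from bchoice[OF this] obtain phi :: "real ^ 'a => real ^ 'a => real" where
  chi: "ALL t:D. continuous_on UNIV (phi t) & (ALL x. 0 <= phi t x) & (ALL x. 0 < phi t x \<longleftrightarrow> x : Psi t ` ball 0 (rho t / 2))" ..
 have cc: "continuous_on M (phi t)" if "t : D" for t using chi that continuous_on_subset by blast
 let ?X = "%x. \<Sum>t\<in>D. phi t x * c t"
 have Xpos: "0 < ?X x" if x: "x : M" for x
 proof -
  obtain t where "t : D" "x : Psi t ` ball 0 (rho t / 2)" using D(3) x by blast
  moreover have "0 < c u" "0 <= phi u x" if "u : D" for u using chi c that by blast+
  moreover have "0 < phi t x" using calculation chi by blast
  ultimately show ?thesis by (intro sum_pos2[OF D(1), of t] mult_nonneg_nonneg mult_pos_pos) (auto simp: less_imp_le)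
 qed
 have "M ~= {}" using prime by (simp add: primeset_def)
 moreover have "continuous_on M ?X" using cc by (intro continuous_intros) auto
 ultimately obtain x0 where x0: "x0 : M" "!!x. x : M ==> ?X x0 <= ?X x"
  using continuous_attains_inf[OF cpt] by blast
 \<comment> \<open>The minimum of the weighted margin over the compact set \<open>M\<close>.
   Approximating each coefficient up to \<open>m / 2\<close> costs at most half of
   \<open>m * ?T\<close>.\<close>
 define m where "m = ?X x0"
 have m: "m > 0" "!!x. x : M ==> m <= ?X x" using Xpos[OF x0(1)] x0(2) by (auto simp: m_def)
 have "ALL L:flags D. EX g. rpf g & (ALL x:M. \<bar>phi (fst L) x * s L - g x\<bar> < m / 2)"
 proof
  fix L assume "L : flags D"
  then have "fst L : D" by (auto simp: flags_def)
  then have "continuous_on M (%x. phi (fst L) x * s L)" by (intro continuous_intros cc)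
  then show "EX g. rpf g & (ALL x:M. \<bar>phi (fst L) x * s L - g x\<bar> < m / 2)"
   using Stone_Weierstrass_real_polynomial_function[OF cpt, of _ "m / 2"] m(1) by (metis half_gt_zero)
 qed
 from bchoice[OF this] obtain g where g: "ALL L:flags D. rpf (g L) & (ALL x:M. \<bar>phi (fst L) x * s L - g L x\<bar> < m / 2)" ..
 let ?f = "%x. \<Sum>L\<in>flags D. g L x * FF L x"
 show ?thesis
 proof (rule that)
  show "rpf ?f" using g FF_rpf fin_flags(1) by (intro rpf_intros) auto
  fix S x assume S: "S = A | S = B" and x: "x : S" and h: "h0 x ~= 0"
  have xM: "x : M" using S x AM BM by blast
  let ?T = "\<Sum>L\<in>flags D. \<bar>FF L x\<bar>"
  have loc: "0 < ?T & c t * ?T <= sg S * (\<Sum>bs | (t, bs) : flags D. s (t, bs) * FF (t, bs) x)"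
   if t: "t : D" and xt: "x : Psi t ` ball 0 (rho t / 2)" for t
  proof -
   obtain z where z: "x = Psi t z" "norm z < rho t / 2" using xt by auto
   have tM: "t : M" using t D(2) by blast
   then have "z : KK t" using z xM M_slice[OF tM, of z] rho_pos[OF tM] by (auto simp: KK_def)
   then show ?thesis using c t S x h z(1) by blast
  qed
  obtain t0 where "t0 : D" "x : Psi t0 ` ball 0 (rho t0 / 2)" using D(3) xM by blast
  then have T: "0 < ?T" using loc by blast
  have step: "phi t x * c t * ?T <= phi t x * (sg S * (\<Sum>bs | (t, bs) : flags D. s (t, bs) * FF (t, bs) x))" if t: "t : D" for t
  proof (cases "0 < phi t x")
   case True
   then show ?thesis using loc[OF t] chi t by (simp add: mult.assoc mult_left_mono)
  next
   case False
   then have "phi t x = 0" using chi t by (meson antisym not_less)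
   then show ?thesis by simp
  qed
  have fl: "flags D = (SIGMA t:D. {bs. (t, bs) : flags D})" by (auto simp: flags_def)
  have "m * ?T <= ?X x * ?T" by (rule mult_right_mono[OF m(2)[OF xM] less_imp_le[OF T]])
  also have "... = (\<Sum>t\<in>D. phi t x * c t * ?T)" by (rule sum_distrib_right)
  also have "... <= (\<Sum>t\<in>D. phi t x * (sg S * (\<Sum>bs | (t, bs) : flags D. s (t, bs) * FF (t, bs) x)))" by (rule sum_mono[OF step])
  also have "... = (\<Sum>t\<in>D. \<Sum>bs | (t, bs) : flags D. sg S * (phi t x * s (t, bs) * FF (t, bs) x))"
   by (simp add: sum_distrib_left mult_ac)
  also have "... = (\<Sum>L\<in>(SIGMA t:D. {bs. (t, bs) : flags D}). sg S * (phi (fst L) x * s L * FF L x))"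
   by (subst sum.Sigma) (use D(1) fin_flags(2) in "auto simp: split_beta")
  also have "... = (\<Sum>L\<in>flags D. sg S * (phi (fst L) x * s L * FF L x))" by (simp only: fl[symmetric])
  finally have low: "m * ?T <= ..." .
  have "sg S * (phi (fst L) x * s L * FF L x) <= sg S * (g L x * FF L x) + m / 2 * \<bar>FF L x\<bar>" if L: "L : flags D" for L
  proof -
   have "sg S * (phi (fst L) x * s L * FF L x) - sg S * (g L x * FF L x) = sg S * ((phi (fst L) x * s L - g L x) * FF L x)"
    by (simp add: algebra_simps)
   also have "... <= \<bar>sg S * ((phi (fst L) x * s L - g L x) * FF L x)\<bar>" by (rule abs_ge_self)
   also have "... = \<bar>phi (fst L) x * s L - g L x\<bar> * \<bar>FF L x\<bar>" by (simp add: abs_mult sg_def)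
   also have "... <= m / 2 * \<bar>FF L x\<bar>" using g L xM by (intro mult_right_mono[OF less_imp_le]) auto
   finally show ?thesis by simp
  qed
  then have "(\<Sum>L\<in>flags D. sg S * (phi (fst L) x * s L * FF L x)) <= (\<Sum>L\<in>flags D. sg S * (g L x * FF L x) + m / 2 * \<bar>FF L x\<bar>)"
   by (rule sum_mono)
  also have "... = sg S * ?f x + m / 2 * ?T" by (simp add: sum.distrib sum_distrib_left)
  finally have "m * ?T <= sg S * ?f x + m / 2 * ?T" using low by (rule order_trans[rotated])
  moreover have "0 < m * ?T" using m(1) T by simp
  ultimately show "0 < sg S * ?f x" by (simp add: field_simps)
 qed
qed

theorem separable_glued: "generically_separable M A B"
proof (cases "A \<union> B = {}")
 case True
 show ?thesis
  by (rule separableI[of "%x. 1"]) (use True prime in "auto simp: primeset_def intro: rpf_intros")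
next
 case False
 obtain y where y: "y : M" "h0 y ~= 0" using h0_nonzero by blast
 obtain f where f: "rpf f" "!!S x. S = A | S = B ==> x : S ==> h0 x ~= 0 ==> 0 < sg S * f x"
  by (rule glued_separation) blast
 have sgB: "x : B ==> sg B = - 1" for x using disj by (auto simp: sg_def)
 \<comment> \<open>The zeros of \<open>h0\<close> are nowhere dense in \<open>A\<close> and
   \<open>B\<close>, so the weak inequality extends across them.\<close>
 have A: "0 <= f x" if "x : A" for x
  by (rule closure_sign[OF oA h0(1) y f(1)]) (use f(2)[of A] that closure_subset in "auto simp: sg_def less_imp_le")
 have B: "0 <= - f x" if "x : B" for x
  by (rule closure_sign[OF oB h0(1) y, of "%x. - f x"])
   (use f(2)[of B] that closure_subset sgB in "auto simp: less_imp_le intro: rpf_intros f")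
 obtain S x where S: "S = A | S = B" "x : S" using False by blast
 have "x : closure {y : S. h0 y ~= 0}"
  by (rule dense_nonzero[OF _ h0(1) y]) (use S oA oB closure_subset in auto)
 then have "{y : S. h0 y ~= 0} ~= {}" by force
 then obtain w where "w : S" "h0 w ~= 0" by blast
 then have "f w ~= 0" "w : M" using f(2)[OF S(1), of w] S(1) AM BM by auto
 then show ?thesis using separableI[OF f(1) _ AM BM] A B by (metis neg_0_le_iff_le)
qed

end

section \<open>Construction of the weights, the positions and the additional factors\<close>

lemma positive_square_sum:
 fixes W :: "(real ^ 'n) set"
 assumes W: "algebraic_set W" and Q: "compact Q" "Q \<inter> W = {}"
 obtains P where "finite P" "!!p. p : P ==> rpf p & (ALL x:W. p x = 0)"
  "EX c>0. ALL x:Q. c <= (\<Sum>p\<in>P. (p x)\<^sup>2)"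
proof (cases "Q = {}")
 case True
 then show ?thesis by (intro that[of "{}"]) (auto intro: exI[of _ 1])
next
 case False
 obtain F where F: "!!p. p : F ==> rpf p" "W = {x. ALL p:F. p x = 0}" using W by (auto simp: algebraic_set_def)
 have "Q \<subseteq> (\<Union>p\<in>F. {x. p x ~= 0})" using Q(2) F(2) by blast
 moreover have "open {x. p x ~= 0}" if "p : F" for p
  by (intro open_Collect_neq continuous_on_const rpf_continuous F that)
 ultimately obtain P where P: "P \<subseteq> F" "finite P" "Q \<subseteq> (\<Union>p\<in>P. {x. p x ~= 0})"
  using compactE_image[OF Q(1), of F "%p. {x. p x ~= 0}"] by blast
 have r: "rpf (%x. \<Sum>p\<in>P. (p x)\<^sup>2)" using P F(1) by (intro rpf_intros) auto
 obtain x0 where x0: "x0 : Q" "!!x. x : Q ==> (\<Sum>p\<in>P. (p x0)\<^sup>2) <= (\<Sum>p\<in>P. (p x)\<^sup>2)"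
  using continuous_attains_inf[OF Q(1) False rpf_continuous[OF r]] by blast
 obtain p where "p : P" "p x0 ~= 0" using P(3) x0(1) by blast
 then have "0 < (\<Sum>p\<in>P. (p x0)\<^sup>2)" by (intro sum_pos2[OF P(2)]) auto
 then show ?thesis using that[OF P(2)] P(1) F x0(2) by blast
qed

context started
begin

lemma compact_KK: "t : M ==> compact (Psi t ` KK t)"
proof (rule compact_continuous_image)
 assume t: "t : M"
 show "continuous_on (KK t) (Psi t)"
  using Psi_cont[OF t] KK[OF t] by (intro continuous_at_imp_continuous_on ballI) blast
 have "closed (slice (J t) \<inter> cball 0 (rho t / 2))"
 proof (rule closed_Int)
  have "slice (J t) = (\<Inter>i\<in>- J t. {z. z $ i = 0})" by (auto simp: slice_def)
  moreover have "closed {z :: real ^ 'a. z $ i = 0}" for i by (intro closed_Collect_eq continuous_intros)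
  ultimately show "closed (slice (J t) :: (real ^ 'a) set)" by (simp add: closed_INT)
 qed simp
 moreover have "KK t = slice (J t) \<inter> cball 0 (rho t / 2)" by (auto simp: KK_def)
 moreover have "bounded (KK t)" unfolding calculation(2) by (rule bounded_subset[OF bounded_cball]) blast
 ultimately show "compact (KK t)" by (simp add: compact_eq_bounded_closed)
qed

text \<open>One finite family has to serve all centres. Local equations at centres on
  \<open>W\<close> make the sum of squares at least the square of the coordinate. For a centre off
  \<open>W\<close>, equations without common zero on its chart are added; they exist since by
  \<open>wall_at\<close> such a wall misses the chart.\<close>

lemma wall_functions:
 assumes D: "finite D" "D \<subseteq> M" and W: "W : walls M A B"
 shows "EX H. finite H & (ALL p:H. rpf p & (ALL x:W. p x = 0)) &
  (ALL t:D. ALL b:Wb t. C t {b} = W --> tht t b : H) &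
  (ALL t:D. t ~: W --> (EX c>0. ALL z:KK t. c <= (\<Sum>p\<in>H. (p (Psi t z))\<^sup>2)))"
proof -
 have "EX P. finite P & (ALL p:P. rpf p & (ALL x:W. p x = 0)) & (EX c>0. ALL x:Psi t ` KK t. c <= (\<Sum>p\<in>P. (p x)\<^sup>2))"
  if t: "t : D - W" for t
 proof -
  have tM: "t : M" using t D(2) by blast
  have "Psi t ` KK t \<inter> W = {}"
  proof (rule ccontr)
   assume "Psi t ` KK t \<inter> W ~= {}"
   then obtain z where z: "z : KK t" "Psi t z : W" by blast
   then have "norm z < rho t" using KK[OF tM] by blast
   then obtain b where "W = C t {b}" using z(2) by (rule wall_at[OF W tM]) blast
   then show False using C_base[OF tM] t by blast
  qed
  from positive_square_sum[OF wall_props(2)[OF W] compact_KK[OF tM] this]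
  obtain P where "finite P" "!!p. p : P ==> rpf p & (ALL x:W. p x = 0)"
   "EX c>0. ALL x:Psi t ` KK t. c <= (\<Sum>p\<in>P. (p x)\<^sup>2)" by blast
  then show ?thesis by blast
 qed
 from bchoice[OF ballI[OF this]] obtain P where P: "ALL t:D - W. finite (P t) & (ALL p:P t. rpf p & (ALL x:W. p x = 0)) &
  (EX c>0. ALL x:Psi t ` KK t. c <= (\<Sum>p\<in>P t. (p x)\<^sup>2))" ..
 let ?H1 = "\<Union>t\<in>D. tht t ` {b : Wb t. C t {b} = W}"
 let ?H2 = "\<Union>t\<in>D - W. P t"
 show ?thesis
 proof (rule exI[of _ "?H1 \<union> ?H2"], intro conjI ballI impI)
  show fin: "finite (?H1 \<union> ?H2)" using D(1) P by auto
  show "rpf p" if "p : ?H1 \<union> ?H2" for p using that P D(2) by (auto intro: rpf_tht)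
  show "p x = 0" if "p : ?H1 \<union> ?H2" "x : W" for p x
   using that P D(2) tht_C[of _ _ "{_}" x] by auto
  show "tht t b : ?H1 \<union> ?H2" if "t : D" "b : Wb t" "C t {b} = W" for t b using that by blast
  fix t assume t: "t : D" "t ~: W"
  then obtain c where c: "c > 0" "ALL x:Psi t ` KK t. c <= (\<Sum>p\<in>P t. (p x)\<^sup>2)" using P by blast
  have "(\<Sum>p\<in>P t. (p x)\<^sup>2) <= (\<Sum>p\<in>?H1 \<union> ?H2. (p x)\<^sup>2)" for x
   by (rule sum_mono2[OF fin]) (use t in auto)
  then show "EX c>0. ALL z:KK t. c <= (\<Sum>p\<in>?H1 \<union> ?H2. (p (Psi t z))\<^sup>2)"
   using c by (intro exI[of _ c]) (meson imageI order_trans)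
 qed
qed

lemma wall_weights:
 assumes D: "finite D" "D \<subseteq> M"
 obtains hh :: "(real ^ 'a) set => real ^ 'a => real" where
  "!!W. W : walls M A B ==> rpf (hh W)" "!!W x. 0 <= hh W x"
  "!!t b. t : D ==> b : Wb t ==> EX K>=0. ALL z:KK t. hh (C t {b}) (Psi t z) <= K * (z $ b)\<^sup>2"
  "!!t b z. t : D ==> b : Wb t ==> z : KK t ==> (z $ b)\<^sup>2 <= hh (C t {b}) (Psi t z)"
  "!!t W. t : D ==> W : walls M A B ==> t ~: W ==> EX c>0. ALL z:KK t. c <= hh W (Psi t z)"
proof -
 from bchoice[OF ballI[OF wall_functions[OF D]]] obtain H where H: "ALL W:walls M A B. finite (H W) &
  (ALL p:H W. rpf p & (ALL x:W. p x = 0)) & (ALL t:D. ALL b:Wb t. C t {b} = W --> tht t b : H W) &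
  (ALL t:D. t ~: W --> (EX c>0. ALL z:KK t. c <= (\<Sum>p\<in>H W. (p (Psi t z))\<^sup>2)))" ..
 let ?h = "%W x. \<Sum>p\<in>H W. (p x)\<^sup>2"
 show ?thesis
 proof (rule that[of ?h])
  show "rpf (?h W)" if "W : walls M A B" for W using H that by (intro rpf_intros) auto
  show "0 <= ?h W x" for W x by (simp add: sum_nonneg)
  show "EX c>0. ALL z:KK t. c <= ?h W (Psi t z)" if "t : D" "W : walls M A B" "t ~: W" for t W using H that by blast
  fix t b assume t: "t : D" and b: "b : Wb t"
  have tM: "t : M" using t D(2) by blast
  define W where "W = C t {b}"
  have W: "W : walls M A B" using b by (simp add: W_def Wb_def)
  then have fin: "finite (H W)" and th: "tht t b : H W" and v: "ALL p:H W. rpf p & (ALL x:W. p x = 0)" using H t b by (auto simp: W_def)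
  have "(z $ b)\<^sup>2 <= ?h W (Psi t z)" if z: "z : KK t" for z
   using member_le_sum[OF th _ fin, of "%p. (p (Psi t z))\<^sup>2"] tht_Psi[OF tM, of z b] KK[OF tM z] by simp
  then show "z : KK t ==> (z $ b)\<^sup>2 <= ?h (C t {b}) (Psi t z)" for z unfolding W_def .
  have "ALL p:H W. EX K>0. ALL z:KK t. \<bar>p (Psi t z)\<bar> <= K * \<bar>z $ b\<bar>"
  proof
   fix p assume "p : H W"
   then have "nul t {b} p" using v by (simp add: nul_C W_def)
   from chart_bound[OF tM this] show "EX K>0. ALL z:KK t. \<bar>p (Psi t z)\<bar> <= K * \<bar>z $ b\<bar>" by simp
  qed
  from bchoice[OF this] obtain K where K: "ALL p:H W. 0 < K p & (ALL z:KK t. \<bar>p (Psi t z)\<bar> <= K p * \<bar>z $ b\<bar>)" ..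
  have "?h W (Psi t z) <= (\<Sum>p\<in>H W. (K p)\<^sup>2) * (z $ b)\<^sup>2" if z: "z : KK t" for z
  proof -
   have "(p (Psi t z))\<^sup>2 <= (K p)\<^sup>2 * (z $ b)\<^sup>2" if "p : H W" for p
   proof -
    have "\<bar>p (Psi t z)\<bar>\<^sup>2 <= (K p * \<bar>z $ b\<bar>)\<^sup>2" using K that z by (intro power_mono) auto
    then show ?thesis by (simp add: power_mult_distrib)
   qed
   then show ?thesis unfolding sum_distrib_right by (rule sum_mono)
  qed
  then show "EX K>=0. ALL z:KK t. ?h (C t {b}) (Psi t z) <= K * (z $ b)\<^sup>2"
   unfolding W_def[symmetric] by (intro exI[of _ "\<Sum>p\<in>H W. (K p)\<^sup>2"]) (auto intro: sum_nonneg)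
 qed
qed

text \<open>Walls of the flag get their index, the other walls distinct larger numbers. The gap at
  \<open>length cs\<close> is deliberate: a wall whose position equals the length \<open>j\<close>
  of an initial part must belong to the flag.\<close>

lemma wall_positions:
 obtains pos :: "(real ^ 'a) \<times> 'a list => (real ^ 'a) set => nat" where
  "!!L. L : flags D ==> inj_on (pos L) (walls M A B)"
  "!!s cs i. D \<subseteq> M ==> (s, cs) : flags D ==> i < length cs ==> pos (s, cs) (C s {cs ! i}) = i"
  "!!s cs W. (s, cs) : flags D ==> pos (s, cs) W ~= length cs"
proof -
 obtain e :: "(real ^ 'a) set => nat" where e: "inj_on e (walls M A B)"
  using finite_imp_inj_to_nat_seg[OF finite_walls] by blast
 define P where "P = (%L W i. i < length (snd L) & W = C (fst L) {snd L ! i})"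
 define pos where "pos = (%L W. if EX i. P L W i then LEAST i. P L W i else length (snd L) + 1 + e W)"
 have pI: "P L W (pos L W)" if "EX i. P L W i" for L W using that unfolding pos_def by (auto intro: LeastI_ex)
 have pN: "pos L W = length (snd L) + 1 + e W" if "\<not> (EX i. P L W i)" for L W using that unfolding pos_def by (rule if_not_P)
 show ?thesis
 proof (rule that[of pos])
  fix L
  show "inj_on (pos L) (walls M A B)"
  proof (rule inj_onI)
   fix V W assume VW: "V : walls M A B" "W : walls M A B" "pos L V = pos L W"
   show "V = W"
   proof (cases "EX i. P L V i")
    case True
    note V = pI[OF True]
    have "EX i. P L W i" using V VW(3) by (rule_tac ccontr, drule_tac pN) (simp add: P_def)
    from pI[OF this] V VW(3) show ?thesis by (simp add: P_def)
   next
    case False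
    have "\<not> (EX i. P L W i)" using pN[OF False] VW(3) by (intro notI, drule_tac pI) (simp add: P_def)
    from pN[OF this] pN[OF False] VW(3) have "e V = e W" by linarith
    then show ?thesis by (rule inj_onD[OF e _ VW(1,2)])
   qed
  qed
 next
  fix s cs W
  show "pos (s, cs) W ~= length cs"
   using pI[of "(s, cs)" W] pN[of "(s, cs)" W] by (cases "EX i. P (s, cs) W i") (auto simp: P_def)
 next
  fix s cs i assume D: "D \<subseteq> M" and L: "(s, cs) : flags D" and i: "i < length cs"
  have s: "s : M" and cs: "distinct cs" "set cs = Wb s" using L D by (auto simp: flags_def)
  have "P (s, cs) (C s {cs ! i}) i" using i by (simp add: P_def)
  then have p: "P (s, cs) (C s {cs ! i}) (pos (s, cs) (C s {cs ! i}))" using pI by blast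
  then have "cs ! i = cs ! pos (s, cs) (C s {cs ! i})"
   using C_inj[OF s, of "cs ! i"] Wb_J cs(2) i nth_mem[OF i] by (simp add: P_def)
  then show "pos (s, cs) (C s {cs ! i}) = i" using cs(1) i p by (simp add: nth_eq_iff_index_eq P_def)
 qed
qed

text \<open>For each centre \<open>t\<close> at which the flag leaves its stratum, a sum of squares
  is taken that vanishes on the component through \<open>t\<close> and is positive on the chart of
  \<open>s\<close>. The component misses that chart: otherwise \<open>C_mem_eq\<close> would
  identify it with the stratum of the flag, which does not contain \<open>t\<close>.\<close>

lemma extra_factor:
 assumes D: "finite D" "D \<subseteq> M" and L: "(s, cs) : flags D"
  and pos_inj: "inj_on ps (walls M A B)" and pos_nth: "ALL i<length cs. ps (C s {cs ! i}) = i"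
 shows "EX e. (ALL x. 0 <= e x) & rpf e & (EX c>0. ALL z:KK s. c <= e (Psi s z)) &
  (ALL t i. t : D & i < length cs & t : C s (set (take i cs)) & t : C s {cs ! i} & t ~: C s (set (take (Suc i) cs)) -->
   (EX K>=0. ALL z:KK t. e (Psi t z) <= K * (\<Sum>b\<in>{b:Wb t. ps (C t {b}) <= i}. \<bar>z $ b\<bar>)))"
proof -
 have s: "s : M" and cs: "distinct cs" "set cs = Wb s" using L D by (auto simp: flags_def)
 define T where "T = {(t, i). t : D & i < length cs & t : C s (set (take i cs)) & t : C s {cs ! i} & t ~: C s (set (take (Suc i) cs))}"
 define R where "R = (%(t, i). {b:Wb t. ps (C t {b}) <= i})"
 have fT: "finite T" by (rule finite_subset[of _ "D \<times> {..<length cs}"]) (use D in "auto simp: T_def")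
 have "EX d. rpf d & (ALL x. 0 <= d x) & (ALL x:C (fst a) (R a). d x = 0) & (EX c>0. ALL x:Psi s ` KK s. c <= d x)" if a: "a : T" for a
 proof -
  obtain t i where ti: "a = (t, i)" by (cases a)
  have t: "t : M" and i: "i < length cs" and tt: "t : C s (set (take i cs))" "t : C s {cs ! i}" "t ~: C s (set (take (Suc i) cs))"
   using a D by (auto simp: T_def ti)
  \<comment> \<open>Among the walls through \<open>t\<close>, those of position at most
    \<open>i\<close> are exactly the first \<open>i + 1\<close> walls of the flag.\<close>
  have RW: "(%b. C t {b}) ` R a = (%c. C s {c}) ` set (take (Suc i) cs)"
  proof (intro equalityI subsetI)
   fix W assume "W : (%c. C s {c}) ` set (take (Suc i) cs)"
   then obtain c where c: "c : set (take (Suc i) cs)" "W = C s {c}" by blast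
   from c(1) obtain k where "k < length (take (Suc i) cs)" "take (Suc i) cs ! k = c" unfolding in_set_conv_nth by blast
   with c(2) have k: "k <= i" "W = C s {cs ! k}" by simp_all
   have kl: "k < length cs" using k(1) i by simp
   then have W: "W : walls M A B" using cs(2) nth_mem[OF kl] k(2) by (auto simp: Wb_def)
   have "t : W"
   proof (cases "k = i")
    case False
    then have "cs ! k : set (take i cs)" using k(1) i by (auto simp: in_set_conv_nth intro!: exI[of _ k])
    then show ?thesis using C_mono[of "{cs ! k}" "set (take i cs)" s] tt(1) k(2) by auto
   qed (use tt k in simp)
   from wall_through[OF W this] obtain b where b: "b : J t" "W = C t {b}" by blast
   have "b : R a" using b W pos_nth[rule_format, OF kl] k by (auto simp: R_def ti Wb_def)
   with b show "W : (%b. C t {b}) ` R a" by blast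
  next
   fix W assume "W : (%b. C t {b}) ` R a"
   then obtain b where b: "b : Wb t" "ps W <= i" "W = C t {b}" by (auto simp: R_def ti)
   have W: "W : walls M A B" using b by (simp add: Wb_def)
   have l: "ps W < length cs" using b(2) i by simp
   have "C s {cs ! ps W} : walls M A B" using cs(2) nth_mem[OF l] by (auto simp: Wb_def)
   then have "W = C s {cs ! ps W}" using inj_onD[OF pos_inj, of W "C s {cs ! ps W}"] pos_nth[rule_format, OF l] W by simp
   moreover have "cs ! ps W : set (take (Suc i) cs)" using b(2) l by (auto simp: in_set_conv_nth intro!: exI[of _ "ps W"])
   ultimately show "W : (%c. C s {c}) ` set (take (Suc i) cs)" by blast
  qed
  have "Psi s ` KK s \<inter> C t (R a) = {}"
  proof (rule ccontr)
   assume "Psi s ` KK s \<inter> C t (R a) ~= {}"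
   then obtain z where z: "z : KK s" "Psi s z : C t (R a)" by blast
   note zz = KK[OF s z(1)]
   have "z $ c = 0" if c: "c : set (take (Suc i) cs)" for c
   proof -
    obtain b where b: "b : R a" "C t {b} = C s {c}" using RW c by (metis (no_types, lifting) imageE imageI)
    have "Psi s z : C s {c}" using z(2) C_mono[of "{b}" "R a" t] b by auto
    then have "tht s c (Psi s z) = 0" by (intro tht_C[OF s, of c "{c}"]) auto
    moreover have "norm z < rho s" using zz by blast
    ultimately show ?thesis using tht_Psi[OF s, of z c] by simp
   qed
   then have "z : slice (J s - set (take (Suc i) cs))" using zz by (auto simp: slice_def)
   then have "Psi s z : C s (set (take (Suc i) cs))" using zz by (intro C_germ) auto
   moreover have "set (take (Suc i) cs) \<subseteq> Wb s" using set_take_subset[of "Suc i" cs] cs(2) by simp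
   ultimately have "C s (set (take (Suc i) cs)) = C t (R a)" by (intro C_mem_eq[OF s t _ RW[symmetric] _ z(2)])
   then show False using tt(3) C_base[OF t] by blast
  qed
  from positive_square_sum[OF C_alg compact_KK[OF s] this] obtain P where P: "finite P" "!!p. p : P ==> rpf p & (ALL x:C t (R a). p x = 0)"
   "EX c>0. ALL x:Psi s ` KK s. c <= (\<Sum>p\<in>P. (p x)\<^sup>2)" by blast
  have "rpf (%x. \<Sum>p\<in>P. (p x)\<^sup>2)" by (intro rpf_intros) (use P in auto)
  moreover have "fst a = t" by (simp add: ti)
  ultimately show ?thesis
   by (intro exI[of _ "%x. \<Sum>p\<in>P. (p x)\<^sup>2"] conjI P(3)) (simp_all add: P(2) sum_nonneg)
 qed
 from bchoice[OF ballI[OF this]] obtain d where d: "ALL a:T. rpf (d a) & (ALL x. 0 <= d a x) & (ALL x:C (fst a) (R a). d a x = 0) & (EX c>0. ALL x:Psi s ` KK s. c <= d a x)" ..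
 let ?e = "%x. \<Prod>a\<in>T. d a x"
 show ?thesis
 proof (rule exI[of _ ?e], intro conjI allI impI)
  show "rpf ?e" using d fT by (intro rpf_intros) auto
  show "0 <= ?e x" for x using d by (intro prod_nonneg) auto
  have "EX c>0. ALL z:KK s. c * (\<Prod>a\<in>T. 1) <= (\<Prod>a\<in>T. d a (Psi s z))"
   by (rule prod_lower[OF fT]) (use d in auto)
  then show "EX c>0. ALL z:KK s. c <= ?e (Psi s z)" by simp
  fix t i assume a: "t : D & i < length cs & t : C s (set (take i cs)) & t : C s {cs ! i} & t ~: C s (set (take (Suc i) cs))"
  then have T: "(t, i) : T" and t: "t : M" using D by (auto simp: T_def)
  have "nul t (R (t, i)) (d (t, i))" using d T by (auto simp: nul_C)
  from chart_bound[OF t this] obtain K where K: "K > 0" "ALL z:KK t. \<bar>d (t, i) (Psi t z)\<bar> <= K * (\<Sum>b\<in>R (t, i). \<bar>z $ b\<bar>)" by blast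
  have "rpf (%x. \<Prod>a\<in>T - {(t, i)}. d a x)" using d fT by (intro rpf_intros) auto
  then obtain K' where K': "K' >= 1" "ALL x:M. \<bar>\<Prod>a\<in>T - {(t, i)}. d a x\<bar> <= K'" using rpf_bounded by blast
  show "EX K>=0. ALL z:KK t. ?e (Psi t z) <= K * (\<Sum>b\<in>{b:Wb t. ps (C t {b}) <= i}. \<bar>z $ b\<bar>)"
  proof (rule exI[of _ "K * K'"], intro conjI ballI)
   fix z assume z: "z : KK t"
   have zM: "Psi t z : M" using KK[OF t z] by blast
   have "?e (Psi t z) = d (t, i) (Psi t z) * (\<Prod>a\<in>T - {(t, i)}. d a (Psi t z))" by (rule prod.remove[OF fT T])
   also have "... <= \<bar>d (t, i) (Psi t z)\<bar> * \<bar>\<Prod>a\<in>T - {(t, i)}. d a (Psi t z)\<bar>" by (simp add: abs_mult[symmetric])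
   also have "... <= (K * (\<Sum>b\<in>R (t, i). \<bar>z $ b\<bar>)) * K'"
    using K K' z zM by (intro mult_mono mult_nonneg_nonneg sum_nonneg) auto
   also have "... = K * K' * (\<Sum>b\<in>{b:Wb t. ps (C t {b}) <= i}. \<bar>z $ b\<bar>)" by (simp add: R_def mult_ac)
   finally show "?e (Psi t z) <= ..." .
  qed (use K K' in simp)
 qed
qed

theorem separable: "generically_separable M A B"
proof -
 obtain D where D: "finite D" "D \<subseteq> M" "M \<subseteq> (\<Union>p\<in>D. Psi p ` ball 0 (rho p / 2))" by (rule finite_cover)
 obtain hh where hh: "!!W. W : walls M A B ==> rpf (hh W)" "!!W x. 0 <= hh W x"
  "!!t b. t : D ==> b : Wb t ==> EX K>=0. ALL z:KK t. hh (C t {b}) (Psi t z) <= K * (z $ b)\<^sup>2"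
  "!!t b z. t : D ==> b : Wb t ==> z : KK t ==> (z $ b)\<^sup>2 <= hh (C t {b}) (Psi t z)"
  "!!t W. t : D ==> W : walls M A B ==> t ~: W ==> EX c>0. ALL z:KK t. c <= hh W (Psi t z)"
  by (rule wall_weights[OF D(1,2)]) (rule that)
 obtain pos where pos: "!!L. L : flags D ==> inj_on (pos L) (walls M A B)"
  "!!s cs i. D \<subseteq> M ==> (s, cs) : flags D ==> i < length cs ==> pos (s, cs) (C s {cs ! i}) = i"
  "!!s cs W. (s, cs) : flags D ==> pos (s, cs) W ~= length cs"
  by (rule wall_positions[of D]) (rule that)
 \<comment> \<open>Outside \<open>flags D\<close> the constant \<open>1\<close> is taken, because
   non-negativity in \<open>glued\<close> is stated for all indices.\<close>
 have "EX e. (ALL x. 0 <= e x) & (L : flags D --> rpf e & (EX c>0. ALL z:KK (fst L). c <= e (Psi (fst L) z)) &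
  (ALL t i. t : D & i < length (snd L) & t : C (fst L) (set (take i (snd L))) & t : C (fst L) {snd L ! i} &
    t ~: C (fst L) (set (take (Suc i) (snd L))) -->
   (EX K>=0. ALL z:KK t. e (Psi t z) <= K * (\<Sum>b\<in>{b:Wb t. pos L (C t {b}) <= i}. \<bar>z $ b\<bar>))))" for L
 proof (cases "L : flags D")
  case True
  obtain s cs where L: "L = (s, cs)" by (cases L)
  note T = True[unfolded L]
  have "ALL i<length cs. pos (s, cs) (C s {cs ! i}) = i" using pos(2)[OF D(2) T] by blast
  from extra_factor[OF D(1,2) T pos(1)[OF T] this] show ?thesis using T unfolding L by simp
 qed (auto intro: exI[of _ "%x. 1"])
 from choice[OF allI[OF this]] obtain ex where ex: "ALL L. (ALL x. 0 <= ex L x) & (L : flags D --> rpf (ex L) & (EX c>0. ALL z:KK (fst L). c <= ex L (Psi (fst L) z)) &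
  (ALL t i. t : D & i < length (snd L) & t : C (fst L) (set (take i (snd L))) & t : C (fst L) {snd L ! i} &
    t ~: C (fst L) (set (take (Suc i) (snd L))) -->
   (EX K>=0. ALL z:KK t. ex L (Psi t z) <= K * (\<Sum>b\<in>{b:Wb t. pos L (C t {b}) <= i}. \<bar>z $ b\<bar>))))" ..
 interpret glued M A B n h0 tht J Psi rho \<epsilon> H1 D hh pos ex
 proof unfold_locales
  fix s cs t i assume L: "(s, cs) : flags D" and a: "t : D" "i < length cs" "t : C s (set (take i cs))"
    "t : C s {cs ! i}" "t ~: C s (set (take (Suc i) cs))"
  from ex[rule_format, of "(s, cs)", THEN conjunct2, rule_format, OF L, THEN conjunct2, THEN conjunct2, rule_format, of t i] a
  show "EX K>=0. ALL z:KK t. ex (s, cs) (Psi t z) <= K * (\<Sum>b\<in>{b:Wb t. pos (s, cs) (C t {b}) <= i}. \<bar>z $ b\<bar>)" by simp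
 next
  fix s cs assume L: "(s, cs) : flags D"
  from ex[rule_format, of "(s, cs)", THEN conjunct2, rule_format, OF L, THEN conjunct2, THEN conjunct1]
  show "EX c>0. ALL z:KK s. c <= ex (s, cs) (Psi s z)" by simp
 next
  fix L x show "0 <= ex L x" using ex by blast
 next
  fix L assume "L : flags D" then show "rpf (ex L)" using ex by blast
 qed (fact D hh pos(1) pos(2)[OF D(2)] pos(3))+
 show ?thesis by (rule separable_glued)
qed

end

theorem theorem5p5:
  fixes M A B :: "(real ^ 'n) set"
    and t :: "(real ^ 'n) set \<Rightarrow> ((real ^ 'n \<Rightarrow> real) \<times> (real ^ 'n \<Rightarrow> real)) set"
  assumes "irreducible_algebraic_set M" and "compact M" and "nonsingular M"
    and "A \<subseteq> M" and "semialgebraic A" and "openin (top_of_set M) A"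
    and "B \<subseteq> M" and "semialgebraic B" and "openin (top_of_set M) B"
    and "A \<inter> B = {}"
    and "walls_at_normal_crossings M A B"
    and "\<And>W. W \<in> walls M A B \<Longrightarrow> nonsingular W"
    and "\<And>W. W \<in> walls M A B \<Longrightarrow> uniformizer (local_ring_at M W) (t W)"
  shows "generically_separable M A B \<longleftrightarrow>
    (\<forall>W \<in> walls M A B.
       generically_separable W (shadow W A) (shadow W B) \<or>
       generically_separable W (shadow W (twist M (t W) A B)) (shadow W (twist M (t W) B A)))"
proof -
 obtain n h0 tht J Psi rho where "atlas M A B n h0 tht J Psi rho"
  by (rule atlas_exists[OF assms(1,2,3,6,9,10,11)])
 then interpret atlas M A B n h0 tht J Psi rho .
 show ?thesis
 proof (intro iffI ballI)
  fix W assume "generically_separable M A B" and W: "W : walls M A B"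
  then obtain f where f: "rpf f" "EX x:M. f x ~= 0" "!!x. x : A ==> f x >= 0" "!!x. x : B ==> f x <= 0"
   using separableE[OF _ AM BM] by blast
  show "generically_separable W (shadow W A) (shadow W B) |
    generically_separable W (shadow W (twist M (t W) A B)) (shadow W (twist M (t W) B A))"
   by (rule separable_on_walls[OF f W assms(13)[OF W]])
 next
  assume s: "ALL W : walls M A B.
    generically_separable W (shadow W A) (shadow W B) |
    generically_separable W (shadow W (twist M (t W) A B)) (shadow W (twist M (t W) B A))"
  \<comment> \<open>Both kinds of separation lead to the same form of starting data and differ only
    in the parity.\<close>
  have "ALL W:walls M A B. EX e. start W (fst e) (snd e)"
  proof
   fix W assume W: "W : walls M A B"
   then have "EX \<epsilon> H. start W \<epsilon> H" using s shadow_start counter_shadow_start[OF W assms(13)[OF W]] by blast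
   then show "EX e. start W (fst e) (snd e)" by auto
  qed
  from bchoice[OF this] obtain e where e: "ALL W:walls M A B. start W (fst (e W)) (snd (e W))" ..
  interpret started M A B n h0 tht J Psi rho "%W. fst (e W)" "%W. snd (e W)"
   by unfold_locales (use e in blast)
  show "generically_separable M A B" by (rule separable)
 qed
qed

end
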